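(* Let $\alpha$ be a positive integer. There is an equivalence of categories $$\operatorname{gr}\text{-}A\left(z^2\right)\equiv\operatorname{qgr}\text{-}A\left(z(z+\alpha)\right).$$
   Context: $\Bbbk$ is an algebraically closed field of characteristic zero; equivalences are $\Bbbk$-linear. For $f\in\Bbbk[z]$, $A(f)$ is the $\Bbbk$-algebra generated over $\Bbbk[z]$ by $x,y$ with relations $xz=(z+1)x$, $yz=(z-1)y$, $xy=f(z)$, $yx=f(z-1)$, with $\mathbb{Z}$-grading $\deg x=1$, $\deg y=-1$, $\deg z=0$. $\operatorname{gr}\text{-}A$ is the category of finitely generated $\mathbb{Z}$-graded right $A$-modules with degree-preserving homomorphisms, $\operatorname{fdim}\text{-}A$ is its full (Serre) subcategory of modules finite-dimensional over $\Bbbk$, and $\operatorname{qgr}\text{-}A=\operatorname{gr}\text{-}A/\operatorname{fdim}\text{-}A$ is the Gabriel quotient category. *)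

theory Defs
  imports
    "HOL-Algebra.QuotRing"
    "HOL-Library.Poly_Mapping"
    "HOL-Library.FuncSet"
    "HOL-Computational_Algebra.Polynomial"
begin

section \<open>The free algebra on three generators\<close>

datatype gen = GX | GY | GZ

text \<open>Words in the generators, written additively so that \<open>word \<Rightarrow>\<^sub>0 'k\<close> (with the convolution product
  of \<^theory>\<open>HOL-Library.Poly_Mapping\<close>) is the free associative algebra \<open>'k\<langle>x, y, z\<rangle>\<close>.\<close>

datatype word = Word (letters: "gen list")

instantiation word :: monoid_add
begin

definition zero_word :: word where "0 = Word []"

definition plus_word :: "word \<Rightarrow> word \<Rightarrow> word" where "u + v = Word (letters u @ letters v)"

instance by standard (simp_all add: zero_word_def plus_word_def)

end

type_synonym 'k free_alg = "word \<Rightarrow>\<^sub>0 'k"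

definition free_ring :: "'k::field free_alg ring" where
  "free_ring = \<lparr>carrier = UNIV, monoid.mult = (*), one = 1, zero = 0, add = (+)\<rparr>"

definition free_const :: "'k::field \<Rightarrow> 'k free_alg" where
  "free_const c = Poly_Mapping.single 0 c"

definition free_gen :: "gen \<Rightarrow> 'k::field free_alg" where
  "free_gen g = Poly_Mapping.single (Word [g]) 1"

text \<open>The value \<open>p(a)\<close> of a polynomial \<open>p\<close> at an element \<open>a\<close> of the free algebra;
  \<^const>\<open>poly\<close> is only available over commutative rings.\<close>

definition free_eval :: "'k::field poly \<Rightarrow> 'k free_alg \<Rightarrow> 'k free_alg" where
  "free_eval p a = (\<Sum>i\<le>degree p. free_const (coeff p i) * a ^ i)"

text \<open>The grading with \<open>deg x = 1\<close>, \<open>deg y = -1\<close>, \<open>deg z = 0\<close>.\<close>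

definition word_deg :: "word \<Rightarrow> int" where
  "word_deg w = int (count_list (letters w) GX) - int (count_list (letters w) GY)"


section \<open>The algebras \<open>A(f)\<close>\<close>

text \<open>A graded algebra is a ring together with its structure map \<open>scal\<close> from the ground field and
  its homogeneous components \<open>apart i\<close>.\<close>

record ('k, 'a) galgebra = "'a ring" +
  scal :: "'k \<Rightarrow> 'a"
  apart :: "int \<Rightarrow> 'a set"

definition gwa_rels :: "'k::field poly \<Rightarrow> 'k free_alg set" where
  "gwa_rels f = (let x = free_gen GX; y = free_gen GY; z = free_gen GZ in
     {x * z - (z + 1) * x,
      y * z - (z - 1) * y,
      x * y - free_eval f z,
      y * x - free_eval f (z - 1)})"

definition gwa_ideal :: "'k::field poly \<Rightarrow> 'k free_alg set" where
  "gwa_ideal f = Idl\<^bsub>free_ring\<^esub> (gwa_rels f)"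

definition gwa_proj :: "'k::field poly \<Rightarrow> 'k free_alg \<Rightarrow> 'k free_alg set" where
  "gwa_proj f p = gwa_ideal f +>\<^bsub>free_ring\<^esub> p"

definition gwa :: "'k::field poly \<Rightarrow> ('k, 'k free_alg set) galgebra" where
  "gwa f = ring.extend (free_ring Quot gwa_ideal f)
     \<lparr>scal = (\<lambda>c. gwa_proj f (free_const c)),
      apart = (\<lambda>i. gwa_proj f ` {p. \<forall>w \<in> Poly_Mapping.keys p. word_deg w = i})\<rparr>"


section \<open>Graded right modules\<close>

text \<open>As for the modules of HOL-Algebra, the multiplicative fields of the underlying ring record
  are ignored.\<close>

record ('a, 'm) gmodule = "'m ring" +
  ract :: "'m \<Rightarrow> 'a \<Rightarrow> 'm"
  mpart :: "int \<Rightarrow> 'm set"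

locale right_module = ring A + M: abelian_group M
  for A :: "('k, 'a) galgebra" and M :: "('a, 'm) gmodule" +
  assumes ract_closed: "\<lbrakk>m \<in> carrier M; a \<in> carrier A\<rbrakk> \<Longrightarrow> ract M m a \<in> carrier M"
    and ract_add_left: "\<lbrakk>m \<in> carrier M; n \<in> carrier M; a \<in> carrier A\<rbrakk>
          \<Longrightarrow> ract M (m \<oplus>\<^bsub>M\<^esub> n) a = ract M m a \<oplus>\<^bsub>M\<^esub> ract M n a"
    and ract_add_right: "\<lbrakk>m \<in> carrier M; a \<in> carrier A; b \<in> carrier A\<rbrakk>
          \<Longrightarrow> ract M m (a \<oplus>\<^bsub>A\<^esub> b) = ract M m a \<oplus>\<^bsub>M\<^esub> ract M m b"
    and ract_mult: "\<lbrakk>m \<in> carrier M; a \<in> carrier A; b \<in> carrier A\<rbrakk>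
          \<Longrightarrow> ract M m (a \<otimes>\<^bsub>A\<^esub> b) = ract M (ract M m a) b"
    and ract_one: "m \<in> carrier M \<Longrightarrow> ract M m \<one>\<^bsub>A\<^esub> = m"

text \<open>\<open>c\<close> is a decomposition of \<open>m\<close> into homogeneous components.\<close>

definition homog_decomp :: "('a, 'm) gmodule \<Rightarrow> 'm \<Rightarrow> (int \<Rightarrow> 'm) \<Rightarrow> bool" where
  "homog_decomp M m c \<longleftrightarrow> (\<forall>i. c i \<in> mpart M i) \<and> finite {i. c i \<noteq> \<zero>\<^bsub>M\<^esub>} \<and>
     m = (\<Oplus>\<^bsub>M\<^esub>i\<in>{i. c i \<noteq> \<zero>\<^bsub>M\<^esub>}. c i)"

locale graded_right_module = right_module +
  assumes mpart_subgroup: "additive_subgroup (mpart M i) M"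
    and mpart_ract: "\<lbrakk>m \<in> mpart M i; a \<in> apart A j\<rbrakk> \<Longrightarrow> ract M m a \<in> mpart M (i + j)"
    and direct_sum: "m \<in> carrier M \<Longrightarrow> \<exists>!c. homog_decomp M m c"

definition submodule_closed :: "('k, 'a) galgebra \<Rightarrow> 'm set \<Rightarrow> ('a, 'm) gmodule \<Rightarrow> bool" where
  "submodule_closed A N M \<longleftrightarrow> additive_subgroup N M \<and> (\<forall>n\<in>N. \<forall>a\<in>carrier A. ract M n a \<in> N)"

definition fin_gen :: "('k, 'a) galgebra \<Rightarrow> ('a, 'm) gmodule \<Rightarrow> bool" where
  "fin_gen A M \<longleftrightarrow> (\<exists>S. finite S \<and> S \<subseteq> carrier M \<and>
     (\<forall>N. submodule_closed A N M \<and> S \<subseteq> N \<longrightarrow> N = carrier M))"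

definition fin_dim :: "('k, 'a) galgebra \<Rightarrow> ('a, 'm) gmodule \<Rightarrow> bool" where
  "fin_dim A M \<longleftrightarrow> (\<exists>B. finite B \<and> B \<subseteq> carrier M \<and>
     (\<forall>m\<in>carrier M. \<exists>c. m = (\<Oplus>\<^bsub>M\<^esub>b\<in>B. ract M b (scal A (c b)))))"

definition gr_obj :: "('k, 'a) galgebra \<Rightarrow> ('a, 'm) gmodule set" where
  "gr_obj A = {M. graded_right_module A M \<and> fin_gen A M}"

definition fdim_obj :: "('k, 'a) galgebra \<Rightarrow> ('a, 'm) gmodule set" where
  "fdim_obj A = {M \<in> gr_obj A. fin_dim A M}"

text \<open>Homomorphisms are required to be \<^const>\<open>undefined\<close> outside the carrier, so that equality of
  morphisms is equality of functions.\<close>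

definition gr_hom ::
  "('k, 'a) galgebra \<Rightarrow> ('a, 'm) gmodule \<Rightarrow> ('a, 'n) gmodule \<Rightarrow> ('m \<Rightarrow> 'n) set" where
  "gr_hom A M N = {h \<in> carrier M \<rightarrow>\<^sub>E carrier N.
     (\<forall>m\<in>carrier M. \<forall>n\<in>carrier M. h (m \<oplus>\<^bsub>M\<^esub> n) = h m \<oplus>\<^bsub>N\<^esub> h n) \<and>
     (\<forall>m\<in>carrier M. \<forall>a\<in>carrier A. h (ract M m a) = ract N (h m) a) \<and>
     (\<forall>i. h ` mpart M i \<subseteq> mpart N i)}"

definition sub_module :: "('a, 'm) gmodule \<Rightarrow> 'm set \<Rightarrow> ('a, 'm) gmodule" where
  "sub_module M N = M\<lparr>carrier := N, mpart := (\<lambda>i. mpart M i \<inter> N)\<rparr>"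

text \<open>The quotient \<open>M / N\<close>, on cosets. For a coset \<open>C = m + N\<close>, the set \<open>N + C a\<close> is the coset of
  \<open>m a\<close>.\<close>

definition coset_act :: "('a, 'm) gmodule \<Rightarrow> 'm set \<Rightarrow> 'm set \<Rightarrow> 'a \<Rightarrow> 'm set" where
  "coset_act M N C a = N <+>\<^bsub>M\<^esub> (\<lambda>m. ract M m a) ` C"

definition quot_module :: "('a, 'm) gmodule \<Rightarrow> 'm set \<Rightarrow> ('a, 'm set) gmodule" where
  "quot_module M N = ring.extend (M Quot N)
     \<lparr>ract = coset_act M N, mpart = (\<lambda>i. (\<lambda>m. N +>\<^bsub>M\<^esub> m) ` mpart M i)\<rparr>"


section \<open>Linear categories and their equivalences\<close>

text \<open>\<open>cmp C X Y Z g f\<close> is the composite of \<open>f : X \<rightarrow> Y\<close> and \<open>g : Y \<rightarrow> Z\<close>. Hom-sets of different pairs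
  of objects need not be disjoint.\<close>

record ('o, 'm, 'k) lincat =
  obj :: "'o set"
  homs :: "'o \<Rightarrow> 'o \<Rightarrow> 'm set"
  cmp :: "'o \<Rightarrow> 'o \<Rightarrow> 'o \<Rightarrow> 'm \<Rightarrow> 'm \<Rightarrow> 'm"
  idm :: "'o \<Rightarrow> 'm"
  hadd :: "'o \<Rightarrow> 'o \<Rightarrow> 'm \<Rightarrow> 'm \<Rightarrow> 'm"
  hzero :: "'o \<Rightarrow> 'o \<Rightarrow> 'm"
  hscale :: "'o \<Rightarrow> 'o \<Rightarrow> 'k \<Rightarrow> 'm \<Rightarrow> 'm"

locale linear_category =
  fixes C :: "('o, 'm, 'k::field) lincat"
  assumes id_hom: "X \<in> obj C \<Longrightarrow> idm C X \<in> homs C X X"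
    and cmp_hom: "\<lbrakk>X \<in> obj C; Y \<in> obj C; Z \<in> obj C; f \<in> homs C X Y; g \<in> homs C Y Z\<rbrakk>
          \<Longrightarrow> cmp C X Y Z g f \<in> homs C X Z"
    and cmp_id: "\<lbrakk>X \<in> obj C; Y \<in> obj C; f \<in> homs C X Y\<rbrakk> \<Longrightarrow> cmp C X X Y f (idm C X) = f"
    and id_cmp: "\<lbrakk>X \<in> obj C; Y \<in> obj C; f \<in> homs C X Y\<rbrakk> \<Longrightarrow> cmp C X Y Y (idm C Y) f = f"
    and cmp_assoc: "\<lbrakk>W \<in> obj C; X \<in> obj C; Y \<in> obj C; Z \<in> obj C;
            f \<in> homs C W X; g \<in> homs C X Y; h \<in> homs C Y Z\<rbrakk>
          \<Longrightarrow> cmp C W X Z (cmp C X Y Z h g) f = cmp C W Y Z h (cmp C W X Y g f)"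
    and hom_group: "\<lbrakk>X \<in> obj C; Y \<in> obj C\<rbrakk>
          \<Longrightarrow> comm_group \<lparr>carrier = homs C X Y, monoid.mult = hadd C X Y, one = hzero C X Y\<rparr>"
    and scale_hom: "\<lbrakk>X \<in> obj C; Y \<in> obj C; f \<in> homs C X Y\<rbrakk> \<Longrightarrow> hscale C X Y c f \<in> homs C X Y"
    and scale_add_right: "\<lbrakk>X \<in> obj C; Y \<in> obj C; f \<in> homs C X Y; g \<in> homs C X Y\<rbrakk>
          \<Longrightarrow> hscale C X Y c (hadd C X Y f g) = hadd C X Y (hscale C X Y c f) (hscale C X Y c g)"
    and scale_add_left: "\<lbrakk>X \<in> obj C; Y \<in> obj C; f \<in> homs C X Y\<rbrakk>
          \<Longrightarrow> hscale C X Y (c + d) f = hadd C X Y (hscale C X Y c f) (hscale C X Y d f)"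
    and scale_scale: "\<lbrakk>X \<in> obj C; Y \<in> obj C; f \<in> homs C X Y\<rbrakk>
          \<Longrightarrow> hscale C X Y (c * d) f = hscale C X Y c (hscale C X Y d f)"
    and scale_one: "\<lbrakk>X \<in> obj C; Y \<in> obj C; f \<in> homs C X Y\<rbrakk> \<Longrightarrow> hscale C X Y 1 f = f"
    and cmp_add_left: "\<lbrakk>X \<in> obj C; Y \<in> obj C; Z \<in> obj C;
            f \<in> homs C X Y; g \<in> homs C Y Z; g' \<in> homs C Y Z\<rbrakk>
          \<Longrightarrow> cmp C X Y Z (hadd C Y Z g g') f = hadd C X Z (cmp C X Y Z g f) (cmp C X Y Z g' f)"
    and cmp_add_right: "\<lbrakk>X \<in> obj C; Y \<in> obj C; Z \<in> obj C;
            f \<in> homs C X Y; f' \<in> homs C X Y; g \<in> homs C Y Z\<rbrakk>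
          \<Longrightarrow> cmp C X Y Z g (hadd C X Y f f') = hadd C X Z (cmp C X Y Z g f) (cmp C X Y Z g f')"
    and cmp_scale_left: "\<lbrakk>X \<in> obj C; Y \<in> obj C; Z \<in> obj C; f \<in> homs C X Y; g \<in> homs C Y Z\<rbrakk>
          \<Longrightarrow> cmp C X Y Z (hscale C Y Z c g) f = hscale C X Z c (cmp C X Y Z g f)"
    and cmp_scale_right: "\<lbrakk>X \<in> obj C; Y \<in> obj C; Z \<in> obj C; f \<in> homs C X Y; g \<in> homs C Y Z\<rbrakk>
          \<Longrightarrow> cmp C X Y Z g (hscale C X Y c f) = hscale C X Z c (cmp C X Y Z g f)"

locale linear_functor =
  fixes C :: "('o, 'm, 'k::field) lincat" and D :: "('p, 'n, 'k) lincat"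
    and Fo :: "'o \<Rightarrow> 'p" and Fm :: "'o \<Rightarrow> 'o \<Rightarrow> 'm \<Rightarrow> 'n"
  assumes fun_obj: "X \<in> obj C \<Longrightarrow> Fo X \<in> obj D"
    and fun_hom: "\<lbrakk>X \<in> obj C; Y \<in> obj C; f \<in> homs C X Y\<rbrakk> \<Longrightarrow> Fm X Y f \<in> homs D (Fo X) (Fo Y)"
    and fun_id: "X \<in> obj C \<Longrightarrow> Fm X X (idm C X) = idm D (Fo X)"
    and fun_cmp: "\<lbrakk>X \<in> obj C; Y \<in> obj C; Z \<in> obj C; f \<in> homs C X Y; g \<in> homs C Y Z\<rbrakk>
          \<Longrightarrow> Fm X Z (cmp C X Y Z g f) = cmp D (Fo X) (Fo Y) (Fo Z) (Fm Y Z g) (Fm X Y f)"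
    and fun_add: "\<lbrakk>X \<in> obj C; Y \<in> obj C; f \<in> homs C X Y; g \<in> homs C X Y\<rbrakk>
          \<Longrightarrow> Fm X Y (hadd C X Y f g) = hadd D (Fo X) (Fo Y) (Fm X Y f) (Fm X Y g)"
    and fun_scale: "\<lbrakk>X \<in> obj C; Y \<in> obj C; f \<in> homs C X Y\<rbrakk>
          \<Longrightarrow> Fm X Y (hscale C X Y c f) = hscale D (Fo X) (Fo Y) c (Fm X Y f)"

definition iso_in :: "('o, 'm, 'k) lincat \<Rightarrow> 'o \<Rightarrow> 'o \<Rightarrow> 'm \<Rightarrow> bool" where
  "iso_in C X Y f \<longleftrightarrow> f \<in> homs C X Y \<and>
     (\<exists>g\<in>homs C Y X. cmp C X Y X g f = idm C X \<and> cmp C Y X Y f g = idm C Y)"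

definition natural_iso ::
  "('o, 'm, 'k) lincat \<Rightarrow> ('p, 'n, 'k) lincat \<Rightarrow> ('o \<Rightarrow> 'p) \<Rightarrow> ('o \<Rightarrow> 'o \<Rightarrow> 'm \<Rightarrow> 'n) \<Rightarrow>
   ('o \<Rightarrow> 'p) \<Rightarrow> ('o \<Rightarrow> 'o \<Rightarrow> 'm \<Rightarrow> 'n) \<Rightarrow> ('o \<Rightarrow> 'n) \<Rightarrow> bool" where
  "natural_iso C D Fo Fm Go Gm \<eta> \<longleftrightarrow>
     (\<forall>X\<in>obj C. iso_in D (Fo X) (Go X) (\<eta> X)) \<and>
     (\<forall>X\<in>obj C. \<forall>Y\<in>obj C. \<forall>f\<in>homs C X Y.
        cmp D (Fo X) (Fo Y) (Go Y) (\<eta> Y) (Fm X Y f) = cmp D (Fo X) (Go X) (Go Y) (Gm X Y f) (\<eta> X))"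

definition linearly_equivalent :: "('o, 'm, 'k::field) lincat \<Rightarrow> ('p, 'n, 'k) lincat \<Rightarrow> bool" where
  "linearly_equivalent C D \<longleftrightarrow> linear_category C \<and> linear_category D \<and>
     (\<exists>Fo Fm Go Gm \<eta> \<epsilon>.
        linear_functor C D Fo Fm \<and> linear_functor D C Go Gm \<and>
        natural_iso C C (\<lambda>X. X) (\<lambda>X Y f. f) (\<lambda>X. Go (Fo X)) (\<lambda>X Y f. Gm (Fo X) (Fo Y) (Fm X Y f)) \<eta> \<and>
        natural_iso D D (\<lambda>X. Fo (Go X)) (\<lambda>X Y f. Fm (Go X) (Go Y) (Gm X Y f)) (\<lambda>X. X) (\<lambda>X Y f. f) \<epsilon>)"


section \<open>The categories \<open>gr-A\<close> and \<open>qgr-A\<close>\<close>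

text \<open>The categories are formed inside a universe: their objects are the modules whose carrier is a
  set of elements of the type \<open>'u\<close>. If \<open>nat \<Rightarrow> 'k\<close> injects into \<open>'u\<close> and \<open>A\<close> has countable dimension,
  every finitely generated graded module is isomorphic to such a module.\<close>

definition gr_cat ::
  "'u itself \<Rightarrow> ('k::field, 'a) galgebra \<Rightarrow> (('a, 'u) gmodule, 'u \<Rightarrow> 'u, 'k) lincat" where
  "gr_cat U A =
     \<lparr>obj = gr_obj A,
      homs = gr_hom A,
      cmp = (\<lambda>L M N g f. compose (carrier L) g f),
      idm = (\<lambda>M. restrict (\<lambda>m. m) (carrier M)),
      hadd = (\<lambda>M N f g. restrict (\<lambda>m. f m \<oplus>\<^bsub>N\<^esub> g m) (carrier M)),
      hzero = (\<lambda>M N. restrict (\<lambda>m. \<zero>\<^bsub>N\<^esub>) (carrier M)),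
      hscale = (\<lambda>M N c f. restrict (\<lambda>m. ract N (f m) (scal A c)) (carrier M))\<rparr>"

text \<open>In the Gabriel quotient, \<open>Hom(M, N)\<close> is the colimit of the groups of degree-preserving
  homomorphisms \<open>M' \<rightarrow> N / N'\<close>, where \<open>M' \<subseteq> M\<close> and \<open>N' \<subseteq> N\<close> are subobjects in \<open>gr-A\<close> such that
  \<open>M / M'\<close> and \<open>N'\<close> belong to \<open>fdim-A\<close>. A morphism is thus an equivalence class of triples
  \<open>(M', N', h)\<close>, two triples being equivalent if they induce the same homomorphism
  \<open>M\<^sub>0 \<rightarrow> N / N\<^sub>0\<close> for some admissible \<open>M\<^sub>0\<close> and \<open>N\<^sub>0\<close>.\<close>

type_synonym 'u qrep = "'u set \<times> 'u set \<times> ('u \<Rightarrow> 'u set)"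

definition cofin_subs :: "('k, 'a) galgebra \<Rightarrow> ('a, 'u) gmodule \<Rightarrow> 'u set set" where
  "cofin_subs A M = {M'. M' \<subseteq> carrier M \<and> sub_module M M' \<in> gr_obj A \<and> quot_module M M' \<in> fdim_obj A}"

definition fin_subs :: "('k, 'a) galgebra \<Rightarrow> ('a, 'u) gmodule \<Rightarrow> 'u set set" where
  "fin_subs A N = {N'. N' \<subseteq> carrier N \<and> sub_module N N' \<in> fdim_obj A}"

definition qreps ::
  "('k, 'a) galgebra \<Rightarrow> ('a, 'u) gmodule \<Rightarrow> ('a, 'u) gmodule \<Rightarrow> 'u qrep set" where
  "qreps A M N = {(M', N', h). M' \<in> cofin_subs A M \<and> N' \<in> fin_subs A N \<and>
     h \<in> gr_hom A (sub_module M M') (quot_module N N')}"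

definition qrel ::
  "('k, 'a) galgebra \<Rightarrow> ('a, 'u) gmodule \<Rightarrow> ('a, 'u) gmodule \<Rightarrow> ('u qrep \<times> 'u qrep) set" where
  "qrel A M N = {((M\<^sub>1, N\<^sub>1, h\<^sub>1), (M\<^sub>2, N\<^sub>2, h\<^sub>2)).
     (M\<^sub>1, N\<^sub>1, h\<^sub>1) \<in> qreps A M N \<and> (M\<^sub>2, N\<^sub>2, h\<^sub>2) \<in> qreps A M N \<and>
     (\<exists>M\<^sub>0\<in>cofin_subs A M. \<exists>N\<^sub>0\<in>fin_subs A N. M\<^sub>0 \<subseteq> M\<^sub>1 \<inter> M\<^sub>2 \<and> N\<^sub>1 \<union> N\<^sub>2 \<subseteq> N\<^sub>0 \<and>
        (\<forall>m\<in>M\<^sub>0. N\<^sub>0 <+>\<^bsub>N\<^esub> h\<^sub>1 m = N\<^sub>0 <+>\<^bsub>N\<^esub> h\<^sub>2 m))}"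

text \<open>Composition: for \<open>f : L\<^sub>1 \<rightarrow> M / M\<^sub>1\<close> and \<open>g : M\<^sub>2 \<rightarrow> N / N\<^sub>2\<close>, let
  \<open>L' = f\<^sup>-\<^sup>1((M\<^sub>1 + M\<^sub>2) / M\<^sub>1)\<close> and let \<open>N' / N\<^sub>2 = g(M\<^sub>1 \<inter> M\<^sub>2)\<close>. The composite is
  \<open>L' \<rightarrow> (M\<^sub>1 + M\<^sub>2) / M\<^sub>1 \<cong> M\<^sub>2 / (M\<^sub>1 \<inter> M\<^sub>2) \<rightarrow> N / N'\<close>; it takes \<open>l\<close> to the union of the cosets \<open>g m\<close> for
  \<open>m \<in> f l \<inter> M\<^sub>2\<close>.\<close>

definition qcomp :: "'u qrep \<Rightarrow> 'u qrep \<Rightarrow> 'u qrep" where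
  "qcomp = (\<lambda>(M\<^sub>2, N\<^sub>2, g) (L\<^sub>1, M\<^sub>1, f).
     let L' = {l \<in> L\<^sub>1. f l \<inter> M\<^sub>2 \<noteq> {}} in
     (L', \<Union>m\<in>M\<^sub>1 \<inter> M\<^sub>2. g m, restrict (\<lambda>l. \<Union>m\<in>f l \<inter> M\<^sub>2. g m) L'))"

definition qadd :: "('a, 'u) gmodule \<Rightarrow> 'u qrep \<Rightarrow> 'u qrep \<Rightarrow> 'u qrep" where
  "qadd N = (\<lambda>(M\<^sub>1, N\<^sub>1, f) (M\<^sub>2, N\<^sub>2, g).
     (M\<^sub>1 \<inter> M\<^sub>2, N\<^sub>1 <+>\<^bsub>N\<^esub> N\<^sub>2, restrict (\<lambda>m. f m <+>\<^bsub>N\<^esub> g m) (M\<^sub>1 \<inter> M\<^sub>2)))"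

definition qscale :: "('k, 'a) galgebra \<Rightarrow> ('a, 'u) gmodule \<Rightarrow> 'k \<Rightarrow> 'u qrep \<Rightarrow> 'u qrep" where
  "qscale A N c = (\<lambda>(M', N', f). (M', N', restrict (\<lambda>m. coset_act N N' (f m) (scal A c)) M'))"

definition qgr_cat ::
  "'u itself \<Rightarrow> ('k::field, 'a) galgebra \<Rightarrow> (('a, 'u) gmodule, 'u qrep set, 'k) lincat" where
  "qgr_cat U A =
     \<lparr>obj = gr_obj A,
      homs = (\<lambda>M N. qreps A M N // qrel A M N),
      cmp = (\<lambda>L M N G F. \<Union>g\<in>G. \<Union>f\<in>F. qrel A L N `` {qcomp g f}),
      idm = (\<lambda>M. qrel A M M `` {(carrier M, {\<zero>\<^bsub>M\<^esub>}, restrict (\<lambda>m. {m}) (carrier M))}),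
      hadd = (\<lambda>M N F G. \<Union>f\<in>F. \<Union>g\<in>G. qrel A M N `` {qadd N f g}),
      hzero = (\<lambda>M N. qrel A M N `` {(carrier M, {\<zero>\<^bsub>N\<^esub>}, restrict (\<lambda>m. {\<zero>\<^bsub>N\<^esub>}) (carrier M))}),
      hscale = (\<lambda>M N c F. \<Union>f\<in>F. qrel A M N `` {qscale A N c f})\<rparr>"

end

theory Submission
  imports Defs
begin

text \<open>Write \<open>t\<close> for a polynomial variable. In degree \<open>i\<close> of a graded right module over \<open>A(z(z+\<beta>))\<close> the element
  \<open>z - i\<close> acts as an operator that commutes with \<open>x\<close> and \<open>y\<close>; call it \<open>t\<close>. A graded module is thus a family
  of \<open>k[t]\<close>-modules \<open>M i\<close>, one for every integer \<open>i\<close>, with maps \<open>x : M i \<rightarrow> M (i+1)\<close> and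
  \<open>y : M (i+1) \<rightarrow> M i\<close>, whose composites in both orders are multiplication by \<open>(t+i)(t+i+\<beta>)\<close>. Attach to
  \<open>i\<close> the divisor \<open>L \<beta> i\<close>, the function on the integers with value \<open>[m < i] + [m < i + \<beta>]\<close> at \<open>m\<close>, where \<open>m\<close>
  stands for the linear factor \<open>t + m\<close>. Two such divisors differ at finitely many places, and the
  composites of the powers of \<open>x\<close> and \<open>y\<close> along \<open>i, j, k\<close> differ from the direct map \<open>i \<rightarrow> k\<close> by a
  product \<open>cc\<close> of linear factors that depends only on the three divisors. The algebra
  \<open>A(z\<^sup>2)\<close> is the case of the divisors \<open>L 0 n\<close>, all of whose values are even; \<open>B = A(z(z+\<alpha>))\<close>
  is the case of the divisors \<open>L \<alpha> k\<close>. Both algebras are therefore given by families of rank one lattices inside the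
  same function field, and the maps between the lattices of the two families are again governed by \<open>cc\<close>.

  A \<open>B\<close>-module \<open>M\<close> yields an \<open>A\<close>-module \<open>F(M)\<close>: its part of degree \<open>n\<close> consists of the families
  \<open>(a k)\<close> with \<open>a k \<in> M k\<close> that transform under the maps of \<open>M\<close> like the maps from the lattice \<open>L 0 n\<close> into
  the lattices \<open>L \<alpha> k\<close>, with the factors \<open>cc (L 0 n) (L \<alpha> i) (L \<alpha> j)\<close>. The key point is that for
  \<open>i \<le> n - \<alpha>\<close> and \<open>j \<ge> n\<close> the factors for \<open>i\<close> and for \<open>j\<close> are coprime (\<open>cc_L0_bezout\<close>). Such a family is
  hence determined by two entries as far out as one likes, one on each side. A finitely generated module
  is finite-dimensional if and only if its parts vanish far out and are killed by one polynomial
  (\<open>fin_dim_iff\<close>), so \<open>F\<close> does not see finite-dimensional modules: families of \<open>M\<close> lie in every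
  cofinite submodule of \<open>M\<close>, and families of a quotient of \<open>N\<close> by a finite-dimensional submodule lift
  uniquely to \<open>N\<close> (\<open>induced_map\<close>). So a morphism of \<open>qgr-B\<close>, represented by \<open>M' \<rightarrow> N/N'\<close>, induces a
  homomorphism \<open>F(M) \<rightarrow> F(N)\<close>.

  This is a bijection on morphisms. For \<open>v \<in> M k\<close> the families \<open>lift\<close> generated by \<open>v\<close> contain the
  multiple of \<open>v\<close> by \<open>rr \<alpha> k = cc (L \<alpha> k) (L 0 k) (L \<alpha> k)\<close>; these polynomials are coprime for indices at
  distance at least \<open>\<alpha>\<close>. Therefore a submodule that contains all entries of all families is cofinite
  (\<open>torsion_cobounded\<close>), and the elements that generate only zero families form a finite-dimensional
  submodule (\<open>tors_bounded\<close>). The first gives the domain on which a homomorphism \<open>F(M) \<rightarrow> F(N)\<close>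
  is realized, the second the ambiguity of its values (\<open>induced_hom_qrel\<close>, \<open>induced_hom_surj\<close>).

  Finally \<open>F\<close> is essentially surjective. The construction of families works in the other direction as well: for
  an \<open>A\<close>-module \<open>Y\<close> let \<open>X\<close> be the \<open>B\<close>-module of the families of \<open>Y\<close> at the indices \<open>L \<alpha> k\<close> that are generated by
  elements of \<open>Y\<close>. It is finitely generated (\<open>H_ofg\<close>), and the coprime factors show that
  \<open>Y \<rightarrow> F(X)\<close> is bijective (\<open>essentially_surjective\<close>). A fully faithful and essentially surjective assignment transports
  the structure of a linear category and is an equivalence (\<open>fully_faithful\<close>).

  Objects are modules on subsets of a given infinite type. A module of families has to be carried
  over to that type; this is possible because a family is determined by two of its entries, so that
  finite sequences of families can be coded by elements of the type (\<open>realization\<close>).\<close>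

section \<open>Cocycles of linear factors\<close>

definition bezout :: "'a::comm_ring_1 \<Rightarrow> 'a \<Rightarrow> bool" where
  "bezout p q \<longleftrightarrow> (\<exists>u v. u * p + v * q = 1)"

lemma bezout_commute: "bezout p q \<Longrightarrow> bezout q p"
  unfolding bezout_def by (metis add.commute)

lemma bezout_1 [simp]: "bezout 1 q" "bezout p 1"
  unfolding bezout_def by (metis add.right_neutral mult.left_neutral mult_zero_left)
    (metis add.left_neutral mult.left_neutral mult_zero_left)

lemma bezout_mult:
  assumes "bezout p q" "bezout p q'"
  shows "bezout p (q * q')"
proof -
  obtain u v u' v' where *: "u * p + v * q = 1" "u' * p + v' * q' = 1"
    using assms unfolding bezout_def by blast
  have "(u * p + v * q) * (u' * p + v' * q') = 1" using * by simp
  then have "(u * u' * p + u * v' * q' + v * q * u') * p + (v * v') * (q * q') = 1"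
    by (simp add: algebra_simps)
  then show ?thesis unfolding bezout_def by blast
qed

lemma bezout_power: "bezout p q \<Longrightarrow> bezout p (q ^ n)"
  by (induction n) (auto intro: bezout_mult)

lemma bezout_prod: "(\<And>i. i \<in> S \<Longrightarrow> bezout p (g i)) \<Longrightarrow> bezout p (prod g S)"
  by (induction S rule: infinite_finite_induct) (auto intro: bezout_mult)

definition lin :: "int \<Rightarrow> 'k::field_char_0 poly" where
  "lin m = [:of_int m, 1:]"

lemma lin_nonzero [simp]: "lin m \<noteq> 0"
  by (simp add: lin_def)

lemma bezout_lin:
  assumes "i \<noteq> j"
  shows "bezout (lin i) (lin j :: 'k::field_char_0 poly)"
proof -
  have "of_int i - of_int j \<noteq> (0::'k)" using assms by simp
  then obtain c :: 'k where c: "of_int i * c - of_int j * c = 1"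
    by (metis left_diff_distrib right_inverse)
  then have "[:c:] * lin i + (- [:c:]) * lin j = 1"
    by (simp add: lin_def one_pCons mult.commute)
  then show ?thesis unfolding bezout_def by blast
qed

text \<open>The excess length of the path \<open>a, b, c\<close> when only upward steps count. It vanishes if \<open>b\<close> lies between \<open>a\<close> and \<open>c\<close>,
  and \<open>max 0\<close> of a step is the exponent of the generator of the maps between two lattices at one place.\<close>

definition gam :: "int \<Rightarrow> int \<Rightarrow> int \<Rightarrow> nat" where
  "gam a b c = nat (max 0 (b - a) + max 0 (c - b) - max 0 (c - a))"

text \<open>If \<open>e u v\<close> denotes the generator of the maps from the lattice with divisor \<open>u\<close> to the one with divisor \<open>v\<close>, then
  \<open>e u v\<close> followed by \<open>e v w\<close> is \<open>cc u v w\<close> times \<open>e u w\<close>.\<close>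

definition cc :: "(int \<Rightarrow> int) \<Rightarrow> (int \<Rightarrow> int) \<Rightarrow> (int \<Rightarrow> int) \<Rightarrow> 'k::field_char_0 poly" where
  "cc u v w = (\<Prod>m\<in>{m. gam (u m) (v m) (w m) \<noteq> 0}. lin m ^ gam (u m) (v m) (w m))"

lemma cc_nonzero [simp]: "cc u v w \<noteq> 0"
proof (cases "finite {m. gam (u m) (v m) (w m) \<noteq> 0}")
  case True
  then show ?thesis by (simp add: cc_def)
next
  case False
  then show ?thesis unfolding cc_def by (subst prod.infinite) auto
qed

lemma cc_expand:
  assumes "finite S" "{m. gam (u m) (v m) (w m) \<noteq> 0} \<subseteq> S"
  shows "cc u v w = (\<Prod>m\<in>S. lin m ^ gam (u m) (v m) (w m))"
  unfolding cc_def by (rule prod.mono_neutral_left) (use assms in auto)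

lemma gam_eq_0_iff: "gam a b c = 0 \<longleftrightarrow> (a \<le> b \<and> b \<le> c) \<or> (c \<le> b \<and> b \<le> a)"
  unfolding gam_def by auto

lemma cc_eq_1: "(\<And>m. gam (u m) (v m) (w m) = 0) \<Longrightarrow> cc u v w = 1"
  by (simp add: cc_def)

lemma cc_same [simp]: "cc u u w = 1" "cc u w w = 1"
  by (rule cc_eq_1; simp add: gam_eq_0_iff; linarith)+

lemma cc_rev: "cc u v w = cc w v u"
proof -
  have "gam a b c = gam c b a" for a b c
    unfolding gam_def by auto
  then show ?thesis unfolding cc_def by simp
qed

text \<open>Distinct places have coprime linear factors, so two cocycles are coprime as soon as no place occurs in both.\<close>

lemma cc_bezout:
  assumes "\<And>m. gam (u m) (v m) (w m) = 0 \<or> gam (u' m) (v' m) (w' m) = 0"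
  shows "bezout (cc u v w) (cc u' v' w')"
proof -
  have "bezout (lin i ^ p) (lin j ^ q)"
    if "gam (u i) (v i) (w i) \<noteq> 0" "gam (u' j) (v' j) (w' j) \<noteq> 0" for i j p q
  proof -
    have "i \<noteq> j" using assms[of i] that by auto
    then show ?thesis by (intro bezout_power bezout_commute[OF bezout_power] bezout_lin) auto
  qed
  then show ?thesis unfolding cc_def
    by (intro bezout_prod) (rule bezout_commute, intro bezout_prod, rule bezout_commute, auto)
qed

text \<open>The divisor that belongs to the degree \<open>k\<close> of modules over \<open>A(z(z+\<alpha>))\<close>. Passing from \<open>k\<close> to \<open>k + 1\<close> raises
  it by one at \<open>k\<close> and at \<open>k + \<alpha>\<close>, hence by two at \<open>k\<close> if \<open>\<alpha> = 0\<close>.\<close>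

definition L :: "nat \<Rightarrow> int \<Rightarrow> int \<Rightarrow> int" where
  "L \<alpha> k m = (if m < k then 1 else 0) + (if m < k + int \<alpha> then 1 else 0)"

lemma L_near: "finite {m. L \<alpha> i m \<noteq> L \<beta> j m}"
proof (rule finite_subset)
  show "{m. L \<alpha> i m \<noteq> L \<beta> j m} \<subseteq> {min i j .. max (i + int \<alpha>) (j + int \<beta>)}"
    by (auto simp: L_def split: if_splits)
qed simp

text \<open>Associativity of composition along four lattices; place by place it is the identity between the excess lengths of the
  two ways to subdivide a path. Finiteness of the set where the divisors differ is needed to
  compare the products.\<close>

lemma cc_cocycle:
  fixes p q r s :: int and a b c d :: nat
  defines "u \<equiv> L a p" and "v \<equiv> L b q" and "w \<equiv> L c r" and "x \<equiv> L d s"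
  shows "cc u v w * cc u w x = (cc v w x * cc u v x :: 'k::field_char_0 poly)"
proof -
  define S where "S = {m. u m \<noteq> v m} \<union> {m. v m \<noteq> w m} \<union> {m. w m \<noteq> x m}"
  have fin: "finite S" unfolding S_def u_def v_def w_def x_def by (simp add: L_near)
  have *: "gam (f m) (g m) (h m) \<noteq> 0 \<Longrightarrow> m \<in> S" if "{f,g,h} \<subseteq> {u,v,w,x}" for f g h m
    using that unfolding S_def gam_eq_0_iff by auto
  have e: "gam (u m) (v m) (w m) + gam (u m) (w m) (x m) = gam (v m) (w m) (x m) + gam (u m) (v m) (x m)" for m
    unfolding gam_def by (auto simp: max_def)
  have "cc u v w * cc u w x
      = (\<Prod>m\<in>S. lin m ^ (gam (u m) (v m) (w m) + gam (u m) (w m) (x m)) :: 'k poly)"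
    by (subst (1 2) cc_expand[OF fin]) (use * in \<open>force simp: power_add prod.distrib\<close>)+
  also have "\<dots> = cc v w x * cc u v x"
    unfolding e by (subst (1 2) cc_expand[OF fin]) (use * in \<open>force simp: power_add prod.distrib\<close>)+
  finally show ?thesis .
qed

lemma cc_L_mono:
  assumes "i \<le> j \<and> j \<le> k \<or> k \<le> j \<and> j \<le> i"
  shows "cc (L \<alpha> i) (L \<alpha> j) (L \<alpha> k) = 1"
  by (rule cc_eq_1) (use assms in \<open>auto simp: gam_eq_0_iff L_def\<close>)

text \<open>Below \<open>n\<close> the divisor \<open>L \<alpha> k2\<close> has the value \<open>2\<close> of the end point \<open>L \<beta> n\<close>, and from \<open>n + \<beta>\<close> on the divisor
  \<open>L \<alpha> k1\<close> has its value \<open>0\<close>. At the places in between the end point has the value \<open>1\<close>; there are such places only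
  if \<open>\<alpha> = 0\<close>, and then the value of the starting point is \<open>0\<close> as for \<open>k1\<close> or \<open>2\<close> as for \<open>k2\<close>.\<close>

lemma cc_L_bezout:
  assumes "\<alpha> = 0 \<or> \<beta> = 0" "k1 \<le> n - int \<alpha>" "n + int \<beta> \<le> k2"
  shows "bezout (cc (L \<alpha> i) (L \<alpha> k1) (L \<beta> n)) (cc (L \<alpha> i) (L \<alpha> k2) (L \<beta> n))"
  by (rule cc_bezout) (use assms in \<open>auto simp: gam_eq_0_iff L_def\<close>)

lemma cc_L_bezout':
  assumes "\<alpha> = 0 \<or> \<beta> = 0" "n1 \<le> i - int \<beta>" "i + int \<alpha> \<le> n2"
  shows "bezout (cc (L \<alpha> i) (L \<beta> n1) (L \<beta> n)) (cc (L \<alpha> i) (L \<beta> n2) (L \<beta> n))"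
  by (rule cc_bezout) (use assms in \<open>auto simp: gam_eq_0_iff L_def\<close>)

text \<open>Below \<open>n\<close> the first step of the path through \<open>k2\<close> changes nothing since both divisors have the value \<open>2\<close>, and from
  \<open>n\<close> on the same holds for the path through \<open>k1\<close> with the value \<open>0\<close>. So the end points do not matter.\<close>

lemma cc_L0_bezout:
  assumes "k1 \<le> n - int \<alpha>" "n \<le> k2"
  shows "bezout (cc (L 0 n) (L \<alpha> k1) w) (cc (L 0 n) (L \<alpha> k2) w')"
proof (rule cc_bezout)
  fix m
  show "gam (L 0 n m) (L \<alpha> k1 m) (w m) = 0 \<or> gam (L 0 n m) (L \<alpha> k2 m) (w' m) = 0"
    using assms by (cases "m < n") (auto simp: gam_eq_0_iff L_def)
qed

text \<open>This identifies the composite of \<open>x\<close> and \<open>y\<close> between neighbouring degrees with the shifted polynomial \<open>z(z+\<alpha>)\<close>.\<close>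

lemma cc_L_edge:
  "cc (L \<alpha> i) (L \<alpha> (i+1)) (L \<alpha> i) = (lin i * lin (i + int \<alpha>) :: 'a::field_char_0 poly)"
  "cc (L \<alpha> (i+1)) (L \<alpha> i) (L \<alpha> (i+1)) = (lin i * lin (i + int \<alpha>) :: 'a::field_char_0 poly)"
proof -
  let ?S = "{i, i + int \<alpha>}"
  have a: "\<And>m. m \<notin> ?S \<Longrightarrow> L \<alpha> (i+1) m = L \<alpha> i m" by (auto simp: L_def)
  have b: "\<alpha> \<noteq> 0 \<Longrightarrow> m \<in> ?S \<Longrightarrow> L \<alpha> (i+1) m = L \<alpha> i m + 1"
    "\<alpha> = 0 \<Longrightarrow> m \<in> ?S \<Longrightarrow> L \<alpha> (i+1) m = L \<alpha> i m + 2" for m by (auto simp: L_def)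
  have "cc (L \<alpha> i) (L \<alpha> (i+1)) (L \<alpha> i) = (\<Prod>m\<in>?S. lin m ^ gam (L \<alpha> i m) (L \<alpha> (i+1) m) (L \<alpha> i m) :: 'a poly)"
    by (rule cc_expand) (use a in \<open>force simp: gam_def\<close>)+
  also have "\<dots> = lin i * lin (i + int \<alpha>)"
    using b by (cases "\<alpha> = 0") (auto simp: gam_def power2_eq_square)
  finally show 1: "cc (L \<alpha> i) (L \<alpha> (i+1)) (L \<alpha> i) = lin i * (lin (i + int \<alpha>)::'a poly)" .
  have "cc (L \<alpha> i) (L \<alpha> (i+1)) (L \<alpha> i) * cc (L \<alpha> i) (L \<alpha> i) (L \<alpha> (i+1))
    = (cc (L \<alpha> (i+1)) (L \<alpha> i) (L \<alpha> (i+1)) * cc (L \<alpha> i) (L \<alpha> (i+1)) (L \<alpha> (i+1)) :: 'a poly)"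
    by (rule cc_cocycle)
  then show "cc (L \<alpha> (i+1)) (L \<alpha> i) (L \<alpha> (i+1)) = lin i * (lin (i + int \<alpha>)::'a poly)"
    using 1 by simp
qed

text \<open>The factor of the round trip from the lattice \<open>L \<alpha> k\<close> through \<open>L 0 k\<close>: the product of the \<open>t + m\<close> with
  \<open>k \<le> m < k + \<alpha>\<close>. It moves with \<open>k\<close>, so that distant indices have coprime factors.\<close>

definition rr :: "nat \<Rightarrow> int \<Rightarrow> 'k::field_char_0 poly" where
  "rr \<alpha> k = cc (L \<alpha> k) (L 0 k) (L \<alpha> k)"

lemma rr_nonzero [simp]: "rr \<alpha> k \<noteq> 0"
  by (simp add: rr_def)

lemma rr_bezout: "\<bar>j - k\<bar> \<ge> int \<alpha> \<Longrightarrow> bezout (rr \<alpha> j) (rr \<alpha> k)"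
  unfolding rr_def by (rule cc_bezout) (auto simp: gam_eq_0_iff L_def)

section \<open>Representations of a tiled order\<close>

text \<open>Graded modules over \<open>A(z(z+\<alpha>))\<close> without reference to the algebra: the parts \<open>C i\<close> are modules over the
  polynomials, and \<open>e i j\<close> is the power of \<open>x\<close> or of \<open>y\<close> that leads from \<open>i\<close> to \<open>j\<close>. The lattices with the divisors
  \<open>L \<alpha> i\<close> and the maps between them form a tiled order, of which these are the representations.\<close>

locale orep = abelian_group G for G (structure) +
  fixes \<alpha> :: nat and C :: "int \<Rightarrow> 'a set"
    and act :: "int \<Rightarrow> 'k::field_char_0 poly \<Rightarrow> 'a \<Rightarrow> 'a"
    and e :: "int \<Rightarrow> int \<Rightarrow> 'a \<Rightarrow> 'a"
  assumes C_carrier: "v \<in> C i \<Longrightarrow> v \<in> carrier G"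
    and C_zero: "\<zero> \<in> C i"
    and C_add: "\<lbrakk>v \<in> C i; w \<in> C i\<rbrakk> \<Longrightarrow> v \<oplus> w \<in> C i"
    and act_C: "v \<in> C i \<Longrightarrow> act i p v \<in> C i"
    and act_add: "\<lbrakk>v \<in> C i; w \<in> C i\<rbrakk> \<Longrightarrow> act i p (v \<oplus> w) = act i p v \<oplus> act i p w"
    and act_padd: "v \<in> C i \<Longrightarrow> act i (p + q) v = act i p v \<oplus> act i q v"
    and act_mult: "v \<in> C i \<Longrightarrow> act i (p * q) v = act i p (act i q v)"
    and act_one: "v \<in> C i \<Longrightarrow> act i 1 v = v"
    and e_C: "v \<in> C i \<Longrightarrow> e i j v \<in> C j"
    and e_add: "\<lbrakk>v \<in> C i; w \<in> C i\<rbrakk> \<Longrightarrow> e i j (v \<oplus> w) = e i j v \<oplus> e i j w"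
    and e_act: "v \<in> C i \<Longrightarrow> e i j (act i p v) = act j p (e i j v)"
    and e_id: "v \<in> C i \<Longrightarrow> e i i v = v"
    and e_comp: "v \<in> C i \<Longrightarrow> e j k (e i j v) = act k (cc (L \<alpha> i) (L \<alpha> j) (L \<alpha> k)) (e i k v)"
begin

lemmas C_intros [simp, intro] = C_zero C_add act_C e_C

declare C_carrier [simp]

lemma act_carrier [simp]: "v \<in> C i \<Longrightarrow> act i p v \<in> carrier G"
  and e_carrier [simp]: "v \<in> C i \<Longrightarrow> e i j v \<in> carrier G"
  using C_carrier by blast+

lemma act_0 [simp]: "v \<in> C i \<Longrightarrow> act i 0 v = \<zero>"
proof -
  assume v: "v \<in> C i"
  have "act i 0 v = act i 0 v \<oplus> act i 0 v" using act_padd[OF v, of 0 0] by simp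
  then show ?thesis using act_carrier[OF v] by (metis add.l_cancel_one')
qed

lemma act_zero [simp]: "act i p \<zero> = \<zero>"
  using act_mult[OF C_zero, of i p 0] by simp

lemma e_zero [simp]: "e i j \<zero> = \<zero>"
  using e_act[OF C_zero, of i j 0] by simp

lemma act_uminus: "v \<in> C i \<Longrightarrow> act i (-1) v = \<ominus> v"
proof -
  assume v: "v \<in> C i"
  have "act i (-1) v \<oplus> v = \<zero>" using act_padd[OF v, of "-1" 1] v by (simp add: act_one)
  then show ?thesis using v by (metis C_carrier act_C minus_equality)
qed

lemma C_uminus [simp, intro]: "v \<in> C i \<Longrightarrow> \<ominus> v \<in> C i"
  by (metis act_C act_uminus)

lemma act_commute: "v \<in> C i \<Longrightarrow> act i p (act i q v) = act i q (act i p v)"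
  by (metis act_mult mult.commute)

text \<open>Two coprime multiples determine an element. This is how elements and families are
  reassembled throughout.\<close>

lemma act_bezout:
  assumes "u * p + w * q = 1" "v \<in> C i"
  shows "v = act i u (act i p v) \<oplus> act i w (act i q v)"
  using act_padd[OF assms(2), of "u * p" "w * q"] assms by (simp add: act_mult act_one)

text \<open>The subrepresentations.\<close>

definition oclosed :: "(int \<Rightarrow> 'a set) \<Rightarrow> bool" where
  "oclosed Q \<longleftrightarrow>
     (\<forall>k. Q k \<subseteq> C k \<and> \<zero> \<in> Q k \<and> (\<forall>v\<in>Q k. \<forall>w\<in>Q k. v \<oplus> w \<in> Q k) \<and> (\<forall>p. \<forall>v\<in>Q k. act k p v \<in> Q k)) \<and>
     (\<forall>i j. \<forall>v\<in>Q i. e i j v \<in> Q j)"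

lemma oclosedD:
  assumes "oclosed Q"
  shows "v \<in> Q k \<Longrightarrow> v \<in> C k" "\<zero> \<in> Q k" "\<lbrakk>v \<in> Q k; w \<in> Q k\<rbrakk> \<Longrightarrow> v \<oplus> w \<in> Q k"
    "v \<in> Q k \<Longrightarrow> act k p v \<in> Q k" "v \<in> Q i \<Longrightarrow> e i j v \<in> Q j"
  using assms unfolding oclosed_def by blast+

lemma oclosedI:
  assumes "\<And>k v. v \<in> Q k \<Longrightarrow> v \<in> C k" "\<And>k. \<zero> \<in> Q k"
    "\<And>k v w. \<lbrakk>v \<in> Q k; w \<in> Q k\<rbrakk> \<Longrightarrow> v \<oplus> w \<in> Q k"
    "\<And>k p v. v \<in> Q k \<Longrightarrow> act k p v \<in> Q k" "\<And>i j v. v \<in> Q i \<Longrightarrow> e i j v \<in> Q j"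
  shows "oclosed Q"
  unfolding oclosed_def using assms by blast

lemma bezout_mem:
  assumes "oclosed Q" "bezout p q" "v \<in> C i" "act i p v \<in> Q i" "act i q v \<in> Q i"
  shows "v \<in> Q i"
proof -
  obtain u w where "u * p + w * q = 1" using assms(2) unfolding bezout_def by blast
  from act_bezout[OF this assms(3)] show ?thesis
    using oclosedD(3,4)[OF assms(1)] assms(4,5) by metis
qed

lemma oclosed_zero: "oclosed (\<lambda>k. {\<zero>})"
  by (rule oclosedI) auto

lemma sub_orep:
  assumes Q: "oclosed Q"
  shows "orep G \<alpha> Q act e"
proof (unfold_locales, goal_cases)
  case 1 then show ?case by (rule C_carrier[OF oclosedD(1)[OF Q]])
next
  case 2 show ?case by (rule oclosedD(2)[OF Q])
next
  case 3 then show ?case by (rule oclosedD(3)[OF Q])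
next
  case 4 then show ?case by (rule oclosedD(4)[OF Q])
next
  case 5 then show ?case by (rule act_add[OF oclosedD(1)[OF Q] oclosedD(1)[OF Q]])
next
  case 6 then show ?case by (rule act_padd[OF oclosedD(1)[OF Q]])
next
  case 7 then show ?case by (rule act_mult[OF oclosedD(1)[OF Q]])
next
  case 8 then show ?case by (rule act_one[OF oclosedD(1)[OF Q]])
next
  case 9 then show ?case by (rule oclosedD(5)[OF Q])
next
  case 10 then show ?case by (rule e_add[OF oclosedD(1)[OF Q] oclosedD(1)[OF Q]])
next
  case 11 then show ?case by (rule e_act[OF oclosedD(1)[OF Q]])
next
  case 12 then show ?case by (rule e_id[OF oclosedD(1)[OF Q]])
next
  case 13 then show ?case by (rule e_comp[OF oclosedD(1)[OF Q]])
qed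

definition gens :: "(int \<times> 'a) set \<Rightarrow> bool" where
  "gens T \<longleftrightarrow> finite T \<and> (\<forall>(d, g)\<in>T. g \<in> C d) \<and>
     (\<forall>Q. oclosed Q \<and> (\<forall>(d, g)\<in>T. g \<in> Q d) \<longrightarrow> (\<forall>k. C k \<subseteq> Q k))"

definition ofg :: bool where "ofg \<longleftrightarrow> (\<exists>T. gens T)"

lemma gensD: "gens T \<Longrightarrow> finite T" "gens T \<Longrightarrow> (d, g) \<in> T \<Longrightarrow> g \<in> C d"
  unfolding gens_def by auto

lemma gens_induct:
  assumes "gens T" "oclosed Q" "\<And>d g. (d, g) \<in> T \<Longrightarrow> g \<in> Q d" "v \<in> C k"
  shows "v \<in> Q k"
  using assms unfolding gens_def by blast

text \<open>Submodules over the polynomials of one part.\<close>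

definition kclosed :: "int \<Rightarrow> 'a set \<Rightarrow> bool" where
  "kclosed k W \<longleftrightarrow> W \<subseteq> C k \<and> \<zero> \<in> W \<and> (\<forall>v\<in>W. \<forall>w\<in>W. v \<oplus> w \<in> W) \<and> (\<forall>p. \<forall>v\<in>W. act k p v \<in> W)"

lemma kclosedD:
  assumes "kclosed k W"
  shows "v \<in> W \<Longrightarrow> v \<in> C k" "\<zero> \<in> W" "\<lbrakk>v \<in> W; w \<in> W\<rbrakk> \<Longrightarrow> v \<oplus> w \<in> W" "v \<in> W \<Longrightarrow> act k p v \<in> W"
  using assms unfolding kclosed_def by blast+

lemma oclosed_kclosed: "oclosed Q \<Longrightarrow> kclosed k (Q k)"
  unfolding oclosed_def kclosed_def by blast

text \<open>Every composite of structure maps is a multiple of a structure map, so in each degree the images of the generators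
  already span over the polynomials.\<close>

lemma gens_span:
  assumes "gens T" "kclosed k W" "\<And>d g. (d, g) \<in> T \<Longrightarrow> e d k g \<in> W" "v \<in> C k"
  shows "v \<in> W"
proof -
  note W = kclosedD[OF assms(2)]
  define Q where "Q = (\<lambda>j. {v. v \<in> C j \<and> e j k v \<in> W})"
  have Q: "x \<in> Q j \<longleftrightarrow> x \<in> C j \<and> e j k x \<in> W" for x j by (simp add: Q_def)
  have "oclosed Q"
  proof (rule oclosedI, goal_cases)
    case (3 i x y)
    then show ?case using W(3)[of "e i k x" "e i k y"] by (simp add: Q e_add)
  next
    case (4 i p x)
    then show ?case using W(4)[of "e i k x"] by (simp add: Q e_act)
  next
    case (5 i j x)
    then show ?case using W(4)[of "e i k x"] by (simp add: Q e_comp)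
  qed (auto simp: Q W(2))
  then have "v \<in> Q k"
    by (rule gens_induct[OF assms(1)]) (use assms(3,4) gensD[OF assms(1)] in \<open>auto simp: Q\<close>)
  then show ?thesis using assms(4) by (simp add: Q e_id)
qed

text \<open>For subrepresentations of finitely generated ones this is finite dimension: finitely many parts are nonzero,
  and they are torsion with a common annihilator.\<close>

definition bounded :: "(int \<Rightarrow> 'a set) \<Rightarrow> bool" where
  "bounded Q \<longleftrightarrow> (\<exists>K q. q \<noteq> 0 \<and> (\<forall>k. \<bar>k\<bar> \<ge> K \<longrightarrow> Q k \<subseteq> {\<zero>}) \<and> (\<forall>k. \<forall>v\<in>Q k. act k q v = \<zero>))"

text \<open>The quotient by \<open>Q\<close> is bounded.\<close>

definition cobounded :: "(int \<Rightarrow> 'a set) \<Rightarrow> bool" where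
  "cobounded Q \<longleftrightarrow> (\<exists>K q. q \<noteq> 0 \<and> (\<forall>k. \<bar>k\<bar> \<ge> K \<longrightarrow> C k \<subseteq> Q k) \<and> (\<forall>k. \<forall>v\<in>C k. act k q v \<in> Q k))"

lemma gens_bound:
  assumes "gens T"
  obtains K :: int where "K \<ge> 0" "\<And>d g. (d, g) \<in> T \<Longrightarrow> \<bar>d\<bar> \<le> K"
proof -
  let ?S = "insert 0 ((\<lambda>x. \<bar>fst x\<bar>) ` T)"
  have fin: "finite ?S" using gensD(1)[OF assms] by simp
  show ?thesis
  proof (rule that[of "Max ?S"])
    show "0 \<le> Max ?S" by (rule Max_ge[OF fin]) simp
    show "\<bar>d\<bar> \<le> Max ?S" if "(d, g) \<in> T" for d g
      using Max_ge[OF fin] imageI[OF that, of "\<lambda>x. \<bar>fst x\<bar>"] by simp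
  qed
qed

text \<open>The polynomials \<open>rr \<alpha> k\<close> move with \<open>k\<close>. The image \<open>e d k g\<close> of a generator far out is also the image of an element
  of a part \<open>j\<close> at distance \<open>\<alpha>\<close> from \<open>k\<close>, so both \<open>rr \<alpha> j\<close> and \<open>rr \<alpha> k\<close> move it into \<open>Q\<close>. They are coprime, so it
  lies in \<open>Q\<close> itself. For the finitely many remaining parts the product of the \<open>rr \<alpha> k\<close> works.\<close>

lemma torsion_cobounded:
  assumes "ofg" "oclosed Q" and rr: "\<And>k v. v \<in> C k \<Longrightarrow> act k (rr \<alpha> k) v \<in> Q k"
  shows "cobounded Q"
proof -
  obtain T where T: "gens T" using assms(1) ofg_def by auto
  note Q = oclosedD[OF assms(2)]
  obtain K where K: "K \<ge> 0" "\<And>d g. (d, g) \<in> T \<Longrightarrow> \<bar>d\<bar> \<le> K" by (rule gens_bound[OF T]) blast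
  have far: "v \<in> Q k" if k: "\<bar>k\<bar> \<ge> K + int \<alpha>" and v: "v \<in> C k" for k v
  proof (rule gens_span[OF T oclosed_kclosed[OF assms(2)] _ v])
    fix d g assume dg: "(d, g) \<in> T"
    \<comment> \<open>the index at distance \<open>\<alpha>\<close> from \<open>k\<close> towards the generators\<close>
    define j where "j = (if k \<ge> 0 then k - int \<alpha> else k + int \<alpha>)"
    have g: "g \<in> C d" using gensD(2)[OF T dg] .
    have "(d \<le> j \<and> j \<le> k) \<or> (k \<le> j \<and> j \<le> d)" using K(2)[OF dg] k unfolding j_def by auto
    then have *: "e j k (e d j g) = e d k g" using g by (simp add: e_comp cc_L_mono act_one)
    have "act k (rr \<alpha> j) (e j k (e d j g)) = e j k (act j (rr \<alpha> j) (e d j g))"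
      using g by (simp add: e_act)
    also have "\<dots> \<in> Q k" using rr[of "e d j g" j] g Q(5) by auto
    finally have "act k (rr \<alpha> j) (e d k g) \<in> Q k" unfolding * .
    moreover have "act k (rr \<alpha> k) (e d k g) \<in> Q k" using rr g by simp
    moreover have "bezout (rr \<alpha> j :: 'k poly) (rr \<alpha> k)" by (rule rr_bezout) (auto simp: j_def)
    ultimately show "e d k g \<in> Q k" using bezout_mem[OF assms(2)] g by blast
  qed
  define q :: "'k poly" where "q = (\<Prod>k\<in>{-(K + int \<alpha>)..K + int \<alpha>}. rr \<alpha> k)"
  have "q \<noteq> 0" unfolding q_def by simp
  moreover have "act k q v \<in> Q k" if v: "v \<in> C k" for k v
  proof (cases "k \<in> {-(K + int \<alpha>)..K + int \<alpha>}")
    case True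
    then have "q = (\<Prod>k\<in>{-(K + int \<alpha>)..K + int \<alpha>} - {k}. rr \<alpha> k) * rr \<alpha> k"
      unfolding q_def by (subst prod.remove[of _ k]) (auto simp: mult.commute)
    then show ?thesis using rr[OF v] v Q(4) by (simp add: act_mult)
  next
    case False
    then have "\<bar>k\<bar> \<ge> K + int \<alpha>" by auto
    then show ?thesis using far v by simp
  qed
  ultimately show ?thesis unfolding cobounded_def using far by blast
qed

end

subsection \<open>Submodules are finitely generated\<close>

text \<open>Submodules of a free module over the polynomials.\<close>

definition psub :: "('i \<Rightarrow> 'k::field poly) set \<Rightarrow> bool" where
  "psub Z \<longleftrightarrow> (\<lambda>_. 0) \<in> Z \<and> (\<forall>y\<in>Z. \<forall>z\<in>Z. (\<lambda>i. y i + z i) \<in> Z) \<and> (\<forall>p. \<forall>z\<in>Z. (\<lambda>i. p * z i) \<in> Z)"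

lemma psubD:
  assumes "psub Z"
  shows "(\<lambda>_. 0) \<in> Z" "\<lbrakk>y \<in> Z; z \<in> Z\<rbrakk> \<Longrightarrow> (\<lambda>i. y i + z i) \<in> Z" "z \<in> Z \<Longrightarrow> (\<lambda>i. p * z i) \<in> Z"
  using assms unfolding psub_def by blast+

text \<open>Induction on the rank: an element whose entry at \<open>t\<close> has minimal degree divides all entries at \<open>t\<close>,
  and together with generators of the submodule of elements vanishing at \<open>t\<close> it generates.\<close>

lemma psub_finitely_generated:
  assumes "finite T" "psub Z" "\<forall>z\<in>Z. \<forall>i. i \<notin> T \<longrightarrow> z i = 0"
  shows "\<exists>B. finite B \<and> B \<subseteq> Z \<and> (\<forall>Z'. psub Z' \<and> B \<subseteq> Z' \<longrightarrow> Z \<subseteq> Z')"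
  using assms
proof (induction T arbitrary: Z rule: finite_induct)
  case empty
  then have "Z \<subseteq> {\<lambda>_. 0}" by auto
  then show ?case by (intro exI[of _ "{}"]) (auto simp: psub_def)
next
  case (insert t T)
  define Z1 where "Z1 = {z \<in> Z. z t = 0}"
  have Z1: "psub Z1" using insert.prems(1) unfolding psub_def Z1_def by auto
  have supp: "\<forall>z\<in>Z1. \<forall>i. i \<notin> T \<longrightarrow> z i = 0"
    using insert.prems(2) unfolding Z1_def by (metis (mono_tags, lifting) insert_iff mem_Collect_eq)
  obtain B where B0: "finite B \<and> B \<subseteq> Z1 \<and> (\<forall>Z'. psub Z' \<and> B \<subseteq> Z' \<longrightarrow> Z1 \<subseteq> Z')"
    using insert.IH[OF Z1 supp] ..
  then have B: "finite B" "B \<subseteq> Z1" "\<And>Z'. psub Z' \<Longrightarrow> B \<subseteq> Z' \<Longrightarrow> Z1 \<subseteq> Z'" by simp_all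
  show ?case
  proof (cases "Z1 = Z")
    case True
    then show ?thesis using B0 by (intro exI[of _ B]) simp
  next
    case False
    then obtain z1 where z1: "z1 \<in> Z \<and> z1 t \<noteq> 0" unfolding Z1_def by auto
    obtain z0 where z0: "z0 \<in> Z" "z0 t \<noteq> 0"
      and min: "\<And>z. z \<in> Z \<Longrightarrow> z t \<noteq> 0 \<Longrightarrow> degree (z0 t) \<le> degree (z t)"
      using ex_has_least_nat[of "\<lambda>z. z \<in> Z \<and> z t \<noteq> 0", OF z1, of "\<lambda>z. degree (z t)"] by auto
    have "Z \<subseteq> Z'" if Z': "psub Z'" "insert z0 B \<subseteq> Z'" for Z'
    proof
      fix z assume z: "z \<in> Z"
      define q where "q = z t div z0 t"
      define y where "y = (\<lambda>i. z i + (- q) * z0 i)"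
      have "y \<in> Z"
        unfolding y_def by (intro psubD(2,3)[OF insert.prems(1)] z z0(1))
      have "y t = z t mod z0 t" unfolding y_def q_def by (simp add: minus_div_mult_eq_mod)
      then have "y t = 0"
        using min[OF \<open>y \<in> Z\<close>] degree_mod_less[OF z0(2), of "z t"] by (metis not_less)
      with \<open>y \<in> Z\<close> have "y \<in> Z1" unfolding Z1_def by simp
      then have "y \<in> Z'" using B(3)[OF Z'(1)] Z'(2) by blast
      moreover have "(\<lambda>i. q * z0 i) \<in> Z'" by (rule psubD(3)[OF Z'(1)]) (use Z'(2) in blast)
      ultimately have "(\<lambda>i. y i + q * z0 i) \<in> Z'" by (rule psubD(2)[OF Z'(1)])
      moreover have "(\<lambda>i. y i + q * z0 i) = z" unfolding y_def by auto
      ultimately show "z \<in> Z'" by simp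
    qed
    then show ?thesis
      using B(1,2) z0(1) unfolding Z1_def by (intro exI[of _ "insert z0 B"]) auto
  qed
qed

context orep
begin

definition ev :: "(int \<times> 'a) set \<Rightarrow> int \<Rightarrow> (int \<times> 'a \<Rightarrow> 'k poly) \<Rightarrow> 'a" where
  "ev T k z = (\<Oplus>x\<in>T. act k (z x) (e (fst x) k (snd x)))"

lemma ev_insert:
  assumes "finite T" "x \<notin> T" "\<forall>x\<in>insert x T. snd x \<in> C (fst x)"
  shows "ev (insert x T) k z = act k (z x) (e (fst x) k (snd x)) \<oplus> ev T k z"
  unfolding ev_def using assms by (subst finsum_insert) (auto intro!: act_carrier)

lemma ev_empty: "ev {} k z = \<zero>"
  by (simp add: ev_def)

lemma ev_C:
  assumes "finite T" "\<forall>x\<in>T. snd x \<in> C (fst x)"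
  shows "ev T k z \<in> C k"
  using assms by (induction T rule: finite_induct) (simp_all add: ev_empty ev_insert)

lemma ev_add:
  assumes "finite T" "\<forall>x\<in>T. snd x \<in> C (fst x)"
  shows "ev T k (\<lambda>i. y i + z i) = ev T k y \<oplus> ev T k z"
  using assms
proof (induction T rule: finite_induct)
  case (insert x T)
  then have T: "\<forall>x\<in>T. snd x \<in> C (fst x)" by blast
  have "ev T k y \<in> C k" "ev T k z \<in> C k" "snd x \<in> C (fst x)"
    using ev_C[OF insert.hyps(1) T] insert.prems by auto
  then show ?case using insert by (simp add: ev_insert act_padd a_ac)
qed (simp add: ev_empty)

lemma ev_scale:
  assumes "finite T" "\<forall>x\<in>T. snd x \<in> C (fst x)"
  shows "ev T k (\<lambda>i. p * z i) = act k p (ev T k z)"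
  using assms
proof (induction T rule: finite_induct)
  case (insert x T)
  then have T: "\<forall>x\<in>T. snd x \<in> C (fst x)" by blast
  show ?case using insert ev_C[OF insert.hyps(1) T] by (simp add: ev_insert act_mult act_add)
qed (simp add: ev_empty)

text \<open>Moving away from all generators, the structure maps do not change coefficients.\<close>

lemma e_ev:
  assumes "finite T" "\<forall>x\<in>T. snd x \<in> C (fst x)"
    and "\<forall>x\<in>T. cc (L \<alpha> (fst x)) (L \<alpha> k) (L \<alpha> j) = (1::'k poly)"
  shows "e k j (ev T k z) = ev T j z"
  using assms
proof (induction T rule: finite_induct)
  case (insert x T)
  then have T: "\<forall>x\<in>T. snd x \<in> C (fst x)" by blast
  have "e k j (ev T k z) = ev T j z" using insert.IH[OF T] insert.prems(2) by blast
  moreover have "ev T k z \<in> C k" by (rule ev_C[OF insert.hyps(1) T])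
  moreover have "snd x \<in> C (fst x)" "cc (L \<alpha> (fst x)) (L \<alpha> k) (L \<alpha> j) = (1::'k poly)"
    using insert.prems by auto
  ultimately show ?case
    unfolding ev_insert[OF insert.hyps insert.prems(1)]
    by (simp add: e_add e_act e_comp act_one)
qed (simp add: ev_empty)

lemma ev_zero:
  assumes "finite T" "\<forall>x\<in>T. snd x \<in> C (fst x)" "\<forall>x\<in>T. z x = 0"
  shows "ev T k z = \<zero>"
  using assms by (induction T rule: finite_induct) (simp_all add: ev_empty ev_insert)

lemma ev_surj:
  assumes "gens T" "v \<in> C k"
  obtains z where "v = ev T k z" "\<forall>x. x \<notin> T \<longrightarrow> z x = 0"
proof -
  have T: "finite T" "\<forall>x\<in>T. snd x \<in> C (fst x)" using gensD[OF assms(1)] by auto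
  define Z where "Z = {z :: int \<times> 'a \<Rightarrow> 'k poly. \<forall>x. x \<notin> T \<longrightarrow> z x = 0}"
  have zero: "ev T k (\<lambda>_. 0) = \<zero>" by (rule ev_zero[OF T]) simp
  have "kclosed k (ev T k ` Z)"
    unfolding kclosed_def
  proof (intro conjI allI ballI subsetI)
    show "\<zero> \<in> ev T k ` Z" by (rule image_eqI[of _ _ "\<lambda>_. 0"]) (auto simp: zero Z_def)
  next
    fix v w assume "v \<in> ev T k ` Z" "w \<in> ev T k ` Z"
    then obtain y z where "y \<in> Z" "z \<in> Z" "v = ev T k y" "w = ev T k z" by blast
    then show "v \<oplus> w \<in> ev T k ` Z"
      by (intro image_eqI[of _ _ "\<lambda>i. y i + z i"]) (auto simp: ev_add[OF T] Z_def)
  next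
    fix p v assume "v \<in> ev T k ` Z"
    then obtain z where "z \<in> Z" "v = ev T k z" by blast
    then show "act k p v \<in> ev T k ` Z"
      by (intro image_eqI[of _ _ "\<lambda>i. p * z i"]) (auto simp: ev_scale[OF T] Z_def)
  qed (auto simp: ev_C[OF T])
  then have "v \<in> ev T k ` Z"
  proof (rule gens_span[OF assms(1) _ _ assms(2)])
    fix d g assume dg: "(d, g) \<in> T"
    define z :: "int \<times> 'a \<Rightarrow> 'k poly" where "z = (\<lambda>x. if x = (d, g) then 1 else 0)"
    have g: "g \<in> C d" using gensD(2)[OF assms(1) dg] .
    have ins: "insert (d, g) (T - {(d, g)}) = T" using dg by blast
    have T': "finite (T - {(d,g)})" "\<forall>x\<in>T - {(d,g)}. snd x \<in> C (fst x)" using T by auto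
    have "ev T k z = act k (z (d, g)) (e d k g) \<oplus> ev (T - {(d, g)}) k z"
      using ev_insert[OF T'(1), of "(d, g)" k z] T dg unfolding ins by auto
    moreover have "ev (T - {(d, g)}) k z = \<zero>"
      by (rule ev_zero[OF T']) (auto simp: z_def)
    ultimately have "e d k g = ev T k z" using g by (simp add: z_def act_one)
    moreover have "z \<in> Z" using dg by (auto simp: Z_def z_def)
    ultimately show "e d k g \<in> ev T k ` Z" by blast
  qed
  then show ?thesis using that unfolding Z_def by blast
qed

text \<open>Far out in the direction \<open>s\<close> all parts are spanned by the same generators, with structure maps that preserve
  coefficients (\<open>e_ev\<close>). Pulled back to coefficients, the parts of \<open>Q\<close> form an increasing chain of submodules
  of a free module of finite rank, which is stationary. So from some index on \<open>Q\<close> is carried along by the structure maps.\<close>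

lemma oclosed_stable:
  assumes T: "gens T" and Q: "oclosed Q" and K: "\<forall>x\<in>T. \<bar>fst x\<bar> \<le> int K"
    and s: "s = 1 \<or> s = -1"
  shows "\<exists>N. \<forall>i j. N \<le> i \<longrightarrow> i \<le> j \<longrightarrow> Q (s * int j) \<subseteq> e (s * int i) (s * int j) ` Q (s * int i)"
proof -
  note T' = gensD(1)[OF T]
  have TC: "\<forall>x\<in>T. snd x \<in> C (fst x)" using gensD[OF T] by auto
  define Z where "Z i = {z :: int \<times> 'a \<Rightarrow> 'k poly. (\<forall>x. x \<notin> T \<longrightarrow> z x = 0) \<and>
    ev T (s * int (K + i)) z \<in> Q (s * int (K + i))}" for i
  have zero: "ev T k (\<lambda>_. 0) = \<zero>" for k by (rule ev_zero[OF T' TC]) simp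
  have Z: "psub (Z i)" for i
    using oclosedD[OF Q] unfolding psub_def Z_def
    by (simp add: zero ev_add[OF T' TC] ev_scale[OF T' TC])
  have trans: "e (s * int (K + i)) (s * int (K + j)) (ev T (s * int (K + i)) z) = ev T (s * int (K + j)) z"
    if "i \<le> j" for i j z
  proof (rule e_ev[OF T' TC], rule ballI)
    fix x assume "x \<in> T"
    then have "\<bar>fst x\<bar> \<le> int K" using K by blast
    then show "cc (L \<alpha> (fst x)) (L \<alpha> (s * int (K + i))) (L \<alpha> (s * int (K + j))) = (1::'k poly)"
      using s that by (intro cc_L_mono) auto
  qed
  have mono: "Z i \<subseteq> Z j" if "i \<le> j" for i j
  proof
    fix z assume "z \<in> Z i"
    then show "z \<in> Z j" using oclosedD(5)[OF Q, of "ev T (s * int (K + i)) z" "s * int (K + i)" "s * int (K + j)"]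
      unfolding Z_def trans[OF that] by simp
  qed
  define U where "U = (\<Union>i. Z i)"
  have U: "z \<in> U \<longleftrightarrow> (\<exists>i. z \<in> Z i)" for z by (simp add: U_def)
  have "psub U"
    unfolding psub_def
  proof (intro conjI ballI allI)
    show "(\<lambda>_. 0) \<in> U" unfolding U by (rule exI[of _ 0], rule psubD(1)[OF Z])
  next
    fix p z assume "z \<in> U"
    then obtain i where "z \<in> Z i" unfolding U ..
    then show "(\<lambda>x. p * z x) \<in> U" unfolding U by (intro exI[of _ i]) (rule psubD(3)[OF Z])
  next
    fix y z assume "y \<in> U" "z \<in> U"
    then obtain i j where "y \<in> Z i" "z \<in> Z j" unfolding U by (elim exE)
    then have "y \<in> Z (max i j)" "z \<in> Z (max i j)"
      using mono[of i "max i j"] mono[of j "max i j"] by auto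
    then have "(\<lambda>x. y x + z x) \<in> Z (max i j)" by (rule psubD(2)[OF Z])
    then show "(\<lambda>x. y x + z x) \<in> U" unfolding U ..
  qed
  moreover have "\<forall>z\<in>U. \<forall>x. x \<notin> T \<longrightarrow> z x = 0" unfolding U_def Z_def by blast
  ultimately have "\<exists>B. finite B \<and> B \<subseteq> U \<and> (\<forall>Z'. psub Z' \<and> B \<subseteq> Z' \<longrightarrow> U \<subseteq> Z')"
    by (rule psub_finitely_generated[OF T'])
  then obtain B where B0: "finite B \<and> B \<subseteq> U \<and> (\<forall>Z'. psub Z' \<and> B \<subseteq> Z' \<longrightarrow> U \<subseteq> Z')" ..
  then have B: "finite B" "B \<subseteq> U" by simp_all
  have "\<exists>n. B \<subseteq> Z n"
    using B(1,2)
  proof (induction B rule: finite_induct)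
    case (insert b B)
    then obtain n where "B \<subseteq> Z n" by auto
    moreover obtain m where "b \<in> Z m" using insert.prems U by blast
    ultimately have "insert b B \<subseteq> Z (max n m)" using mono[of n "max n m"] mono[of m "max n m"] by auto
    then show ?case by blast
  qed simp
  then obtain n where "B \<subseteq> Z n" by blast
  then have "U \<subseteq> Z n" using B0 Z by simp
  then have stable: "Z j \<subseteq> Z n" for j unfolding U_def by blast
  show ?thesis
  proof (intro exI[of _ "K + n"] allI impI subsetI)
    fix i j v assume i: "K + n \<le> i" "i \<le> j" and v: "v \<in> Q (s * int j)"
    obtain i' j' where ij: "i = K + i'" "j = K + j'" "n \<le> i'" "i' \<le> j'"
      by (rule that[of "i - K" "j - K"]) (use i in auto)
    obtain z where z: "v = ev T (s * int j) z" "\<forall>x. x \<notin> T \<longrightarrow> z x = 0"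
      by (rule ev_surj[OF T oclosedD(1)[OF Q v]])
    then have "z \<in> Z j'" using v unfolding Z_def ij by simp
    then have "z \<in> Z i'" using stable mono[OF ij(3)] by blast
    then have "ev T (s * int i) z \<in> Q (s * int i)" unfolding Z_def ij by simp
    moreover have "v = e (s * int i) (s * int j) (ev T (s * int i) z)"
      using trans[OF ij(4)] unfolding z(1) ij by simp
    ultimately show "v \<in> e (s * int i) (s * int j) ` Q (s * int i)" by blast
  qed
qed

text \<open>The representations are noetherian: beyond some \<open>N\<close> in both directions \<open>Q\<close> comes from its part at \<open>N\<close>, and each of the finitely
  many parts in between is finitely generated over the polynomials, as the image of a submodule of a free module.\<close>

theorem oclosed_finitely_generated:
  assumes "ofg" and Q: "oclosed Q"
  shows "orep.ofg G Q act e"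
proof -
  interpret Q: orep G \<alpha> Q act e by (rule sub_orep[OF Q])
  obtain T where T: "gens T" using assms(1) ofg_def by auto
  note T' = gensD(1)[OF T]
  have TC: "\<forall>x\<in>T. snd x \<in> C (fst x)" using gensD[OF T] by auto
  have zero: "ev T k (\<lambda>_. 0) = \<zero>" for k by (rule ev_zero[OF T' TC]) simp
  obtain K where K: "K \<ge> 0" "\<And>d g. (d, g) \<in> T \<Longrightarrow> \<bar>d\<bar> \<le> K" by (rule gens_bound[OF T]) blast
  then have K': "\<forall>x\<in>T. \<bar>fst x\<bar> \<le> int (nat K)" by auto
  obtain N1 where N1: "\<forall>i j. N1 \<le> i \<longrightarrow> i \<le> j \<longrightarrow> Q (1 * int j) \<subseteq> e (1 * int i) (1 * int j) ` Q (1 * int i)"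
    using oclosed_stable[OF T Q K' disjI1[OF refl]] ..
  obtain N2 where N2: "\<forall>i j. N2 \<le> i \<longrightarrow> i \<le> j \<longrightarrow> Q (-1 * int j) \<subseteq> e (-1 * int i) (-1 * int j) ` Q (-1 * int i)"
    using oclosed_stable[OF T Q K' disjI2[OF refl]] ..
  define N where "N = max N1 N2"
  have "\<exists>B. finite B \<and> B \<subseteq> Q k \<and> (\<forall>W. kclosed k W \<and> B \<subseteq> W \<longrightarrow> Q k \<subseteq> W)" for k
  proof -
    define Z where "Z W = {z :: int \<times> 'a \<Rightarrow> 'k poly. (\<forall>x. x \<notin> T \<longrightarrow> z x = 0) \<and> ev T k z \<in> W}" for W
    have psub: "psub (Z W)" if "kclosed k W" for W
      using kclosedD[OF that] unfolding psub_def Z_def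
      by (simp add: zero ev_add[OF T' TC] ev_scale[OF T' TC])
    have "\<exists>B. finite B \<and> B \<subseteq> Z (Q k) \<and> (\<forall>Z'. psub Z' \<and> B \<subseteq> Z' \<longrightarrow> Z (Q k) \<subseteq> Z')"
      by (rule psub_finitely_generated[OF T' psub[OF oclosed_kclosed[OF Q]]]) (auto simp: Z_def)
    then obtain B where B: "finite B \<and> B \<subseteq> Z (Q k) \<and> (\<forall>Z'. psub Z' \<and> B \<subseteq> Z' \<longrightarrow> Z (Q k) \<subseteq> Z')" ..
    show ?thesis
    proof (intro exI[of _ "ev T k ` B"] conjI allI impI)
      show "finite (ev T k ` B)" using B by simp
      show "ev T k ` B \<subseteq> Q k" using B unfolding Z_def by blast
      fix W assume W: "kclosed k W \<and> ev T k ` B \<subseteq> W"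
      then have "B \<subseteq> Z W" using B unfolding Z_def by blast
      then have ZW: "Z (Q k) \<subseteq> Z W" using B psub W by simp
      show "Q k \<subseteq> W"
      proof
        fix v assume v: "v \<in> Q k"
        obtain z where z: "v = ev T k z" "\<forall>x. x \<notin> T \<longrightarrow> z x = 0"
          by (rule ev_surj[OF T oclosedD(1)[OF Q v]])
        then have "z \<in> Z (Q k)" using v unfolding Z_def by simp
        then show "v \<in> W" using ZW z(1) unfolding Z_def by blast
      qed
    qed
  qed
  then obtain B where B0: "\<forall>k. finite (B k) \<and> B k \<subseteq> Q k \<and> (\<forall>W. kclosed k W \<and> B k \<subseteq> W \<longrightarrow> Q k \<subseteq> W)"
    using choice[of "\<lambda>k B. finite B \<and> B \<subseteq> Q k \<and> (\<forall>W. kclosed k W \<and> B \<subseteq> W \<longrightarrow> Q k \<subseteq> W)"] by blast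
  then have B: "finite (B k)" "B k \<subseteq> Q k" "kclosed k W \<Longrightarrow> B k \<subseteq> W \<Longrightarrow> Q k \<subseteq> W" for k W
    by blast+
  have "Q.gens (SIGMA k:{-int N..int N}. B k)"
    unfolding Q.gens_def
  proof (intro conjI allI impI)
    show "finite (SIGMA k:{-int N..int N}. B k)" using B(1) by blast
    show "\<forall>(d, g)\<in>SIGMA k:{-int N..int N}. B k. g \<in> Q d" using B(2) by blast
    fix R k assume R: "Q.oclosed R \<and> (\<forall>(d, g)\<in>SIGMA k:{-int N..int N}. B k. g \<in> R d)"
    note RD = Q.oclosedD[OF conjunct1[OF R]]
    have mid: "Q k \<subseteq> R k" if "k \<in> {-int N..int N}" for k
    proof (rule B(3))
      show "kclosed k (R k)"
        unfolding kclosed_def by (intro conjI ballI allI subsetI oclosedD(1)[OF Q] RD)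
      show "B k \<subseteq> R k" using R that by blast
    qed
    show "Q k \<subseteq> R k"
    proof (cases "k \<in> {-int N..int N}")
      case True
      then show ?thesis by (rule mid)
    next
      case False
      define s :: int where "s = (if k > 0 then 1 else -1)"
      have k: "k = s * int (nat \<bar>k\<bar>)" "N \<le> nat \<bar>k\<bar>" using False by (auto simp: s_def)
      have "Q (s * int (nat \<bar>k\<bar>)) \<subseteq> e (s * int N) (s * int (nat \<bar>k\<bar>)) ` Q (s * int N)"
      proof (cases "s = 1")
        case True
        then show ?thesis using N1[rule_format, of N "nat \<bar>k\<bar>"] k(2) by (simp add: N_def)
      next
        case False
        then have "s = -1" by (auto simp: s_def split: if_splits)
        then show ?thesis using N2[rule_format, of N "nat \<bar>k\<bar>"] k(2) by (simp add: N_def)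
      qed
      then have "Q k \<subseteq> e (s * int N) k ` Q (s * int N)" using k(1) by simp
      also have "\<dots> \<subseteq> R k"
      proof (rule image_subsetI)
        fix x assume "x \<in> Q (s * int N)"
        then have "x \<in> R (s * int N)" using mid[of "s * int N"] by (auto simp: s_def)
        then show "e (s * int N) k x \<in> R k" by (rule RD(5))
      qed
      finally show ?thesis .
    qed
  qed
  then show ?thesis unfolding Q.ofg_def by blast
qed

end

section \<open>Compatible families\<close>

text \<open>A ring record only for the sake of its additive group; the multiplicative fields are dummies.\<close>

definition fun_group :: "('a, 'm) ring_scheme \<Rightarrow> (int \<Rightarrow> 'a) ring" where
  "fun_group G = \<lparr>carrier = {a. \<forall>i. a i \<in> carrier G}, monoid.mult = (\<lambda>a b. a), one = (\<lambda>_. \<zero>\<^bsub>G\<^esub>),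
     zero = (\<lambda>_. \<zero>\<^bsub>G\<^esub>), add = (\<lambda>a b i. a i \<oplus>\<^bsub>G\<^esub> b i)\<rparr>"

lemma fun_group_simps [simp]:
  "a \<in> carrier (fun_group G) \<longleftrightarrow> (\<forall>i. a i \<in> carrier G)"
  "\<zero>\<^bsub>fun_group G\<^esub> = (\<lambda>_. \<zero>\<^bsub>G\<^esub>)"
  "a \<oplus>\<^bsub>fun_group G\<^esub> b = (\<lambda>i. a i \<oplus>\<^bsub>G\<^esub> b i)"
  by (simp_all add: fun_group_def)

lemma abelian_group_fun_group:
  assumes "abelian_group G"
  shows "abelian_group (fun_group G)"
proof -
  interpret abelian_group G by fact
  show ?thesis
  proof (rule abelian_groupI)
    fix x assume x: "x \<in> carrier (fun_group G)"
    show "\<exists>y\<in>carrier (fun_group G). y \<oplus>\<^bsub>fun_group G\<^esub> x = \<zero>\<^bsub>fun_group G\<^esub>"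
      by (rule bexI[of _ "\<lambda>i. \<ominus>\<^bsub>G\<^esub> x i"]) (use x in \<open>simp_all add: l_neg\<close>)
  qed (simp_all add: fun_eq_iff a_ac)
qed

context orep
begin

definition pact :: "'k poly \<Rightarrow> (int \<Rightarrow> 'a) \<Rightarrow> int \<Rightarrow> 'a" where
  "pact p a = (\<lambda>j. act j p (a j))"

text \<open>The families that transform like the maps from the lattice with divisor \<open>L \<beta> n\<close> to the lattices \<open>L \<alpha> i\<close>. In
  other words, these are the homomorphisms into the given representation from the one that this lattice represents.\<close>

definition fam :: "nat \<Rightarrow> int \<Rightarrow> (int \<Rightarrow> 'a) set" where
  "fam \<beta> n = {a. (\<forall>i. a i \<in> C i) \<and> (\<forall>i j. e i j (a i) = act j (cc (L \<beta> n) (L \<alpha> i) (L \<alpha> j)) (a j))}"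

text \<open>The structure map of the representation formed by the families: composition with the map from \<open>L \<beta> n\<close> to \<open>L \<beta> m\<close>.\<close>

definition tr :: "nat \<Rightarrow> int \<Rightarrow> int \<Rightarrow> (int \<Rightarrow> 'a) \<Rightarrow> int \<Rightarrow> 'a" where
  "tr \<beta> n m a = (\<lambda>j. act j (cc (L \<beta> n) (L \<beta> m) (L \<alpha> j)) (a j))"

text \<open>The family generated by \<open>v\<close> in degree \<open>i\<close>: its entry at \<open>j\<close> is the effect on \<open>v\<close> of the detour from
  \<open>L \<alpha> i\<close> through \<open>L \<beta> n\<close> to \<open>L \<alpha> j\<close>.\<close>

definition lift :: "nat \<Rightarrow> int \<Rightarrow> int \<Rightarrow> 'a \<Rightarrow> int \<Rightarrow> 'a" where
  "lift \<beta> n i v = (\<lambda>j. act j (cc (L \<alpha> i) (L \<beta> n) (L \<alpha> j)) (e i j v))"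

lemma famI:
  assumes "\<And>i. a i \<in> C i" "\<And>i j. e i j (a i) = act j (cc (L \<beta> n) (L \<alpha> i) (L \<alpha> j)) (a j)"
  shows "a \<in> fam \<beta> n"
  using assms unfolding fam_def by blast

lemma famD:
  assumes "a \<in> fam \<beta> n"
  shows "a i \<in> C i" "e i j (a i) = act j (cc (L \<beta> n) (L \<alpha> i) (L \<alpha> j)) (a j)"
  using assms unfolding fam_def by blast+

lemma fam_add: "\<lbrakk>a \<in> fam \<beta> n; b \<in> fam \<beta> n\<rbrakk> \<Longrightarrow> (\<lambda>i. a i \<oplus> b i) \<in> fam \<beta> n"
  by (rule famI) (simp_all add: famD e_add act_add)

lemma fam_zero: "(\<lambda>_. \<zero>) \<in> fam \<beta> n"
  by (rule famI) simp_all

lemma fam_pact: "a \<in> fam \<beta> n \<Longrightarrow> pact p a \<in> fam \<beta> n"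
  by (rule famI) (simp_all add: famD pact_def e_act act_commute)

lemma fam_tr: "a \<in> fam \<beta> n \<Longrightarrow> tr \<beta> n m a \<in> fam \<beta> m"
proof (rule famI)
  fix i j assume a: "a \<in> fam \<beta> n"
  show "tr \<beta> n m a i \<in> C i" unfolding tr_def using famD(1)[OF a] by simp
  have "e i j (tr \<beta> n m a i)
      = act j (cc (L \<beta> n) (L \<beta> m) (L \<alpha> i) * cc (L \<beta> n) (L \<alpha> i) (L \<alpha> j)) (a j)"
    unfolding tr_def using famD[OF a] by (simp add: e_act act_mult)
  also have "\<dots> = act j (cc (L \<beta> m) (L \<alpha> i) (L \<alpha> j)) (tr \<beta> n m a j)"
    unfolding tr_def using famD[OF a] by (subst cc_cocycle) (simp add: act_mult)
  finally show "e i j (tr \<beta> n m a i) = act j (cc (L \<beta> m) (L \<alpha> i) (L \<alpha> j)) (tr \<beta> n m a j)" .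
qed

lemma tr_tr: "a \<in> fam \<beta> n \<Longrightarrow> tr \<beta> m k (tr \<beta> n m a) = pact (cc (L \<beta> n) (L \<beta> m) (L \<beta> k)) (tr \<beta> n k a)"
proof (rule ext)
  fix j assume a: "a \<in> fam \<beta> n"
  have "tr \<beta> m k (tr \<beta> n m a) j
      = act j (cc (L \<beta> m) (L \<beta> k) (L \<alpha> j) * cc (L \<beta> n) (L \<beta> m) (L \<alpha> j)) (a j)"
    unfolding tr_def using famD[OF a] by (simp add: act_mult)
  also have "\<dots> = pact (cc (L \<beta> n) (L \<beta> m) (L \<beta> k)) (tr \<beta> n k a) j"
    unfolding tr_def pact_def using famD[OF a] by (subst cc_cocycle[symmetric]) (simp add: act_mult)
  finally show "tr \<beta> m k (tr \<beta> n m a) j = pact (cc (L \<beta> n) (L \<beta> m) (L \<beta> k)) (tr \<beta> n k a) j" .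
qed

lemma fam_orep: "orep (fun_group G) \<beta> (fam \<beta>) (\<lambda>_. pact) (tr \<beta>)"
proof -
  interpret F: abelian_group "fun_group G"
    by (rule abelian_group_fun_group) (rule abelian_group_axioms)
  show ?thesis
  proof (unfold_locales, goal_cases)
    case 1 then show ?case using famD(1) C_carrier by (simp, blast)
  next
    case 2 show ?case using fam_zero by simp
  next
    case 3 then show ?case using fam_add by simp
  next
    case 4 then show ?case by (rule fam_pact)
  next
    case 5 then show ?case by (simp add: pact_def act_add[OF famD(1) famD(1)])
  next
    case 6 then show ?case by (simp add: pact_def act_padd[OF famD(1)])
  next
    case 7 then show ?case by (simp add: pact_def act_mult[OF famD(1)])
  next
    case 8 then show ?case by (simp add: pact_def act_one[OF famD(1)])
  next
    case 9 then show ?case by (rule fam_tr)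
  next
    case 10 then show ?case by (simp add: tr_def act_add[OF famD(1) famD(1)])
  next
    case 11 then show ?case by (simp add: tr_def pact_def act_commute[OF famD(1)])
  next
    case 12 then show ?case by (simp add: tr_def act_one[OF famD(1)])
  next
    case 13 then show ?case by (rule tr_tr)
  qed
qed

lemma lift_fam: "v \<in> C i \<Longrightarrow> lift \<beta> n i v \<in> fam \<beta> n"
proof (rule famI)
  fix j k assume v: "v \<in> C i"
  show "lift \<beta> n i v j \<in> C j" unfolding lift_def using v by simp
  have "e j k (lift \<beta> n i v j)
      = act k (cc (L \<alpha> i) (L \<beta> n) (L \<alpha> j) * cc (L \<alpha> i) (L \<alpha> j) (L \<alpha> k)) (e i k v)"
    unfolding lift_def using v by (simp add: e_act e_comp act_mult)
  also have "\<dots> = act k (cc (L \<beta> n) (L \<alpha> j) (L \<alpha> k)) (lift \<beta> n i v k)"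
    unfolding lift_def using v by (subst cc_cocycle) (simp add: act_mult)
  finally show "e j k (lift \<beta> n i v j) = act k (cc (L \<beta> n) (L \<alpha> j) (L \<alpha> k)) (lift \<beta> n i v k)" .
qed

lemma lift_add: "\<lbrakk>v \<in> C i; w \<in> C i\<rbrakk> \<Longrightarrow> lift \<beta> n i (v \<oplus> w) = (\<lambda>j. lift \<beta> n i v j \<oplus> lift \<beta> n i w j)"
  unfolding lift_def by (simp add: e_add act_add)

lemma lift_zero [simp]: "lift \<beta> n i \<zero> = (\<lambda>_. \<zero>)"
  unfolding lift_def by simp

lemma lift_act: "v \<in> C i \<Longrightarrow> lift \<beta> n i (act i p v) = pact p (lift \<beta> n i v)"
  unfolding lift_def pact_def by (simp add: e_act act_commute)

lemma tr_lift: "v \<in> C i \<Longrightarrow> tr \<beta> n m (lift \<beta> n i v) = pact (cc (L \<alpha> i) (L \<beta> n) (L \<beta> m)) (lift \<beta> m i v)"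
proof (rule ext)
  fix j assume v: "v \<in> C i"
  have "tr \<beta> n m (lift \<beta> n i v) j
      = act j (cc (L \<beta> n) (L \<beta> m) (L \<alpha> j) * cc (L \<alpha> i) (L \<beta> n) (L \<alpha> j)) (e i j v)"
    unfolding tr_def lift_def using v by (simp add: act_mult)
  also have "\<dots> = pact (cc (L \<alpha> i) (L \<beta> n) (L \<beta> m)) (lift \<beta> m i v) j"
    unfolding lift_def pact_def using v by (subst cc_cocycle[symmetric]) (simp add: act_mult)
  finally show "tr \<beta> n m (lift \<beta> n i v) j = pact (cc (L \<alpha> i) (L \<beta> n) (L \<beta> m)) (lift \<beta> m i v) j" .
qed

lemma lift_e: "v \<in> C i \<Longrightarrow> lift \<beta> n j (e i j v) = pact (cc (L \<alpha> i) (L \<alpha> j) (L \<beta> n)) (lift \<beta> n i v)"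
proof (rule ext)
  fix k assume v: "v \<in> C i"
  have "lift \<beta> n j (e i j v) k
      = act k (cc (L \<alpha> j) (L \<beta> n) (L \<alpha> k) * cc (L \<alpha> i) (L \<alpha> j) (L \<alpha> k)) (e i k v)"
    unfolding lift_def using v by (simp add: e_comp act_mult)
  also have "\<dots> = pact (cc (L \<alpha> i) (L \<alpha> j) (L \<beta> n)) (lift \<beta> n i v) k"
    unfolding lift_def pact_def using v by (subst cc_cocycle[symmetric]) (simp add: act_mult)
  finally show "lift \<beta> n j (e i j v) k = pact (cc (L \<alpha> i) (L \<alpha> j) (L \<beta> n)) (lift \<beta> n i v) k" .
qed

text \<open>By the cocycle identity it makes no difference, up to a round trip factor, whether a family is transported or
  generated anew from one of its entries.\<close>

lemma lift_proj:
  "a \<in> fam \<beta> n \<Longrightarrow> lift \<beta> m i (a i) = pact (cc (L \<beta> n) (L \<alpha> i) (L \<beta> m)) (tr \<beta> n m a)"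
proof (rule ext)
  fix j assume a: "a \<in> fam \<beta> n"
  have "lift \<beta> m i (a i) j
      = act j (cc (L \<alpha> i) (L \<beta> m) (L \<alpha> j) * cc (L \<beta> n) (L \<alpha> i) (L \<alpha> j)) (a j)"
    unfolding lift_def using famD[OF a] by (simp add: act_mult)
  also have "\<dots> = pact (cc (L \<beta> n) (L \<alpha> i) (L \<beta> m)) (tr \<beta> n m a) j"
    unfolding tr_def pact_def using famD[OF a] by (subst cc_cocycle[symmetric]) (simp add: act_mult)
  finally show "lift \<beta> m i (a i) j = pact (cc (L \<beta> n) (L \<alpha> i) (L \<beta> m)) (tr \<beta> n m a) j" .
qed

lemma tr_id [simp]: "a \<in> fam \<beta> n \<Longrightarrow> tr \<beta> n n a = a"
  by (rule ext) (simp add: tr_def act_one famD(1))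

lemma lift_proj_same: "a \<in> fam \<beta> n \<Longrightarrow> lift \<beta> n i (a i) = pact (cc (L \<beta> n) (L \<alpha> i) (L \<beta> n)) a"
  by (simp add: lift_proj)

lemma bezout_cancel:
  assumes "bezout p q" "v \<in> C i" "w \<in> C i" "act i p v = act i p w" "act i q v = act i q w"
  shows "v = w"
proof -
  obtain u t where "u * p + t * q = 1" using assms(1) unfolding bezout_def by blast
  from act_bezout[OF this assms(2)] act_bezout[OF this assms(3)] assms(4,5) show ?thesis by metis
qed

text \<open>The images of the two entries in degree \<open>j\<close> are multiples of the entry there by coprime factors. Besides uniqueness of
  families this provides codes of families by pairs of elements.\<close>

lemma fam_determined:
  assumes "\<alpha> = 0 \<or> \<beta> = 0" and a: "a \<in> fam \<beta> n" and b: "b \<in> fam \<beta> n"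
    and eq: "a (n - int \<alpha>) = b (n - int \<alpha>)" "a (n + int \<beta>) = b (n + int \<beta>)"
  shows "a = b"
proof (rule ext)
  fix j
  have "bezout (cc (L \<beta> n) (L \<alpha> (n - int \<alpha>)) (L \<alpha> j)) (cc (L \<beta> n) (L \<alpha> (n + int \<beta>)) (L \<alpha> j) :: 'k poly)"
    using cc_L_bezout[OF assms(1) order_refl order_refl, of j n] by (simp add: cc_rev)
  then show "a j = b j"
    by (rule bezout_cancel[OF _ famD(1)[OF a] famD(1)[OF b]]) (metis famD(2)[OF a] famD(2)[OF b] eq)+
qed

text \<open>The entries far out on the left and on the right are mapped to two coprime multiples of any given entry.\<close>

lemma fam_mem:
  assumes Q: "oclosed Q" and a: "a \<in> fam 0 n" and far: "\<And>k. \<bar>k\<bar> \<ge> K \<Longrightarrow> a k \<in> Q k"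
  shows "a j \<in> Q j"
proof -
  define k1 k2 where "k1 = - (\<bar>K\<bar> + \<bar>n\<bar> + int \<alpha>)" and "k2 = \<bar>K\<bar> + \<bar>n\<bar>"
  have "a k1 \<in> Q k1" "a k2 \<in> Q k2" using far[of k1] far[of k2] unfolding k1_def k2_def by auto
  then have "e k1 j (a k1) \<in> Q j" "e k2 j (a k2) \<in> Q j" using oclosedD(5)[OF Q] by blast+
  then show ?thesis
    unfolding famD(2)[OF a]
    by (intro bezout_mem[OF Q cc_L0_bezout[of k1 n \<alpha> k2] famD(1)[OF a]]) (auto simp: k1_def k2_def)
qed

text \<open>A bounded subrepresentation vanishes far out, so it contains no nonzero family.\<close>

lemma fam_eq_zero:
  assumes "oclosed Q" "bounded Q" "a \<in> fam 0 n" "\<And>k. a k \<in> Q k"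
  shows "a j = \<zero>"
proof -
  obtain K where K: "\<And>k. \<bar>k\<bar> \<ge> K \<Longrightarrow> Q k \<subseteq> {\<zero>}" using assms(2) unfolding bounded_def by blast
  have "a k \<in> {\<zero>}" if "\<bar>k\<bar> \<ge> K" for k using K[OF that] assms(4)[of k] by blast
  then have "a j \<in> {\<zero>}" by (rule fam_mem[OF oclosed_zero assms(3)])
  then show ?thesis by simp
qed

subsection \<open>The part generated by the given representation\<close>

text \<open>The families generated by the elements of the representation. Two indices suffice as
  sources (\<open>lift_H\<close>); with this choice \<open>H\<close> is visibly closed under addition.\<close>

definition H :: "nat \<Rightarrow> int \<Rightarrow> (int \<Rightarrow> 'a) set" where
  "H \<beta> n = {a. \<exists>v\<in>C (n - int \<alpha>). \<exists>w\<in>C (n + int \<beta>).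
     a = (\<lambda>j. lift \<beta> n (n - int \<alpha>) v j \<oplus> lift \<beta> n (n + int \<beta>) w j)}"

lemma lift_H:
  assumes "\<alpha> = 0 \<or> \<beta> = 0" "v \<in> C i"
  shows "lift \<beta> n i v \<in> H \<beta> n"
proof -
  let ?k = "n - int \<alpha>" and ?l = "n + int \<beta>"
  let ?p = "cc (L \<alpha> i) (L \<alpha> ?k) (L \<beta> n) :: 'k poly" and ?q = "cc (L \<alpha> i) (L \<alpha> ?l) (L \<beta> n) :: 'k poly"
  have "bezout ?p ?q" by (rule cc_L_bezout) (use assms in auto)
  then obtain u w where uw: "u * ?p + w * ?q = 1" unfolding bezout_def by blast
  have "lift \<beta> n i v = (\<lambda>j. lift \<beta> n ?k (act ?k u (e i ?k v)) j \<oplus> lift \<beta> n ?l (act ?l w (e i ?l v)) j)"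
  proof (rule ext)
    fix j
    have "lift \<beta> n i v j \<in> C j" using lift_fam[OF assms(2)] famD(1) by blast
    from act_bezout[OF uw this]
    show "lift \<beta> n i v j = lift \<beta> n ?k (act ?k u (e i ?k v)) j \<oplus> lift \<beta> n ?l (act ?l w (e i ?l v)) j"
      using assms(2) by (simp add: lift_act lift_e pact_def)
  qed
  then show ?thesis unfolding H_def using assms(2)
    by (intro CollectI bexI[of _ "act ?k u (e i ?k v)"] bexI[of _ "act ?l w (e i ?l v)"]) auto
qed

lemma H_fam: "a \<in> H \<beta> n \<Longrightarrow> a \<in> fam \<beta> n"
  unfolding H_def by (auto intro!: fam_add lift_fam)

lemma H_add:
  assumes "a \<in> H \<beta> n" "b \<in> H \<beta> n"
  shows "(\<lambda>j. a j \<oplus> b j) \<in> H \<beta> n"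
proof -
  let ?k = "n - int \<alpha>" and ?l = "n + int \<beta>"
  obtain v w v' w' where vw: "v \<in> C ?k" "w \<in> C ?l" "v' \<in> C ?k" "w' \<in> C ?l"
    and ab: "a = (\<lambda>j. lift \<beta> n ?k v j \<oplus> lift \<beta> n ?l w j)" "b = (\<lambda>j. lift \<beta> n ?k v' j \<oplus> lift \<beta> n ?l w' j)"
    using assms unfolding H_def by blast
  have "lift \<beta> n ?k v j \<in> carrier G" "lift \<beta> n ?l w j \<in> carrier G"
    "lift \<beta> n ?k v' j \<in> carrier G" "lift \<beta> n ?l w' j \<in> carrier G" for j
    using vw lift_fam famD(1) C_carrier by meson+
  then have "(\<lambda>j. a j \<oplus> b j) = (\<lambda>j. lift \<beta> n ?k (v \<oplus> v') j \<oplus> lift \<beta> n ?l (w \<oplus> w') j)"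
    unfolding ab using vw by (simp add: lift_add a_ac)
  then show ?thesis unfolding H_def using vw
    by (intro CollectI bexI[of _ "v \<oplus> v'"] bexI[of _ "w \<oplus> w'"]) auto
qed

lemma H_induct:
  assumes "a \<in> H \<beta> n" "\<And>i v. v \<in> C i \<Longrightarrow> P (lift \<beta> n i v)"
    "\<And>a b. \<lbrakk>a \<in> fam \<beta> n; b \<in> fam \<beta> n; P a; P b\<rbrakk> \<Longrightarrow> P (\<lambda>j. a j \<oplus> b j)"
  shows "P a"
  using assms(1) unfolding H_def by (auto intro!: assms(2,3) lift_fam)

lemma H_oclosed:
  assumes "\<alpha> = 0 \<or> \<beta> = 0"
  shows "orep.oclosed (fun_group G) (fam \<beta>) (\<lambda>_. pact) (tr \<beta>) (H \<beta>)"
proof -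
  interpret F: orep "fun_group G" \<beta> "fam \<beta>" "\<lambda>_. pact" "tr \<beta>" by (rule fam_orep)
  show ?thesis
  proof (rule F.oclosedI)
    show "\<zero>\<^bsub>fun_group G\<^esub> \<in> H \<beta> k" for k using lift_H[OF assms C_zero] by simp
    show "a \<oplus>\<^bsub>fun_group G\<^esub> b \<in> H \<beta> k" if "a \<in> H \<beta> k" "b \<in> H \<beta> k" for k a b
      using H_add[OF that] by simp
    show act: "pact p a \<in> H \<beta> k" if "a \<in> H \<beta> k" for k p a
      using that
    proof (rule H_induct)
      show "pact p (lift \<beta> k i v) \<in> H \<beta> k" if "v \<in> C i" for i v
        using lift_H[OF assms act_C[OF that]] by (simp add: lift_act that)
      fix a b assume ab: "a \<in> fam \<beta> k" "b \<in> fam \<beta> k" "pact p a \<in> H \<beta> k" "pact p b \<in> H \<beta> k"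
      have "pact p (\<lambda>j. a j \<oplus> b j) = (\<lambda>j. pact p a j \<oplus> pact p b j)"
        unfolding pact_def using famD(1)[OF ab(1)] famD(1)[OF ab(2)] by (simp add: act_add)
      then show "pact p (\<lambda>j. a j \<oplus> b j) \<in> H \<beta> k" using H_add[OF ab(3,4)] by simp
    qed
    show "tr \<beta> k m a \<in> H \<beta> m" if "a \<in> H \<beta> k" for k m a
      using that
    proof (rule H_induct)
      show "tr \<beta> k m (lift \<beta> k i v) \<in> H \<beta> m" if "v \<in> C i" for i v
        using act[OF lift_H[OF assms that]] by (simp add: tr_lift that)
      fix a b assume ab: "a \<in> fam \<beta> k" "b \<in> fam \<beta> k" "tr \<beta> k m a \<in> H \<beta> m" "tr \<beta> k m b \<in> H \<beta> m"
      have "tr \<beta> k m (\<lambda>j. a j \<oplus> b j) = (\<lambda>j. tr \<beta> k m a j \<oplus> tr \<beta> k m b j)"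
        unfolding tr_def using famD(1)[OF ab(1)] famD(1)[OF ab(2)] by (simp add: act_add)
      then show "tr \<beta> k m (\<lambda>j. a j \<oplus> b j) \<in> H \<beta> m" using H_add[OF ab(3,4)] by simp
    qed
  qed (rule H_fam)
qed

lemma H_orep: "\<alpha> = 0 \<or> \<beta> = 0 \<Longrightarrow> orep (fun_group G) \<beta> (H \<beta>) (\<lambda>_. pact) (tr \<beta>)"
  by (rule orep.sub_orep[OF fam_orep H_oclosed])

text \<open>For a generator \<open>g\<close> in degree \<open>d\<close> the families \<open>lift \<beta> n d g\<close> for all \<open>n\<close> are generated by those for
  \<open>n = d - \<beta>\<close> and \<open>n = d + \<alpha>\<close>: transported to any index these two give multiples of the family there by coprime factors.\<close>

lemma H_ofg:
  assumes "ofg" and ab: "\<alpha> = 0 \<or> \<beta> = 0"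
  shows "orep.ofg (fun_group G) (H \<beta>) (\<lambda>_. pact) (tr \<beta>)"
proof -
  interpret H: orep "fun_group G" \<beta> "H \<beta>" "\<lambda>_. pact" "tr \<beta>" by (rule H_orep[OF ab])
  obtain T where T: "gens T" using assms(1) ofg_def by auto
  define S where "S = (\<lambda>(d, g). (d - int \<beta>, lift \<beta> (d - int \<beta>) d g)) ` T \<union>
    (\<lambda>(d, g). (d + int \<alpha>, lift \<beta> (d + int \<alpha>) d g)) ` T"
  have "H.gens S"
    unfolding H.gens_def
  proof (intro conjI allI impI)
    show "finite S" unfolding S_def using gensD(1)[OF T] by simp
    show "\<forall>(n, a)\<in>S. a \<in> H \<beta> n" unfolding S_def using gensD(2)[OF T] lift_H[OF ab] by auto
    fix R k assume R: "H.oclosed R \<and> (\<forall>(n, a)\<in>S. a \<in> R n)"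
    note RD = H.oclosedD[OF conjunct1[OF R]]
    define Q where "Q = (\<lambda>k. {v. v \<in> C k \<and> (\<forall>n. lift \<beta> n k v \<in> R n)})"
    have Q: "v \<in> Q k \<longleftrightarrow> v \<in> C k \<and> (\<forall>n. lift \<beta> n k v \<in> R n)" for v k by (simp add: Q_def)
    have "oclosed Q"
    proof (rule oclosedI, goal_cases)
      case (2 k)
      show ?case unfolding Q using RD(2) by simp
    next
      case (3 k v w)
      then have "lift \<beta> n k (v \<oplus> w) \<in> R n" for n
        using RD(3)[of "lift \<beta> n k v" n "lift \<beta> n k w"] unfolding Q by (simp add: lift_add)
      then show ?case using 3 unfolding Q by simp
    next
      case (4 k p v)
      then have "lift \<beta> n k (act k p v) \<in> R n" for n
        using RD(4)[of "lift \<beta> n k v" n p] unfolding Q by (simp add: lift_act)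
      then show ?case using 4 unfolding Q by simp
    next
      case (5 i j v)
      then have "lift \<beta> n j (e i j v) \<in> R n" for n
        using RD(4)[of "lift \<beta> n i v" n] unfolding Q by (simp add: lift_e)
      then show ?case using 5 unfolding Q by simp
    qed (simp add: Q)
    moreover have "g \<in> Q d" if dg: "(d, g) \<in> T" for d g
    proof -
      have g: "g \<in> C d" using gensD(2)[OF T dg] .
      have "lift \<beta> n d g \<in> R n" for n
      proof (rule H.bezout_mem[OF conjunct1[OF R] _ lift_H[OF ab g]])
        show "bezout (cc (L \<alpha> d) (L \<beta> (d - int \<beta>)) (L \<beta> n)) (cc (L \<alpha> d) (L \<beta> (d + int \<alpha>)) (L \<beta> n) :: 'k poly)"
          by (rule cc_L_bezout') (use ab in auto)
        have "lift \<beta> (d - int \<beta>) d g \<in> R (d - int \<beta>)" "lift \<beta> (d + int \<alpha>) d g \<in> R (d + int \<alpha>)"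
          using R dg unfolding S_def by force+
        from RD(5)[OF this(1)] RD(5)[OF this(2)]
        show "pact (cc (L \<alpha> d) (L \<beta> (d - int \<beta>)) (L \<beta> n)) (lift \<beta> n d g) \<in> R n"
          "pact (cc (L \<alpha> d) (L \<beta> (d + int \<alpha>)) (L \<beta> n)) (lift \<beta> n d g) \<in> R n"
          unfolding tr_lift[OF g] by blast+
      qed
      then show ?thesis using g unfolding Q by blast
    qed
    ultimately have "v \<in> Q i" if "v \<in> C i" for v i using gens_induct[OF T _ _ that, of Q] by blast
    then have mem: "lift \<beta> k i v \<in> R k" if "v \<in> C i" for v i using that unfolding Q by blast
    show "H \<beta> k \<subseteq> R k"
    proof
      fix a assume "a \<in> H \<beta> k"
      then obtain v w where vw: "v \<in> C (k - int \<alpha>)" "w \<in> C (k + int \<beta>)"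
        "a = (\<lambda>j. lift \<beta> k (k - int \<alpha>) v j \<oplus> lift \<beta> k (k + int \<beta>) w j)" unfolding H_def by blast
      from RD(3)[OF mem[OF vw(1)] mem[OF vw(2)]] show "a \<in> R k" unfolding vw(3) by simp
    qed
  qed
  then show ?thesis unfolding H.ofg_def by blast
qed

lemma fam_zero_bezout:
  obtains u w where "u * cc (L 0 n) (L \<alpha> (n - int \<alpha>)) x + w * cc (L 0 n) (L \<alpha> n) y = (1::'k poly)"
  using cc_L0_bezout[OF order_refl order_refl, of n \<alpha> x y] unfolding bezout_def by blast

text \<open>At the divisors \<open>L 0 n\<close> every family is generated by two of its entries, since the two round trip factors are
  coprime. At the divisors \<open>L \<alpha> k\<close> with \<open>\<alpha> > 0\<close> the round trips through all \<open>L 0 n\<close> share a linear factor, so there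
  \<open>H\<close> can be smaller than \<open>fam\<close>.\<close>

lemma fam_0_eq_H: "fam 0 n = H 0 n"
proof (rule equalityI[OF subsetI subsetI])
  fix a assume a: "a \<in> fam 0 n"
  let ?k = "n - int \<alpha>"
  obtain u w where uw: "u * cc (L 0 n) (L \<alpha> ?k) (L 0 n) + w * cc (L 0 n) (L \<alpha> n) (L 0 n) = (1::'k poly)"
    by (rule fam_zero_bezout)
  have "a = (\<lambda>j. lift 0 n ?k (act ?k u (a ?k)) j \<oplus> lift 0 n n (act n w (a n)) j)"
  proof (rule ext)
    fix j
    from act_bezout[OF uw famD(1)[OF a]]
    show "a j = lift 0 n ?k (act ?k u (a ?k)) j \<oplus> lift 0 n n (act n w (a n)) j"
      using famD(1)[OF a] by (simp add: lift_act lift_proj_same[OF a] pact_def)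
  qed
  then show "a \<in> H 0 n" unfolding H_def using famD(1)[OF a]
    by (intro CollectI bexI[of _ "act ?k u (a ?k)"] bexI[of _ "act n w (a n)"]) auto
qed (rule H_fam)

lemma fam_0_ofg: "ofg \<Longrightarrow> orep.ofg (fun_group G) (fam 0) (\<lambda>_. pact) (tr 0)"
proof -
  have "fam 0 = H 0" by (rule ext) (rule fam_0_eq_H)
  then show "ofg \<Longrightarrow> orep.ofg (fun_group G) (fam 0) (\<lambda>_. pact) (tr 0)" using H_ofg[of 0] by simp
qed

subsection \<open>Torsion\<close>

definition tors :: "int \<Rightarrow> 'a set" where
  "tors k = {v \<in> C k. \<forall>n. lift 0 n k v = (\<lambda>_. \<zero>)}"

lemma tors_oclosed: "oclosed tors"
proof (rule oclosedI, goal_cases)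
  case (4 k p v)
  then show ?case by (simp add: tors_def lift_act pact_def)
next
  case (5 i j v)
  then show ?case by (simp add: tors_def lift_e pact_def)
qed (simp_all add: tors_def lift_add)

lemma lift_rr: "v \<in> C k \<Longrightarrow> lift 0 k k v k = act k (rr \<alpha> k) v"
  unfolding lift_def rr_def by (simp add: e_id)

text \<open>An entry of \<open>lift 0 k k v\<close> is \<open>rr \<alpha> k\<close> times \<open>v\<close>, so \<open>rr \<alpha> k\<close> annihilates the part of degree \<open>k\<close>. Apply
  \<open>torsion_cobounded\<close> to the zero subrepresentation of this finitely generated representation.\<close>

lemma tors_bounded:
  assumes "ofg"
  shows "bounded tors"
proof -
  interpret T: orep G \<alpha> tors act e by (rule sub_orep[OF tors_oclosed])
  have "act k (rr \<alpha> k) v = \<zero>" if "v \<in> tors k" for k v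
  proof -
    have "lift 0 k k v = (\<lambda>_. \<zero>)" "v \<in> C k" using that unfolding tors_def by auto
    then show ?thesis using lift_rr[of v k] by simp
  qed
  then have "T.cobounded (\<lambda>k. {\<zero>})"
    by (intro T.torsion_cobounded oclosed_finitely_generated[OF assms tors_oclosed] T.oclosed_zero) auto
  then show ?thesis unfolding T.cobounded_def bounded_def by simp
qed

lemma bounded_tors:
  assumes "oclosed Q" "bounded Q"
  shows "Q k \<subseteq> tors k"
proof
  fix v assume v: "v \<in> Q k"
  have C: "v \<in> C k" using oclosedD(1)[OF assms(1) v] .
  have "lift 0 n k v j = \<zero>" for n j
  proof (rule fam_eq_zero[OF assms lift_fam[OF C]])
    show "lift 0 n k v i \<in> Q i" for i
      unfolding lift_def by (intro oclosedD(4,5)[OF assms(1)] v)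
  qed
  then show "v \<in> tors k" unfolding tors_def using C by auto
qed

end

section \<open>The algebras and their modules\<close>

subsection \<open>Evaluating polynomials in the free algebra\<close>

lemma free_alg_induct [case_names zero add]:
  assumes "P 0" "\<And>w c p. P p \<Longrightarrow> P (Poly_Mapping.single w c + p)"
  shows "P (p :: 'k::field free_alg)"
proof (induction p rule: update_induct)
  case (update f a b)
  have "Poly_Mapping.update a b f = Poly_Mapping.single a b + f"
    using update(1) by (intro poly_mapping_eqI) (auto simp: lookup_update lookup_add lookup_single in_keys_iff when_def)
  then show ?case using assms(2)[OF update(3)] by simp
qed (rule assms(1))

text \<open>The generators and the constants generate the free algebra; so closure properties of the action need to be checked only for them.\<close>

lemma free_alg_gen_induct [case_names const gen add mult]:
  assumes "\<And>c. P (free_const c)" "\<And>g. P (free_gen g)"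
    and "\<And>p q. P p \<Longrightarrow> P q \<Longrightarrow> P (p + q)" "\<And>p q. P p \<Longrightarrow> P q \<Longrightarrow> P (p * q)"
  shows "P (p :: 'k::field free_alg)"
proof -
  have word: "P (Poly_Mapping.single (Word l) 1)" for l
  proof (induction l)
    case Nil
    then show ?case using assms(1)[of 1] by (simp add: free_const_def zero_word_def)
  next
    case (Cons g l)
    have "Poly_Mapping.single (Word (g # l)) 1 = free_gen g * Poly_Mapping.single (Word l) (1::'k)"
      by (simp add: free_gen_def mult_single plus_word_def)
    then show ?case using assms(4)[OF assms(2) Cons] by simp
  qed
  show ?thesis
  proof (induction p rule: free_alg_induct)
    case zero
    then show ?case using assms(1)[of 0] by (simp add: free_const_def)
  next
    case (add w c p)
    have "Poly_Mapping.single w c = free_const c * Poly_Mapping.single w 1"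
      by (simp add: free_const_def mult_single)
    then have "P (Poly_Mapping.single w c)" using assms(4)[OF assms(1) word[of "letters w"], of c] by simp
    then show ?case by (rule assms(3)[OF _ add])
  qed
qed

lemma free_const_hom:
  "free_const (c + d) = free_const c + free_const d" "free_const (c * d) = free_const c * free_const d"
  "free_const 0 = 0" "free_const 1 = 1" "free_const (c - d) = free_const c - free_const d"
  unfolding free_const_def by (simp_all add: single_add mult_single single_diff)

lemma free_const_central: "free_const c * p = p * free_const c"
proof (induction p rule: free_alg_induct)
  case (add w d p)
  then show ?case
    by (simp add: free_const_def algebra_simps mult_single)
qed simp

lemma free_eval_altdef:
  "degree p \<le> n \<Longrightarrow> free_eval p a = (\<Sum>i\<le>n. free_const (coeff p i) * a ^ i)"
  unfolding free_eval_def
  by (rule sum.mono_neutral_left) (auto simp: coeff_eq_0 free_const_hom)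

lemma free_eval_0 [simp]: "free_eval 0 a = 0"
  by (simp add: free_eval_def free_const_hom)

lemma free_eval_add: "free_eval (p + q) a = free_eval p a + free_eval q a"
proof -
  let ?n = "max (degree p) (degree q)"
  have "degree (p + q) \<le> ?n" by (rule degree_add_le_max)
  then show ?thesis
    by (simp add: free_eval_altdef[of _ ?n] free_const_hom distrib_right sum.distrib)
qed

lemma free_eval_smult: "free_eval (smult c p) a = free_const c * free_eval p a"
  using degree_smult_le[of c p]
  by (simp add: free_eval_altdef[of _ "degree p"] free_const_hom sum_distrib_left mult.assoc)

lemma free_eval_pCons: "free_eval (pCons c p) a = free_const c + a * free_eval p a"
proof -
  have "degree (pCons c p) \<le> Suc (degree p)" by (rule degree_pCons_le)
  then have "free_eval (pCons c p) a = (\<Sum>i\<le>Suc (degree p). free_const (coeff (pCons c p) i) * a ^ i)"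
    by (rule free_eval_altdef)
  also have "\<dots> = free_const c + (\<Sum>i\<le>degree p. free_const (coeff p i) * a ^ Suc i)"
    by (simp add: sum.atMost_Suc_shift del: sum.atMost_Suc power_Suc)
  also have "(\<Sum>i\<le>degree p. free_const (coeff p i) * a ^ Suc i) = a * free_eval p a"
    unfolding free_eval_def sum_distrib_left
    by (rule sum.cong) (simp_all add: free_const_central[of _ a] mult.assoc flip: mult.assoc)
  finally show ?thesis .
qed

lemma free_eval_mult: "free_eval (p * q) a = free_eval p a * free_eval q a"
  by (induction p) (simp_all add: free_eval_add free_eval_smult free_eval_pCons free_const_hom algebra_simps)

lemma free_eval_1 [simp]: "free_eval 1 a = 1"
  by (simp add: one_pCons free_eval_pCons free_const_hom)

lemma free_eval_const: "free_eval [:c:] a = free_const c"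
  by (simp add: free_eval_pCons)

lemma free_eval_shift: "free_eval (pcompose p [:c, 1:]) a = free_eval p (a + free_const c)"
  by (induction p)
    (simp_all add: pcompose_pCons free_eval_add free_eval_smult free_eval_pCons free_const_hom algebra_simps)

subsection \<open>Homogeneous elements\<close>

definition homog :: "int \<Rightarrow> 'k::field free_alg set" where
  "homog i = {p. \<forall>w\<in>Poly_Mapping.keys p. word_deg w = i}"

lemma word_deg_add: "word_deg (u + v) = word_deg u + word_deg v"
  by (simp add: word_deg_def plus_word_def)

lemma homog_0: "0 \<in> homog i" by (simp add: homog_def)

lemma homog_add: "p \<in> homog i \<Longrightarrow> q \<in> homog i \<Longrightarrow> p + q \<in> homog i"
  unfolding homog_def using keys_add[of p q] by blast

lemma homog_mult: "p \<in> homog i \<Longrightarrow> q \<in> homog j \<Longrightarrow> p * q \<in> homog (i + j)"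
  unfolding homog_def using keys_mult[of p q] by (fastforce simp: word_deg_add)

lemma homog_const: "free_const c \<in> homog 0"
  by (simp add: homog_def free_const_def word_deg_def zero_word_def)

lemma homog_gen: "free_gen GX \<in> homog 1" "free_gen GY \<in> homog (-1)" "free_gen GZ \<in> homog 0"
  by (simp_all add: homog_def free_gen_def word_deg_def)

lemma homog_eval: "a \<in> homog 0 \<Longrightarrow> free_eval p a \<in> homog 0"
proof (induction p)
  case (pCons c p)
  then have "a * free_eval p a \<in> homog 0" using homog_mult[of a 0 "free_eval p a" 0] by simp
  then show ?case using homog_add[OF homog_const] by (simp add: free_eval_pCons)
qed (simp add: homog_0)

text \<open>The variable \<open>t = z - n\<close> of the polynomials that act in degree \<open>n\<close>.\<close>

definition zn :: "int \<Rightarrow> 'k::field_char_0 free_alg" where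
  "zn n = free_gen GZ - free_const (of_int n)"

lemma homog_zn: "zn n \<in> homog 0"
proof -
  have eq: "zn n = free_gen GZ + free_const (- of_int n)"
    unfolding zn_def free_const_def by (simp add: single_uminus)
  show ?thesis unfolding eq by (rule homog_add[OF homog_gen(3) homog_const])
qed

subsection \<open>The quotient algebra\<close>

lemma ring_free_ring: "ring (free_ring :: 'k::field free_alg ring)"
  unfolding free_ring_def
  by (rule ringI; (rule abelian_groupI monoidI)?)
    (auto simp: algebra_simps intro: exI[of _ "- x" for x])

lemma gwa_ideal: "ideal (gwa_ideal f) free_ring"
  unfolding gwa_ideal_def by (rule ring.genideal_ideal[OF ring_free_ring]) (simp add: free_ring_def)

lemma ring_extend:
  assumes "ring R"
  shows "ring (ring.extend R m)"
proof -
  interpret ring R by fact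
  show ?thesis
  proof (rule ringI)
    show "abelian_group (ring.extend R m)"
    proof (rule abelian_groupI)
      fix x assume "x \<in> carrier (ring.extend R m)"
      then show "\<exists>y\<in>carrier (ring.extend R m). y \<oplus>\<^bsub>ring.extend R m\<^esub> x = \<zero>\<^bsub>ring.extend R m\<^esub>"
        by (intro bexI[of _ "\<ominus>\<^bsub>R\<^esub> x"]) (auto simp: ring.defs l_neg)
    qed (auto simp: ring.defs a_ac)
    show "monoid (ring.extend R m)"
      by (rule monoidI) (auto simp: ring.defs m_assoc)
  qed (auto simp: ring.defs l_distr r_distr)
qed

lemma ring_gwa: "ring (gwa f)"
  unfolding gwa_def by (rule ring_extend[OF ideal.quotient_is_ring[OF gwa_ideal]])

lemma gwa_proj_hom:
  "gwa_proj f (p + q) = gwa_proj f p \<oplus>\<^bsub>gwa f\<^esub> gwa_proj f q"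
  "gwa_proj f (p * q) = gwa_proj f p \<otimes>\<^bsub>gwa f\<^esub> gwa_proj f q"
  "gwa_proj f 1 = \<one>\<^bsub>gwa f\<^esub>" "carrier (gwa f) = range (gwa_proj f)"
  "scal (gwa f) c = gwa_proj f (free_const c)" "apart (gwa f) i = gwa_proj f ` homog i"
proof -
  have h: "(+>\<^bsub>free_ring\<^esub>) (gwa_ideal f) \<in> ring_hom free_ring (free_ring Quot gwa_ideal f)"
    by (rule ideal.rcos_ring_hom[OF gwa_ideal])
  have [simp]: "carrier free_ring = (UNIV :: 'a free_alg set)" "\<one>\<^bsub>free_ring\<^esub> = (1 :: 'a free_alg)"
    "p \<oplus>\<^bsub>free_ring\<^esub> q = p + q" "p \<otimes>\<^bsub>free_ring\<^esub> q = p * q" for p q :: "'a free_alg"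
    by (simp_all add: free_ring_def)
  show "gwa_proj f (p + q) = gwa_proj f p \<oplus>\<^bsub>gwa f\<^esub> gwa_proj f q"
    "gwa_proj f (p * q) = gwa_proj f p \<otimes>\<^bsub>gwa f\<^esub> gwa_proj f q"
    "gwa_proj f 1 = \<one>\<^bsub>gwa f\<^esub>"
    using ring_hom_add[OF h, of p q] ring_hom_mult[OF h, of p q] ring_hom_one[OF h]
    by (simp_all add: gwa_proj_def gwa_def ring.defs)
  show "carrier (gwa f) = range (gwa_proj f)"
    by (auto simp: gwa_def ring.defs FactRing_def A_RCOSETS_def' gwa_proj_def)
  show "scal (gwa f) c = gwa_proj f (free_const c)" "apart (gwa f) i = gwa_proj f ` homog i"
    by (simp_all add: gwa_def ring.defs homog_def)
qed

lemma gwa_proj_eq_iff: "gwa_proj f p = gwa_proj f q \<longleftrightarrow> p - q \<in> gwa_ideal f"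
proof -
  interpret I: ideal "gwa_ideal f" free_ring by (rule gwa_ideal)
  have [simp]: "carrier free_ring = (UNIV :: 'a free_alg set)"
    "p \<oplus>\<^bsub>free_ring\<^esub> q = p + q" for p q :: "'a free_alg"
    by (simp_all add: free_ring_def)
  have mem: "x \<in> gwa_proj f y \<longleftrightarrow> x - y \<in> gwa_ideal f" for x y
    unfolding gwa_proj_def a_r_coset_def' by (auto simp: image_iff) (metis add.commute diff_add_cancel)
  show ?thesis
    using mem[of p q] I.a_repr_independence'[of p q] I.a_rcos_self[of p] unfolding gwa_proj_def by auto
qed

lemma gwa_proj_rels:
  "gwa_proj f (free_gen GX * free_gen GZ) = gwa_proj f ((free_gen GZ + 1) * free_gen GX)"
  "gwa_proj f (free_gen GY * free_gen GZ) = gwa_proj f ((free_gen GZ - 1) * free_gen GY)"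
  "gwa_proj f (free_gen GX * free_gen GY) = gwa_proj f (free_eval f (free_gen GZ))"
  "gwa_proj f (free_gen GY * free_gen GX) = gwa_proj f (free_eval f (free_gen GZ - 1))"
proof -
  have "gwa_rels f \<subseteq> gwa_ideal f"
    unfolding gwa_ideal_def by (rule ring.genideal_self[OF ring_free_ring]) (simp add: free_ring_def)
  then show
    "gwa_proj f (free_gen GX * free_gen GZ) = gwa_proj f ((free_gen GZ + 1) * free_gen GX)"
    "gwa_proj f (free_gen GY * free_gen GZ) = gwa_proj f ((free_gen GZ - 1) * free_gen GY)"
    "gwa_proj f (free_gen GX * free_gen GY) = gwa_proj f (free_eval f (free_gen GZ))"
    "gwa_proj f (free_gen GY * free_gen GX) = gwa_proj f (free_eval f (free_gen GZ - 1))"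
    unfolding gwa_proj_eq_iff gwa_rels_def Let_def by blast+
qed

lemma gwa_proj_cong:
  "gwa_proj f p = gwa_proj f p' \<Longrightarrow> gwa_proj f q = gwa_proj f q' \<Longrightarrow> gwa_proj f (p * q) = gwa_proj f (p' * q')"
  "gwa_proj f p = gwa_proj f p' \<Longrightarrow> gwa_proj f q = gwa_proj f q' \<Longrightarrow> gwa_proj f (p + q) = gwa_proj f (p' + q')"
  by (simp_all add: gwa_proj_hom)

lemma gwa_proj_eval_commute:
  assumes "gwa_proj f (a * x) = gwa_proj f (x * b)"
  shows "gwa_proj f (free_eval p a * x) = gwa_proj f (x * free_eval p b)"
proof (induction p)
  case (pCons c p)
  have "gwa_proj f (a * (free_eval p a * x)) = gwa_proj f (a * (x * free_eval p b))"
    by (rule gwa_proj_cong(1)[OF refl pCons(2)])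
  also have "\<dots> = gwa_proj f (a * x * free_eval p b)" by (simp add: mult.assoc)
  also have "\<dots> = gwa_proj f (x * b * free_eval p b)" by (rule gwa_proj_cong(1)[OF assms refl])
  finally have "gwa_proj f (free_const c * x + a * (free_eval p a * x))
      = gwa_proj f (free_const c * x + x * b * free_eval p b)"
    by (rule gwa_proj_cong(2)[OF refl])
  then show ?case by (simp add: free_eval_pCons algebra_simps free_const_central)
qed simp

text \<open>The shift of \<open>z\<close> by \<open>x\<close> and \<open>y\<close> is absorbed by the dependence of the variable on the degree.\<close>

lemma gwa_proj_zn_commute:
  "gwa_proj f (zn n * free_gen GX) = gwa_proj f (free_gen GX * zn (n + 1))"
  "gwa_proj f (zn (n + 1) * free_gen GY) = gwa_proj f (free_gen GY * zn n)"
proof -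
  have "gwa_proj f (free_gen GX * free_gen GZ + (- free_gen GX - free_gen GX * free_const (of_int n)))
    = gwa_proj f ((free_gen GZ + 1) * free_gen GX + (- free_gen GX - free_gen GX * free_const (of_int n)))"
    by (rule gwa_proj_cong(2)[OF gwa_proj_rels(1) refl])
  then show "gwa_proj f (zn n * free_gen GX) = gwa_proj f (free_gen GX * zn (n + 1))"
    by (simp add: zn_def algebra_simps free_const_central free_const_hom)
  have "gwa_proj f (free_gen GY * free_gen GZ + (- (free_gen GY * free_const (of_int n))))
    = gwa_proj f ((free_gen GZ - 1) * free_gen GY + (- (free_gen GY * free_const (of_int n))))"
    by (rule gwa_proj_cong(2)[OF gwa_proj_rels(2) refl])
  then show "gwa_proj f (zn (n + 1) * free_gen GY) = gwa_proj f (free_gen GY * zn n)"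
    by (simp add: zn_def algebra_simps free_const_central free_const_hom)
qed

definition edge :: "nat \<Rightarrow> 'k::field_char_0 poly" where
  "edge \<alpha> = [:0, 1:] * [:of_nat \<alpha>, 1:]"

lemma edge_shift: "pcompose (edge \<alpha>) [:of_int n, 1:] = lin n * lin (n + int \<alpha>)"
  unfolding edge_def pcompose_mult by (simp add: pcompose_pCons lin_def add.commute)

lemma gwa_proj_edge:
  "gwa_proj (edge \<alpha>) (free_gen GX * free_gen GY) = gwa_proj (edge \<alpha>) (free_eval (lin n * lin (n + int \<alpha>)) (zn n))"
  "gwa_proj (edge \<alpha>) (free_gen GY * free_gen GX) = gwa_proj (edge \<alpha>) (free_eval (lin n * lin (n + int \<alpha>)) (zn (n + 1)))"
  unfolding edge_shift[symmetric] free_eval_shift gwa_proj_rels zn_def by (simp_all add: free_const_hom)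

subsection \<open>Graded modules as representations\<close>

text \<open>The action through representatives in the free algebra, which avoids cosets as scalars.\<close>

definition mact :: "'k::field poly \<Rightarrow> ('k free_alg set, 'm) gmodule \<Rightarrow> 'm \<Rightarrow> 'k free_alg \<Rightarrow> 'm" where
  "mact f M m p = ract M m (gwa_proj f p)"

definition tact :: "'k::field_char_0 poly \<Rightarrow> ('k free_alg set, 'm) gmodule \<Rightarrow> int \<Rightarrow> 'k poly \<Rightarrow> 'm \<Rightarrow> 'm" where
  "tact f M n p m = mact f M m (free_eval p (zn n))"

definition mmap :: "'k::field_char_0 poly \<Rightarrow> ('k free_alg set, 'm) gmodule \<Rightarrow> int \<Rightarrow> int \<Rightarrow> 'm \<Rightarrow> 'm" where
  "mmap f M i j m = (if i \<le> j then ((\<lambda>v. mact f M v (free_gen GX)) ^^ nat (j - i)) m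
     else ((\<lambda>v. mact f M v (free_gen GY)) ^^ nat (i - j)) m)"

locale gmod =
  fixes f :: "'k::field_char_0 poly" and M :: "('k free_alg set, 'm) gmodule"
  assumes graded: "graded_right_module (gwa f) M"
begin

sublocale R: graded_right_module "gwa f" M by (rule graded)

abbreviation act where "act \<equiv> mact f M"

lemma proj_carrier [simp]: "gwa_proj f p \<in> carrier (gwa f)"
  by (simp add: gwa_proj_hom)

lemma act_closed [simp, intro]: "m \<in> carrier M \<Longrightarrow> act m p \<in> carrier M"
  unfolding mact_def by (rule R.ract_closed) simp_all

lemma act_rules:
  "\<lbrakk>m \<in> carrier M; n \<in> carrier M\<rbrakk> \<Longrightarrow> act (m \<oplus>\<^bsub>M\<^esub> n) p = act m p \<oplus>\<^bsub>M\<^esub> act n p"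
  "m \<in> carrier M \<Longrightarrow> act m (p + q) = act m p \<oplus>\<^bsub>M\<^esub> act m q"
  "m \<in> carrier M \<Longrightarrow> act m (p * q) = act (act m p) q"
  "m \<in> carrier M \<Longrightarrow> act m 1 = m"
  unfolding mact_def
  by (simp_all add: R.ract_add_left R.ract_add_right R.ract_mult R.ract_one gwa_proj_hom(1-3))

lemma act_0 [simp]: "m \<in> carrier M \<Longrightarrow> act m 0 = \<zero>\<^bsub>M\<^esub>"
proof -
  assume m: "m \<in> carrier M"
  have "act m 0 = act m 0 \<oplus>\<^bsub>M\<^esub> act m 0" using act_rules(2)[OF m, of 0 0] by simp
  then show ?thesis using act_closed[OF m] by (metis R.M.add.l_cancel_one')
qed

lemma act_zero [simp]: "act \<zero>\<^bsub>M\<^esub> p = \<zero>\<^bsub>M\<^esub>"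
  using act_rules(3)[of "\<zero>\<^bsub>M\<^esub>" 0 p] by simp

lemma mpart_carrier: "m \<in> mpart M i \<Longrightarrow> m \<in> carrier M"
  using additive_subgroup.a_subset[OF R.mpart_subgroup] by blast

lemma mpart_add: "m \<in> mpart M i \<Longrightarrow> n \<in> mpart M i \<Longrightarrow> m \<oplus>\<^bsub>M\<^esub> n \<in> mpart M i"
  using additive_subgroup.a_closed[OF R.mpart_subgroup] by blast

lemma mpart_zero: "\<zero>\<^bsub>M\<^esub> \<in> mpart M i"
  using additive_subgroup.zero_closed[OF R.mpart_subgroup] by blast

lemma mpart_act: "m \<in> mpart M i \<Longrightarrow> p \<in> homog j \<Longrightarrow> act m p \<in> mpart M (i + j)"
  unfolding mact_def by (rule R.mpart_ract) (simp_all add: gwa_proj_hom(6))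

lemma act_X: "m \<in> mpart M i \<Longrightarrow> act m (free_gen GX) \<in> mpart M (i + 1)"
  and act_Y: "m \<in> mpart M i \<Longrightarrow> act m (free_gen GY) \<in> mpart M (i - 1)"
  and act_const: "m \<in> mpart M i \<Longrightarrow> act m (free_const c) \<in> mpart M i"
  using mpart_act[of m i _ 1] mpart_act[of m i _ "-1"] mpart_act[of m i _ 0] homog_gen homog_const by force+

lemma tact_mpart: "m \<in> mpart M i \<Longrightarrow> tact f M n p m \<in> mpart M i"
  unfolding tact_def using mpart_act[of m i _ 0] homog_eval[OF homog_zn] by fastforce

lemma act_closure:
  assumes "S \<subseteq> carrier M" "\<And>m n. m \<in> S \<Longrightarrow> n \<in> S \<Longrightarrow> m \<oplus>\<^bsub>M\<^esub> n \<in> S"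
    and "\<And>m g. m \<in> S \<Longrightarrow> act m (free_gen g) \<in> S" "\<And>m c. m \<in> S \<Longrightarrow> act m (free_const c) \<in> S" "m \<in> S"
  shows "act m p \<in> S"
  using assms(5)
proof (induction p arbitrary: m rule: free_alg_gen_induct)
  case (add p q)
  then show ?case using assms(1,2) by (simp add: act_rules(2) subset_iff)
next
  case (mult p q)
  then show ?case using assms(1) by (simp add: act_rules(3) subset_iff)
qed (use assms in auto)

lemma tact_X: "m \<in> carrier M \<Longrightarrow> act (tact f M n p m) (free_gen GX) = tact f M (n + 1) p (act m (free_gen GX))"
  unfolding tact_def
  using gwa_proj_eval_commute[OF gwa_proj_zn_commute(1), of f p n]
  by (simp flip: act_rules(3)) (simp add: mact_def)

lemma tact_Y: "m \<in> carrier M \<Longrightarrow> act (tact f M (n + 1) p m) (free_gen GY) = tact f M n p (act m (free_gen GY))"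
  unfolding tact_def
  using gwa_proj_eval_commute[OF gwa_proj_zn_commute(2), of f p n]
  by (simp flip: act_rules(3)) (simp add: mact_def)

lemma mmap_mpart: "v \<in> mpart M i \<Longrightarrow> mmap f M i j v \<in> mpart M j"
proof -
  assume v: "v \<in> mpart M i"
  have up: "((\<lambda>v. act v (free_gen GX)) ^^ d) v \<in> mpart M (i + int d)" for d
  proof (induction d)
    case (Suc d)
    then show ?case using act_X[OF Suc] by (simp add: algebra_simps)
  qed (simp add: v)
  have down: "((\<lambda>v. act v (free_gen GY)) ^^ d) v \<in> mpart M (i - int d)" for d
  proof (induction d)
    case (Suc d)
    then show ?case using act_Y[OF Suc] by (simp add: algebra_simps)
  qed (simp add: v)
  show ?thesis using up[of "nat (j - i)"] down[of "nat (i - j)"] unfolding mmap_def by auto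
qed

lemma mmap_id [simp]: "mmap f M i i v = v"
  by (simp add: mmap_def)

lemma mmap_up: "i \<le> j \<Longrightarrow> mmap f M i (j + 1) v = act (mmap f M i j v) (free_gen GX)"
proof -
  assume "i \<le> j"
  then have "nat (j + 1 - i) = Suc (nat (j - i))" by auto
  then show ?thesis using \<open>i \<le> j\<close> by (simp add: mmap_def)
qed

lemma mmap_down: "j < i \<Longrightarrow> mmap f M i j v = act (mmap f M i (j + 1) v) (free_gen GY)"
proof -
  assume "j < i"
  then have "nat (i - j) = Suc (nat (i - (j + 1)))" by auto
  then show ?thesis using \<open>j < i\<close> by (auto simp: mmap_def)
qed

lemma mmap_induct [case_names base up down]:
  fixes i :: int
  assumes "P i" "\<And>j. i \<le> j \<Longrightarrow> P j \<Longrightarrow> P (j + 1)" "\<And>j. j < i \<Longrightarrow> P (j + 1) \<Longrightarrow> P j"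
  shows "P j"
proof (cases "i \<le> j")
  case True
  then show ?thesis by (induction j rule: int_ge_induct) (use assms in auto)
next
  case False
  then have "j \<le> i" by simp
  then show ?thesis
  proof (induction j rule: int_le_induct)
    case (step k)
    then show ?case using assms(3)[of "k - 1"] by simp
  qed (rule assms(1))
qed

lemma mmap_add:
  assumes "v \<in> mpart M i" "w \<in> mpart M i"
  shows "mmap f M i j (v \<oplus>\<^bsub>M\<^esub> w) = mmap f M i j v \<oplus>\<^bsub>M\<^esub> mmap f M i j w"
proof (induction rule: mmap_induct[of _ i])
  case (up j)
  then show ?case
    using mpart_carrier[OF mmap_mpart[OF assms(1), of j]] mpart_carrier[OF mmap_mpart[OF assms(2), of j]]
    by (simp add: mmap_up act_rules)
next
  case (down j)
  then show ?case
    using mpart_carrier[OF mmap_mpart[OF assms(1), of "j + 1"]] mpart_carrier[OF mmap_mpart[OF assms(2), of "j + 1"]]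
    by (simp add: mmap_down act_rules)
qed simp

lemma mmap_tact:
  assumes "v \<in> mpart M i"
  shows "mmap f M i j (tact f M i p v) = tact f M j p (mmap f M i j v)"
proof (induction rule: mmap_induct[of _ i])
  case (up j)
  then show ?case using mpart_carrier[OF mmap_mpart[OF assms(1), of j]]
    by (simp add: mmap_up tact_X)
next
  case (down j)
  then show ?case using mpart_carrier[OF mmap_mpart[OF assms(1), of "j + 1"]]
    by (simp add: mmap_down tact_Y)
qed simp

lemma tact_rules:
  assumes "v \<in> carrier M"
  shows "tact f M i (p + q) v = tact f M i p v \<oplus>\<^bsub>M\<^esub> tact f M i q v"
    "tact f M i (p * q) v = tact f M i p (tact f M i q v)" "tact f M i 1 v = v"
    "w \<in> carrier M \<Longrightarrow> tact f M i p (v \<oplus>\<^bsub>M\<^esub> w) = tact f M i p v \<oplus>\<^bsub>M\<^esub> tact f M i p w"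
    "tact f M i p v \<in> carrier M" "tact f M i [:c:] v = act v (free_const c)"
  unfolding tact_def using assms
  by (simp_all add: act_rules free_eval_add free_eval_const flip: free_eval_mult)
    (metis act_rules(3) assms free_eval_mult mult.commute)

end

locale gmod_edge = gmod "edge \<alpha>" M for \<alpha> and M :: "('k::field_char_0 free_alg set, 'm) gmodule"
begin

lemma XY: "v \<in> carrier M \<Longrightarrow> act (act v (free_gen GX)) (free_gen GY) = tact (edge \<alpha>) M n (lin n * lin (n + int \<alpha>)) v"
  by (simp flip: act_rules(3)) (simp add: tact_def mact_def gwa_proj_edge(1)[of _ n])

lemma YX: "v \<in> carrier M \<Longrightarrow> act (act v (free_gen GY)) (free_gen GX) = tact (edge \<alpha>) M (n + 1) (lin n * lin (n + int \<alpha>)) v"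
  by (simp flip: act_rules(3)) (simp add: tact_def mact_def gwa_proj_edge(2)[of _ n])

text \<open>Each step back cancels a step forth at the cost of the edge factor, which is a cocycle by \<open>cc_L_edge\<close>;
  monotone paths cost nothing.\<close>

lemma mmap_mmap:
  assumes v: "v \<in> mpart M i"
  shows "mmap (edge \<alpha>) M j k (mmap (edge \<alpha>) M i j v)
    = tact (edge \<alpha>) M k (cc (L \<alpha> i) (L \<alpha> j) (L \<alpha> k)) (mmap (edge \<alpha>) M i k v)"
proof -
  have C: "mmap (edge \<alpha>) M i j v \<in> carrier M" for j using mpart_carrier[OF mmap_mpart[OF v]] .
  have upX: "act (mmap (edge \<alpha>) M i j v) (free_gen GX)
      = tact (edge \<alpha>) M (j + 1) (cc (L \<alpha> i) (L \<alpha> j) (L \<alpha> (j + 1))) (mmap (edge \<alpha>) M i (j + 1) v)" for j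
  proof (cases "i \<le> j")
    case True
    then show ?thesis by (simp add: cc_L_mono mmap_up tact_rules C)
  next
    case False
    have "cc (L \<alpha> i) (L \<alpha> (j+1)) (L \<alpha> j) * cc (L \<alpha> i) (L \<alpha> j) (L \<alpha> (j+1))
        = (cc (L \<alpha> (j+1)) (L \<alpha> j) (L \<alpha> (j+1)) * cc (L \<alpha> i) (L \<alpha> (j+1)) (L \<alpha> (j+1)) :: 'k poly)"
      by (rule cc_cocycle)
    then have "cc (L \<alpha> i) (L \<alpha> j) (L \<alpha> (j+1)) = (lin j * lin (j + int \<alpha>) :: 'k poly)"
      using False by (simp add: cc_L_mono cc_L_edge)
    then show ?thesis using False C YX[of _ j] by (simp add: mmap_down)
  qed
  have downY: "act (mmap (edge \<alpha>) M i (j + 1) v) (free_gen GY)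
      = tact (edge \<alpha>) M j (cc (L \<alpha> i) (L \<alpha> (j + 1)) (L \<alpha> j)) (mmap (edge \<alpha>) M i j v)" for j
  proof (cases "j < i")
    case True
    then show ?thesis by (simp add: cc_L_mono mmap_down tact_rules C)
  next
    case False
    have "cc (L \<alpha> i) (L \<alpha> j) (L \<alpha> (j+1)) * cc (L \<alpha> i) (L \<alpha> (j+1)) (L \<alpha> j)
        = (cc (L \<alpha> j) (L \<alpha> (j+1)) (L \<alpha> j) * cc (L \<alpha> i) (L \<alpha> j) (L \<alpha> j) :: 'k poly)"
      by (rule cc_cocycle)
    then have "cc (L \<alpha> i) (L \<alpha> (j+1)) (L \<alpha> j) = (lin j * lin (j + int \<alpha>) :: 'k poly)"
      using False by (simp add: cc_L_mono cc_L_edge)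
    then show ?thesis using False C XY[of _ j] by (simp add: mmap_up)
  qed
  show ?thesis
  proof (induction rule: mmap_induct[of _ j])
    case base
    then show ?case by (simp add: tact_rules C)
  next
    case (up k)
    have "mmap (edge \<alpha>) M j (k + 1) (mmap (edge \<alpha>) M i j v)
        = tact (edge \<alpha>) M (k + 1) (cc (L \<alpha> i) (L \<alpha> j) (L \<alpha> k)) (act (mmap (edge \<alpha>) M i k v) (free_gen GX))"
      using up by (simp add: mmap_up tact_X C)
    also have "\<dots> = tact (edge \<alpha>) M (k + 1) (cc (L \<alpha> i) (L \<alpha> j) (L \<alpha> k) * cc (L \<alpha> i) (L \<alpha> k) (L \<alpha> (k + 1)))
        (mmap (edge \<alpha>) M i (k + 1) v)"
      unfolding upX by (simp add: tact_rules C)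
    also have "\<dots> = tact (edge \<alpha>) M (k + 1) (cc (L \<alpha> i) (L \<alpha> j) (L \<alpha> (k + 1))) (mmap (edge \<alpha>) M i (k + 1) v)"
      using up(1) by (subst cc_cocycle) (simp add: cc_L_mono)
    finally show ?case .
  next
    case (down k)
    have "mmap (edge \<alpha>) M j k (mmap (edge \<alpha>) M i j v)
        = tact (edge \<alpha>) M k (cc (L \<alpha> i) (L \<alpha> j) (L \<alpha> (k + 1))) (act (mmap (edge \<alpha>) M i (k + 1) v) (free_gen GY))"
      using down by (simp add: mmap_down tact_Y C)
    also have "\<dots> = tact (edge \<alpha>) M k (cc (L \<alpha> i) (L \<alpha> j) (L \<alpha> (k + 1)) * cc (L \<alpha> i) (L \<alpha> (k + 1)) (L \<alpha> k))
        (mmap (edge \<alpha>) M i k v)"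
      unfolding downY by (simp add: tact_rules C)
    also have "\<dots> = tact (edge \<alpha>) M k (cc (L \<alpha> i) (L \<alpha> j) (L \<alpha> k)) (mmap (edge \<alpha>) M i k v)"
      using down(1) by (subst cc_cocycle) (simp add: cc_L_mono)
    finally show ?case .
  qed
qed

theorem orep: "orep M \<alpha> (mpart M) (tact (edge \<alpha>) M) (mmap (edge \<alpha>) M)"
  by unfold_locales
    (simp_all add: mpart_carrier mpart_zero mpart_add tact_mpart tact_rules mmap_mpart mmap_add mmap_tact mmap_mmap)

end

subsection \<open>Homogeneous components\<close>

definition hcomp :: "('a, 'm) gmodule \<Rightarrow> 'm \<Rightarrow> int \<Rightarrow> 'm" where
  "hcomp M m = (THE c. homog_decomp M m c)"

definition assemble :: "('a, 'm) gmodule \<Rightarrow> (int \<Rightarrow> 'm) \<Rightarrow> 'm" where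
  "assemble M c = (\<Oplus>\<^bsub>M\<^esub>i\<in>{i. c i \<noteq> \<zero>\<^bsub>M\<^esub>}. c i)"

lemma (in abelian_monoid) finsum_support:
  assumes "finite S" "{i. c i \<noteq> \<zero>} \<subseteq> S" "\<And>i. c i \<in> carrier G"
  shows "(\<Oplus>i\<in>{i. c i \<noteq> \<zero>}. c i) = (\<Oplus>i\<in>S. c i)"
  unfolding finsum_def
  by (rule comm_monoid.finprod_mono_neutral_cong_left[OF a_comm_monoid]) (use assms in auto)

lemma (in abelian_monoid) finsum_mem:
  assumes "finite S" "\<zero> \<in> N" "\<And>m n. m \<in> N \<Longrightarrow> n \<in> N \<Longrightarrow> m \<oplus> n \<in> N" "N \<subseteq> carrier G" "\<And>i. i \<in> S \<Longrightarrow> c i \<in> N"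
  shows "(\<Oplus>i\<in>S. c i) \<in> N"
  using assms(1,5)
proof (induction S rule: finite_induct)
  case (insert x S)
  then have "(\<Oplus>i\<in>insert x S. c i) = c x \<oplus> (\<Oplus>i\<in>S. c i)"
    using assms(4) by (intro finsum_insert) auto
  then show ?case using insert assms(3) by simp
qed (simp add: assms(2))

text \<open>A natural way to establish the decomposition: additive projections onto the homogeneous parts that are orthogonal and
  jointly injective.\<close>

lemma homog_decomp_unique:
  fixes M :: "('a, 'm) gmodule" and pr :: "'m \<Rightarrow> int \<Rightarrow> 'm"
  assumes "abelian_group M" and sub: "\<And>i. additive_subgroup (mpart M i) M"
    and pr: "\<And>m i. m \<in> carrier M \<Longrightarrow> pr m i \<in> mpart M i"
    and fin: "\<And>m. m \<in> carrier M \<Longrightarrow> finite {i. pr m i \<noteq> \<zero>\<^bsub>M\<^esub>}"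
    and add: "\<And>m n i. m \<in> carrier M \<Longrightarrow> n \<in> carrier M \<Longrightarrow> pr (m \<oplus>\<^bsub>M\<^esub> n) i = pr m i \<oplus>\<^bsub>M\<^esub> pr n i"
    and hom: "\<And>m i j. m \<in> mpart M i \<Longrightarrow> pr m j = (if j = i then m else \<zero>\<^bsub>M\<^esub>)"
    and inj: "\<And>m. m \<in> carrier M \<Longrightarrow> (\<And>i. pr m i = \<zero>\<^bsub>M\<^esub>) \<Longrightarrow> m = \<zero>\<^bsub>M\<^esub>"
    and m: "m \<in> carrier M"
  shows "\<exists>!c. homog_decomp M m c"
proof -
  interpret abelian_group M by fact
  have sub_carrier: "v \<in> carrier M" if "v \<in> mpart M i" for v i
    using additive_subgroup.a_subset[OF sub] that by blast
  have zero: "pr \<zero>\<^bsub>M\<^esub> i = \<zero>\<^bsub>M\<^esub>" for i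
    using hom[OF additive_subgroup.zero_closed[OF sub[of i]]] by simp
  have sum: "pr (\<Oplus>\<^bsub>M\<^esub>i\<in>S. c i) j = (if j \<in> S then c j else \<zero>\<^bsub>M\<^esub>)"
    if "finite S" "\<And>i. c i \<in> mpart M i" for S c j
    using that(1)
  proof (induction S rule: finite_induct)
    case (insert x S)
    have c: "c i \<in> carrier M" for i using sub_carrier that(2) by blast
    then have "(\<Oplus>\<^bsub>M\<^esub>i\<in>insert x S. c i) = c x \<oplus>\<^bsub>M\<^esub> (\<Oplus>\<^bsub>M\<^esub>i\<in>S. c i)"
      using insert by (intro finsum_insert) auto
    moreover have "(\<Oplus>\<^bsub>M\<^esub>i\<in>S. c i) \<in> carrier M" by (rule finsum_closed) (use c in auto)
    ultimately show ?case using insert c hom[OF that(2)[of x], of j] by (auto simp: add)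
  qed (simp add: zero)
  have ex: "homog_decomp M m (pr m)"
    unfolding homog_decomp_def
  proof (intro conjI allI)
    let ?s = "\<Oplus>\<^bsub>M\<^esub>i\<in>{i. pr m i \<noteq> \<zero>\<^bsub>M\<^esub>}. pr m i"
    have s: "?s \<in> carrier M" by (rule finsum_closed) (use pr[OF m] sub_carrier in auto)
    have "pr (m \<oplus>\<^bsub>M\<^esub> \<ominus>\<^bsub>M\<^esub> ?s) i = \<zero>\<^bsub>M\<^esub>" for i
    proof -
      have "pr ?s i = pr m i" using sum[OF fin[OF m] pr[OF m]] by auto
      then have "pr m i \<oplus>\<^bsub>M\<^esub> pr (\<ominus>\<^bsub>M\<^esub> ?s) i = pr (?s \<oplus>\<^bsub>M\<^esub> \<ominus>\<^bsub>M\<^esub> ?s) i"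
        using s by (simp only: add a_inv_closed)
      then show ?thesis using s m zero by (simp add: add r_neg)
    qed
    then have "m \<oplus>\<^bsub>M\<^esub> \<ominus>\<^bsub>M\<^esub> ?s = \<zero>\<^bsub>M\<^esub>" using inj m s by simp
    then show "m = ?s" using m s by (metis minus_equality minus_minus a_inv_closed)
  qed (use pr[OF m] fin[OF m] in auto)
  have "c = pr m" if "homog_decomp M m c" for c
  proof (rule ext)
    fix j
    have "pr (\<Oplus>\<^bsub>M\<^esub>i\<in>{i. c i \<noteq> \<zero>\<^bsub>M\<^esub>}. c i) j = (if j \<in> {i. c i \<noteq> \<zero>\<^bsub>M\<^esub>} then c j else \<zero>\<^bsub>M\<^esub>)"
      by (rule sum) (use that in \<open>auto simp: homog_decomp_def\<close>)
    then show "c j = pr m j" using that by (auto simp: homog_decomp_def split: if_splits)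
  qed
  then show ?thesis using ex by blast
qed

context gmod
begin

lemma hcomp_decomp: "m \<in> carrier M \<Longrightarrow> homog_decomp M m (hcomp M m)"
  unfolding hcomp_def by (rule theI'[OF R.direct_sum])

lemma hcomp_unique: "m \<in> carrier M \<Longrightarrow> homog_decomp M m c \<Longrightarrow> hcomp M m = c"
  using R.direct_sum hcomp_decomp by blast

lemma hcomp_mpart: "m \<in> carrier M \<Longrightarrow> hcomp M m i \<in> mpart M i"
  using hcomp_decomp unfolding homog_decomp_def by blast

lemma hcomp_carrier [simp]: "m \<in> carrier M \<Longrightarrow> hcomp M m i \<in> carrier M"
  using hcomp_mpart mpart_carrier by blast

lemma hcomp_finite: "m \<in> carrier M \<Longrightarrow> finite {i. hcomp M m i \<noteq> \<zero>\<^bsub>M\<^esub>}"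
  using hcomp_decomp unfolding homog_decomp_def by blast

lemma assemble_hcomp: "m \<in> carrier M \<Longrightarrow> assemble M (hcomp M m) = m"
  using hcomp_decomp unfolding homog_decomp_def assemble_def by auto

lemma hcomp_assemble:
  assumes "\<And>i. c i \<in> mpart M i" "finite {i. c i \<noteq> \<zero>\<^bsub>M\<^esub>}"
  shows "assemble M c \<in> carrier M" "hcomp M (assemble M c) = c"
proof -
  show "assemble M c \<in> carrier M"
    unfolding assemble_def by (rule R.M.finsum_closed) (use assms mpart_carrier in auto)
  then show "hcomp M (assemble M c) = c"
    by (rule hcomp_unique) (use assms in \<open>simp add: homog_decomp_def assemble_def\<close>)
qed

lemma hcomp_eqI: "\<lbrakk>m \<in> carrier M; n \<in> carrier M; \<And>i. hcomp M m i = hcomp M n i\<rbrakk> \<Longrightarrow> m = n"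
  using assemble_hcomp[of m] assemble_hcomp[of n] by (metis ext)

lemma hcomp_homog: "m \<in> mpart M i \<Longrightarrow> hcomp M m j = (if j = i then m else \<zero>\<^bsub>M\<^esub>)"
proof -
  assume m: "m \<in> mpart M i"
  let ?c = "\<lambda>j. if j = i then m else \<zero>\<^bsub>M\<^esub>"
  have supp: "{j. ?c j \<noteq> \<zero>\<^bsub>M\<^esub>} \<subseteq> {i}" by auto
  have "(\<Oplus>\<^bsub>M\<^esub>j\<in>{j. ?c j \<noteq> \<zero>\<^bsub>M\<^esub>}. ?c j) = (\<Oplus>\<^bsub>M\<^esub>j\<in>{i}. ?c j)"
    by (rule R.M.finsum_support) (use supp m mpart_carrier in auto)
  also have "\<dots> = m" using mpart_carrier[OF m] by (subst R.M.finsum_insert) auto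
  finally have "homog_decomp M m ?c"
    unfolding homog_decomp_def using m mpart_zero finite_subset[OF supp] by simp
  from hcomp_unique[OF mpart_carrier[OF m] this] show ?thesis by simp
qed

lemma hcomp_add:
  assumes m: "m \<in> carrier M" and n: "n \<in> carrier M"
  shows "hcomp M (m \<oplus>\<^bsub>M\<^esub> n) i = hcomp M m i \<oplus>\<^bsub>M\<^esub> hcomp M n i"
proof -
  let ?c = "\<lambda>i. hcomp M m i \<oplus>\<^bsub>M\<^esub> hcomp M n i"
  let ?S = "{i. hcomp M m i \<noteq> \<zero>\<^bsub>M\<^esub>} \<union> {i. hcomp M n i \<noteq> \<zero>\<^bsub>M\<^esub>}"
  have S: "finite ?S" using hcomp_finite[OF m] hcomp_finite[OF n] by simp
  have supp: "{i. ?c i \<noteq> \<zero>\<^bsub>M\<^esub>} \<subseteq> ?S" by auto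
  have "m = (\<Oplus>\<^bsub>M\<^esub>i\<in>?S. hcomp M m i)"
    using R.M.finsum_support[OF S, of "hcomp M m"] assemble_hcomp[OF m] m unfolding assemble_def by auto
  moreover have "n = (\<Oplus>\<^bsub>M\<^esub>i\<in>?S. hcomp M n i)"
    using R.M.finsum_support[OF S, of "hcomp M n"] assemble_hcomp[OF n] n unfolding assemble_def by auto
  ultimately have "m \<oplus>\<^bsub>M\<^esub> n = (\<Oplus>\<^bsub>M\<^esub>i\<in>?S. hcomp M m i) \<oplus>\<^bsub>M\<^esub> (\<Oplus>\<^bsub>M\<^esub>i\<in>?S. hcomp M n i)"
    by simp
  also have "\<dots> = (\<Oplus>\<^bsub>M\<^esub>i\<in>?S. ?c i)" by (rule R.M.finsum_addf[symmetric]) (use m n in auto)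
  also have "\<dots> = (\<Oplus>\<^bsub>M\<^esub>i\<in>{i. ?c i \<noteq> \<zero>\<^bsub>M\<^esub>}. ?c i)"
    by (rule R.M.finsum_support[OF S supp, symmetric]) (use m n in auto)
  finally have "homog_decomp M (m \<oplus>\<^bsub>M\<^esub> n) ?c"
    unfolding homog_decomp_def using mpart_add hcomp_mpart m n finite_subset[OF supp S] by simp
  from hcomp_unique[OF _ this] m n show ?thesis by simp
qed

lemma carrier_induct [consumes 1, case_names homog add]:
  assumes "m \<in> carrier M" "\<And>i m. m \<in> mpart M i \<Longrightarrow> P m"
    "\<And>m n. \<lbrakk>m \<in> carrier M; n \<in> carrier M; P m; P n\<rbrakk> \<Longrightarrow> P (m \<oplus>\<^bsub>M\<^esub> n)"
  shows "P m"
proof -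
  have "assemble M (hcomp M m) \<in> {m \<in> carrier M. P m}"
    unfolding assemble_def
    by (rule R.M.finsum_mem[OF hcomp_finite[OF assms(1)]])
      (use assms(1,3) assms(2)[OF mpart_zero] assms(2)[OF hcomp_mpart[OF assms(1)]] in auto)
  then show ?thesis using assemble_hcomp[OF assms(1)] by simp
qed

lemma hcomp_zero [simp]: "hcomp M \<zero>\<^bsub>M\<^esub> i = \<zero>\<^bsub>M\<^esub>"
  using hcomp_homog[OF mpart_zero[of i], of i] by simp

lemma hcomp_act:
  assumes "m \<in> carrier M" "p \<in> homog j"
  shows "hcomp M (act m p) i = act (hcomp M m (i - j)) p"
  using assms(1)
proof (induction rule: carrier_induct)
  case (homog k m)
  then show ?case
    using hcomp_homog[OF mpart_act[OF homog assms(2)], of i] hcomp_homog[OF homog, of "i - j"] by auto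
next
  case (add m n)
  then show ?case by (simp add: act_rules hcomp_add)
qed

lemma hcomp_const: "m \<in> carrier M \<Longrightarrow> hcomp M (act m (free_const c)) i = act (hcomp M m i) (free_const c)"
  using hcomp_act[OF _ homog_const, of m c i] by simp

lemma act_Z: "v \<in> carrier M \<Longrightarrow> act v (free_gen GZ) = tact f M i [:of_int i, 1:] v"
  unfolding tact_def by (simp add: free_eval_pCons zn_def free_const_hom)

text \<open>The graded submodule with the parts \<open>Q i\<close>.\<close>

definition total :: "(int \<Rightarrow> 'm set) \<Rightarrow> 'm set" where
  "total Q = {m \<in> carrier M. \<forall>i. hcomp M m i \<in> Q i}"

end

lemma submodule_closed_iff:
  "submodule_closed (gwa f) N M \<longleftrightarrow> additive_subgroup N M \<and> (\<forall>n\<in>N. \<forall>p. mact f M n p \<in> N)"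
  unfolding submodule_closed_def mact_def gwa_proj_hom(4) by blast

lemma additive_subgroupI':
  assumes "abelian_group G" "N \<subseteq> carrier G" "\<zero>\<^bsub>G\<^esub> \<in> N"
    "\<And>m n. m \<in> N \<Longrightarrow> n \<in> N \<Longrightarrow> m \<oplus>\<^bsub>G\<^esub> n \<in> N" "\<And>m. m \<in> N \<Longrightarrow> \<ominus>\<^bsub>G\<^esub> m \<in> N"
  shows "additive_subgroup N G"
proof -
  interpret abelian_group G by fact
  show ?thesis
    by unfold_locales (use assms in \<open>auto simp: a_inv_def[symmetric]\<close>)
qed

context gmod
begin

lemma act_minus_one: "m \<in> carrier M \<Longrightarrow> act m (free_const (-1)) = \<ominus>\<^bsub>M\<^esub> m"
proof -
  assume m: "m \<in> carrier M"
  have "act m (free_const (-1)) \<oplus>\<^bsub>M\<^esub> m = act m (free_const (-1) + 1)"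
    using m by (simp add: act_rules)
  also have "free_const (-1) + 1 = (0 :: 'k free_alg)"
    using free_const_hom(1)[of "-1" "1::'k"] by (simp add: free_const_hom)
  finally show ?thesis using m by (simp add: R.M.minus_equality)
qed

lemma hcomp_minus: "m \<in> carrier M \<Longrightarrow> hcomp M (\<ominus>\<^bsub>M\<^esub> m) i = \<ominus>\<^bsub>M\<^esub> hcomp M m i"
  using hcomp_const[of m "-1" i] by (simp add: act_minus_one)

end

context gmod_edge
begin

sublocale O: orep M \<alpha> "mpart M" "tact (edge \<alpha>) M" "mmap (edge \<alpha>) M" by (rule orep)

lemma oclosed_act:
  assumes "O.oclosed Q" "v \<in> Q i"
  shows "act v (free_gen GX) \<in> Q (i + 1)" "act v (free_gen GY) \<in> Q (i - 1)"
    "act v (free_gen GZ) \<in> Q i" "act v (free_const c) \<in> Q i"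
proof -
  note Q = O.oclosedD[OF assms(1)]
  have v: "v \<in> carrier M" using Q(1)[OF assms(2)] mpart_carrier by blast
  show "act v (free_gen GX) \<in> Q (i + 1)" using Q(5)[OF assms(2), of "i + 1"] by (simp add: mmap_up)
  show "act v (free_gen GY) \<in> Q (i - 1)" using Q(5)[OF assms(2), of "i - 1"] by (simp add: mmap_down)
  show "act v (free_gen GZ) \<in> Q i" using Q(4)[OF assms(2)] by (simp add: act_Z[OF v, of i])
  show "act v (free_const c) \<in> Q i" using Q(4)[OF assms(2), of "[:c:]"] v by (simp add: tact_rules)
qed

lemma total_submodule:
  assumes "O.oclosed Q"
  shows "submodule_closed (gwa (edge \<alpha>)) (total Q) M"
proof -
  note Q = O.oclosedD[OF assms]
  have add: "m \<oplus>\<^bsub>M\<^esub> n \<in> total Q" if "m \<in> total Q" "n \<in> total Q" for m n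
    using that Q(3) unfolding total_def by (simp add: hcomp_add)
  have const: "act m (free_const c) \<in> total Q" if "m \<in> total Q" for m c
    using that oclosed_act(4)[OF assms] unfolding total_def by (simp add: hcomp_const)
  have gen: "act m (free_gen g) \<in> total Q" if "m \<in> total Q" for m g
  proof -
    have m: "m \<in> carrier M" "\<And>i. hcomp M m i \<in> Q i" using that unfolding total_def by auto
    have "hcomp M (act m (free_gen g)) i \<in> Q i" for i
      using oclosed_act(1)[OF assms m(2)[of "i - 1"]] oclosed_act(2)[OF assms m(2)[of "i + 1"]]
        oclosed_act(3)[OF assms m(2)[of i]]
        hcomp_act[OF m(1) homog_gen(1), of i] hcomp_act[OF m(1) homog_gen(2), of i] hcomp_act[OF m(1) homog_gen(3), of i]
      by (cases g) simp_all
    then show ?thesis using m unfolding total_def by simp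
  qed
  show ?thesis
    unfolding submodule_closed_iff
  proof (intro conjI ballI allI)
    show "additive_subgroup (total Q) M"
    proof (rule additive_subgroupI'[OF R.M.abelian_group_axioms])
      show "\<ominus>\<^bsub>M\<^esub> m \<in> total Q" if "m \<in> total Q" for m
        using const[OF that, of "-1"] that unfolding total_def by (simp add: act_minus_one)
    qed (use Q(2) add in \<open>auto simp: total_def\<close>)
    show "act m p \<in> total Q" if "m \<in> total Q" for m p
      by (rule act_closure) (use that add const gen in \<open>auto simp: total_def\<close>)
  qed
qed

lemma submodule_oclosed:
  assumes "submodule_closed (gwa (edge \<alpha>)) N M"
  shows "O.oclosed (\<lambda>k. N \<inter> mpart M k)"
proof -
  have N: "additive_subgroup N M" "\<And>n p. n \<in> N \<Longrightarrow> act n p \<in> N"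
    using assms unfolding submodule_closed_iff by auto
  have mm: "mmap (edge \<alpha>) M i j v \<in> N" if "v \<in> N" for i j v
  proof (induction rule: mmap_induct[of _ i])
    case (up j) then show ?case using N(2) by (simp add: mmap_up)
  next
    case (down j) then show ?case using N(2) by (simp add: mmap_down)
  qed (simp add: that)
  show ?thesis
    by (rule O.oclosedI)
      (use mm N additive_subgroup.zero_closed[OF N(1)] additive_subgroup.a_closed[OF N(1)] in
        \<open>auto simp: mpart_zero mpart_add tact_mpart[unfolded tact_def] mmap_mpart tact_def\<close>)
qed

lemma submodule_top:
  assumes "submodule_closed (gwa (edge \<alpha>)) N M" "\<And>k. mpart M k \<subseteq> N"
  shows "N = carrier M"
proof -
  have N: "additive_subgroup N M" using assms(1) unfolding submodule_closed_iff by auto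
  have "m \<in> N" if "m \<in> carrier M" for m
    using that
  proof (induction rule: carrier_induct)
    case (homog i m) then show ?case using assms(2) by blast
  next
    case (add m n) then show ?case using additive_subgroup.a_closed[OF N] by blast
  qed
  then show ?thesis using additive_subgroup.a_subset[OF N] by blast
qed

text \<open>Homogeneous components of generators generate as well, and graded submodules correspond to subrepresentations;
  every submodule that contains all homogeneous parts is the whole module.\<close>

theorem fin_gen_iff: "fin_gen (gwa (edge \<alpha>)) M \<longleftrightarrow> O.ofg"
proof
  assume "fin_gen (gwa (edge \<alpha>)) M"
  then obtain S where S: "finite S" "S \<subseteq> carrier M"
    "\<forall>N. submodule_closed (gwa (edge \<alpha>)) N M \<and> S \<subseteq> N \<longrightarrow> N = carrier M"
    unfolding fin_gen_def by blast
  define T where "T = (\<Union>s\<in>S. (\<lambda>i. (i, hcomp M s i)) ` {i. hcomp M s i \<noteq> \<zero>\<^bsub>M\<^esub>})"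
  have "O.gens T"
    unfolding O.gens_def
  proof (intro conjI allI impI)
    show "finite T" unfolding T_def using S(1,2) hcomp_finite by (intro finite_UN_I finite_imageI) auto
    show "\<forall>(d, g)\<in>T. g \<in> mpart M d" unfolding T_def using S(2) hcomp_mpart by blast
    fix Q k assume Q: "O.oclosed Q \<and> (\<forall>(d, g)\<in>T. g \<in> Q d)"
    have "hcomp M s i \<in> Q i" if "s \<in> S" for s i
      using Q that O.oclosedD(2)[of Q i] unfolding T_def by (cases "hcomp M s i = \<zero>\<^bsub>M\<^esub>") auto
    then have "S \<subseteq> total Q" unfolding total_def using S(2) by blast
    then have "total Q = carrier M" using S(3) total_submodule Q by blast
    then have "v \<in> total Q" if "v \<in> mpart M k" for v using mpart_carrier[OF that] by simp
    then have "hcomp M v k \<in> Q k" if "v \<in> mpart M k" for v using that unfolding total_def by simp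
    then show "mpart M k \<subseteq> Q k" using hcomp_homog[of _ k k] by auto
  qed
  then show "O.ofg" unfolding O.ofg_def by blast
next
  assume "O.ofg"
  then obtain T where T: "O.gens T" unfolding O.ofg_def by blast
  show "fin_gen (gwa (edge \<alpha>)) M"
    unfolding fin_gen_def
  proof (intro exI[of _ "snd ` T"] conjI allI impI)
    show "finite (snd ` T)" using O.gensD(1)[OF T] by simp
    show "snd ` T \<subseteq> carrier M" using O.gensD(2)[OF T] mpart_carrier by force
    fix N assume N: "submodule_closed (gwa (edge \<alpha>)) N M \<and> snd ` T \<subseteq> N"
    show "N = carrier M"
    proof (rule submodule_top)
      show "mpart M k \<subseteq> N" for k
        using O.gens_induct[OF T submodule_oclosed[OF conjunct1[OF N]]] N O.gensD(2)[OF T] by force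
    qed (use N in blast)
  qed
qed

end

subsection \<open>Homomorphisms\<close>

lemma gr_homD:
  assumes "h \<in> gr_hom (gwa f) M N"
  shows "h \<in> extensional (carrier M)" "m \<in> carrier M \<Longrightarrow> h m \<in> carrier N"
    "\<lbrakk>m \<in> carrier M; n \<in> carrier M\<rbrakk> \<Longrightarrow> h (m \<oplus>\<^bsub>M\<^esub> n) = h m \<oplus>\<^bsub>N\<^esub> h n"
    "m \<in> carrier M \<Longrightarrow> h (mact f M m p) = mact f N (h m) p"
    "m \<in> mpart M i \<Longrightarrow> h m \<in> mpart N i"
  using assms unfolding gr_hom_def mact_def gwa_proj_hom(4) by (auto simp: PiE_def image_subset_iff)

lemma gr_homI:
  assumes "h \<in> extensional (carrier M)" "\<And>m. m \<in> carrier M \<Longrightarrow> h m \<in> carrier N"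
    "\<And>m n. \<lbrakk>m \<in> carrier M; n \<in> carrier M\<rbrakk> \<Longrightarrow> h (m \<oplus>\<^bsub>M\<^esub> n) = h m \<oplus>\<^bsub>N\<^esub> h n"
    "\<And>m p. m \<in> carrier M \<Longrightarrow> h (mact f M m p) = mact f N (h m) p"
    "\<And>m i. m \<in> mpart M i \<Longrightarrow> h m \<in> mpart N i"
  shows "h \<in> gr_hom (gwa f) M N"
  using assms unfolding gr_hom_def mact_def gwa_proj_hom(4) by (auto simp: PiE_def)

locale gmod_pair = M: gmod f M + N: gmod f N
  for f :: "'k::field_char_0 poly" and M :: "('k free_alg set, 'm) gmodule"
    and N :: "('k free_alg set, 'n) gmodule"
begin

lemma gr_hom_ext:
  assumes h: "h \<in> gr_hom (gwa f) M N" and h': "h' \<in> gr_hom (gwa f) M N"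
    and eq: "\<And>i m. m \<in> mpart M i \<Longrightarrow> h m = h' m"
  shows "h = h'"
proof (rule extensionalityI[OF gr_homD(1)[OF h] gr_homD(1)[OF h']])
  fix m assume "m \<in> carrier M"
  then show "h m = h' m"
    by (induction rule: M.carrier_induct) (simp_all add: eq gr_homD(3)[OF h] gr_homD(3)[OF h'])
qed

lemma gr_hom_zero: "h \<in> gr_hom (gwa f) M N \<Longrightarrow> h \<zero>\<^bsub>M\<^esub> = \<zero>\<^bsub>N\<^esub>"
  using gr_homD(4)[of h f M N "\<zero>\<^bsub>M\<^esub>" 0] gr_homD(2)[of h f M N "\<zero>\<^bsub>M\<^esub>"] by simp

lemma gr_hom_hcomp:
  assumes h: "h \<in> gr_hom (gwa f) M N" and "m \<in> carrier M"
  shows "hcomp N (h m) i = h (hcomp M m i)"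
  using assms(2)
proof (induction rule: M.carrier_induct)
  case (homog k m)
  then show ?case
    using N.hcomp_homog[OF gr_homD(5)[OF h homog], of i] M.hcomp_homog[OF homog, of i] gr_hom_zero[OF h]
    by simp
next
  case (add m n)
  then show ?case by (simp add: M.hcomp_add N.hcomp_add gr_homD[OF h])
qed

lemma gr_hom_tact:
  "h \<in> gr_hom (gwa f) M N \<Longrightarrow> m \<in> carrier M \<Longrightarrow> h (tact f M i p m) = tact f N i p (h m)"
  unfolding tact_def by (rule gr_homD(4))

lemma gr_hom_mmap:
  assumes h: "h \<in> gr_hom (gwa f) M N" and m: "m \<in> mpart M i"
  shows "h (mmap f M i j m) = mmap f N i j (h m)"
proof (induction rule: M.mmap_induct[of _ i])
  case (up j)
  then show ?case using M.mpart_carrier[OF M.mmap_mpart[OF m, of j]]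
    by (simp add: M.mmap_up N.mmap_up gr_homD[OF h])
next
  case (down j)
  then show ?case using M.mpart_carrier[OF M.mmap_mpart[OF m, of "j + 1"]]
    by (simp add: M.mmap_down N.mmap_down gr_homD[OF h])
qed simp

definition hom_of :: "(int \<Rightarrow> 'm \<Rightarrow> 'n) \<Rightarrow> 'm \<Rightarrow> 'n" where
  "hom_of \<psi> = restrict (\<lambda>m. assemble N (\<lambda>i. \<psi> i (hcomp M m i))) (carrier M)"

lemma hom_of:
  assumes mp: "\<And>i v. v \<in> mpart M i \<Longrightarrow> \<psi> i v \<in> mpart N i"
    and add: "\<And>i v w. \<lbrakk>v \<in> mpart M i; w \<in> mpart M i\<rbrakk> \<Longrightarrow> \<psi> i (v \<oplus>\<^bsub>M\<^esub> w) = \<psi> i v \<oplus>\<^bsub>N\<^esub> \<psi> i w"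
    and tact: "\<And>i v p. v \<in> mpart M i \<Longrightarrow> \<psi> i (tact f M i p v) = tact f N i p (\<psi> i v)"
    and mmap: "\<And>i j v. v \<in> mpart M i \<Longrightarrow> \<psi> j (mmap f M i j v) = mmap f N i j (\<psi> i v)"
  shows "hom_of \<psi> \<in> gr_hom (gwa f) M N" "m \<in> mpart M i \<Longrightarrow> hom_of \<psi> m = \<psi> i m"
proof -
  have zero: "\<psi> i \<zero>\<^bsub>M\<^esub> = \<zero>\<^bsub>N\<^esub>" for i
    using tact[OF M.mpart_zero[of i], of 0] N.mpart_carrier[OF mp[OF M.mpart_zero[of i]]]
    by (simp add: tact_def)
  have c: "\<psi> i (hcomp M m i) \<in> mpart N i" "finite {i. \<psi> i (hcomp M m i) \<noteq> \<zero>\<^bsub>N\<^esub>}" if "m \<in> carrier M" for m i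
  proof -
    show "\<psi> i (hcomp M m i) \<in> mpart N i" by (rule mp[OF M.hcomp_mpart[OF that]])
    have "{i. \<psi> i (hcomp M m i) \<noteq> \<zero>\<^bsub>N\<^esub>} \<subseteq> {i. hcomp M m i \<noteq> \<zero>\<^bsub>M\<^esub>}" by (auto simp: zero)
    then show "finite {i. \<psi> i (hcomp M m i) \<noteq> \<zero>\<^bsub>N\<^esub>}" by (rule finite_subset[OF _ M.hcomp_finite[OF that]])
  qed
  let ?h = "hom_of \<psi>"
  have h: "?h m \<in> carrier N" "hcomp N (?h m) i = \<psi> i (hcomp M m i)" if "m \<in> carrier M" for m i
    using N.hcomp_assemble[OF c[OF that]] that unfolding hom_of_def by simp_all
  have hom: "?h m = \<psi> i m" if "m \<in> mpart M i" for m i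
  proof (rule N.hcomp_eqI)
    show "hcomp N (?h m) j = hcomp N (\<psi> i m) j" for j
      using h(2)[OF M.mpart_carrier[OF that], of j] M.hcomp_homog[OF that, of j] N.hcomp_homog[OF mp[OF that], of j]
      by (simp add: zero)
  qed (use h(1) M.mpart_carrier[OF that] N.mpart_carrier[OF mp[OF that]] in auto)
  show "m \<in> mpart M i \<Longrightarrow> ?h m = \<psi> i m" by (rule hom)
  have hadd: "?h (m \<oplus>\<^bsub>M\<^esub> n) = ?h m \<oplus>\<^bsub>N\<^esub> ?h n" if "m \<in> carrier M" "n \<in> carrier M" for m n
    by (rule N.hcomp_eqI) (use that h in \<open>simp_all add: N.hcomp_add M.hcomp_add add M.hcomp_mpart\<close>)
  have "\<psi> i (M.act m (free_const c)) = N.act (\<psi> i m) (free_const c)"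
    "\<psi> (i + 1) (M.act m (free_gen GX)) = N.act (\<psi> i m) (free_gen GX)"
    "\<psi> (i - 1) (M.act m (free_gen GY)) = N.act (\<psi> i m) (free_gen GY)"
    "\<psi> i (M.act m (free_gen GZ)) = N.act (\<psi> i m) (free_gen GZ)" if "m \<in> mpart M i" for m i c
    using tact[OF that, of "[:c:]"] mmap[OF that, of "i + 1"] mmap[OF that, of "i - 1"] tact[OF that, of "[:of_int i, 1:]"]
      M.mpart_carrier[OF that] N.mpart_carrier[OF mp[OF that]]
    by (simp_all add: M.tact_rules N.tact_rules M.mmap_up N.mmap_up M.mmap_down N.mmap_down
        M.act_Z[of m i] N.act_Z[of "\<psi> i m" i])
  then have ops: "?h (M.act m (free_const c)) = N.act (?h m) (free_const c)"
    "?h (M.act m (free_gen g)) = N.act (?h m) (free_gen g)" if "m \<in> mpart M i" for m i c g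
    using that hom[OF that] hom[OF M.act_X[OF that]] hom[OF M.act_Y[OF that]] hom[OF M.act_const[OF that, of c]]
      hom[of "M.act m (free_gen GZ)" i] M.mpart_act[OF that homog_gen(3)]
    by (simp, cases g, simp_all)
  have "?h (M.act m p) = N.act (?h m) p" if "m \<in> carrier M" for m p
    using that
  proof (induction p arbitrary: m rule: free_alg_gen_induct)
    case (const c)
    then show ?case
      by (induction rule: M.carrier_induct) (simp_all add: ops M.act_rules N.act_rules hadd h)
  next
    case (gen g)
    then show ?case
      by (induction rule: M.carrier_induct) (simp_all add: ops M.act_rules N.act_rules hadd h)
  qed (simp_all add: M.act_rules N.act_rules hadd h)
  then show "?h \<in> gr_hom (gwa f) M N"
    by (intro gr_homI) (use h(1) hadd hom mp in \<open>auto simp: hom_of_def\<close>)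
qed

end

subsection \<open>Graded submodules and quotients\<close>

text \<open>For the modules constructed below, subgroups and uniqueness of decompositions follow from a family of projections.\<close>

lemma graded_moduleI:
  fixes M :: "('k::field_char_0 free_alg set, 'm) gmodule" and pr :: "'m \<Rightarrow> int \<Rightarrow> 'm"
  assumes ab: "abelian_group M"
    and closed: "\<And>m p. m \<in> carrier M \<Longrightarrow> mact f M m p \<in> carrier M"
    and rules: "\<And>m n p. \<lbrakk>m \<in> carrier M; n \<in> carrier M\<rbrakk> \<Longrightarrow> mact f M (m \<oplus>\<^bsub>M\<^esub> n) p = mact f M m p \<oplus>\<^bsub>M\<^esub> mact f M n p"
      "\<And>m p q. m \<in> carrier M \<Longrightarrow> mact f M m (p + q) = mact f M m p \<oplus>\<^bsub>M\<^esub> mact f M m q"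
      "\<And>m p q. m \<in> carrier M \<Longrightarrow> mact f M m (p * q) = mact f M (mact f M m p) q"
      "\<And>m. m \<in> carrier M \<Longrightarrow> mact f M m 1 = m"
    and mp: "\<And>m i. m \<in> mpart M i \<Longrightarrow> m \<in> carrier M" "\<And>i. \<zero>\<^bsub>M\<^esub> \<in> mpart M i"
      "\<And>m n i. \<lbrakk>m \<in> mpart M i; n \<in> mpart M i\<rbrakk> \<Longrightarrow> m \<oplus>\<^bsub>M\<^esub> n \<in> mpart M i"
      "\<And>m p i j. \<lbrakk>m \<in> mpart M i; p \<in> homog j\<rbrakk> \<Longrightarrow> mact f M m p \<in> mpart M (i + j)"
    and pr: "\<And>m i. m \<in> carrier M \<Longrightarrow> pr m i \<in> mpart M i"
      "\<And>m. m \<in> carrier M \<Longrightarrow> finite {i. pr m i \<noteq> \<zero>\<^bsub>M\<^esub>}"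
      "\<And>m n i. m \<in> carrier M \<Longrightarrow> n \<in> carrier M \<Longrightarrow> pr (m \<oplus>\<^bsub>M\<^esub> n) i = pr m i \<oplus>\<^bsub>M\<^esub> pr n i"
      "\<And>m i j. m \<in> mpart M i \<Longrightarrow> pr m j = (if j = i then m else \<zero>\<^bsub>M\<^esub>)"
      "\<And>m. m \<in> carrier M \<Longrightarrow> (\<And>i. pr m i = \<zero>\<^bsub>M\<^esub>) \<Longrightarrow> m = \<zero>\<^bsub>M\<^esub>"
  shows "graded_right_module (gwa f) M"
proof -
  interpret abelian_group M by (rule ab)
  have minus: "\<ominus>\<^bsub>M\<^esub> m = mact f M m (free_const (-1))" if m: "m \<in> carrier M" for m
  proof -
    have "mact f M m 0 = mact f M m 0 \<oplus>\<^bsub>M\<^esub> mact f M m 0" using rules(2)[OF m, of 0 0] by simp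
    then have z: "mact f M m 0 = \<zero>\<^bsub>M\<^esub>" using closed[OF m, of 0] by (metis add.l_cancel_one')
    have "mact f M m (free_const (-1)) \<oplus>\<^bsub>M\<^esub> m = mact f M m (free_const (-1) + 1)"
      using m by (simp add: rules)
    also have "free_const (-1) + 1 = (0 :: 'k free_alg)"
      using free_const_hom(1)[of "-1" "1::'k"] by (simp add: free_const_hom)
    finally show ?thesis using m z closed by (simp add: minus_equality)
  qed
  have sub: "additive_subgroup (mpart M i) M" for i
  proof (rule additive_subgroupI'[OF ab])
    show "\<ominus>\<^bsub>M\<^esub> m \<in> mpart M i" if "m \<in> mpart M i" for m
      using mp(4)[OF that homog_const] minus[OF mp(1)[OF that]] by simp
  qed (use mp in auto)
  show ?thesis
  proof (intro graded_right_module.intro right_module.intro right_module_axioms.intro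
      graded_right_module_axioms.intro ring_gwa ab, goal_cases)
    case (1 m a) then show ?case using closed by (auto simp: gwa_proj_hom(4) mact_def)
  next
    case (2 m n a) then show ?case using rules(1) by (auto simp: gwa_proj_hom(4) mact_def)
  next
    case (3 m a b) then show ?case using rules(2)[of m] by (auto simp: gwa_proj_hom(4) mact_def gwa_proj_hom(1))
  next
    case (4 m a b) then show ?case using rules(3)[of m] by (auto simp: gwa_proj_hom(4) mact_def gwa_proj_hom(2))
  next
    case (5 m) then show ?case using rules(4)[of m] by (simp add: mact_def gwa_proj_hom(3))
  next
    case (6 i) show ?case by (rule sub)
  next
    case (7 m i a j) then show ?case using mp(4) by (auto simp: gwa_proj_hom(6) mact_def)
  next
    case (8 m)
    show ?case
    proof (rule homog_decomp_unique[where pr = pr, OF ab])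
      show "n = \<zero>\<^bsub>M\<^esub>" if "n \<in> carrier M" "\<And>i. pr n i = \<zero>\<^bsub>M\<^esub>" for n by (rule pr(5)[OF that])
    qed (fact sub pr(1-4) 8)+
  qed
qed

text \<open>The graded submodules.\<close>

definition gsub :: "'k::field_char_0 poly \<Rightarrow> ('k free_alg set, 'm) gmodule \<Rightarrow> 'm set \<Rightarrow> bool" where
  "gsub f M N \<longleftrightarrow> submodule_closed (gwa f) N M \<and> (\<forall>n\<in>N. \<forall>i. hcomp M n i \<in> N)"

lemma sub_module_simps [simp]:
  "carrier (sub_module M N) = N" "a \<oplus>\<^bsub>sub_module M N\<^esub> b = a \<oplus>\<^bsub>M\<^esub> b" "\<zero>\<^bsub>sub_module M N\<^esub> = \<zero>\<^bsub>M\<^esub>"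
  "mpart (sub_module M N) i = mpart M i \<inter> N" "mact f (sub_module M N) = mact f M"
  by (simp_all add: sub_module_def mact_def fun_eq_iff)

lemma sub_module_maps [simp]:
  "tact f (sub_module M N) = tact f M" "mmap f (sub_module M N) = mmap f M"
  by (simp_all add: tact_def mmap_def fun_eq_iff)

context gmod
begin

lemma gsubD:
  assumes "gsub f M N"
  shows "n \<in> N \<Longrightarrow> n \<in> carrier M" "\<zero>\<^bsub>M\<^esub> \<in> N" "\<lbrakk>m \<in> N; n \<in> N\<rbrakk> \<Longrightarrow> m \<oplus>\<^bsub>M\<^esub> n \<in> N" "n \<in> N \<Longrightarrow> act n p \<in> N"
    "n \<in> N \<Longrightarrow> hcomp M n i \<in> N" "n \<in> N \<Longrightarrow> \<ominus>\<^bsub>M\<^esub> n \<in> N" "abelian_subgroup N M"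
proof -
  have N: "additive_subgroup N M" "\<And>n p. n \<in> N \<Longrightarrow> act n p \<in> N" "\<And>n i. n \<in> N \<Longrightarrow> hcomp M n i \<in> N"
    using assms unfolding gsub_def submodule_closed_iff by auto
  then show "\<zero>\<^bsub>M\<^esub> \<in> N" "\<lbrakk>m \<in> N; n \<in> N\<rbrakk> \<Longrightarrow> m \<oplus>\<^bsub>M\<^esub> n \<in> N" "n \<in> N \<Longrightarrow> act n p \<in> N" "n \<in> N \<Longrightarrow> hcomp M n i \<in> N"
    using additive_subgroup.zero_closed additive_subgroup.a_closed by auto
  show c: "n \<in> N \<Longrightarrow> n \<in> carrier M" for n using additive_subgroup.a_subset[OF N(1)] by blast
  show "n \<in> N \<Longrightarrow> \<ominus>\<^bsub>M\<^esub> n \<in> N" using N(2)[of n "free_const (-1)"] c[of n] by (simp add: act_minus_one)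
  show "abelian_subgroup N M"
    by (rule abelian_subgroupI3[OF N(1) R.M.abelian_group_axioms])
qed

lemma gsubI:
  assumes "N \<subseteq> carrier M" "\<zero>\<^bsub>M\<^esub> \<in> N" "\<And>m n. \<lbrakk>m \<in> N; n \<in> N\<rbrakk> \<Longrightarrow> m \<oplus>\<^bsub>M\<^esub> n \<in> N"
    "\<And>n p. n \<in> N \<Longrightarrow> act n p \<in> N" "\<And>n i. n \<in> N \<Longrightarrow> hcomp M n i \<in> N"
  shows "gsub f M N"
  unfolding gsub_def submodule_closed_iff
proof (intro conjI ballI allI)
  show "additive_subgroup N M"
  proof (rule additive_subgroupI'[OF R.M.abelian_group_axioms])
    show "\<ominus>\<^bsub>M\<^esub> m \<in> N" if "m \<in> N" for m
      using assms(4)[OF that, of "free_const (-1)"] assms(1) that by (simp add: act_minus_one subset_iff)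
  qed (use assms in auto)
qed (use assms in auto)

lemma gsub_memI:
  assumes "gsub f M N" "m \<in> carrier M" "\<And>i. hcomp M m i \<in> N"
  shows "m \<in> N"
proof -
  have "assemble M (hcomp M m) \<in> N"
    unfolding assemble_def
    by (rule R.M.finsum_mem[OF hcomp_finite[OF assms(2)]]) (use gsubD[OF assms(1)] assms(3) in auto)
  then show ?thesis using assemble_hcomp[OF assms(2)] by simp
qed

lemma sub_module_graded:
  assumes "gsub f M N"
  shows "graded_right_module (gwa f) (sub_module M N)"
proof (rule graded_moduleI[where pr = "hcomp M"])
  note N = gsubD[OF assms]
  show "abelian_group (sub_module M N)"
  proof (rule abelian_groupI)
    fix x assume "x \<in> carrier (sub_module M N)"
    then show "\<exists>y\<in>carrier (sub_module M N). y \<oplus>\<^bsub>sub_module M N\<^esub> x = \<zero>\<^bsub>sub_module M N\<^esub>"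
      using N(1,6) by (intro bexI[of _ "\<ominus>\<^bsub>M\<^esub> x"]) (auto simp: R.M.l_neg)
  qed (use N(1-3) in \<open>auto simp: R.M.a_ac\<close>)
  show "m = \<zero>\<^bsub>sub_module M N\<^esub>" if "m \<in> carrier (sub_module M N)" "\<And>i. hcomp M m i = \<zero>\<^bsub>sub_module M N\<^esub>" for m
    using hcomp_eqI[of m "\<zero>\<^bsub>M\<^esub>"] that N(1) by simp
  show "hcomp M m j = (if j = i then m else \<zero>\<^bsub>sub_module M N\<^esub>)" if "m \<in> mpart (sub_module M N) i" for m i j
    using hcomp_homog[of m i j] that by simp
qed (use gsubD(1-5)[OF assms] in \<open>simp_all add: act_rules mpart_zero mpart_add mpart_act hcomp_mpart hcomp_finite hcomp_add\<close>)

text \<open>If \<open>N\<close> with the parts \<open>mpart M i \<inter> N\<close> is a graded module, then the decomposition in \<open>N\<close> is one in \<open>M\<close>, so \<open>N\<close>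
  contains the components taken in \<open>M\<close>.\<close>

lemma graded_sub_module:
  assumes "graded_right_module (gwa f) (sub_module M N)" "N \<subseteq> carrier M"
  shows "gsub f M N"
proof -
  interpret S: gmod f "sub_module M N" by (rule gmod.intro) (rule assms(1))
  show ?thesis
  proof (rule gsubI[OF assms(2)])
    show "\<zero>\<^bsub>M\<^esub> \<in> N" using S.R.M.zero_closed by simp
    show "m \<oplus>\<^bsub>M\<^esub> n \<in> N" if "m \<in> N" "n \<in> N" for m n using S.R.M.a_closed[of m n] that by simp
    show "act n p \<in> N" if "n \<in> N" for n p using S.act_closed[of n p] that by simp
    fix n i assume n: "n \<in> N"
    have sum: "finsum (sub_module M N) c S = finsum M c S \<and> finsum M c S \<in> N"
      if "finite S" "\<And>i. c i \<in> N" for c and S :: "int set"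
      using that(1)
    proof (induction S rule: finite_induct)
      case (insert x S)
      have 1: "finsum M c (insert x S) = c x \<oplus>\<^bsub>M\<^esub> finsum M c S"
        by (rule R.M.finsum_insert) (use insert that(2) assms(2) in auto)
      have 2: "finsum (sub_module M N) c (insert x S) = c x \<oplus>\<^bsub>sub_module M N\<^esub> finsum (sub_module M N) c S"
        by (rule S.R.M.finsum_insert) (use insert that(2) in auto)
      show ?case using 1 2 insert.IH that(2) S.R.M.a_closed[of "c x" "finsum M c S"] by simp
    qed (use S.R.M.zero_closed in simp)
    let ?d = "hcomp (sub_module M N) n"
    have d: "homog_decomp (sub_module M N) n ?d" by (rule S.hcomp_decomp) (use n in simp)
    have dN: "?d i \<in> N" for i using S.hcomp_carrier[of n i] n by simp
    have "homog_decomp M n ?d"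
      using d dN sum[of "{i. ?d i \<noteq> \<zero>\<^bsub>M\<^esub>}" ?d] unfolding homog_decomp_def by simp
    then show "hcomp M n i \<in> N" using hcomp_unique[of n ?d] assms(2) n dN by auto
  qed
qed

end

subsection \<open>Cosets\<close>

locale gquot = gmod f M for f :: "'k::field_char_0 poly" and M :: "('k free_alg set, 'm) gmodule" +
  fixes N
  assumes N: "gsub f M N"
begin

sublocale S: abelian_subgroup N M by (rule gsubD(7)[OF N])

abbreviation \<pi> where "\<pi> m \<equiv> N +>\<^bsub>M\<^esub> m"
abbreviation Q where "Q \<equiv> quot_module M N"

lemmas N_simps = gsubD[OF N]

lemma mem_coset: "m \<in> carrier M \<Longrightarrow> x \<in> \<pi> m \<longleftrightarrow> (\<exists>n\<in>N. x = n \<oplus>\<^bsub>M\<^esub> m)"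
  unfolding a_r_coset_def' by auto

lemma coset_eq: "m \<in> carrier M \<Longrightarrow> x \<in> \<pi> m \<Longrightarrow> \<pi> x = \<pi> m"
  using S.a_repr_independence' by blast

lemma coset_carrier: "m \<in> carrier M \<Longrightarrow> x \<in> \<pi> m \<Longrightarrow> x \<in> carrier M"
  using mem_coset N_simps(1) by auto

lemma coset_self: "m \<in> carrier M \<Longrightarrow> m \<in> \<pi> m"
  by (rule S.a_rcos_self)

lemma coset_eq_N: "m \<in> carrier M \<Longrightarrow> \<pi> m = N \<longleftrightarrow> m \<in> N"
  using S.a_rcos_const coset_self by blast

lemma coset_eq_iff:
  assumes "m \<in> carrier M" "n \<in> carrier M"
  shows "\<pi> m = \<pi> n \<longleftrightarrow> (\<exists>x\<in>N. m = x \<oplus>\<^bsub>M\<^esub> n)"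
  using coset_eq[OF assms(2), of m] coset_self[OF assms(1)] mem_coset[OF assms(2), of m] by blast

lemma quot_simps:
  "carrier Q = \<pi> ` carrier M" "\<zero>\<^bsub>Q\<^esub> = N" "mpart Q i = \<pi> ` mpart M i"
  "\<lbrakk>m \<in> carrier M; n \<in> carrier M\<rbrakk> \<Longrightarrow> \<pi> m \<oplus>\<^bsub>Q\<^esub> \<pi> n = \<pi> (m \<oplus>\<^bsub>M\<^esub> n)"
proof -
  show "carrier Q = \<pi> ` carrier M"
    by (auto simp: quot_module_def ring.defs FactRing_def A_RCOSETS_def')
  show "\<zero>\<^bsub>Q\<^esub> = N" "mpart Q i = \<pi> ` mpart M i"
    by (simp_all add: quot_module_def ring.defs FactRing_def)
  show "\<lbrakk>m \<in> carrier M; n \<in> carrier M\<rbrakk> \<Longrightarrow> \<pi> m \<oplus>\<^bsub>Q\<^esub> \<pi> n = \<pi> (m \<oplus>\<^bsub>M\<^esub> n)"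
    by (simp add: quot_module_def ring.defs FactRing_def S.a_rcos_sum)
qed

lemma coset_act_eq:
  assumes m: "m \<in> carrier M"
  shows "coset_act M N (\<pi> m) (gwa_proj f p) = \<pi> (act m p)"
proof (intro equalityI subsetI)
  fix x assume "x \<in> coset_act M N (\<pi> m) (gwa_proj f p)"
  then obtain n n' where n: "n \<in> N" "n' \<in> N" "x = n \<oplus>\<^bsub>M\<^esub> act (n' \<oplus>\<^bsub>M\<^esub> m) p"
    unfolding coset_act_def set_add_def' mact_def using mem_coset[OF m] by auto
  then have "x = (n \<oplus>\<^bsub>M\<^esub> act n' p) \<oplus>\<^bsub>M\<^esub> act m p"
    using m N_simps(1,4) by (simp add: act_rules R.M.a_assoc)
  then show "x \<in> \<pi> (act m p)" using n N_simps(3,4) m by (subst mem_coset) auto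
next
  fix x assume "x \<in> \<pi> (act m p)"
  then obtain n where "n \<in> N" "x = n \<oplus>\<^bsub>M\<^esub> act m p" using mem_coset[of "act m p" x] m by auto
  then show "x \<in> coset_act M N (\<pi> m) (gwa_proj f p)"
    unfolding coset_act_def set_add_def' mact_def using coset_self[OF m] by auto
qed

lemma quot_act: "m \<in> carrier M \<Longrightarrow> mact f Q (\<pi> m) p = \<pi> (act m p)"
  unfolding coset_act_eq[symmetric] by (simp add: mact_def quot_module_def ring.defs)

lemma quot_tact: "m \<in> carrier M \<Longrightarrow> tact f Q i p (\<pi> m) = \<pi> (tact f M i p m)"
  unfolding tact_def by (rule quot_act)

lemma coset_hcomp:
  assumes "m \<in> carrier M" "n \<in> carrier M" "\<pi> m = \<pi> n"
  shows "\<pi> (hcomp M m i) = \<pi> (hcomp M n i)"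
proof -
  obtain x where x: "x \<in> N" "m = x \<oplus>\<^bsub>M\<^esub> n" using assms coset_eq_iff by blast
  have "hcomp M m i = hcomp M x i \<oplus>\<^bsub>M\<^esub> hcomp M n i" unfolding x(2) using assms(2) N_simps(1)[OF x(1)] by (rule hcomp_add[rotated])
  then show ?thesis using coset_eq_iff[of "hcomp M m i" "hcomp M n i"] assms N_simps(5)[OF x(1)] by auto
qed

definition qpr :: "'m set \<Rightarrow> int \<Rightarrow> 'm set" where
  "qpr X i = \<pi> (hcomp M (SOME m. m \<in> carrier M \<and> \<pi> m = X) i)"

lemma qpr: "m \<in> carrier M \<Longrightarrow> qpr (\<pi> m) i = \<pi> (hcomp M m i)"
proof -
  assume m: "m \<in> carrier M"
  let ?m = "SOME n. n \<in> carrier M \<and> \<pi> n = \<pi> m"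
  have "?m \<in> carrier M \<and> \<pi> ?m = \<pi> m" by (rule someI[of _ m]) (use m in simp)
  then show ?thesis unfolding qpr_def using coset_hcomp m by blast
qed

lemma coset_zero: "\<pi> \<zero>\<^bsub>M\<^esub> = N"
  using coset_eq_N[of "\<zero>\<^bsub>M\<^esub>"] N_simps(2) by simp

lemma quot_graded: "graded_right_module (gwa f) Q"
proof (rule graded_moduleI[where pr = qpr])
  show "abelian_group Q"
  proof (rule abelian_groupI)
    fix x assume "x \<in> carrier Q"
    then obtain m where m: "m \<in> carrier M" "x = \<pi> m" unfolding quot_simps by blast
    then show "\<exists>y\<in>carrier Q. y \<oplus>\<^bsub>Q\<^esub> x = \<zero>\<^bsub>Q\<^esub>"
      by (intro bexI[of _ "\<pi> (\<ominus>\<^bsub>M\<^esub> m)"]) (auto simp: quot_simps R.M.l_neg coset_zero)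
    show "\<zero>\<^bsub>Q\<^esub> \<oplus>\<^bsub>Q\<^esub> x = x" using m quot_simps(4)[OF R.M.zero_closed m(1)] by (simp add: quot_simps coset_zero)
  next
    show "\<zero>\<^bsub>Q\<^esub> \<in> carrier Q" unfolding quot_simps using coset_zero R.M.zero_closed by blast
  qed (auto simp: quot_simps R.M.a_ac)
  show "mact f Q m p \<in> carrier Q" if "m \<in> carrier Q" for m p
    using that by (auto simp: quot_simps quot_act)
  show "mact f Q (m \<oplus>\<^bsub>Q\<^esub> n) p = mact f Q m p \<oplus>\<^bsub>Q\<^esub> mact f Q n p"
    if "m \<in> carrier Q" "n \<in> carrier Q" for m n p
    using that by (auto simp: quot_simps quot_act act_rules)
  show "mact f Q m (p + q) = mact f Q m p \<oplus>\<^bsub>Q\<^esub> mact f Q m q" if "m \<in> carrier Q" for m p q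
    using that by (auto simp: quot_simps quot_act act_rules)
  show "mact f Q m (p * q) = mact f Q (mact f Q m p) q" if "m \<in> carrier Q" for m p q
    using that by (auto simp: quot_simps quot_act act_rules)
  show "mact f Q m 1 = m" if "m \<in> carrier Q" for m
    using that by (auto simp: quot_simps quot_act act_rules)
  show "m \<in> carrier Q" if "m \<in> mpart Q i" for m i
    using that mpart_carrier by (auto simp: quot_simps)
  show "\<zero>\<^bsub>Q\<^esub> \<in> mpart Q i" for i unfolding quot_simps using coset_zero mpart_zero by blast
  show "m \<oplus>\<^bsub>Q\<^esub> n \<in> mpart Q i" if "m \<in> mpart Q i" "n \<in> mpart Q i" for m n i
    using that mpart_carrier mpart_add by (auto simp: quot_simps(3) quot_simps(4))
  show "mact f Q m p \<in> mpart Q (i + j)" if "m \<in> mpart Q i" "p \<in> homog j" for m p i j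
    using that mpart_carrier mpart_act by (auto simp: quot_simps(3) quot_act)
  show "qpr m i \<in> mpart Q i" if "m \<in> carrier Q" for m i
    using that hcomp_mpart by (auto simp: quot_simps qpr)
  show "finite {i. qpr m i \<noteq> \<zero>\<^bsub>Q\<^esub>}" if mQ: "m \<in> carrier Q" for m
  proof -
    obtain x where x: "x \<in> carrier M" "m = \<pi> x" using mQ by (auto simp: quot_simps(1))
    have "{i. qpr m i \<noteq> \<zero>\<^bsub>Q\<^esub>} \<subseteq> {i. hcomp M x i \<noteq> \<zero>\<^bsub>M\<^esub>}"
    proof (rule subsetI, rule CollectI, rule notI)
      fix i assume "i \<in> {i. qpr m i \<noteq> \<zero>\<^bsub>Q\<^esub>}" "hcomp M x i = \<zero>\<^bsub>M\<^esub>"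
      then show False using coset_zero x by (simp add: quot_simps(2) qpr)
    qed
    then show ?thesis by (rule finite_subset[OF _ hcomp_finite[OF x(1)]])
  qed
  show "qpr (m \<oplus>\<^bsub>Q\<^esub> n) i = qpr m i \<oplus>\<^bsub>Q\<^esub> qpr n i" if "m \<in> carrier Q" "n \<in> carrier Q" for m n i
    using that by (auto simp: quot_simps(1) quot_simps(4) qpr hcomp_add)
  show "qpr m j = (if j = i then m else \<zero>\<^bsub>Q\<^esub>)" if "m \<in> mpart Q i" for m i j
    using that mpart_carrier hcomp_homog[of _ i j] coset_zero by (auto simp: quot_simps(2,3) qpr)
  show "m = \<zero>\<^bsub>Q\<^esub>" if mQ: "m \<in> carrier Q" "\<And>i. qpr m i = \<zero>\<^bsub>Q\<^esub>" for m
  proof -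
    obtain x where x: "x \<in> carrier M" "m = \<pi> x" using mQ(1) by (auto simp: quot_simps(1))
    have "hcomp M x i \<in> N" for i
      using mQ(2)[of i] coset_eq_N[of "hcomp M x i"] x by (simp add: qpr quot_simps(2))
    then have "x \<in> N" by (rule gsub_memI[OF N x(1)])
    then show ?thesis using coset_eq_N x by (simp add: quot_simps(2))
  qed
qed

lemma quot_fin_gen:
  assumes "fin_gen (gwa f) M"
  shows "fin_gen (gwa f) Q"
proof -
  obtain T where T: "finite T" "T \<subseteq> carrier M" "\<And>N. submodule_closed (gwa f) N M \<Longrightarrow> T \<subseteq> N \<Longrightarrow> N = carrier M"
    using assms unfolding fin_gen_def by blast
  interpret Q: gmod f Q by (rule gmod.intro) (rule quot_graded)
  show ?thesis
    unfolding fin_gen_def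
  proof (intro exI[of _ "\<pi> ` T"] conjI allI impI)
    show "finite (\<pi> ` T)" "\<pi> ` T \<subseteq> carrier Q" using T by (auto simp: quot_simps)
    fix P assume P: "submodule_closed (gwa f) P Q \<and> \<pi> ` T \<subseteq> P"
    have sub: "additive_subgroup P Q" and act: "\<And>x p. x \<in> P \<Longrightarrow> mact f Q x p \<in> P"
      using P unfolding submodule_closed_iff by auto
    define P' where "P' = {m \<in> carrier M. \<pi> m \<in> P}"
    have P'act: "act m p \<in> P'" if "m \<in> P'" for m p
      using that act[of "\<pi> m" p] unfolding P'_def by (simp add: quot_act)
    have "submodule_closed (gwa f) P' M"
      unfolding submodule_closed_iff
    proof (intro conjI ballI allI)
      show "additive_subgroup P' M"
      proof (rule additive_subgroupI'[OF R.M.abelian_group_axioms])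
        show "\<zero>\<^bsub>M\<^esub> \<in> P'" using additive_subgroup.zero_closed[OF sub] coset_zero by (simp add: P'_def quot_simps(2))
        show "m \<oplus>\<^bsub>M\<^esub> n \<in> P'" if "m \<in> P'" "n \<in> P'" for m n
          using that additive_subgroup.a_closed[OF sub, of "\<pi> m" "\<pi> n"] by (simp add: P'_def quot_simps(4))
        show "\<ominus>\<^bsub>M\<^esub> m \<in> P'" if "m \<in> P'" for m
          using P'act[OF that, of "free_const (-1)"] that by (simp add: P'_def act_minus_one)
      qed (auto simp: P'_def)
    qed (rule P'act)
    moreover have "T \<subseteq> P'" using T(2) P unfolding P'_def by blast
    ultimately have "P' = carrier M" by (rule T(3))
    then have "carrier Q \<subseteq> P" unfolding quot_simps P'_def by blast
    then show "P = carrier Q" using additive_subgroup.a_subset[OF sub] by blast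
  qed
qed

end

subsection \<open>Finite dimension\<close>

text \<open>Infinitely many vectors in a space of finite dimension are dependent, by elimination of one coordinate at a time: two relations
  on disjoint ranges of vectors (the bound \<open>l\<close> keeps them apart) are combined to one that respects one more coordinate.\<close>

lemma linear_relation:
  fixes c :: "nat \<Rightarrow> 'b \<Rightarrow> 'k::field"
  assumes "finite B"
  shows "\<exists>n a. (\<forall>i<l. a i = 0) \<and> (\<exists>i<n. a i \<noteq> 0) \<and> (\<forall>b\<in>B. (\<Sum>i<n. a i * c i b) = 0)"
  using assms
proof (induction B arbitrary: l rule: finite_induct)
  case empty
  show ?case by (rule exI[of _ "Suc l"], rule exI[of _ "\<lambda>i. if i = l then 1 else 0"]) auto
next
  case (insert x B)
  obtain n a where a: "\<forall>i<l. a i = 0" "\<exists>i<n. a i \<noteq> 0" "\<forall>b\<in>B. (\<Sum>i<n. a i * c i b) = 0"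
    using insert.IH[of l] by blast
  obtain n' a' where a': "\<forall>i<max n l. a' i = 0" "\<exists>i<n'. a' i \<noteq> 0" "\<forall>b\<in>B. (\<Sum>i<n'. a' i * c i b) = 0"
    using insert.IH[of "max n l"] by blast
  let ?s = "\<Sum>i<n. a i * c i x" and ?s' = "\<Sum>i<n'. a' i * c i x"
  show ?case
  proof (cases "?s = 0")
    case True
    then show ?thesis using a by (intro exI[of _ n] exI[of _ a]) auto
  next
    case False
    let ?m = "max n n'"
    define d where "d = (\<lambda>i. ?s' * (if i < n then a i else 0) - ?s * (if i < n' then a' i else 0))"
    have sum: "(\<Sum>i<?m. d i * c i b) = ?s' * (\<Sum>i<n. a i * c i b) - ?s * (\<Sum>i<n'. a' i * c i b)" for b
    proof -
      have "(\<Sum>i<?m. (if i < n then a i else 0) * c i b) = (\<Sum>i<n. a i * c i b)"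
        by (rule sum.mono_neutral_cong_right) auto
      moreover have "(\<Sum>i<?m. (if i < n' then a' i else 0) * c i b) = (\<Sum>i<n'. a' i * c i b)"
        by (rule sum.mono_neutral_cong_right) auto
      ultimately show ?thesis
        unfolding d_def by (simp add: left_diff_distrib sum_subtractf mult.assoc flip: sum_distrib_left)
    qed
    obtain i where i: "i < n'" "a' i \<noteq> 0" using a'(2) by blast
    then have "\<not> i < n" using a'(1) by auto
    then have "d i \<noteq> 0" unfolding d_def using i False by simp
    moreover have "\<forall>i<l. d i = 0" unfolding d_def using a(1) a'(1) by simp
    moreover have "\<forall>b\<in>insert x B. (\<Sum>i<?m. d i * c i b) = 0"
      unfolding sum using a(3) a'(3) by (auto simp: mult.commute)
    moreover have "i < ?m" using i(1) by simp
    ultimately show ?thesis by (intro exI[of _ ?m] exI[of _ d]) blast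
  qed
qed

context gmod
begin

inductive_set vspan :: "'m set \<Rightarrow> 'm set" for B where
  zero: "\<zero>\<^bsub>M\<^esub> \<in> vspan B"
| step: "v \<in> vspan B \<Longrightarrow> b \<in> B \<Longrightarrow> v \<oplus>\<^bsub>M\<^esub> act b (free_const c) \<in> vspan B"

lemma vspan_carrier: "v \<in> vspan B \<Longrightarrow> B \<subseteq> carrier M \<Longrightarrow> v \<in> carrier M"
  by (induction rule: vspan.induct) auto

lemma vspan_mono: "v \<in> vspan B \<Longrightarrow> B \<subseteq> B' \<Longrightarrow> v \<in> vspan B'"
  by (induction rule: vspan.induct) (auto intro: vspan.intros)

lemma vspan_add:
  assumes "w \<in> vspan B" "v \<in> vspan B" "B \<subseteq> carrier M"
  shows "v \<oplus>\<^bsub>M\<^esub> w \<in> vspan B"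
  using assms(1)
proof (induction rule: vspan.induct)
  case zero
  then show ?case using assms vspan_carrier by simp
next
  case (step w b c)
  have "v \<oplus>\<^bsub>M\<^esub> (w \<oplus>\<^bsub>M\<^esub> act b (free_const c)) = v \<oplus>\<^bsub>M\<^esub> w \<oplus>\<^bsub>M\<^esub> act b (free_const c)"
    using step assms vspan_carrier[OF step(1)] vspan_carrier[OF assms(2)] by (subst R.M.a_assoc) auto
  then show ?case using vspan.step[OF step(3,2)] by simp
qed

text \<open>Linear combinations in which basis vectors may be repeated can be collected into one coefficient per basis vector.\<close>

lemma vspan_combination:
  assumes "m \<in> vspan B" "finite B" "B \<subseteq> carrier M"
  shows "\<exists>c. m = (\<Oplus>\<^bsub>M\<^esub>b\<in>B. ract M b (scal (gwa f) (c b)))"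
  using assms(1)
proof (induction rule: vspan.induct)
  case zero
  have "(\<Oplus>\<^bsub>M\<^esub>b\<in>B. ract M b (scal (gwa f) 0)) = (\<Oplus>\<^bsub>M\<^esub>b\<in>B. \<zero>\<^bsub>M\<^esub>)"
    by (rule R.M.finsum_cong')
      (use assms(3) act_0[unfolded mact_def] in \<open>auto simp: gwa_proj_hom free_const_hom\<close>)
  then show ?case using R.M.finsum_zero by (intro exI[of _ "\<lambda>_. 0"]) simp
next
  case (step v b d)
  then obtain c where c: "v = (\<Oplus>\<^bsub>M\<^esub>b\<in>B. ract M b (scal (gwa f) (c b)))" by blast
  have r: "ract M b (scal (gwa f) x) = act b (free_const x)" for b x by (simp add: mact_def gwa_proj_hom(5))
  have b: "insert b (B - {b}) = B" using step(2) by blast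
  have *: "(\<Oplus>\<^bsub>M\<^esub>x\<in>B. act x (free_const (g x)))
      = act b (free_const (g b)) \<oplus>\<^bsub>M\<^esub> (\<Oplus>\<^bsub>M\<^esub>x\<in>B - {b}. act x (free_const (g x)))" for g
    using R.M.finsum_insert[of "B - {b}" b "\<lambda>x. act x (free_const (g x))"] assms(2,3) step(2)
    unfolding b by (auto simp: subset_iff)
  let ?g = "c(b := c b + d)"
  have "(\<Oplus>\<^bsub>M\<^esub>x\<in>B - {b}. act x (free_const (?g x))) = (\<Oplus>\<^bsub>M\<^esub>x\<in>B - {b}. act x (free_const (c x)))"
    by (rule R.M.finsum_cong') (use assms(3) in auto)
  moreover have "(\<Oplus>\<^bsub>M\<^esub>x\<in>B - {b}. act x (free_const (c x))) \<in> carrier M"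
    by (rule R.M.finsum_closed) (use assms(3) in auto)
  ultimately have "v \<oplus>\<^bsub>M\<^esub> act b (free_const d) = (\<Oplus>\<^bsub>M\<^esub>x\<in>B. act x (free_const (?g x)))"
    unfolding c r *[of ?g] *[of c] using step(2) assms(3)
    by (auto simp: free_const_hom act_rules R.M.a_ac subset_iff)
  then show ?case unfolding r by blast
qed

end

context gmod_edge
begin

text \<open>A part that is killed by \<open>q\<close> is spanned by the images of the generators and their multiples by the powers of \<open>t\<close>
  below the degree of \<open>q\<close>.\<close>

lemma fin_dim_if_bounded:
  assumes "O.ofg" "O.bounded (mpart M)"
  shows "fin_dim (gwa (edge \<alpha>)) M"
proof -
  obtain T where T: "O.gens T" using assms(1) unfolding O.ofg_def by blast
  obtain K q where Kq: "q \<noteq> 0 \<and> (\<forall>k. \<bar>k\<bar> \<ge> K \<longrightarrow> mpart M k \<subseteq> {\<zero>\<^bsub>M\<^esub>}) \<and>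
      (\<forall>k. \<forall>v\<in>mpart M k. tact (edge \<alpha>) M k q v = \<zero>\<^bsub>M\<^esub>)"
    using assms(2) unfolding O.bounded_def by (elim exE)
  then have q: "q \<noteq> 0" and K: "\<And>k. \<bar>k\<bar> \<ge> K \<Longrightarrow> mpart M k \<subseteq> {\<zero>\<^bsub>M\<^esub>}"
    and qv: "\<And>k v. v \<in> mpart M k \<Longrightarrow> tact (edge \<alpha>) M k q v = \<zero>\<^bsub>M\<^esub>"
    by simp_all
  define Bk where "Bk k = (\<lambda>((d, g), i). tact (edge \<alpha>) M k (monom 1 i) (mmap (edge \<alpha>) M d k g)) ` (T \<times> {..<degree q})" for k
  define B where "B = (\<Union>k\<in>{-K..K}. Bk k)"
  have Bkm: "b \<in> mpart M k" if "b \<in> Bk k" for b k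
    using that O.gensD(2)[OF T] mmap_mpart tact_mpart unfolding Bk_def by auto
  then have Bkc: "Bk k \<subseteq> carrier M" for k using mpart_carrier by blast
  have Bc: "B \<subseteq> carrier M" unfolding B_def using Bkc by blast
  have fin: "finite B" unfolding B_def Bk_def using O.gensD(1)[OF T] by auto
  have reduce: "tact (edge \<alpha>) M k p (mmap (edge \<alpha>) M d k g) \<in> vspan (Bk k)" if dg: "(d, g) \<in> T" for d g p k
  proof -
    let ?w = "mmap (edge \<alpha>) M d k g"
    have w: "?w \<in> mpart M k" using mmap_mpart O.gensD(2)[OF T dg] by blast
    note wc = mpart_carrier[OF w]
    have "p = p div q * q + p mod q" by simp
    then have "tact (edge \<alpha>) M k p ?w = tact (edge \<alpha>) M k (p div q * q + p mod q) ?w" by simp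
    also have "\<dots> = tact (edge \<alpha>) M k (p mod q) ?w"
      using wc qv[OF w] O.act_zero[of k] by (simp only: tact_rules(1)[OF wc] tact_rules(2)[OF wc]) (simp add: tact_rules)
    also have "p mod q = (\<Sum>i<degree q. monom (coeff (p mod q) i) i)"
    proof (cases "p mod q = 0")
      case False
      then have lt: "degree (p mod q) < degree q" using degree_mod_less[OF q, of p] by auto
      have "p mod q = (\<Sum>i\<le>degree (p mod q). monom (coeff (p mod q) i) i)" by (simp add: poly_as_sum_of_monoms)
      also have "\<dots> = (\<Sum>i<degree q. monom (coeff (p mod q) i) i)"
        by (rule sum.mono_neutral_left) (use lt in \<open>auto simp: coeff_eq_0\<close>)
      finally show ?thesis .
    qed simp
    also have "tact (edge \<alpha>) M k (\<Sum>i<n. monom (a i) i) ?w \<in> vspan (Bk k)" if "n \<le> degree q" for n a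
      using that
    proof (induction n)
      case 0
      then show ?case using w by (simp add: vspan.zero)
    next
      case (Suc n)
      have "monom (a n) n = [:a n:] * monom 1 n" by (simp add: smult_monom)
      then have "tact (edge \<alpha>) M k (monom (a n) n) ?w = act (tact (edge \<alpha>) M k (monom 1 n) ?w) (free_const (a n))"
        using wc by (simp only: tact_rules(2)[OF wc]) (simp add: tact_rules)
      moreover have "tact (edge \<alpha>) M k (monom 1 n) ?w \<in> Bk k" unfolding Bk_def using dg Suc.prems by force
      ultimately show ?case using Suc vspan.step by (simp add: tact_rules wc)
    qed
    finally show ?thesis by simp
  qed
  have hom: "v \<in> vspan (Bk k)" if v: "v \<in> mpart M k" for v k
  proof -
    have "v \<in> {v. \<forall>p. tact (edge \<alpha>) M k p v \<in> vspan (Bk k)} \<inter> mpart M k"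
    proof (rule O.gens_span[OF T _ _ v])
      show "O.kclosed k ({v. \<forall>p. tact (edge \<alpha>) M k p v \<in> vspan (Bk k)} \<inter> mpart M k)"
        unfolding O.kclosed_def using vspan_add[OF _ _ Bkc]
        by (auto simp: vspan.zero O.act_add tact_mpart mpart_zero mpart_add O.act_mult[symmetric])
      show "mmap (edge \<alpha>) M d k g \<in> {v. \<forall>p. tact (edge \<alpha>) M k p v \<in> vspan (Bk k)} \<inter> mpart M k"
        if "(d, g) \<in> T" for d g
        using reduce[OF that] mmap_mpart O.gensD(2)[OF T that] by blast
    qed
    then have "tact (edge \<alpha>) M k 1 v \<in> vspan (Bk k)" by blast
    then show ?thesis using v by (simp add: O.act_one)
  qed
  have "m \<in> vspan B" if "m \<in> carrier M" for m
    using that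
  proof (induction rule: carrier_induct)
    case (homog k m)
    show ?case
    proof (cases "\<bar>k\<bar> \<ge> K")
      case True
      then show ?thesis using K[OF True] homog vspan.zero by blast
    next
      case False
      then have "Bk k \<subseteq> B" unfolding B_def by (intro UN_upper) auto
      then show ?thesis using vspan_mono hom[OF homog] by blast
    qed
  next
    case (add m n)
    then show ?case using vspan_add[OF _ _ Bc] by blast
  qed
  then show ?thesis
    unfolding fin_dim_def using vspan_combination[OF _ fin Bc] fin Bc by blast
qed

text \<open>The degrees of the components of a finite spanning set bound the nonzero parts. The multiples of a generator by the powers
  of \<open>t\<close> are linearly dependent, which gives an annihilating polynomial; multiply these over all generators.\<close>

lemma bounded_if_fin_dim:
  assumes "O.ofg" "fin_dim (gwa (edge \<alpha>)) M"
  shows "O.bounded (mpart M)"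
proof -
  obtain T where T: "O.gens T" using assms(1) unfolding O.ofg_def by blast
  obtain B where B: "finite B" "B \<subseteq> carrier M"
    and ex: "\<forall>m\<in>carrier M. \<exists>c. m = (\<Oplus>\<^bsub>M\<^esub>b\<in>B. ract M b (scal (gwa (edge \<alpha>)) (c b)))"
    using assms(2) unfolding fin_dim_def by blast
  have r: "ract M b (scal (gwa (edge \<alpha>)) x) = act b (free_const x)" for b x
    by (simp add: mact_def gwa_proj_hom(5))
  have comb: "\<exists>c. m = (\<Oplus>\<^bsub>M\<^esub>b\<in>B. act b (free_const (c b)))" if "m \<in> carrier M" for m
    using ex that unfolding r by blast
  let ?S = "insert 0 (\<Union>b\<in>B. abs ` {i. hcomp M b i \<noteq> \<zero>\<^bsub>M\<^esub>})"
  have fin: "finite ?S" using B hcomp_finite by auto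
  define K where "K = Max ?S + 1"
  have K: "x < K" if "x \<in> ?S" for x using Max_ge[OF fin that] unfolding K_def by simp
  have far: "mpart M k \<subseteq> {\<zero>\<^bsub>M\<^esub>}" if k: "\<bar>k\<bar> \<ge> K" for k
  proof
    fix v assume v: "v \<in> mpart M k"
    let ?N = "{m \<in> carrier M. hcomp M m k = \<zero>\<^bsub>M\<^esub>}"
    have bk: "hcomp M b k = \<zero>\<^bsub>M\<^esub>" if "b \<in> B" for b
      using K[of "\<bar>k\<bar>"] k that by force
    obtain c where c: "v = (\<Oplus>\<^bsub>M\<^esub>b\<in>B. act b (free_const (c b)))" using comb[OF mpart_carrier[OF v]] by blast
    have "(\<Oplus>\<^bsub>M\<^esub>b\<in>B. act b (free_const (c b))) \<in> ?N"
      by (rule R.M.finsum_mem[OF B(1)]) (use B(2) bk in \<open>auto simp: hcomp_add hcomp_const subset_iff\<close>)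
    then show "v \<in> {\<zero>\<^bsub>M\<^esub>}" using hcomp_homog[OF v, of k] unfolding c[symmetric] by simp
  qed
  have ann: "\<exists>q. q \<noteq> 0 \<and> tact (edge \<alpha>) M d q g = \<zero>\<^bsub>M\<^esub>" if g: "g \<in> mpart M d" for d g
  proof -
    note gc = mpart_carrier[OF g]
    have "\<forall>i. \<exists>c. tact (edge \<alpha>) M d (monom 1 i) g = (\<Oplus>\<^bsub>M\<^esub>b\<in>B. act b (free_const (c b)))"
      using comb tact_rules(5)[OF gc] by blast
    then obtain c where c: "\<And>i. tact (edge \<alpha>) M d (monom 1 i) g = (\<Oplus>\<^bsub>M\<^esub>b\<in>B. act b (free_const (c i b)))"
      by metis
    obtain n a where a: "\<exists>i<n. a i \<noteq> 0" "\<forall>b\<in>B. (\<Sum>i<n. a i * c i b) = 0"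
      using linear_relation[OF B(1), of 0 c] by blast
    have cons: "act (\<Oplus>\<^bsub>M\<^esub>b\<in>B. act b (free_const (e b))) (free_const x) = (\<Oplus>\<^bsub>M\<^esub>b\<in>B. act b (free_const (x * e b)))" for e x
      using B
    proof (induction B rule: finite_induct)
      case (insert b B)
      have 1: "(\<Oplus>\<^bsub>M\<^esub>b\<in>insert b B. act b (free_const (h b))) = act b (free_const (h b)) \<oplus>\<^bsub>M\<^esub> (\<Oplus>\<^bsub>M\<^esub>b\<in>B. act b (free_const (h b)))" for h
        by (rule R.M.finsum_insert) (use insert in auto)
      have 2: "(\<Oplus>\<^bsub>M\<^esub>b\<in>B. act b (free_const (h b))) \<in> carrier M" for h
        by (rule R.M.finsum_closed) (use insert in auto)
      have "act (act b (free_const (e b))) (free_const x) = act b (free_const (x * e b))"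
        using act_rules(3)[of b "free_const (e b)" "free_const x"] insert.prems
        by (simp add: mult.commute flip: free_const_hom(2))
      then show ?case using insert 2 unfolding 1 by (simp add: act_rules(1))
    qed simp
    have lin: "tact (edge \<alpha>) M d (\<Sum>i<m. monom (a i) i) g = (\<Oplus>\<^bsub>M\<^esub>b\<in>B. act b (free_const (\<Sum>i<m. a i * c i b)))" for m
    proof (induction m)
      case 0
      have "(\<Oplus>\<^bsub>M\<^esub>b\<in>B. act b (free_const 0)) = (\<Oplus>\<^bsub>M\<^esub>b\<in>B. \<zero>\<^bsub>M\<^esub>)"
        by (rule R.M.finsum_cong') (use B(2) in \<open>auto simp: free_const_hom\<close>)
      then show ?case using g by (simp add: R.M.finsum_zero)
    next
      case (Suc m)
      have "monom (a m) m = [:a m:] * monom 1 m" by (simp add: smult_monom)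
      then have "tact (edge \<alpha>) M d (monom (a m) m) g = act (tact (edge \<alpha>) M d (monom 1 m) g) (free_const (a m))"
        by (simp only: tact_rules(2)[OF gc] tact_rules(6)[OF tact_rules(5)[OF gc]])
      then have "tact (edge \<alpha>) M d (monom (a m) m) g = (\<Oplus>\<^bsub>M\<^esub>b\<in>B. act b (free_const (a m * c m b)))"
        unfolding c cons .
      then have "tact (edge \<alpha>) M d (\<Sum>i<Suc m. monom (a i) i) g
          = (\<Oplus>\<^bsub>M\<^esub>b\<in>B. act b (free_const (\<Sum>i<m. a i * c i b))) \<oplus>\<^bsub>M\<^esub> (\<Oplus>\<^bsub>M\<^esub>b\<in>B. act b (free_const (a m * c m b)))"
        using Suc by (simp add: tact_rules(1)[OF gc])
      also have "\<dots> = (\<Oplus>\<^bsub>M\<^esub>b\<in>B. act b (free_const (\<Sum>i<m. a i * c i b)) \<oplus>\<^bsub>M\<^esub> act b (free_const (a m * c m b)))"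
        by (rule R.M.finsum_addf[symmetric]) (use B(2) in auto)
      also have "\<dots> = (\<Oplus>\<^bsub>M\<^esub>b\<in>B. act b (free_const (\<Sum>i<Suc m. a i * c i b)))"
        by (rule R.M.finsum_cong') (use B(2) in \<open>auto simp: free_const_hom(1) act_rules(2) subset_iff\<close>)
      finally show ?case .
    qed
    let ?q = "\<Sum>i<n. monom (a i) i"
    have "coeff ?q i = (if i < n then a i else 0)" for i
      by (simp add: coeff_sum if_distrib cong: if_cong) (simp add: when_def)?
    then have "?q \<noteq> 0" using a(1) by (metis coeff_0)
    moreover have "tact (edge \<alpha>) M d ?q g = (\<Oplus>\<^bsub>M\<^esub>b\<in>B. \<zero>\<^bsub>M\<^esub>)"
      unfolding lin by (rule R.M.finsum_cong') (use a(2) B(2) in \<open>auto simp: free_const_hom(3)\<close>)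
    ultimately show ?thesis by (metis R.M.finsum_zero)
  qed
  have "\<forall>x\<in>T. \<exists>q. q \<noteq> 0 \<and> tact (edge \<alpha>) M (fst x) q (snd x) = \<zero>\<^bsub>M\<^esub>"
    using ann O.gensD(2)[OF T] by auto
  then obtain Q where Q: "\<And>x. x \<in> T \<Longrightarrow> Q x \<noteq> 0 \<and> tact (edge \<alpha>) M (fst x) (Q x) (snd x) = \<zero>\<^bsub>M\<^esub>" by metis
  define q where "q = (\<Prod>x\<in>T. Q x)"
  have "q \<noteq> 0" unfolding q_def using Q O.gensD(1)[OF T] by simp
  moreover have "tact (edge \<alpha>) M k q v = \<zero>\<^bsub>M\<^esub>" if v: "v \<in> mpart M k" for k v
  proof -
    define W where "W = (\<lambda>k. {v. v \<in> mpart M k \<and> tact (edge \<alpha>) M k q v = \<zero>\<^bsub>M\<^esub>})"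
    have W: "v \<in> W k \<longleftrightarrow> v \<in> mpart M k \<and> tact (edge \<alpha>) M k q v = \<zero>\<^bsub>M\<^esub>" for v k by (simp add: W_def)
    have "O.oclosed W"
    proof (rule O.oclosedI, goal_cases)
      case (4 k p v) then show ?case by (simp add: W tact_mpart O.act_commute[of v k q p])
    next
      case (5 i j v) then show ?case by (simp add: W mmap_mpart O.e_act[symmetric])
    qed (simp_all add: W mpart_zero mpart_add O.act_add)
    moreover have "g \<in> W d" if dg: "(d, g) \<in> T" for d g
    proof -
      have "q = (\<Prod>x\<in>T - {(d, g)}. Q x) * Q (d, g)"
        unfolding q_def using prod.remove[OF O.gensD(1)[OF T] dg, of Q] by (simp add: mult.commute)
      then show ?thesis using Q[OF dg] O.gensD(2)[OF T dg] by (simp add: W O.act_mult)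
    qed
    ultimately have "v \<in> W k" using O.gens_induct[OF T _ _ v, of W] by blast
    then show ?thesis by (simp add: W)
  qed
  ultimately show ?thesis unfolding O.bounded_def using far by blast
qed

theorem fin_dim_iff: "O.ofg \<Longrightarrow> fin_dim (gwa (edge \<alpha>)) M \<longleftrightarrow> O.bounded (mpart M)"
  using fin_dim_if_bounded bounded_if_fin_dim by blast

end

subsection \<open>Finitely generated graded modules\<close>

text \<open>Finite generation depends only on the operations, not on the carrier of the ambient group. It is used to pass from a
  module to a submodule, whose carrier is smaller.\<close>

lemma ofg_cong:
  assumes "orep G \<alpha> C act e" "orep G' \<alpha> C act e" "\<zero>\<^bsub>G\<^esub> = \<zero>\<^bsub>G'\<^esub>" "\<And>v w. v \<oplus>\<^bsub>G\<^esub> w = v \<oplus>\<^bsub>G'\<^esub> w"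
  shows "orep.ofg G C act e \<longleftrightarrow> orep.ofg G' C act e"
  unfolding orep.ofg_def[OF assms(1)] orep.ofg_def[OF assms(2)] orep.gens_def[OF assms(1)]
    orep.gens_def[OF assms(2)] orep.oclosed_def[OF assms(1)] orep.oclosed_def[OF assms(2)] assms(3,4) ..

locale grmod = gmod_edge \<alpha> M for \<alpha> and M :: "('k::field_char_0 free_alg set, 'm) gmodule" +
  assumes fin_gen: "fin_gen (gwa (edge \<alpha>)) M"

lemma gr_obj_iff: "M \<in> gr_obj (gwa (edge \<alpha>)) \<longleftrightarrow> grmod \<alpha> M"
  by (auto simp: gr_obj_def grmod_def grmod_axioms_def gmod_edge_def gmod_def)

context grmod
begin

lemma ofg: "O.ofg"
  using fin_gen fin_gen_iff by blast

lemma sub_module_grmod: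
  assumes N: "gsub (edge \<alpha>) M N"
  shows "grmod \<alpha> (sub_module M N)"
proof -
  interpret S: gmod_edge \<alpha> "sub_module M N"
    by (intro gmod_edge.intro gmod.intro sub_module_graded N)
  have sub: "O.oclosed (\<lambda>k. N \<inter> mpart M k)"
    using N submodule_oclosed unfolding gsub_def by blast
  have eq: "mpart (sub_module M N) = (\<lambda>k. N \<inter> mpart M k)" by auto
  have "orep.ofg M (\<lambda>k. N \<inter> mpart M k) (tact (edge \<alpha>) M) (mmap (edge \<alpha>) M)"
    by (rule O.oclosed_finitely_generated[OF ofg sub])
  then have "orep.ofg (sub_module M N) (\<lambda>k. N \<inter> mpart M k) (tact (edge \<alpha>) M) (mmap (edge \<alpha>) M)"
    using ofg_cong[OF O.sub_orep[OF sub] S.orep[unfolded eq sub_module_maps]] by simp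
  then have "fin_gen (gwa (edge \<alpha>)) (sub_module M N)"
    using S.fin_gen_iff unfolding eq sub_module_maps by blast
  then show ?thesis by unfold_locales
qed

lemma sub_module_obj_iff:
  "N \<subseteq> carrier M \<Longrightarrow> sub_module M N \<in> gr_obj (gwa (edge \<alpha>)) \<longleftrightarrow> gsub (edge \<alpha>) M N"
  using graded_sub_module sub_module_grmod gr_obj_iff[of "sub_module M N" \<alpha>] unfolding gr_obj_def by blast

lemma sub_module_fdim_iff:
  assumes "N \<subseteq> carrier M"
  shows "sub_module M N \<in> fdim_obj (gwa (edge \<alpha>)) \<longleftrightarrow>
    gsub (edge \<alpha>) M N \<and> O.bounded (\<lambda>k. N \<inter> mpart M k)"
proof (cases "gsub (edge \<alpha>) M N")
  case True
  interpret S: grmod \<alpha> "sub_module M N" by (rule sub_module_grmod[OF True])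
  have eq: "mpart (sub_module M N) = (\<lambda>k. N \<inter> mpart M k)" by auto
  have "fin_dim (gwa (edge \<alpha>)) (sub_module M N) \<longleftrightarrow> O.bounded (\<lambda>k. N \<inter> mpart M k)"
    using S.fin_dim_iff[OF S.ofg] unfolding S.O.bounded_def O.bounded_def eq by simp
  then show ?thesis using sub_module_obj_iff[OF assms] True unfolding fdim_obj_def by blast
qed (use sub_module_obj_iff[OF assms] in \<open>auto simp: fdim_obj_def\<close>)

lemma quot_grmod:
  assumes N: "gsub (edge \<alpha>) M N"
  shows "grmod \<alpha> (quot_module M N)"
proof -
  interpret Q: gquot "edge \<alpha>" M N by unfold_locales (rule N)
  interpret S: gmod_edge \<alpha> "quot_module M N" by (intro gmod_edge.intro gmod.intro Q.quot_graded)
  show ?thesis by unfold_locales (rule Q.quot_fin_gen[OF fin_gen])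
qed

lemma quot_fdim_iff:
  assumes N: "gsub (edge \<alpha>) M N"
  shows "quot_module M N \<in> fdim_obj (gwa (edge \<alpha>)) \<longleftrightarrow> O.cobounded (\<lambda>k. N \<inter> mpart M k)"
proof -
  interpret Q: gquot "edge \<alpha>" M N by unfold_locales (rule N)
  interpret S: grmod \<alpha> "quot_module M N" by (rule quot_grmod[OF N])
  have "S.O.bounded (mpart (quot_module M N)) \<longleftrightarrow> O.cobounded (\<lambda>k. N \<inter> mpart M k)"
  proof -
    have 1: "mpart (quot_module M N) k \<subseteq> {\<zero>\<^bsub>quot_module M N\<^esub>} \<longleftrightarrow> mpart M k \<subseteq> N \<inter> mpart M k" for k
    proof -
      have "Q.\<pi> x = N \<longleftrightarrow> x \<in> N" if "x \<in> mpart M k" for x by (rule Q.coset_eq_N[OF mpart_carrier[OF that]])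
      then show ?thesis unfolding Q.quot_simps(2,3) image_subset_iff by auto
    qed
    have 2: "(\<forall>v\<in>mpart (quot_module M N) k. tact (edge \<alpha>) (quot_module M N) k q v = \<zero>\<^bsub>quot_module M N\<^esub>)
        \<longleftrightarrow> (\<forall>v\<in>mpart M k. tact (edge \<alpha>) M k q v \<in> N \<inter> mpart M k)" for k q
      unfolding Q.quot_simps(2,3)
      by (auto simp: Q.coset_eq_N Q.quot_tact mpart_carrier tact_mpart tact_rules(5))
    show ?thesis unfolding S.O.bounded_def O.cobounded_def 1 2 ..
  qed
  then show ?thesis
    using S.fin_dim_iff[OF S.ofg] S.grmod_axioms gr_obj_iff unfolding fdim_obj_def by blast
qed

text \<open>The subobjects that occur in the definition of morphisms of the quotient category, in terms of representations.\<close>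

lemma cofin_subs_iff:
  "N \<in> cofin_subs (gwa (edge \<alpha>)) M \<longleftrightarrow> gsub (edge \<alpha>) M N \<and> O.cobounded (\<lambda>k. N \<inter> mpart M k)"
  unfolding cofin_subs_def using sub_module_obj_iff quot_fdim_iff gsubD(1) by blast

lemma fin_subs_iff:
  "N \<in> fin_subs (gwa (edge \<alpha>)) M \<longleftrightarrow> gsub (edge \<alpha>) M N \<and> O.bounded (\<lambda>k. N \<inter> mpart M k)"
  unfolding fin_subs_def using sub_module_fdim_iff gsubD(1) by blast

end

section \<open>Modules from representations\<close>

text \<open>The type is infinite, so pairs of its elements can be coded by its elements, and so can lists of known length. A family of finite
  support is coded by the list of its entries on a symmetric interval that contains the support together with the length.\<close>

lemma finite_support_code:
  fixes C :: "int \<Rightarrow> 'a set" and r :: "int \<Rightarrow> 'a \<Rightarrow> 'u \<times> 'u"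
  assumes inf: "infinite (UNIV :: 'u set)" and r: "\<And>i. inj_on (r i) (C i)"
  shows "\<exists>code :: (int \<Rightarrow> 'a) \<Rightarrow> 'u. inj_on code {\<phi>. (\<forall>i. \<phi> i \<in> C i) \<and> finite {i. \<phi> i \<noteq> z}}"
proof -
  have "(card_of (UNIV \<times> UNIV :: ('u \<times> 'u) set), card_of (UNIV :: 'u set)) \<in> ordIso"
    by (rule card_of_Times_same_infinite) (rule inf)
  then obtain pr :: "'u \<times> 'u \<Rightarrow> 'u" where pr: "inj pr"
    unfolding card_of_ordIso[symmetric] bij_betw_def by auto
  obtain \<kappa> :: "nat \<Rightarrow> 'u" where \<kappa>: "inj \<kappa>" using infinite_countable_subset[OF inf] by blast
  define np :: "'u list \<Rightarrow> 'u" where "np = (\<lambda>xs. foldr (\<lambda>x y. pr (x, y)) xs (\<kappa> 0))"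
  have np: "xs = ys" if "length xs = length ys" "np xs = np ys" for xs ys
    using that
  proof (induction xs ys rule: list_induct2)
    case (Cons x xs y ys)
    then have "pr (x, np xs) = pr (y, np ys)" by (simp add: np_def)
    then have "x = y" "np xs = np ys" using injD[OF pr] by blast+
    then show ?case using Cons.IH by simp
  qed simp
  \<comment> \<open>\<open>K \<phi>\<close> bounds the support of \<open>\<phi>\<close>; its code \<open>\<kappa> (K \<phi>)\<close> reveals the length of the list that follows\<close>
  define K where "K = (\<lambda>\<phi> :: int \<Rightarrow> 'a. LEAST K :: nat. \<forall>i. \<bar>i\<bar> > int K \<longrightarrow> \<phi> i = z)"
  have K: "\<phi> i = z" if fin: "finite {i. \<phi> i \<noteq> z}" and i: "\<bar>i\<bar> > int (K \<phi>)" for \<phi> i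
  proof -
    let ?S = "insert 0 (abs ` {i. \<phi> i \<noteq> z})"
    have "\<forall>i. \<bar>i\<bar> > int (nat (Max ?S)) \<longrightarrow> \<phi> i = z"
    proof (intro allI impI, rule ccontr)
      fix i assume *: "\<bar>i\<bar> > int (nat (Max ?S))" "\<phi> i \<noteq> z"
      then have "\<bar>i\<bar> \<le> Max ?S" by (intro Max_ge) (use fin in auto)
      then show False using * by (auto split: if_splits)
    qed
    then have "\<forall>i. \<bar>i\<bar> > int (K \<phi>) \<longrightarrow> \<phi> i = z" unfolding K_def by (rule LeastI)
    then show ?thesis using i by blast
  qed
  define code where "code = (\<lambda>\<phi>. pr (\<kappa> (K \<phi>), np (map (\<lambda>i. pr (r i (\<phi> i))) [- int (K \<phi>)..int (K \<phi>)])))"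
  have "inj_on code {\<phi>. (\<forall>i. \<phi> i \<in> C i) \<and> finite {i. \<phi> i \<noteq> z}}"
  proof (rule inj_onI)
    fix \<phi> \<psi>
    assume \<phi>: "\<phi> \<in> {\<phi>. (\<forall>i. \<phi> i \<in> C i) \<and> finite {i. \<phi> i \<noteq> z}}"
      and \<psi>: "\<psi> \<in> {\<phi>. (\<forall>i. \<phi> i \<in> C i) \<and> finite {i. \<phi> i \<noteq> z}}" and eq: "code \<phi> = code \<psi>"
    have "(\<kappa> (K \<phi>), np (map (\<lambda>i. pr (r i (\<phi> i))) [- int (K \<phi>)..int (K \<phi>)]))
      = (\<kappa> (K \<psi>), np (map (\<lambda>i. pr (r i (\<psi> i))) [- int (K \<psi>)..int (K \<psi>)]))"
      using eq unfolding code_def by (rule injD[OF pr])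
    then have k: "K \<phi> = K \<psi>"
      and "np (map (\<lambda>i. pr (r i (\<phi> i))) [- int (K \<phi>)..int (K \<phi>)]) = np (map (\<lambda>i. pr (r i (\<psi> i))) [- int (K \<psi>)..int (K \<psi>)])"
      using injD[OF \<kappa>] by auto
    then have m: "map (\<lambda>i. pr (r i (\<phi> i))) [- int (K \<phi>)..int (K \<phi>)] = map (\<lambda>i. pr (r i (\<psi> i))) [- int (K \<phi>)..int (K \<phi>)]"
      by (intro np) auto
    show "\<phi> = \<psi>"
    proof (rule ext)
      fix i
      show "\<phi> i = \<psi> i"
      proof (cases "\<bar>i\<bar> > int (K \<phi>)")
        case True
        then show ?thesis using K[of \<phi> i] K[of \<psi> i] \<phi> \<psi> k by simp
      next
        case False
        then have "i \<in> set [- int (K \<phi>)..int (K \<phi>)]" by auto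
        then have "pr (r i (\<phi> i)) = pr (r i (\<psi> i))" using m by (simp only: map_eq_conv)
        then have "r i (\<phi> i) = r i (\<psi> i)" by (rule injD[OF pr])
        then show ?thesis using inj_onD[OF r[of i]] \<phi> \<psi> by blast
      qed
    qed
  qed
  then show ?thesis by blast
qed

context orep
begin

text \<open>The direct sum of the parts.\<close>

definition fs :: "(int \<Rightarrow> 'a) set" where
  "fs = {\<phi>. (\<forall>i. \<phi> i \<in> C i) \<and> finite {i. \<phi> i \<noteq> \<zero>}}"

text \<open>The value at \<open>i\<close>: \<open>x\<close> brings the entry at \<open>i - 1\<close> up, \<open>y\<close> brings the entry at \<open>i + 1\<close> down, and \<open>z = t + i\<close>.\<close>

definition gact :: "gen \<Rightarrow> (int \<Rightarrow> 'a) \<Rightarrow> int \<Rightarrow> 'a" where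
  "gact g \<phi> = (\<lambda>i. case g of GX \<Rightarrow> e (i - 1) i (\<phi> (i - 1)) | GY \<Rightarrow> e (i + 1) i (\<phi> (i + 1))
     | GZ \<Rightarrow> act i [:of_int i, 1:] (\<phi> i))"

primrec wact :: "gen list \<Rightarrow> (int \<Rightarrow> 'a) \<Rightarrow> int \<Rightarrow> 'a" where
  "wact [] \<phi> = \<phi>"
| "wact (g # l) \<phi> = wact l (gact g \<phi>)"

text \<open>The right action of the free algebra on the direct sum.\<close>

definition alg_act :: "'k free_alg \<Rightarrow> (int \<Rightarrow> 'a) \<Rightarrow> int \<Rightarrow> 'a" where
  "alg_act p \<phi> = (\<lambda>i. \<Oplus>w\<in>Poly_Mapping.keys p. act i [:Poly_Mapping.lookup p w:] (wact (letters w) \<phi> i))"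

lemma fsD: "\<phi> \<in> fs \<Longrightarrow> \<phi> i \<in> C i"
  by (simp add: fs_def)

lemma fs_cond: "\<phi> \<in> fs \<Longrightarrow> (\<And>i. \<psi> i \<in> C i) \<Longrightarrow> (\<And>i. (\<And>j. \<bar>j - i\<bar> \<le> 1 \<Longrightarrow> \<phi> j = \<zero>) \<Longrightarrow> \<psi> i = \<zero>) \<Longrightarrow> \<psi> \<in> fs"
proof -
  assume \<phi>: "\<phi> \<in> fs" and C: "\<And>i. \<psi> i \<in> C i" and z: "\<And>i. (\<And>j. \<bar>j - i\<bar> \<le> 1 \<Longrightarrow> \<phi> j = \<zero>) \<Longrightarrow> \<psi> i = \<zero>"
  have "{i. \<psi> i \<noteq> \<zero>} \<subseteq> (\<Union>j\<in>{j. \<phi> j \<noteq> \<zero>}. {j - 1..j + 1})"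
  proof
    fix i assume "i \<in> {i. \<psi> i \<noteq> \<zero>}"
    then obtain j where "\<bar>j - i\<bar> \<le> 1" "\<phi> j \<noteq> \<zero>" using z[of i] by blast
    then have "j \<in> {j. \<phi> j \<noteq> \<zero>}" "i \<in> {j - 1..j + 1}" by auto
    then show "i \<in> (\<Union>j\<in>{j. \<phi> j \<noteq> \<zero>}. {j - 1..j + 1})" by blast
  qed
  moreover have "finite (\<Union>j\<in>{j. \<phi> j \<noteq> \<zero>}. {j - 1..j + 1})" using \<phi> by (auto simp: fs_def)
  ultimately show ?thesis using C finite_subset unfolding fs_def by blast
qed

lemma fs_zero: "(\<lambda>_. \<zero>) \<in> fs" by (simp add: fs_def)

lemma fs_add: "\<phi> \<in> fs \<Longrightarrow> \<psi> \<in> fs \<Longrightarrow> (\<lambda>i. \<phi> i \<oplus> \<psi> i) \<in> fs"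
proof -
  assume *: "\<phi> \<in> fs" "\<psi> \<in> fs"
  have "{i. \<phi> i \<oplus> \<psi> i \<noteq> \<zero>} \<subseteq> {i. \<phi> i \<noteq> \<zero>} \<union> {i. \<psi> i \<noteq> \<zero>}" by auto
  then show ?thesis using * finite_subset unfolding fs_def by fastforce
qed

lemma gact_fs: "\<phi> \<in> fs \<Longrightarrow> gact g \<phi> \<in> fs"
  by (rule fs_cond[of \<phi>]) (auto simp: gact_def fsD split: gen.splits)

lemma gact_add: "\<phi> \<in> fs \<Longrightarrow> \<psi> \<in> fs \<Longrightarrow> gact g (\<lambda>i. \<phi> i \<oplus> \<psi> i) = (\<lambda>i. gact g \<phi> i \<oplus> gact g \<psi> i)"
  by (cases g) (simp_all add: gact_def fsD e_add act_add)

lemma gact_const: "\<phi> \<in> fs \<Longrightarrow> gact g (\<lambda>i. act i [:c:] (\<phi> i)) = (\<lambda>i. act i [:c:] (gact g \<phi> i))"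
  by (cases g) (simp_all add: gact_def fsD e_act act_commute[OF fsD])

lemma const_fs: "\<phi> \<in> fs \<Longrightarrow> (\<lambda>i. act i [:c:] (\<phi> i)) \<in> fs"
  by (rule fs_cond[of \<phi>]) (auto simp: fsD)

lemma wact_fs: "\<phi> \<in> fs \<Longrightarrow> wact l \<phi> \<in> fs"
  by (induction l arbitrary: \<phi>) (simp_all add: gact_fs)

lemma wact_add: "\<phi> \<in> fs \<Longrightarrow> \<psi> \<in> fs \<Longrightarrow> wact l (\<lambda>i. \<phi> i \<oplus> \<psi> i) = (\<lambda>i. wact l \<phi> i \<oplus> wact l \<psi> i)"
  by (induction l arbitrary: \<phi> \<psi>) (simp_all add: gact_add gact_fs)

lemma wact_const: "\<phi> \<in> fs \<Longrightarrow> wact l (\<lambda>i. act i [:c:] (\<phi> i)) = (\<lambda>i. act i [:c:] (wact l \<phi> i))"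
  by (induction l arbitrary: \<phi>) (simp_all add: gact_const gact_fs)

lemma wact_append: "wact (l @ l') \<phi> = wact l' (wact l \<phi>)"
  by (induction l arbitrary: \<phi>) simp_all

lemma alg_act_support:
  assumes "\<phi> \<in> fs" "finite S" "Poly_Mapping.keys p \<subseteq> S"
  shows "alg_act p \<phi> i = (\<Oplus>w\<in>S. act i [:Poly_Mapping.lookup p w:] (wact (letters w) \<phi> i))"
  unfolding alg_act_def finsum_def
  by (rule comm_monoid.finprod_mono_neutral_cong_left[OF a_comm_monoid])
    (use assms in \<open>auto simp: in_keys_iff fsD wact_fs act_0[OF fsD[OF wact_fs]] intro!: act_carrier[OF fsD[OF wact_fs]]\<close>)

lemma alg_act_add: "\<phi> \<in> fs \<Longrightarrow> alg_act (p + q) \<phi> = (\<lambda>i. alg_act p \<phi> i \<oplus> alg_act q \<phi> i)"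
proof (rule ext)
  fix i assume \<phi>: "\<phi> \<in> fs"
  let ?S = "Poly_Mapping.keys p \<union> Poly_Mapping.keys q"
  have C: "wact l \<phi> i \<in> C i" for l using fsD[OF wact_fs[OF \<phi>]] .
  have "alg_act (p + q) \<phi> i = (\<Oplus>w\<in>?S. act i [:Poly_Mapping.lookup (p + q) w:] (wact (letters w) \<phi> i))"
    by (rule alg_act_support[OF \<phi>]) (simp_all add: keys_add)
  also have "\<dots> = (\<Oplus>w\<in>?S. act i [:Poly_Mapping.lookup p w:] (wact (letters w) \<phi> i)
      \<oplus> act i [:Poly_Mapping.lookup q w:] (wact (letters w) \<phi> i))"
    by (rule finsum_cong') (auto simp: lookup_add C act_carrier[OF C] simp flip: act_padd[OF C])
  also have "\<dots> = alg_act p \<phi> i \<oplus> alg_act q \<phi> i"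
    by (subst finsum_addf) (auto simp: act_carrier[OF C] alg_act_support[OF \<phi>, of ?S])
  finally show "alg_act (p + q) \<phi> i = alg_act p \<phi> i \<oplus> alg_act q \<phi> i" .
qed

lemma alg_act_single: "\<phi> \<in> fs \<Longrightarrow> alg_act (Poly_Mapping.single w c) \<phi> = (\<lambda>i. act i [:c:] (wact (letters w) \<phi> i))"
proof (rule ext)
  fix i assume \<phi>: "\<phi> \<in> fs"
  have C: "wact l \<phi> i \<in> C i" for l using fsD[OF wact_fs[OF \<phi>]] .
  have "alg_act (Poly_Mapping.single w c) \<phi> i = (\<Oplus>v\<in>{w}. act i [:Poly_Mapping.lookup (Poly_Mapping.single w c) v:] (wact (letters v) \<phi> i))"
    by (rule alg_act_support[OF \<phi>]) auto
  also have "\<dots> = act i [:c:] (wact (letters w) \<phi> i)"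
    by (subst finsum_insert) (auto simp: act_carrier[OF C] C)
  finally show "alg_act (Poly_Mapping.single w c) \<phi> i = act i [:c:] (wact (letters w) \<phi> i)" .
qed

lemma alg_act_0: "\<phi> \<in> fs \<Longrightarrow> alg_act 0 \<phi> = (\<lambda>_. \<zero>)"
  by (simp add: alg_act_def)

lemma alg_act_fs: "\<phi> \<in> fs \<Longrightarrow> alg_act p \<phi> \<in> fs"
proof (induction p rule: free_alg_induct)
  case (add w c p)
  then show ?case using fs_add const_fs[OF wact_fs] by (simp add: alg_act_add alg_act_single)
qed (simp add: alg_act_0 fs_zero)

lemma alg_act_addr: "\<phi> \<in> fs \<Longrightarrow> \<psi> \<in> fs \<Longrightarrow> alg_act p (\<lambda>i. \<phi> i \<oplus> \<psi> i) = (\<lambda>i. alg_act p \<phi> i \<oplus> alg_act p \<psi> i)"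
proof (induction p rule: free_alg_induct)
  case (add w c p)
  have C: "wact (letters w) \<phi> i \<in> C i" "wact (letters w) \<psi> i \<in> C i" for i
    using fsD[OF wact_fs] add.prems by auto
  then have c: "act i [:c:] (wact (letters w) \<phi> i) \<in> carrier G" "act i [:c:] (wact (letters w) \<psi> i) \<in> carrier G"
    "alg_act p \<phi> i \<in> carrier G" "alg_act p \<psi> i \<in> carrier G" for i
    using C_carrier[OF fsD[OF alg_act_fs[OF add.prems(1)]]] C_carrier[OF fsD[OF alg_act_fs[OF add.prems(2)]]] by auto
  show ?case using add C c by (simp add: alg_act_add alg_act_single fs_add wact_add act_add a_ac)
qed (simp add: alg_act_0 fs_add)

lemma alg_act_mult_single:
  assumes "\<phi> \<in> fs"
  shows "alg_act (Poly_Mapping.single w c * q) \<phi> = alg_act q (\<lambda>i. act i [:c:] (wact (letters w) \<phi> i))"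
proof (induction q rule: free_alg_induct)
  case (add v d q)
  have C: "wact l \<phi> i \<in> C i" for l i using fsD[OF wact_fs[OF assms]] .
  have "act i [:c * d:] (wact (letters v) (wact (letters w) \<phi>) i)
      = act i [:d:] (act i [:c:] (wact (letters v) (wact (letters w) \<phi>) i))" for i
    using act_mult[OF fsD[OF wact_fs[OF wact_fs[OF assms]]], of i "[:d:]" "[:c:]"] by (simp add: mult.commute)
  then have "alg_act (Poly_Mapping.single w c * Poly_Mapping.single v d) \<phi>
      = alg_act (Poly_Mapping.single v d) (\<lambda>i. act i [:c:] (wact (letters w) \<phi> i))"
    using assms by (simp add: mult_single alg_act_single const_fs wact_fs wact_const plus_word_def wact_append)
  then show ?case using add.IH assms by (simp add: distrib_left alg_act_add const_fs wact_fs)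
qed (use assms in \<open>simp add: alg_act_0 const_fs wact_fs\<close>)

lemma alg_act_mult: "\<phi> \<in> fs \<Longrightarrow> alg_act (p * q) \<phi> = alg_act q (alg_act p \<phi>)"
proof (induction p rule: free_alg_induct)
  case zero
  then show ?case using alg_act_addr[OF fs_zero fs_zero, of q] alg_act_fs[OF fs_zero, of q] fsD
    by (simp add: alg_act_0 fun_eq_iff) (metis C_carrier add.l_cancel_one')
next
  case (add w c p)
  then show ?case
    by (simp add: distrib_right alg_act_add alg_act_mult_single alg_act_single alg_act_addr const_fs wact_fs alg_act_fs)
qed

lemma alg_act_const: "\<phi> \<in> fs \<Longrightarrow> alg_act (free_const c) \<phi> = (\<lambda>i. act i [:c:] (\<phi> i))"
  unfolding free_const_def by (simp add: alg_act_single zero_word_def)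

lemma alg_act_1: "\<phi> \<in> fs \<Longrightarrow> alg_act 1 \<phi> = \<phi>"
  using alg_act_const[of \<phi> 1] by (simp add: free_const_hom act_one[OF fsD] one_pCons[symmetric])

lemma alg_act_gen: "\<phi> \<in> fs \<Longrightarrow> alg_act (free_gen g) \<phi> = gact g \<phi>"
  unfolding free_gen_def using gact_fs[of \<phi> g]
  by (simp add: alg_act_single one_pCons[symmetric] act_one[OF fsD])

lemma alg_act_eval:
  assumes "\<phi> \<in> fs"
  shows "alg_act (free_eval p (free_gen GZ + free_const c)) \<phi> = (\<lambda>i. act i (pcompose p [:of_int i + c, 1:]) (\<phi> i))"
  using assms
proof (induction p arbitrary: \<phi>)
  case 0
  then show ?case by (simp add: alg_act_0 fsD)
next
  case (pCons a p)
  define z' :: "'k free_alg" where "z' = free_gen GZ + free_const c"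
  have z: "alg_act z' \<phi> = (\<lambda>i. act i [:of_int i + c, 1:] (\<phi> i))" if "\<phi> \<in> fs" for \<phi>
    using that by (simp add: z'_def alg_act_add alg_act_gen alg_act_const gact_def fsD flip: act_padd)
  have "alg_act z' \<phi> \<in> fs" using alg_act_fs[OF pCons.prems] .
  then have "alg_act (free_eval (pCons a p) z') \<phi>
      = (\<lambda>i. act i [:a:] (\<phi> i) \<oplus> act i (pcompose p [:of_int i + c, 1:]) (act i [:of_int i + c, 1:] (\<phi> i)))"
    using pCons(2)[folded z'_def] pCons.prems by (simp add: free_eval_pCons alg_act_add alg_act_const alg_act_mult z)
  also have "\<dots> = (\<lambda>i. act i ([:a:] + pcompose p [:of_int i + c, 1:] * [:of_int i + c, 1:]) (\<phi> i))"
    by (simp only: act_padd[OF fsD[OF pCons.prems]] act_mult[OF fsD[OF pCons.prems]])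
  finally show ?case by (simp add: z'_def pcompose_pCons mult.commute)
qed

text \<open>The defining relations act as zero, and hence so does the ideal that they generate.\<close>

lemma alg_act_rels:
  assumes \<phi>: "\<phi> \<in> fs" and r: "r \<in> gwa_rels (edge \<alpha>)"
  shows "alg_act r \<phi> = (\<lambda>_. \<zero>)"
proof -
  have sub: "alg_act (p - q) \<phi> = (\<lambda>_. \<zero>)" if "alg_act p \<phi> = alg_act q \<phi>" for p q
  proof (rule ext)
    fix i
    have "alg_act (p - q + q) \<phi> i = alg_act (p - q) \<phi> i \<oplus> alg_act q \<phi> i" using \<phi> by (simp only: alg_act_add)
    then show "alg_act (p - q) \<phi> i = \<zero>"
      using that C_carrier[OF fsD[OF alg_act_fs[OF \<phi>]]] by (simp add: add.r_cancel_one')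
  qed
  note g = gact_fs[OF \<phi>]
  have "alg_act (free_gen GX * free_gen GZ) \<phi> = alg_act ((free_gen GZ + 1) * free_gen GX) \<phi>"
  proof -
    have "alg_act (free_gen GZ + 1) \<phi> = (\<lambda>i. act i [:of_int i + 1, 1:] (\<phi> i))"
      using alg_act_eval[OF \<phi>, of "[:0, 1:]" 1] by (simp add: free_eval_pCons free_const_hom pcompose_pCons)
    then show ?thesis
      using \<phi> g alg_act_fs[OF \<phi>, of "free_gen GZ + 1"] by (simp add: alg_act_mult alg_act_gen) (simp add: gact_def e_act fsD)
  qed
  moreover have "alg_act (free_gen GY * free_gen GZ) \<phi> = alg_act ((free_gen GZ - 1) * free_gen GY) \<phi>"
  proof -
    have "free_gen GZ - 1 = free_gen GZ + free_const (- 1 :: 'k)"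
      using free_const_hom(5)[of 0 "1::'k"] by (simp add: free_const_hom)
    then have "alg_act (free_gen GZ - 1) \<phi> = alg_act (free_gen GZ + free_const (- 1)) \<phi>" by (rule arg_cong)
    then have "alg_act (free_gen GZ - 1) \<phi> = (\<lambda>i. act i [:of_int i - 1, 1:] (\<phi> i))"
      using alg_act_eval[OF \<phi>, of "[:0, 1:]" "-1"] by (simp add: free_eval_pCons free_const_hom pcompose_pCons)
    then show ?thesis
      using \<phi> g alg_act_fs[OF \<phi>, of "free_gen GZ - 1"] by (simp add: alg_act_mult alg_act_gen) (simp add: gact_def e_act fsD)
  qed
  moreover have "alg_act (free_gen GX * free_gen GY) \<phi> = alg_act (free_eval (edge \<alpha>) (free_gen GZ)) \<phi>"
    using \<phi> g alg_act_eval[OF \<phi>, of "edge \<alpha>" 0]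
    by (simp add: alg_act_mult alg_act_gen free_const_hom edge_shift) (simp add: gact_def e_comp fsD cc_L_edge e_id[OF fsD])
  moreover have "alg_act (free_gen GY * free_gen GX) \<phi> = alg_act (free_eval (edge \<alpha>) (free_gen GZ - 1)) \<phi>"
  proof -
    have z: "free_gen GZ - 1 = free_gen GZ + free_const (- 1 :: 'k)"
      using free_const_hom(5)[of 0 "1::'k"] by (simp add: free_const_hom)
    have c: "cc (L \<alpha> i) (L \<alpha> (i - 1)) (L \<alpha> i) = (pcompose (edge \<alpha>) [:of_int i - 1, 1:] :: 'k poly)" for i
      by (simp add: cc_L_edge(2)[of \<alpha> "i - 1", simplified] edge_shift[of \<alpha> "i - 1", simplified])
    show ?thesis
      using \<phi> g alg_act_eval[OF \<phi>, of "edge \<alpha>" "-1"]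
      by (simp add: alg_act_mult alg_act_gen z) (simp add: gact_def e_comp fsD c e_id[OF fsD])
  qed
  ultimately show ?thesis using r sub unfolding gwa_rels_def Let_def by auto
qed

lemma alg_act_ideal:
  assumes "r \<in> gwa_ideal (edge \<alpha>)" "\<phi> \<in> fs"
  shows "alg_act r \<phi> = (\<lambda>_. \<zero>)"
proof -
  define I where "I = {r. \<forall>\<phi>\<in>fs. alg_act r \<phi> = (\<lambda>_. \<zero>)}"
  have z: "alg_act p (\<lambda>_. \<zero>) = (\<lambda>_. \<zero>)" for p
    using alg_act_mult[OF fs_zero, of 0 p] by (simp add: alg_act_0 fs_zero)
  have m: "a * r \<in> I" "r * a \<in> I" if "r \<in> I" for a r
    using that by (auto simp: I_def alg_act_mult alg_act_fs z)
  have "ideal I (free_ring :: 'k free_alg ring)"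
  proof (rule idealI[OF ring_free_ring])
    have "additive_subgroup I (free_ring :: 'k free_alg ring)"
    proof (rule additive_subgroupI')
      show "abelian_group (free_ring :: 'k free_alg ring)"
        using ring_free_ring by (rule ringE(1))
      show "\<ominus>\<^bsub>free_ring\<^esub> r \<in> I" if "r \<in> I" for r
      proof -
        have "\<ominus>\<^bsub>free_ring\<^esub> r = - r"
          by (rule abelian_group.minus_equality[OF ringE(1)[OF ring_free_ring]]) (simp_all add: free_ring_def)
        then show ?thesis using m(1)[OF that, of "-1"] by simp
      qed
    qed (auto simp: free_ring_def I_def alg_act_0 alg_act_add)
    then show "subgroup I (add_monoid (free_ring :: 'k free_alg ring))"
      by (rule additive_subgroup.a_subgroup)
  qed (use m in \<open>simp_all add: free_ring_def\<close>)
  then have "gwa_ideal (edge \<alpha>) \<subseteq> I"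
    unfolding gwa_ideal_def
    by (rule ring.genideal_minimal[OF ring_free_ring]) (use alg_act_rels in \<open>auto simp: I_def\<close>)
  then show ?thesis using assms unfolding I_def by blast
qed

lemma alg_act_cong:
  assumes "gwa_proj (edge \<alpha>) p = gwa_proj (edge \<alpha>) q" "\<phi> \<in> fs"
  shows "alg_act p \<phi> = alg_act q \<phi>"
proof -
  have "alg_act (p - q) \<phi> = (\<lambda>_. \<zero>)" using assms alg_act_ideal gwa_proj_eq_iff by blast
  moreover have "alg_act (p - q + q) \<phi> = (\<lambda>i. alg_act (p - q) \<phi> i \<oplus> alg_act q \<phi> i)" using assms(2) by (simp only: alg_act_add)
  ultimately show ?thesis using C_carrier[OF fsD[OF alg_act_fs[OF assms(2)]]] by (simp add: fun_eq_iff)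
qed

definition delta :: "int \<Rightarrow> 'a \<Rightarrow> int \<Rightarrow> 'a" where
  "delta n v = (\<lambda>i. if i = n then v else \<zero>)"

lemma delta_fs: "v \<in> C n \<Longrightarrow> delta n v \<in> fs"
  unfolding fs_def delta_def by (auto intro: finite_subset[of _ "{n}"])

text \<open>The direct sum of the parts, transported along \<open>code\<close>.\<close>

definition coded_module :: "((int \<Rightarrow> 'a) \<Rightarrow> 'u) \<Rightarrow> ('k free_alg set, 'u) gmodule" where
  "coded_module code = \<lparr>carrier = code ` fs, monoid.mult = (\<lambda>a b. a), one = code (\<lambda>_. \<zero>), zero = code (\<lambda>_. \<zero>),
     add = (\<lambda>u v. code (\<lambda>i. inv_into fs code u i \<oplus> inv_into fs code v i)),
     ract = (\<lambda>u a. code (alg_act (SOME p. gwa_proj (edge \<alpha>) p = a) (inv_into fs code u))),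
     mpart = (\<lambda>n. (\<lambda>v. code (delta n v)) ` C n)\<rparr>"

context
  fixes code :: "(int \<Rightarrow> 'a) \<Rightarrow> 'u"
  assumes inj: "inj_on code fs"
begin

lemma dec [simp]: "\<phi> \<in> fs \<Longrightarrow> inv_into fs code (code \<phi>) = \<phi>"
  using inj by simp

lemma coded_module_simps:
  "carrier (coded_module code) = code ` fs" "\<zero>\<^bsub>coded_module code\<^esub> = code (\<lambda>_. \<zero>)"
  "\<phi> \<in> fs \<Longrightarrow> \<psi> \<in> fs \<Longrightarrow> code \<phi> \<oplus>\<^bsub>coded_module code\<^esub> code \<psi> = code (\<lambda>i. \<phi> i \<oplus> \<psi> i)"
  "mpart (coded_module code) n = (\<lambda>v. code (delta n v)) ` C n"
  by (simp_all add: coded_module_def)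

lemma coded_module_act: "\<phi> \<in> fs \<Longrightarrow> mact (edge \<alpha>) (coded_module code) (code \<phi>) p = code (alg_act p \<phi>)"
proof -
  assume \<phi>: "\<phi> \<in> fs"
  have "gwa_proj (edge \<alpha>) (SOME q. gwa_proj (edge \<alpha>) q = gwa_proj (edge \<alpha>) p) = gwa_proj (edge \<alpha>) p"
    by (rule someI) simp
  from alg_act_cong[OF this \<phi>] \<phi> show ?thesis by (simp add: mact_def coded_module_def)
qed

lemma code_eq_iff: "\<phi> \<in> fs \<Longrightarrow> \<psi> \<in> fs \<Longrightarrow> code \<phi> = code \<psi> \<longleftrightarrow> \<phi> = \<psi>"
  using inj by (auto dest: inj_onD)

lemma alg_act_delta:
  assumes v: "v \<in> C n" and p: "p \<in> homog j"
  shows "\<exists>w\<in>C (n + j). alg_act p (delta n v) = delta (n + j) w"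
proof -
  have w: "\<exists>w\<in>C (n + word_deg (Word l)). wact l (delta n v) = delta (n + word_deg (Word l)) w" if "v \<in> C n" for l n v
    using that
  proof (induction l arbitrary: n v)
    case (Cons g l)
    define d :: int where "d = (case g of GX \<Rightarrow> 1 | GY \<Rightarrow> -1 | GZ \<Rightarrow> 0)"
    have "gact g (delta n v) = delta (n + d) (gact g (delta n v) (n + d))"
      by (cases g) (auto simp: gact_def delta_def d_def fun_eq_iff)
    moreover have "gact g (delta n v) (n + d) \<in> C (n + d)"
      using fsD[OF gact_fs[OF delta_fs[OF Cons.prems]]] .
    moreover have "word_deg (Word (g # l)) = d + word_deg (Word l)"
      by (cases g) (simp_all add: d_def word_deg_def)
    ultimately show ?case using Cons.IH[of "gact g (delta n v) (n + d)" "n + d"] by (simp add: add.assoc)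
  qed (auto simp: word_deg_def)
  have "alg_act p (delta n v) i = \<zero>" if "i \<noteq> n + j" for i
  proof -
    have "act i [:Poly_Mapping.lookup p x:] (wact (letters x) (delta n v) i) = \<zero>" if "x \<in> Poly_Mapping.keys p" for x
    proof -
      obtain w where "wact (letters x) (delta n v) = delta (n + word_deg x) w" using w[OF v, of "letters x"] by auto
      moreover have "word_deg x = j" using p that by (simp add: homog_def)
      ultimately show ?thesis using \<open>i \<noteq> n + j\<close> by (simp add: delta_def)
    qed
    then have "alg_act p (delta n v) i = (\<Oplus>w\<in>Poly_Mapping.keys p. \<zero>)"
      unfolding alg_act_def by (intro finsum_cong') auto
    then show ?thesis by simp
  qed
  then have "alg_act p (delta n v) = delta (n + j) (alg_act p (delta n v) (n + j))" by (auto simp: delta_def)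
  moreover have "alg_act p (delta n v) (n + j) \<in> C (n + j)" using fsD[OF alg_act_fs[OF delta_fs[OF v]]] .
  ultimately show ?thesis by blast
qed

lemma delta_add: "delta n v i \<oplus> delta n w i = delta n (v \<oplus> w) i" if "v \<in> C n" "w \<in> C n"
  using that by (simp add: delta_def)

lemma coded_module_graded: "graded_right_module (gwa (edge \<alpha>)) (coded_module code)"
proof (rule graded_moduleI[where pr = "\<lambda>u i. code (delta i (inv_into fs code u i))"])
  show "abelian_group (coded_module code)"
  proof (rule abelian_groupI)
    fix x assume "x \<in> carrier (coded_module code)"
    then obtain \<phi> where \<phi>: "\<phi> \<in> fs" "x = code \<phi>" by (auto simp: coded_module_simps)
    have neg: "(\<lambda>i. \<ominus> \<phi> i) \<in> fs" by (rule fs_cond[OF \<phi>(1)]) (use fsD[OF \<phi>(1)] in auto)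
    show "\<exists>y\<in>carrier (coded_module code). y \<oplus>\<^bsub>coded_module code\<^esub> x = \<zero>\<^bsub>coded_module code\<^esub>"
      by (rule bexI[of _ "code (\<lambda>i. \<ominus> \<phi> i)"])
        (use neg \<phi> in \<open>simp_all add: coded_module_simps l_neg C_carrier[OF fsD]\<close>)
    show "\<zero>\<^bsub>coded_module code\<^esub> \<oplus>\<^bsub>coded_module code\<^esub> x = x" using \<phi> fs_zero by (simp add: coded_module_simps C_carrier[OF fsD])
  qed (auto simp: coded_module_simps fs_add fs_zero a_ac C_carrier[OF fsD])
  fix m n p q i j
  show "mact (edge \<alpha>) (coded_module code) m p \<in> carrier (coded_module code)" if "m \<in> carrier (coded_module code)"
    using that by (auto simp: coded_module_simps coded_module_act alg_act_fs)
  show "mact (edge \<alpha>) (coded_module code) (m \<oplus>\<^bsub>coded_module code\<^esub> n) p = mact (edge \<alpha>) (coded_module code) m p \<oplus>\<^bsub>coded_module code\<^esub> mact (edge \<alpha>) (coded_module code) n p"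
    if "m \<in> carrier (coded_module code)" "n \<in> carrier (coded_module code)"
    using that by (auto simp: coded_module_simps coded_module_act alg_act_fs fs_add alg_act_addr)
  show "mact (edge \<alpha>) (coded_module code) m (p + q) = mact (edge \<alpha>) (coded_module code) m p \<oplus>\<^bsub>coded_module code\<^esub> mact (edge \<alpha>) (coded_module code) m q"
    if "m \<in> carrier (coded_module code)"
    using that by (auto simp: coded_module_simps coded_module_act alg_act_fs alg_act_add)
  show "mact (edge \<alpha>) (coded_module code) m (p * q) = mact (edge \<alpha>) (coded_module code) (mact (edge \<alpha>) (coded_module code) m p) q"
    if "m \<in> carrier (coded_module code)"
    using that by (auto simp: coded_module_simps coded_module_act alg_act_fs alg_act_mult)
  show "mact (edge \<alpha>) (coded_module code) m 1 = m" if "m \<in> carrier (coded_module code)"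
    using that by (auto simp: coded_module_simps coded_module_act alg_act_1)
  show "m \<in> carrier (coded_module code)" if "m \<in> mpart (coded_module code) i"
    using that delta_fs by (auto simp: coded_module_simps)
  have dz: "delta i \<zero> = (\<lambda>_. \<zero>)" for i by (auto simp: delta_def)
  show "\<zero>\<^bsub>coded_module code\<^esub> \<in> mpart (coded_module code) i"
    unfolding coded_module_simps by (rule image_eqI[of _ _ \<zero>]) (simp_all add: dz)
  show "m \<oplus>\<^bsub>coded_module code\<^esub> n \<in> mpart (coded_module code) i" if "m \<in> mpart (coded_module code) i" "n \<in> mpart (coded_module code) i"
    using that delta_fs by (auto simp: coded_module_simps delta_add)
  show "mact (edge \<alpha>) (coded_module code) m p \<in> mpart (coded_module code) (i + j)" if "m \<in> mpart (coded_module code) i" "p \<in> homog j"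
    using that alg_act_delta[OF _ that(2)] delta_fs by (fastforce simp: coded_module_simps coded_module_act)
  show "code (delta i (inv_into fs code m i)) \<in> mpart (coded_module code) i" if "m \<in> carrier (coded_module code)"
    using that fsD by (auto simp: coded_module_simps)
  show "finite {i. code (delta i (inv_into fs code m i)) \<noteq> \<zero>\<^bsub>coded_module code\<^esub>}" if m: "m \<in> carrier (coded_module code)"
  proof -
    obtain \<phi> where \<phi>: "\<phi> \<in> fs" "m = code \<phi>" using m by (auto simp: coded_module_simps)
    have "{i. code (delta i (inv_into fs code m i)) \<noteq> \<zero>\<^bsub>coded_module code\<^esub>} \<subseteq> {i. \<phi> i \<noteq> \<zero>}"
      using \<phi> dz by (auto simp: coded_module_simps)
    then show ?thesis using \<phi>(1) finite_subset unfolding fs_def by blast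
  qed
  show "code (delta i (inv_into fs code (m \<oplus>\<^bsub>coded_module code\<^esub> n) i))
      = code (delta i (inv_into fs code m i)) \<oplus>\<^bsub>coded_module code\<^esub> code (delta i (inv_into fs code n i))"
    if "m \<in> carrier (coded_module code)" "n \<in> carrier (coded_module code)"
    using that delta_fs fsD by (auto simp: coded_module_simps fs_add delta_add)
  show "code (delta j (inv_into fs code m j)) = (if j = i then m else \<zero>\<^bsub>coded_module code\<^esub>)" if "m \<in> mpart (coded_module code) i"
    using that delta_fs dz by (auto simp: coded_module_simps) (auto simp: delta_def)
  show "m = \<zero>\<^bsub>coded_module code\<^esub>" if m: "m \<in> carrier (coded_module code)" "\<And>i. code (delta i (inv_into fs code m i)) = \<zero>\<^bsub>coded_module code\<^esub>"
  proof -
    obtain \<phi> where \<phi>: "\<phi> \<in> fs" "m = code \<phi>" using m(1) by (auto simp: coded_module_simps)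
    have "delta i (\<phi> i) = (\<lambda>_. \<zero>)" for i
      using m(2)[of i] \<phi> code_eq_iff[OF delta_fs[OF fsD[OF \<phi>(1)]] fs_zero] by (simp add: coded_module_simps)
    then have "\<phi> i = \<zero>" for i unfolding delta_def by metis
    then show ?thesis using \<phi>(2) by (simp add: coded_module_simps) (metis ext)
  qed
qed

lemma coded_module_theta:
  "bij_betw (\<lambda>v. code (delta n v)) (C n) (mpart (coded_module code) n)"
  "\<lbrakk>v \<in> C n; w \<in> C n\<rbrakk> \<Longrightarrow> code (delta n (v \<oplus> w)) = code (delta n v) \<oplus>\<^bsub>coded_module code\<^esub> code (delta n w)"
  "v \<in> C n \<Longrightarrow> code (delta n (act n p v)) = tact (edge \<alpha>) (coded_module code) n p (code (delta n v))"
  "v \<in> C n \<Longrightarrow> code (delta m (e n m v)) = mmap (edge \<alpha>) (coded_module code) n m (code (delta n v))"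
proof -
  interpret X: gmod_edge \<alpha> "coded_module code" by (intro gmod_edge.intro gmod.intro coded_module_graded)
  show "bij_betw (\<lambda>v. code (delta n v)) (C n) (mpart (coded_module code) n)"
  proof (rule bij_betw_imageI[OF inj_onI])
    fix v w assume "v \<in> C n" "w \<in> C n" "code (delta n v) = code (delta n w)"
    then have "delta n v = delta n w" using code_eq_iff delta_fs by blast
    then have "delta n v n = delta n w n" by simp
    then show "v = w" by (simp add: delta_def)
  qed (simp add: coded_module_simps)
  show "\<lbrakk>v \<in> C n; w \<in> C n\<rbrakk> \<Longrightarrow> code (delta n (v \<oplus> w)) = code (delta n v) \<oplus>\<^bsub>coded_module code\<^esub> code (delta n w)"
    by (simp add: coded_module_simps delta_fs delta_add)
  show "code (delta n (act n p v)) = tact (edge \<alpha>) (coded_module code) n p (code (delta n v))" if v: "v \<in> C n"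
  proof -
    have eq: "zn n = free_gen GZ + free_const (- of_int n)"
      unfolding zn_def free_const_def by (simp add: single_uminus)
    have "alg_act (free_eval p (zn n)) (delta n v) = delta n (act n p v)"
      unfolding eq alg_act_eval[OF delta_fs[OF v]] by (auto simp: delta_def fun_eq_iff pcompose_idR)
    then show ?thesis using v by (simp add: tact_def coded_module_act delta_fs)
  qed
  show "code (delta m (e n m v)) = mmap (edge \<alpha>) (coded_module code) n m (code (delta n v))" if v: "v \<in> C n"
  proof (induction m rule: X.mmap_induct[of _ n])
    case base
    show ?case using v by (simp add: e_id)
  next
    case (up j)
    have "gact GX (delta j (e n j v)) = delta (j + 1) (e n (j + 1) v)"
      using v up(1) e_comp[OF v, of j "j + 1"]
      by (auto simp: gact_def delta_def fun_eq_iff cc_L_mono act_one[OF e_C])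
    then show ?case using up v by (simp add: X.mmap_up coded_module_act delta_fs alg_act_gen flip: up(2))
  next
    case (down j)
    have "gact GY (delta (j + 1) (e n (j + 1) v)) = delta j (e n j v)"
      using v down(1) e_comp[OF v, of "j + 1" j]
      by (auto simp: gact_def delta_def fun_eq_iff cc_L_mono act_one[OF e_C])
    then show ?case using down v by (simp add: X.mmap_down coded_module_act delta_fs alg_act_gen flip: down(2))
  qed
qed

lemma coded_module_fin_gen:
  assumes "ofg"
  shows "fin_gen (gwa (edge \<alpha>)) (coded_module code)"
proof -
  interpret X: gmod_edge \<alpha> "coded_module code" by (intro gmod_edge.intro gmod.intro coded_module_graded)
  obtain T where T: "gens T" using assms ofg_def by blast
  let ?T = "(\<lambda>(d, g). (d, code (delta d g))) ` T"
  have "X.O.gens ?T"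
    unfolding X.O.gens_def
  proof (intro conjI allI impI)
    show "finite ?T" using gensD(1)[OF T] by simp
    show "\<forall>(d, g)\<in>?T. g \<in> mpart (coded_module code) d" using gensD(2)[OF T] by (auto simp: coded_module_simps)
    fix Q k assume Q: "X.O.oclosed Q \<and> (\<forall>(d, g)\<in>?T. g \<in> Q d)"
    note QD = X.O.oclosedD[OF conjunct1[OF Q]]
    define P where "P = (\<lambda>k. {v. v \<in> C k \<and> code (delta k v) \<in> Q k})"
    have P: "v \<in> P k \<longleftrightarrow> v \<in> C k \<and> code (delta k v) \<in> Q k" for v k by (simp add: P_def)
    have "oclosed P"
    proof (rule oclosedI, goal_cases)
      case (2 k)
      have "delta k \<zero> = (\<lambda>_. \<zero>)" by (auto simp: delta_def)
      then show ?case using QD(2)[of k] by (simp add: P coded_module_simps)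
    next
      case (3 k v w) then show ?case using QD(3) by (simp add: P coded_module_theta(2))
    next
      case (4 k p v) then show ?case using QD(4) by (simp add: P coded_module_theta(3))
    next
      case (5 i j v) then show ?case using QD(5) by (simp add: P coded_module_theta(4))
    qed (simp add: P)
    then have "v \<in> P k" if "v \<in> C k" for v
      by (rule gens_induct[OF T _ _ that]) (use Q gensD(2)[OF T] in \<open>force simp: P\<close>)
    then show "mpart (coded_module code) k \<subseteq> Q k" by (auto simp: coded_module_simps P)
  qed
  then have "X.O.ofg" unfolding X.O.ofg_def by blast
  then show ?thesis using X.fin_gen_iff by blast
qed

end

text \<open>The parts are required to embed into pairs of elements of the type since this is what families provide: they
  are determined by two entries.\<close>

theorem realization:
  assumes "ofg" "infinite (UNIV :: 'u set)" "\<And>i. inj_on (r i :: 'a \<Rightarrow> 'u \<times> 'u) (C i)"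
  shows "\<exists>(X :: ('k free_alg set, 'u) gmodule) \<theta>. grmod \<alpha> X \<and>
    (\<forall>n. bij_betw (\<theta> n) (C n) (mpart X n)) \<and>
    (\<forall>n. \<forall>v\<in>C n. \<forall>w\<in>C n. \<theta> n (v \<oplus> w) = \<theta> n v \<oplus>\<^bsub>X\<^esub> \<theta> n w) \<and>
    (\<forall>n p. \<forall>v\<in>C n. \<theta> n (act n p v) = tact (edge \<alpha>) X n p (\<theta> n v)) \<and>
    (\<forall>n m. \<forall>v\<in>C n. \<theta> m (e n m v) = mmap (edge \<alpha>) X n m (\<theta> n v))"
proof -
  obtain code :: "(int \<Rightarrow> 'a) \<Rightarrow> 'u" where code: "inj_on code fs"
    using finite_support_code[where r = r and C = C, OF assms(2,3)] unfolding fs_def by blast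
  have "grmod \<alpha> (coded_module code)"
    by (intro grmod.intro gmod_edge.intro gmod.intro grmod_axioms.intro coded_module_graded coded_module_fin_gen code assms(1))
  then show ?thesis
    by (intro exI[of _ "coded_module code"] exI[of _ "\<lambda>n v. code (delta n v)"] conjI allI ballI coded_module_theta[OF code])
qed

end

section \<open>Linear categories\<close>

subsection \<open>Transfer along a fully faithful assignment\<close>

text \<open>The laws of a linear category for \<open>D\<close> and functoriality follow from the laws of \<open>C\<close> through the bijections
  \<open>\<phi>\<close>, provided that the operations of \<open>D\<close> are closed.\<close>

locale fully_faithful = C: linear_category C
  for C :: "('o, 'm, 'k::field) lincat" +
  fixes D :: "('p, 'n, 'k) lincat" and F :: "'p \<Rightarrow> 'o" and \<phi> :: "'p \<Rightarrow> 'p \<Rightarrow> 'n \<Rightarrow> 'm"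
  assumes obj: "X \<in> obj D \<Longrightarrow> F X \<in> obj C"
    and bij: "\<lbrakk>X \<in> obj D; Y \<in> obj D\<rbrakk> \<Longrightarrow> bij_betw (\<phi> X Y) (homs D X Y) (homs C (F X) (F Y))"
    and D_id: "X \<in> obj D \<Longrightarrow> idm D X \<in> homs D X X"
    and F_id: "X \<in> obj D \<Longrightarrow> \<phi> X X (idm D X) = idm C (F X)"
    and D_cmp: "\<lbrakk>X \<in> obj D; Y \<in> obj D; Z \<in> obj D; f \<in> homs D X Y; g \<in> homs D Y Z\<rbrakk>
      \<Longrightarrow> cmp D X Y Z g f \<in> homs D X Z"
    and F_cmp: "\<lbrakk>X \<in> obj D; Y \<in> obj D; Z \<in> obj D; f \<in> homs D X Y; g \<in> homs D Y Z\<rbrakk>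
      \<Longrightarrow> \<phi> X Z (cmp D X Y Z g f) = cmp C (F X) (F Y) (F Z) (\<phi> Y Z g) (\<phi> X Y f)"
    and D_add: "\<lbrakk>X \<in> obj D; Y \<in> obj D; f \<in> homs D X Y; g \<in> homs D X Y\<rbrakk> \<Longrightarrow> hadd D X Y f g \<in> homs D X Y"
    and F_add: "\<lbrakk>X \<in> obj D; Y \<in> obj D; f \<in> homs D X Y; g \<in> homs D X Y\<rbrakk>
      \<Longrightarrow> \<phi> X Y (hadd D X Y f g) = hadd C (F X) (F Y) (\<phi> X Y f) (\<phi> X Y g)"
    and D_zero: "\<lbrakk>X \<in> obj D; Y \<in> obj D\<rbrakk> \<Longrightarrow> hzero D X Y \<in> homs D X Y"
    and F_zero: "\<lbrakk>X \<in> obj D; Y \<in> obj D\<rbrakk> \<Longrightarrow> \<phi> X Y (hzero D X Y) = hzero C (F X) (F Y)"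
    and D_scale: "\<lbrakk>X \<in> obj D; Y \<in> obj D; f \<in> homs D X Y\<rbrakk> \<Longrightarrow> hscale D X Y c f \<in> homs D X Y"
    and F_scale: "\<lbrakk>X \<in> obj D; Y \<in> obj D; f \<in> homs D X Y\<rbrakk>
      \<Longrightarrow> \<phi> X Y (hscale D X Y c f) = hscale C (F X) (F Y) c (\<phi> X Y f)"
begin

lemma F_hom: "\<lbrakk>X \<in> obj D; Y \<in> obj D; f \<in> homs D X Y\<rbrakk> \<Longrightarrow> \<phi> X Y f \<in> homs C (F X) (F Y)"
  using bij bij_betwE by blast

lemma F_eqI:
  "\<lbrakk>X \<in> obj D; Y \<in> obj D; f \<in> homs D X Y; g \<in> homs D X Y; \<phi> X Y f = \<phi> X Y g\<rbrakk> \<Longrightarrow> f = g"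
  using bij[of X Y] by (auto simp: bij_betw_def dest: inj_onD)

definition G :: "'p \<Rightarrow> 'p \<Rightarrow> 'm \<Rightarrow> 'n" where
  "G X Y = inv_into (homs D X Y) (\<phi> X Y)"

lemma G_hom:
  assumes "X \<in> obj D" "Y \<in> obj D" "f \<in> homs C (F X) (F Y)"
  shows "G X Y f \<in> homs D X Y" "\<phi> X Y (G X Y f) = f"
  using bij[OF assms(1,2)] assms(3) unfolding G_def bij_betw_def by (auto intro: inv_into_into f_inv_into_f)

lemma C_add:
  assumes "X \<in> obj C" "Y \<in> obj C" "f \<in> homs C X Y" "g \<in> homs C X Y"
  shows "hadd C X Y f g \<in> homs C X Y"
proof -
  interpret G: comm_group "\<lparr>carrier = homs C X Y, monoid.mult = hadd C X Y, one = hzero C X Y\<rparr>"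
    by (rule C.hom_group[OF assms(1,2)])
  show ?thesis using G.m_closed assms(3,4) by simp
qed

lemma D_group:
  assumes XY: "X \<in> obj D" "Y \<in> obj D"
  shows "comm_group \<lparr>carrier = homs D X Y, monoid.mult = hadd D X Y, one = hzero D X Y\<rparr>"
proof -
  interpret G: comm_group "\<lparr>carrier = homs C (F X) (F Y), monoid.mult = hadd C (F X) (F Y), one = hzero C (F X) (F Y)\<rparr>"
    by (rule C.hom_group) (use XY obj in auto)
  show ?thesis
  proof (rule comm_groupI, goal_cases)
    case 1 then show ?case using XY by (simp add: D_add)
  next
    case 2 show ?case using XY by (simp add: D_zero)
  next
    case (3 f g h)
    then show ?case
      using G.m_assoc[of "\<phi> X Y f" "\<phi> X Y g" "\<phi> X Y h"] XY
      by simp (intro F_eqI[OF XY], simp_all add: D_add F_add F_hom)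
  next
    case (4 f g)
    then show ?case
      using G.m_comm[of "\<phi> X Y f" "\<phi> X Y g"] XY
      by simp (intro F_eqI[OF XY], simp_all add: D_add F_add F_hom)
  next
    case (5 f)
    then show ?case
      using G.l_one[of "\<phi> X Y f"] XY
      by simp (intro F_eqI[OF XY], simp_all add: D_add F_add F_hom D_zero F_zero)
  next
    case (6 f)
    then have f: "f \<in> homs D X Y" by simp
    obtain g where g: "g \<in> homs C (F X) (F Y)" "hadd C (F X) (F Y) g (\<phi> X Y f) = hzero C (F X) (F Y)"
      using G.l_inv_ex[of "\<phi> X Y f"] F_hom[OF XY f] by auto
    have "hadd D X Y (G X Y g) f = hzero D X Y"
      using g f XY G_hom[OF XY g(1)]
      by (intro F_eqI[OF XY]) (simp_all add: D_add F_add D_zero F_zero)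
    then show ?case using G_hom(1)[OF XY g(1)] by auto
  qed
qed

lemma D_linear: "linear_category D"
proof (rule linear_category.intro)
  show "comm_group \<lparr>carrier = homs D X Y, monoid.mult = hadd D X Y, one = hzero D X Y\<rparr>"
    if "X \<in> obj D" "Y \<in> obj D" for X Y
    by (rule D_group[OF that])
next
  fix X Y Z f g g' assume *: "X \<in> obj D" "Y \<in> obj D" "Z \<in> obj D" "f \<in> homs D X Y" "g \<in> homs D Y Z" "g' \<in> homs D Y Z"
  show "cmp D X Y Z (hadd D Y Z g g') f = hadd D X Z (cmp D X Y Z g f) (cmp D X Y Z g' f)"
    using * by (intro F_eqI[of X Z]) (simp_all add: D_add F_add D_cmp F_cmp F_hom obj C.cmp_add_left)
next
  fix X Y Z f f' g assume *: "X \<in> obj D" "Y \<in> obj D" "Z \<in> obj D" "f \<in> homs D X Y" "f' \<in> homs D X Y" "g \<in> homs D Y Z"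
  show "cmp D X Y Z g (hadd D X Y f f') = hadd D X Z (cmp D X Y Z g f) (cmp D X Y Z g f')"
    using * by (intro F_eqI[of X Z]) (simp_all add: D_add F_add D_cmp F_cmp F_hom obj C.cmp_add_right)
next
  fix W X Y Z f g h assume *: "W \<in> obj D" "X \<in> obj D" "Y \<in> obj D" "Z \<in> obj D"
    "f \<in> homs D W X" "g \<in> homs D X Y" "h \<in> homs D Y Z"
  show "cmp D W X Z (cmp D X Y Z h g) f = cmp D W Y Z h (cmp D W X Y g f)"
    using * by (intro F_eqI[of W Z]) (simp_all add: D_cmp F_cmp F_hom obj C.cmp_assoc)
next
  fix X Y Z f g c assume *: "X \<in> obj D" "Y \<in> obj D" "Z \<in> obj D" "f \<in> homs D X Y" "g \<in> homs D Y Z"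
  show "cmp D X Y Z (hscale D Y Z c g) f = hscale D X Z c (cmp D X Y Z g f)"
    using * by (intro F_eqI[of X Z]) (simp_all add: D_scale F_scale D_cmp F_cmp F_hom obj C.cmp_scale_left)
  show "cmp D X Y Z g (hscale D X Y c f) = hscale D X Z c (cmp D X Y Z g f)"
    using * by (intro F_eqI[of X Z]) (simp_all add: D_scale F_scale D_cmp F_cmp F_hom obj C.cmp_scale_right)
next
  fix X Y f g c assume *: "X \<in> obj D" "Y \<in> obj D" "f \<in> homs D X Y" "g \<in> homs D X Y"
  show "hscale D X Y c (hadd D X Y f g) = hadd D X Y (hscale D X Y c f) (hscale D X Y c g)"
    using * by (intro F_eqI[of X Y]) (simp_all add: D_scale F_scale D_add F_add F_hom obj C.scale_add_right)
next
  fix X Y f c d assume *: "X \<in> obj D" "Y \<in> obj D" "f \<in> homs D X Y"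
  show "cmp D X X Y f (idm D X) = f" "cmp D X Y Y (idm D Y) f = f" "hscale D X Y 1 f = f"
    "hscale D X Y (c + d) f = hadd D X Y (hscale D X Y c f) (hscale D X Y d f)"
    "hscale D X Y (c * d) f = hscale D X Y c (hscale D X Y d f)"
    using * by (intro F_eqI[of X Y]; simp add: D_scale F_scale D_add F_add F_hom obj D_id F_id D_cmp F_cmp
        C.cmp_id C.id_cmp C.scale_one C.scale_add_left C.scale_scale)+
qed (simp_all add: D_id D_cmp D_scale)

text \<open>Choose a preimage of every object up to isomorphism, and conjugate by the chosen isomorphisms.\<close>

theorem equivalence:
  assumes ess: "\<And>Y. Y \<in> obj C \<Longrightarrow> \<exists>X\<in>obj D. \<exists>u. iso_in C Y (F X) u"
  shows "linearly_equivalent C D"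
proof -
  have "\<forall>Y. \<exists>X u w. Y \<in> obj C \<longrightarrow> X \<in> obj D \<and> u \<in> homs C Y (F X) \<and> w \<in> homs C (F X) Y \<and>
      cmp C Y (F X) Y w u = idm C Y \<and> cmp C (F X) Y (F X) u w = idm C (F X)"
    using ess unfolding iso_in_def by meson
  then have "\<exists>S. \<forall>Y. \<exists>u w. Y \<in> obj C \<longrightarrow> S Y \<in> obj D \<and> u \<in> homs C Y (F (S Y)) \<and> w \<in> homs C (F (S Y)) Y \<and>
      cmp C Y (F (S Y)) Y w u = idm C Y \<and> cmp C (F (S Y)) Y (F (S Y)) u w = idm C (F (S Y))"
    by (rule choice)
  then obtain S where "\<forall>Y. \<exists>u w. Y \<in> obj C \<longrightarrow> S Y \<in> obj D \<and> u \<in> homs C Y (F (S Y)) \<and> w \<in> homs C (F (S Y)) Y \<and>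
      cmp C Y (F (S Y)) Y w u = idm C Y \<and> cmp C (F (S Y)) Y (F (S Y)) u w = idm C (F (S Y))" ..
  then have "\<exists>u. \<forall>Y. \<exists>w. Y \<in> obj C \<longrightarrow> S Y \<in> obj D \<and> u Y \<in> homs C Y (F (S Y)) \<and> w \<in> homs C (F (S Y)) Y \<and>
      cmp C Y (F (S Y)) Y w (u Y) = idm C Y \<and> cmp C (F (S Y)) Y (F (S Y)) (u Y) w = idm C (F (S Y))"
    by (rule choice)
  then obtain u where "\<forall>Y. \<exists>w. Y \<in> obj C \<longrightarrow> S Y \<in> obj D \<and> u Y \<in> homs C Y (F (S Y)) \<and> w \<in> homs C (F (S Y)) Y \<and>
      cmp C Y (F (S Y)) Y w (u Y) = idm C Y \<and> cmp C (F (S Y)) Y (F (S Y)) (u Y) w = idm C (F (S Y))" ..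
  then have "\<exists>w. \<forall>Y. Y \<in> obj C \<longrightarrow> S Y \<in> obj D \<and> u Y \<in> homs C Y (F (S Y)) \<and> w Y \<in> homs C (F (S Y)) Y \<and>
      cmp C Y (F (S Y)) Y (w Y) (u Y) = idm C Y \<and> cmp C (F (S Y)) Y (F (S Y)) (u Y) (w Y) = idm C (F (S Y))"
    by (rule choice)
  then obtain w where "\<forall>Y. Y \<in> obj C \<longrightarrow> S Y \<in> obj D \<and> u Y \<in> homs C Y (F (S Y)) \<and> w Y \<in> homs C (F (S Y)) Y \<and>
      cmp C Y (F (S Y)) Y (w Y) (u Y) = idm C Y \<and> cmp C (F (S Y)) Y (F (S Y)) (u Y) (w Y) = idm C (F (S Y))" ..
  then have S: "S Y \<in> obj D" "u Y \<in> homs C Y (F (S Y))" "w Y \<in> homs C (F (S Y)) Y"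
    "cmp C Y (F (S Y)) Y (w Y) (u Y) = idm C Y" "cmp C (F (S Y)) Y (F (S Y)) (u Y) (w Y) = idm C (F (S Y))"
    if "Y \<in> obj C" for Y
    using that by auto
  have FS: "F (S Y) \<in> obj C" if "Y \<in> obj C" for Y using obj S(1) that by blast
  define J where "J Y Z f = cmp C (F (S Y)) Y (F (S Z)) (cmp C Y Z (F (S Z)) (u Z) f) (w Y)" for Y Z f
  have J: "J Y Z f \<in> homs C (F (S Y)) (F (S Z))" if "Y \<in> obj C" "Z \<in> obj C" "f \<in> homs C Y Z" for Y Z f
    unfolding J_def using that S FS by (intro C.cmp_hom) auto
  define T where "T Y Z f = G (S Y) (S Z) (J Y Z f)" for Y Z f
  have T: "T Y Z f \<in> homs D (S Y) (S Z)" "\<phi> (S Y) (S Z) (T Y Z f) = J Y Z f"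
    if "Y \<in> obj C" "Z \<in> obj C" "f \<in> homs C Y Z" for Y Z f
    unfolding T_def using G_hom S J that by auto
  have uJ: "cmp C Y (F (S Y)) (F (S Z)) (J Y Z f) (u Y) = cmp C Y Z (F (S Z)) (u Z) f"
    if "Y \<in> obj C" "Z \<in> obj C" "f \<in> homs C Y Z" for Y Z f
  proof -
    have K: "cmp C Y Z (F (S Z)) (u Z) f \<in> homs C Y (F (S Z))" using that S FS by (intro C.cmp_hom) auto
    have "cmp C Y (F (S Y)) (F (S Z)) (J Y Z f) (u Y)
        = cmp C Y Y (F (S Z)) (cmp C Y Z (F (S Z)) (u Z) f) (cmp C Y (F (S Y)) Y (w Y) (u Y))"
      unfolding J_def using that S FS K by (intro C.cmp_assoc) auto
    then show ?thesis using that S FS K by (simp add: C.cmp_id)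
  qed
  have Jw: "cmp C (F (S Y)) (F (S Z)) Z (w Z) (J Y Z f) = cmp C (F (S Y)) Y Z f (w Y)"
    if "Y \<in> obj C" "Z \<in> obj C" "f \<in> homs C Y Z" for Y Z f
  proof -
    have "cmp C (F (S Y)) (F (S Z)) Z (w Z) (J Y Z f)
        = cmp C (F (S Y)) Y Z (cmp C Y (F (S Z)) Z (w Z) (cmp C Y Z (F (S Z)) (u Z) f)) (w Y)"
      unfolding J_def using that S FS by (intro C.cmp_assoc[symmetric] C.cmp_hom) auto
    also have "cmp C Y (F (S Z)) Z (w Z) (cmp C Y Z (F (S Z)) (u Z) f) = cmp C Y Z Z (cmp C Z (F (S Z)) Z (w Z) (u Z)) f"
      using that S FS by (intro C.cmp_assoc[symmetric]) auto
    finally show ?thesis using that S by (simp add: C.id_cmp)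
  qed
  have "linear_functor C D S T"
  proof
    fix X Y f assume *: "X \<in> obj C" "Y \<in> obj C" "f \<in> homs C X Y"
    show "T X Y f \<in> homs D (S X) (S Y)" using T * by blast
    show "T X Y (hscale C X Y c f) = hscale D (S X) (S Y) c (T X Y f)" for c
    proof (rule F_eqI)
      show "\<phi> (S X) (S Y) (T X Y (hscale C X Y c f)) = \<phi> (S X) (S Y) (hscale D (S X) (S Y) c (T X Y f))"
        using * S FS T by (simp add: C.scale_hom F_scale J_def C.cmp_hom C.cmp_scale_left C.cmp_scale_right)
    qed (use * S T in \<open>auto simp: C.scale_hom D_scale\<close>)
    fix g assume g: "g \<in> homs C X Y"
    show "T X Y (hadd C X Y f g) = hadd D (S X) (S Y) (T X Y f) (T X Y g)"
    proof (rule F_eqI)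
      show "\<phi> (S X) (S Y) (T X Y (hadd C X Y f g)) = \<phi> (S X) (S Y) (hadd D (S X) (S Y) (T X Y f) (T X Y g))"
        using * g S FS T by (simp add: C_add F_add J_def C.cmp_hom C.cmp_add_left C.cmp_add_right)
    qed (use * g S T in \<open>auto simp: C_add D_add\<close>)
  next
    fix X assume X: "X \<in> obj C"
    show "S X \<in> obj D" using S X by blast
    show "T X X (idm C X) = idm D (S X)"
    proof (rule F_eqI)
      show "\<phi> (S X) (S X) (T X X (idm C X)) = \<phi> (S X) (S X) (idm D (S X))"
        using X S FS T by (simp add: C.id_hom F_id J_def C.cmp_id)
    qed (use X S T in \<open>auto simp: C.id_hom D_id\<close>)
  next
    fix X Y Z f g assume *: "X \<in> obj C" "Y \<in> obj C" "Z \<in> obj C" "f \<in> homs C X Y" "g \<in> homs C Y Z"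
    have gf: "cmp C X Y Z g f \<in> homs C X Z" using * by (intro C.cmp_hom)
    show "T X Z (cmp C X Y Z g f) = cmp D (S X) (S Y) (S Z) (T Y Z g) (T X Y f)"
    proof (rule F_eqI)
      have "J X Z (cmp C X Y Z g f) = cmp C (F (S X)) X (F (S Z)) (cmp C X Y (F (S Z)) (cmp C Y Z (F (S Z)) (u Z) g) f) (w X)"
        unfolding J_def using * S FS by (simp add: C.cmp_assoc)
      also have "\<dots> = cmp C (F (S X)) X (F (S Z)) (cmp C X Y (F (S Z)) (cmp C Y (F (S Y)) (F (S Z)) (J Y Z g) (u Y)) f) (w X)"
        using * by (simp add: uJ)
      also have "\<dots> = cmp C (F (S X)) X (F (S Z)) (cmp C X (F (S Y)) (F (S Z)) (J Y Z g) (cmp C X Y (F (S Y)) (u Y) f)) (w X)"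
        using * S FS J by (simp add: C.cmp_assoc)
      also have "\<dots> = cmp C (F (S X)) (F (S Y)) (F (S Z)) (J Y Z g) (J X Y f)"
        unfolding J_def[of X Y f] using * S FS J by (intro C.cmp_assoc C.cmp_hom) auto
      finally show "\<phi> (S X) (S Z) (T X Z (cmp C X Y Z g f)) = \<phi> (S X) (S Z) (cmp D (S X) (S Y) (S Z) (T Y Z g) (T X Y f))"
        using * gf S T by (simp add: F_cmp)
    qed (use * gf S T in \<open>auto intro: D_cmp\<close>)
  qed
  moreover have "linear_functor D C F \<phi>"
    by unfold_locales (simp_all add: obj F_hom F_id F_cmp F_add F_scale)
  moreover have "natural_iso C C (\<lambda>X. X) (\<lambda>X Y f. f) (\<lambda>X. F (S X)) (\<lambda>X Y f. \<phi> (S X) (S Y) (T X Y f)) u"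
    unfolding natural_iso_def iso_in_def using S T uJ by (metis (no_types, lifting))
  moreover have "natural_iso D D (\<lambda>X. S (F X)) (\<lambda>X Y f. T (F X) (F Y) (\<phi> X Y f)) (\<lambda>X. X) (\<lambda>X Y f. f) (\<lambda>X. G (S (F X)) X (w (F X)))"
    unfolding natural_iso_def
  proof (intro conjI ballI)
    fix X assume X: "X \<in> obj D"
    note FX = obj[OF X]
    note SX = S[OF FX]
    show "iso_in D (S (F X)) X (G (S (F X)) X (w (F X)))"
      unfolding iso_in_def
    proof (intro conjI bexI)
      show "G (S (F X)) X (w (F X)) \<in> homs D (S (F X)) X" using G_hom SX X by blast
      show g: "G X (S (F X)) (u (F X)) \<in> homs D X (S (F X))" using G_hom SX X by blast
      show "cmp D (S (F X)) X (S (F X)) (G X (S (F X)) (u (F X))) (G (S (F X)) X (w (F X))) = idm D (S (F X))"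
        using X SX G_hom by (intro F_eqI[of "S (F X)" "S (F X)"]) (simp_all add: D_cmp F_cmp D_id F_id)
      show "cmp D X (S (F X)) X (G (S (F X)) X (w (F X))) (G X (S (F X)) (u (F X))) = idm D X"
        using X SX G_hom by (intro F_eqI[of X X]) (simp_all add: D_cmp F_cmp D_id F_id)
    qed
    fix Y f assume Y: "Y \<in> obj D" and f: "f \<in> homs D X Y"
    note SY = S[OF obj[OF Y]]
    show "cmp D (S (F X)) (S (F Y)) Y (G (S (F Y)) Y (w (F Y))) (T (F X) (F Y) (\<phi> X Y f))
        = cmp D (S (F X)) X Y f (G (S (F X)) X (w (F X)))"
      using X Y f SX SY G_hom T[OF FX obj[OF Y] F_hom[OF X Y f]] Jw[OF FX obj[OF Y] F_hom[OF X Y f]]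
      by (intro F_eqI[of "S (F X)" Y]) (simp_all add: D_cmp F_cmp)
  qed
  ultimately show ?thesis
    unfolding linearly_equivalent_def using D_linear C.linear_category_axioms by blast
qed

end

subsection \<open>The category of graded modules\<close>

lemma gr_obj_gmod: "M \<in> gr_obj (gwa f) \<Longrightarrow> gmod f M"
  by (simp add: gr_obj_def gmod_def)

theorem gr_cat_linear: "linear_category (gr_cat TYPE('u) (gwa (f :: 'k::field_char_0 poly)))"
proof -
  let ?C = "gr_cat TYPE('u) (gwa f)"
  have scale: "hscale ?C = (\<lambda>M N c h. restrict (\<lambda>m. mact f N (h m) (free_const c)) (carrier M))"
    by (simp add: gr_cat_def mact_def gwa_proj_hom(5))
  have sel: "obj ?C = gr_obj (gwa f)" "homs ?C = gr_hom (gwa f)"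
    "cmp ?C = (\<lambda>L M N g f. compose (carrier L) g f)" "idm ?C = (\<lambda>M. restrict (\<lambda>m. m) (carrier M))"
    "hadd ?C = (\<lambda>M N f g. restrict (\<lambda>m. f m \<oplus>\<^bsub>N\<^esub> g m) (carrier M))"
    "hzero ?C = (\<lambda>M N. restrict (\<lambda>m. \<zero>\<^bsub>N\<^esub>) (carrier M))"
    by (simp_all add: gr_cat_def)
  have comp: "compose (carrier L) g h \<in> gr_hom (gwa f) L N"
    if L: "gmod f L" and h: "h \<in> gr_hom (gwa f) L M" and g: "g \<in> gr_hom (gwa f) M N"
    for L M N :: "('k free_alg set, 'u) gmodule" and g h
  proof -
    interpret L: gmod f L by (rule L)
    show ?thesis
      by (rule gr_homI) (simp_all add: compose_def gr_homD[OF h] gr_homD[OF g] L.mpart_carrier)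
  qed
  have idh: "restrict (\<lambda>m. m) (carrier M) \<in> gr_hom (gwa f) M M"
    if M: "gmod f M" for M :: "('k free_alg set, 'u) gmodule"
  proof -
    interpret M: gmod f M by (rule M)
    show ?thesis by (rule gr_homI) (simp_all add: M.mpart_carrier)
  qed
  have zero: "restrict (\<lambda>m. \<zero>\<^bsub>N\<^esub>) (carrier M) \<in> gr_hom (gwa f) M N"
    if M: "gmod f M" and N: "gmod f N" for M N :: "('k free_alg set, 'u) gmodule"
  proof -
    interpret M: gmod f M by (rule M)
    interpret N: gmod f N by (rule N)
    show ?thesis by (rule gr_homI) (simp_all add: M.mpart_carrier N.mpart_zero)
  qed
  have add: "restrict (\<lambda>m. g m \<oplus>\<^bsub>N\<^esub> h m) (carrier M) \<in> gr_hom (gwa f) M N"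
    if M: "gmod f M" and N: "gmod f N" and h: "h \<in> gr_hom (gwa f) M N" and g: "g \<in> gr_hom (gwa f) M N"
    for M N :: "('k free_alg set, 'u) gmodule" and g h
  proof -
    interpret M: gmod f M by (rule M)
    interpret N: gmod f N by (rule N)
    show ?thesis
      by (rule gr_homI)
        (simp_all add: gr_homD[OF h] gr_homD[OF g] M.mpart_carrier N.mpart_add N.act_rules N.R.M.a_ac)
  qed
  have scal: "restrict (\<lambda>m. mact f N (h m) (free_const c)) (carrier M) \<in> gr_hom (gwa f) M N"
    if M: "gmod f M" and N: "gmod f N" and h: "h \<in> gr_hom (gwa f) M N"
    for M N :: "('k free_alg set, 'u) gmodule" and h c
  proof -
    interpret M: gmod f M by (rule M)
    interpret N: gmod f N by (rule N)
    have comm: "N.act (N.act v p) (free_const c) = N.act (N.act v (free_const c)) p" if "v \<in> carrier N" for v p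
      using N.act_rules(3)[OF that, of p "free_const c"] N.act_rules(3)[OF that, of "free_const c" p]
      by (simp add: free_const_central)
    show ?thesis
      by (rule gr_homI)
        (simp_all add: gr_homD[OF h] M.mpart_carrier N.act_const N.act_rules(1) comm)
  qed
  show ?thesis
  proof (intro linear_category.intro, unfold sel scale)
    fix X Y :: "('k free_alg set, 'u) gmodule" assume XY: "X \<in> gr_obj (gwa f)" "Y \<in> gr_obj (gwa f)"
    interpret X: gmod f X by (rule gr_obj_gmod[OF XY(1)])
    interpret Y: gmod f Y by (rule gr_obj_gmod[OF XY(2)])
    let ?G = "\<lparr>carrier = gr_hom (gwa f) X Y, monoid.mult = (\<lambda>f g. restrict (\<lambda>m. f m \<oplus>\<^bsub>Y\<^esub> g m) (carrier X)),
      one = restrict (\<lambda>m. \<zero>\<^bsub>Y\<^esub>) (carrier X)\<rparr>"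
    show "comm_group ?G"
    proof (rule comm_groupI)
      fix h assume "h \<in> carrier ?G"
      then have h: "h \<in> gr_hom (gwa f) X Y" by simp
      show "\<one>\<^bsub>?G\<^esub> \<otimes>\<^bsub>?G\<^esub> h = h"
        using gr_homD(1,2)[OF h] by (auto simp: fun_eq_iff extensional_def)
      show "\<exists>g\<in>carrier ?G. g \<otimes>\<^bsub>?G\<^esub> h = \<one>\<^bsub>?G\<^esub>"
      proof (rule bexI)
        show "restrict (\<lambda>m. Y.act (h m) (free_const (-1))) (carrier X) \<otimes>\<^bsub>?G\<^esub> h = \<one>\<^bsub>?G\<^esub>"
          using gr_homD(2)[OF h] by (auto simp: fun_eq_iff Y.act_minus_one Y.R.M.l_neg)
      qed (use scal[OF X.gmod_axioms Y.gmod_axioms h] in simp)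
    next
      fix g h l assume "g \<in> carrier ?G" "h \<in> carrier ?G" "l \<in> carrier ?G"
      then have "g \<in> gr_hom (gwa f) X Y" "h \<in> gr_hom (gwa f) X Y" "l \<in> gr_hom (gwa f) X Y" by auto
      note c = this[THEN gr_homD(2)]
      show "g \<otimes>\<^bsub>?G\<^esub> h \<otimes>\<^bsub>?G\<^esub> l = g \<otimes>\<^bsub>?G\<^esub> (h \<otimes>\<^bsub>?G\<^esub> l)"
        using c by (auto simp: fun_eq_iff Y.R.M.a_assoc)
    next
      fix g h assume "g \<in> carrier ?G" "h \<in> carrier ?G"
      then have "g \<in> gr_hom (gwa f) X Y" "h \<in> gr_hom (gwa f) X Y" by auto
      note c = this[THEN gr_homD(2)]
      show "g \<otimes>\<^bsub>?G\<^esub> h = h \<otimes>\<^bsub>?G\<^esub> g" using c by (auto simp: fun_eq_iff Y.R.M.a_comm)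
    qed (use add[OF X.gmod_axioms Y.gmod_axioms] zero[OF X.gmod_axioms Y.gmod_axioms] in simp_all)
  next
    fix X Y h c d assume XY: "X \<in> gr_obj (gwa f)" "Y \<in> gr_obj (gwa f)" and h: "h \<in> gr_hom (gwa f) X (Y :: ('k free_alg set, 'u) gmodule)"
    interpret X: gmod f X by (rule gr_obj_gmod[OF XY(1)])
    interpret Y: gmod f Y by (rule gr_obj_gmod[OF XY(2)])
    note hD = gr_homD[OF h]
    show "compose (carrier X) h (restrict (\<lambda>m. m) (carrier X)) = h"
      "compose (carrier X) (restrict (\<lambda>m. m) (carrier Y)) h = h"
      "(\<lambda>m\<in>carrier X. Y.act (h m) (free_const 1)) = h"
      using hD(1,2) by (auto simp: fun_eq_iff compose_def extensional_def free_const_hom Y.act_rules)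
    show "(\<lambda>m\<in>carrier X. Y.act (h m) (free_const (c + d)))
        = (\<lambda>m\<in>carrier X. (\<lambda>m\<in>carrier X. Y.act (h m) (free_const c)) m \<oplus>\<^bsub>Y\<^esub> (\<lambda>m\<in>carrier X. Y.act (h m) (free_const d)) m)"
      using hD(2) by (auto simp: fun_eq_iff free_const_hom Y.act_rules)
    show "(\<lambda>m\<in>carrier X. Y.act (h m) (free_const (c * d)))
        = (\<lambda>m\<in>carrier X. Y.act ((\<lambda>m\<in>carrier X. Y.act (h m) (free_const d)) m) (free_const c))"
    proof -
      have "Y.act (Y.act v (free_const d)) (free_const c) = Y.act v (free_const (c * d))" if "v \<in> carrier Y" for v
        using Y.act_rules(3)[OF that, of "free_const d" "free_const c"]
        by (simp add: mult.commute flip: free_const_hom(2))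
      then show ?thesis using hD(2) by (auto simp: fun_eq_iff)
    qed
  next
    fix X Y g h c assume XY: "X \<in> gr_obj (gwa f)" "Y \<in> gr_obj (gwa f)" and h: "h \<in> gr_hom (gwa f) X (Y :: ('k free_alg set, 'u) gmodule)"
      and g: "g \<in> gr_hom (gwa f) X Y"
    interpret Y: gmod f Y by (rule gr_obj_gmod[OF XY(2)])
    show "(\<lambda>m\<in>carrier X. Y.act ((\<lambda>m\<in>carrier X. h m \<oplus>\<^bsub>Y\<^esub> g m) m) (free_const c))
        = (\<lambda>m\<in>carrier X. (\<lambda>m\<in>carrier X. Y.act (h m) (free_const c)) m \<oplus>\<^bsub>Y\<^esub> (\<lambda>m\<in>carrier X. Y.act (g m) (free_const c)) m)"
      using gr_homD(2)[OF h] gr_homD(2)[OF g] by (auto simp: fun_eq_iff Y.act_rules)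
  next
    fix W X Y Z :: "('k free_alg set, 'u) gmodule" and f' g h
    assume h: "f' \<in> gr_hom (gwa f) W X"
    show "compose (carrier W) (compose (carrier X) h g) f' = compose (carrier W) h (compose (carrier W) g f')"
      using gr_homD(2)[OF h] by (auto simp: compose_def fun_eq_iff)
  next
    fix X Y Z :: "('k free_alg set, 'u) gmodule" and g g' h
    assume h: "h \<in> gr_hom (gwa f) X Y"
    show "compose (carrier X) (\<lambda>m\<in>carrier Y. g m \<oplus>\<^bsub>Z\<^esub> g' m) h
        = (\<lambda>m\<in>carrier X. compose (carrier X) g h m \<oplus>\<^bsub>Z\<^esub> compose (carrier X) g' h m)"
      using gr_homD(2)[OF h] by (auto simp: compose_def fun_eq_iff)
  next
    fix X Y Z :: "('k free_alg set, 'u) gmodule" and g h h'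
    assume h: "h \<in> gr_hom (gwa f) X Y" "h' \<in> gr_hom (gwa f) X Y" and g: "g \<in> gr_hom (gwa f) Y Z"
    show "compose (carrier X) g (\<lambda>m\<in>carrier X. h m \<oplus>\<^bsub>Y\<^esub> h' m)
        = (\<lambda>m\<in>carrier X. compose (carrier X) g h m \<oplus>\<^bsub>Z\<^esub> compose (carrier X) g h' m)"
      using gr_homD(2)[OF h(1)] gr_homD(2)[OF h(2)] gr_homD(3)[OF g] by (auto simp: compose_def fun_eq_iff)
  next
    fix X Y Z :: "('k free_alg set, 'u) gmodule" and g h c
    assume h: "h \<in> gr_hom (gwa f) X Y" and g: "g \<in> gr_hom (gwa f) Y Z"
    show "compose (carrier X) (\<lambda>m\<in>carrier Y. mact f Z (g m) (free_const c)) h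
        = (\<lambda>m\<in>carrier X. mact f Z (compose (carrier X) g h m) (free_const c))"
      using gr_homD(2)[OF h] by (auto simp: compose_def fun_eq_iff)
    show "compose (carrier X) g (\<lambda>m\<in>carrier X. mact f Y (h m) (free_const c))
        = (\<lambda>m\<in>carrier X. mact f Z (compose (carrier X) g h m) (free_const c))"
      using gr_homD(2)[OF h] gr_homD(4)[OF g] by (auto simp: compose_def fun_eq_iff)
  qed (simp_all add: comp idh scal gr_obj_gmod)
qed

section \<open>The functor\<close>

subsection \<open>Realized representations\<close>

text \<open>The module \<open>X\<close> is a copy of the representation on another type.\<close>

locale realized = R: orep G \<beta> C act e + X: grmod \<beta> X
  for G :: "('a, 'b) ring_scheme" and \<beta> and C :: "int \<Rightarrow> 'a set" and act :: "int \<Rightarrow> 'k::field_char_0 poly \<Rightarrow> 'a \<Rightarrow> 'a"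
    and e and X :: "('k free_alg set, 'u) gmodule" +
  fixes \<theta> :: "int \<Rightarrow> 'a \<Rightarrow> 'u"
  assumes bij: "bij_betw (\<theta> n) (C n) (mpart X n)"
    and \<theta>_add: "\<lbrakk>v \<in> C n; w \<in> C n\<rbrakk> \<Longrightarrow> \<theta> n (v \<oplus>\<^bsub>G\<^esub> w) = \<theta> n v \<oplus>\<^bsub>X\<^esub> \<theta> n w"
    and \<theta>_act: "v \<in> C n \<Longrightarrow> \<theta> n (act n p v) = tact (edge \<beta>) X n p (\<theta> n v)"
    and \<theta>_e: "v \<in> C n \<Longrightarrow> \<theta> m (e n m v) = mmap (edge \<beta>) X n m (\<theta> n v)"
begin

lemma \<theta>_mpart: "v \<in> C n \<Longrightarrow> \<theta> n v \<in> mpart X n"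
  using bij bij_betwE by blast

lemma \<theta>_inj: "\<lbrakk>v \<in> C n; w \<in> C n; \<theta> n v = \<theta> n w\<rbrakk> \<Longrightarrow> v = w"
  using bij unfolding bij_betw_def by (blast dest: inj_onD)

lemma \<theta>_surj: "x \<in> mpart X n \<Longrightarrow> \<exists>v\<in>C n. x = \<theta> n v"
  using bij unfolding bij_betw_def by blast

end

lemma grmod_realized:
  assumes "grmod \<beta> X"
  shows "realized X \<beta> (mpart X) (tact (edge \<beta>) X) (mmap (edge \<beta>) X) X (\<lambda>_ v. v)"
proof -
  interpret X: grmod \<beta> X by fact
  show ?thesis
    by (rule realized.intro[OF X.O.orep_axioms assms realized_axioms.intro]) (simp_all add: bij_betw_def)
qed

text \<open>Homomorphisms between realized modules correspond to maps of the representations, here \<open>ohom\<close>.\<close>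

locale realized_pair = A: realized G \<beta> C act e X \<theta> + B: realized G' \<beta> C' act' e' X' \<theta>'
  for G :: "('a, 'b) ring_scheme" and \<beta> and C and act :: "int \<Rightarrow> 'k::field_char_0 poly \<Rightarrow> 'a \<Rightarrow> 'a" and e
    and X :: "('k free_alg set, 'u) gmodule" and \<theta>
    and G' :: "('c, 'd) ring_scheme" and C' and act' :: "int \<Rightarrow> 'k poly \<Rightarrow> 'c \<Rightarrow> 'c" and e'
    and X' :: "('k free_alg set, 'w) gmodule" and \<theta>'
begin

definition ohom :: "(int \<Rightarrow> 'a \<Rightarrow> 'c) \<Rightarrow> bool" where
  "ohom \<chi> \<longleftrightarrow> (\<forall>n. \<forall>v\<in>C n. \<chi> n v \<in> C' n) \<and>
     (\<forall>n. \<forall>v\<in>C n. \<forall>w\<in>C n. \<chi> n (v \<oplus>\<^bsub>G\<^esub> w) = \<chi> n v \<oplus>\<^bsub>G'\<^esub> \<chi> n w) \<and>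
     (\<forall>n p. \<forall>v\<in>C n. \<chi> n (act n p v) = act' n p (\<chi> n v)) \<and>
     (\<forall>n m. \<forall>v\<in>C n. \<chi> m (e n m v) = e' n m (\<chi> n v))"

lemma ohomD:
  assumes "ohom \<chi>" "v \<in> C n"
  shows "\<chi> n v \<in> C' n" "w \<in> C n \<Longrightarrow> \<chi> n (v \<oplus>\<^bsub>G\<^esub> w) = \<chi> n v \<oplus>\<^bsub>G'\<^esub> \<chi> n w"
    "\<chi> n (act n p v) = act' n p (\<chi> n v)" "\<chi> m (e n m v) = e' n m (\<chi> n v)"
  using assms unfolding ohom_def by blast+

sublocale P: gmod_pair "edge \<beta>" X X'
  by (intro gmod_pair.intro A.X.gmod_axioms B.X.gmod_axioms)

lemma hom_unique:
  assumes h: "h \<in> gr_hom (gwa (edge \<beta>)) X X'" "h' \<in> gr_hom (gwa (edge \<beta>)) X X'"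
    and "\<And>n v. v \<in> C n \<Longrightarrow> h (\<theta> n v) = h' (\<theta> n v)"
  shows "h = h'"
proof (rule P.gr_hom_ext[OF h])
  fix i m assume "m \<in> mpart X i"
  then show "h m = h' m" using A.\<theta>_surj assms(3) by blast
qed

lemma hom_of_ohom:
  assumes "ohom \<chi>"
  shows "\<exists>h\<in>gr_hom (gwa (edge \<beta>)) X X'. \<forall>n. \<forall>v\<in>C n. h (\<theta> n v) = \<theta>' n (\<chi> n v)"
proof -
  note \<chi> = ohomD[OF assms]
  define \<psi> where "\<psi> n x = \<theta>' n (\<chi> n (inv_into (C n) (\<theta> n) x))" for n x
  have \<psi>: "\<psi> n (\<theta> n v) = \<theta>' n (\<chi> n v)" if "v \<in> C n" for n v
    using A.bij[of n] that unfolding \<psi>_def bij_betw_def by simp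
  have 1: "\<psi> i v \<in> mpart X' i" if "v \<in> mpart X i" for i v
    using A.\<theta>_surj[OF that] \<psi> \<chi>(1) B.\<theta>_mpart by auto
  have 2: "\<psi> i (v \<oplus>\<^bsub>X\<^esub> w) = \<psi> i v \<oplus>\<^bsub>X'\<^esub> \<psi> i w" if vw: "v \<in> mpart X i" "w \<in> mpart X i" for i v w
  proof -
    obtain v' where "v' \<in> C i" "v = \<theta> i v'" using A.\<theta>_surj[OF vw(1)] by blast
    moreover obtain w' where "w' \<in> C i" "w = \<theta> i w'" using A.\<theta>_surj[OF vw(2)] by blast
    ultimately show ?thesis using \<psi> \<chi>(1,2) B.\<theta>_add A.R.C_add by (simp flip: A.\<theta>_add)
  qed
  have 3: "\<psi> i (tact (edge \<beta>) X i p v) = tact (edge \<beta>) X' i p (\<psi> i v)" if v: "v \<in> mpart X i" for i v p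
  proof -
    obtain w where "w \<in> C i" "v = \<theta> i w" using A.\<theta>_surj[OF v] by blast
    then show ?thesis using \<psi> \<chi>(1,3) B.\<theta>_act A.R.act_C by (simp flip: A.\<theta>_act)
  qed
  have 4: "\<psi> j (mmap (edge \<beta>) X i j v) = mmap (edge \<beta>) X' i j (\<psi> i v)" if v: "v \<in> mpart X i" for i j v
  proof -
    obtain w where "w \<in> C i" "v = \<theta> i w" using A.\<theta>_surj[OF v] by blast
    then show ?thesis using \<psi> \<chi>(1,4) B.\<theta>_e A.R.e_C by (simp flip: A.\<theta>_e)
  qed
  have hom: "P.hom_of \<psi> \<in> gr_hom (gwa (edge \<beta>)) X X'" "\<And>m i. m \<in> mpart X i \<Longrightarrow> P.hom_of \<psi> m = \<psi> i m"
    using P.hom_of[of \<psi>, OF 1 2 3 4] by blast+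
  show ?thesis using hom(1) hom(2)[OF A.\<theta>_mpart] \<psi> by (intro bexI[of _ "P.hom_of \<psi>"]) auto
qed

lemma ohom_of_hom:
  assumes h: "h \<in> gr_hom (gwa (edge \<beta>)) X X'"
  shows "\<exists>\<chi>. ohom \<chi> \<and> (\<forall>n. \<forall>v\<in>C n. h (\<theta> n v) = \<theta>' n (\<chi> n v))"
proof -
  define \<chi> where "\<chi> n v = inv_into (C' n) (\<theta>' n) (h (\<theta> n v))" for n v
  have \<chi>: "\<chi> n v \<in> C' n" "h (\<theta> n v) = \<theta>' n (\<chi> n v)" if "v \<in> C n" for n v
  proof -
    have "h (\<theta> n v) \<in> \<theta>' n ` C' n"
      using gr_homD(5)[OF h A.\<theta>_mpart[OF that]] B.bij[of n] unfolding bij_betw_def by blast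
    then show "\<chi> n v \<in> C' n" "h (\<theta> n v) = \<theta>' n (\<chi> n v)"
      unfolding \<chi>_def by (simp_all add: inv_into_into f_inv_into_f)
  qed
  have "ohom \<chi>"
    unfolding ohom_def
  proof (intro conjI allI ballI)
    fix n v assume v: "v \<in> C n"
    show "\<chi> n v \<in> C' n" using \<chi> v by blast
    note vX = A.\<theta>_mpart[OF v]
    show "\<chi> n (act n p v) = act' n p (\<chi> n v)" for p
      using v \<chi>[OF v] \<chi>[OF A.R.act_C[OF v]] P.gr_hom_tact[OF h A.X.mpart_carrier[OF vX]]
      by (intro B.\<theta>_inj[of _ n]) (simp_all add: A.\<theta>_act B.\<theta>_act B.R.act_C)
    show "\<chi> m (e n m v) = e' n m (\<chi> n v)" for m
      using v \<chi>[OF v] \<chi>[OF A.R.e_C[OF v]] P.gr_hom_mmap[OF h vX]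
      by (intro B.\<theta>_inj[of _ m]) (simp_all add: A.\<theta>_e B.\<theta>_e B.R.e_C)
    fix w assume w: "w \<in> C n"
    show "\<chi> n (v \<oplus>\<^bsub>G\<^esub> w) = \<chi> n v \<oplus>\<^bsub>G'\<^esub> \<chi> n w"
      using v w \<chi>[OF v] \<chi>[OF w] \<chi>[OF A.R.C_add[OF v w]] A.X.mpart_carrier[OF vX] A.X.mpart_carrier[OF A.\<theta>_mpart[OF w]]
      by (intro B.\<theta>_inj[of _ n]) (simp_all add: A.\<theta>_add B.\<theta>_add B.R.C_add gr_homD(3)[OF h])
  qed
  then show ?thesis using \<chi>(2) by blast
qed

end

subsection \<open>The functor on objects\<close>

locale grmod_inf = grmod \<alpha> M for \<alpha> and M :: "('k::field_char_0 free_alg set, 'm) gmodule" +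
  assumes inf: "infinite (UNIV :: 'm set)"
begin

lemma total_gsub:
  assumes "O.oclosed Q"
  shows "gsub (edge \<alpha>) M (total Q)" "total Q \<inter> mpart M k = Q k"
proof -
  note Q = O.oclosedD[OF assms]
  show "gsub (edge \<alpha>) M (total Q)"
    unfolding gsub_def
  proof (intro conjI ballI allI)
    show "submodule_closed (gwa (edge \<alpha>)) (total Q) M" by (rule total_submodule[OF assms])
    fix n i assume n: "n \<in> total Q"
    then have "n \<in> carrier M" "\<And>i. hcomp M n i \<in> Q i" unfolding total_def by auto
    then show "hcomp M n i \<in> total Q"
      using hcomp_homog[OF hcomp_mpart[of n i]] Q(2) unfolding total_def by simp
  qed
  show "total Q \<inter> mpart M k = Q k"
  proof (intro equalityI subsetI)
    fix v assume v: "v \<in> total Q \<inter> mpart M k"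
    then have "hcomp M v k \<in> Q k" unfolding total_def by simp
    moreover have "hcomp M v k = v" using v hcomp_homog[of v k k] by simp
    ultimately show "v \<in> Q k" by (simp only:)
  next
    fix v assume v: "v \<in> Q k"
    then have "v \<in> mpart M k" by (rule Q(1))
    then show "v \<in> total Q \<inter> mpart M k"
      using hcomp_homog[of v k] mpart_carrier v Q(2) unfolding total_def by auto
  qed
qed

definition is_real where
  "is_real X \<theta> \<longleftrightarrow> realized (fun_group M) 0 (O.fam 0) (\<lambda>_. O.pact) (O.tr 0) (X :: ('k free_alg set, 'm) gmodule) \<theta>"

text \<open>The value of the functor at \<open>M\<close>: some module on the given type that realizes the families of \<open>M\<close> at the
  divisors \<open>L 0 n\<close>. The choice is fixed together with the identification \<open>F\<theta>\<close>.\<close>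

definition FX where "FX = (SOME X. \<exists>\<theta>. is_real X \<theta>)"

definition F\<theta> where "F\<theta> = (SOME \<theta>. is_real FX \<theta>)"

lemma F_real: "realized (fun_group M) 0 (O.fam 0) (\<lambda>_. O.pact) (O.tr 0) FX F\<theta>"
proof -
  interpret F: orep "fun_group M" 0 "O.fam 0" "\<lambda>_. O.pact" "O.tr 0" by (rule O.fam_orep)
  have "inj_on (\<lambda>a. (a (i - int \<alpha>), a (i + int 0))) (O.fam 0 i)" for i
    using O.fam_determined[of 0 _ i] by (intro inj_onI) auto
  from F.realization[OF O.fam_0_ofg[OF ofg] inf this]
  obtain X :: "('k free_alg set, 'm) gmodule" and \<theta> where X: "grmod 0 X" "\<forall>n. bij_betw (\<theta> n) (O.fam 0 n) (mpart X n)"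
    "\<forall>n. \<forall>v\<in>O.fam 0 n. \<forall>w\<in>O.fam 0 n. \<theta> n (v \<oplus>\<^bsub>fun_group M\<^esub> w) = \<theta> n v \<oplus>\<^bsub>X\<^esub> \<theta> n w"
    "\<forall>n p. \<forall>v\<in>O.fam 0 n. \<theta> n (O.pact p v) = tact (edge 0) X n p (\<theta> n v)"
    "\<forall>n m. \<forall>v\<in>O.fam 0 n. \<theta> m (O.tr 0 n m v) = mmap (edge 0) X n m (\<theta> n v)"
    by (elim exE conjE) (rule that, assumption+)
  have "is_real X \<theta>"
    unfolding is_real_def
    by (intro realized.intro realized_axioms.intro F.orep_axioms X(1)) (use X(2-) in auto)
  then have "\<exists>\<theta>. is_real FX \<theta>" unfolding FX_def by (rule someI[of "\<lambda>X. \<exists>\<theta>. is_real X \<theta>", OF exI])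
  then have "is_real FX F\<theta>" unfolding F\<theta>_def by (rule someI_ex)
  then show ?thesis unfolding is_real_def .
qed

end

subsection \<open>Representatives of morphisms\<close>

context grmod_inf
begin

text \<open>A cofinite submodule contains everything far out, and that controls the entries of a family.\<close>

lemma cofinite_fam:
  assumes "gsub (edge \<alpha>) M M'" and M': "O.cobounded (\<lambda>k. M' \<inter> mpart M k)" and a: "a \<in> O.fam 0 n"
  shows "a k \<in> M'"
proof -
  obtain K q where Kq: "q \<noteq> 0 \<and> (\<forall>k. \<bar>k\<bar> \<ge> K \<longrightarrow> mpart M k \<subseteq> M' \<inter> mpart M k) \<and>
      (\<forall>k. \<forall>v\<in>mpart M k. tact (edge \<alpha>) M k q v \<in> M' \<inter> mpart M k)"
    using M' unfolding O.cobounded_def by (elim exE)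
  have cl: "O.oclosed (\<lambda>k. M' \<inter> mpart M k)"
    using assms(1) submodule_oclosed unfolding gsub_def by blast
  have "a k \<in> M' \<inter> mpart M k"
  proof (rule O.fam_mem[OF cl a])
    fix j :: int assume "\<bar>j\<bar> \<ge> K"
    then have "mpart M j \<subseteq> M' \<inter> mpart M j" using Kq by simp
    then show "a j \<in> M' \<inter> mpart M j" using O.famD(1)[OF a, of j] by (rule subsetD)
  qed
  then show ?thesis by simp
qed

lemma cofinite_inter:
  assumes 1: "gsub (edge \<alpha>) M M1" "O.cobounded (\<lambda>k. M1 \<inter> mpart M k)"
    and 2: "gsub (edge \<alpha>) M M2" "O.cobounded (\<lambda>k. M2 \<inter> mpart M k)"
  shows "gsub (edge \<alpha>) M (M1 \<inter> M2)" "O.cobounded (\<lambda>k. M1 \<inter> M2 \<inter> mpart M k)"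
proof -
  note d1 = gsubD[OF 1(1)] and d2 = gsubD[OF 2(1)]
  show "gsub (edge \<alpha>) M (M1 \<inter> M2)"
    by (rule gsubI) (use d1(1-5) d2(1-5) in auto)
  obtain K1 q1 where q1: "q1 \<noteq> 0 \<and> (\<forall>k. \<bar>k\<bar> \<ge> K1 \<longrightarrow> mpart M k \<subseteq> M1 \<inter> mpart M k) \<and>
      (\<forall>k. \<forall>v\<in>mpart M k. tact (edge \<alpha>) M k q1 v \<in> M1 \<inter> mpart M k)"
    using 1(2) unfolding O.cobounded_def by (elim exE)
  obtain K2 q2 where q2: "q2 \<noteq> 0 \<and> (\<forall>k. \<bar>k\<bar> \<ge> K2 \<longrightarrow> mpart M k \<subseteq> M2 \<inter> mpart M k) \<and>
      (\<forall>k. \<forall>v\<in>mpart M k. tact (edge \<alpha>) M k q2 v \<in> M2 \<inter> mpart M k)"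
    using 2(2) unfolding O.cobounded_def by (elim exE)
  show "O.cobounded (\<lambda>k. M1 \<inter> M2 \<inter> mpart M k)"
    unfolding O.cobounded_def
  proof (intro exI[of _ "max K1 K2"] exI[of _ "q1 * q2"] conjI allI impI ballI)
    show "q1 * q2 \<noteq> 0" using q1 q2 by simp
    show "mpart M k \<subseteq> M1 \<inter> M2 \<inter> mpart M k" if "\<bar>k\<bar> \<ge> max K1 K2" for k
    proof -
      have "mpart M k \<subseteq> M1 \<inter> mpart M k" "mpart M k \<subseteq> M2 \<inter> mpart M k" using q1 q2 that by simp_all
      then show ?thesis by blast
    qed
    fix k v assume v: "v \<in> mpart M k"
    have "tact (edge \<alpha>) M k (q1 * q2) v = tact (edge \<alpha>) M k q1 (tact (edge \<alpha>) M k q2 v)"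
      "tact (edge \<alpha>) M k (q1 * q2) v = tact (edge \<alpha>) M k q2 (tact (edge \<alpha>) M k q1 v)"
      using O.act_mult[OF v, of q1 q2] O.act_mult[OF v, of q2 q1] by (simp_all add: mult.commute)
    moreover have "tact (edge \<alpha>) M k q1 w \<in> M1 \<inter> mpart M k" "tact (edge \<alpha>) M k q2 w \<in> M2 \<inter> mpart M k"
      if "w \<in> mpart M k" for w
      using q1 q2 that by simp_all
    ultimately show "tact (edge \<alpha>) M k (q1 * q2) v \<in> M1 \<inter> M2 \<inter> mpart M k"
      using v tact_mpart[OF v] by (metis IntD1 IntD2 IntI)
  qed
qed

end

lemma set_add_mem: "x \<in> A <+>\<^bsub>G\<^esub> B \<longleftrightarrow> (\<exists>a\<in>A. \<exists>b\<in>B. x = a \<oplus>\<^bsub>G\<^esub> b)"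
  unfolding set_add_def' by auto

lemma (in gquot) quot_mmap: "m \<in> carrier M \<Longrightarrow> mmap f Q i j (\<pi> m) = \<pi> (mmap f M i j m)"
proof -
  assume m: "m \<in> carrier M"
  have "((\<lambda>v. mact f Q v p) ^^ k) (\<pi> m) = \<pi> (((\<lambda>v. act v p) ^^ k) m) \<and> ((\<lambda>v. act v p) ^^ k) m \<in> carrier M" for p k
    by (induction k) (use m in \<open>auto simp: quot_act\<close>)
  then show ?thesis unfolding mmap_def by auto
qed

locale qpair = M: grmod_inf \<alpha> M + N: grmod_inf \<alpha> N
  for \<alpha> and M N :: "('k::field_char_0 free_alg set, 'm) gmodule"
begin

abbreviation B where "B \<equiv> gwa (edge \<alpha>)"

sublocale F: realized_pair "fun_group M" 0 "M.O.fam 0" "\<lambda>_. M.O.pact" "M.O.tr 0" M.FX M.F\<theta>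
    "fun_group N" "N.O.fam 0" "\<lambda>_. N.O.pact" "N.O.tr 0" N.FX N.F\<theta>
  by (rule realized_pair.intro[OF M.F_real N.F_real])

text \<open>A homomorphism into a quotient is given by a relation \<open>R\<close> between elements and representatives of their images. This
  is convenient because the operations on morphisms are defined through cosets as sets.\<close>

lemma qrepI:
  assumes M': "gsub (edge \<alpha>) M M'" "M.O.cobounded (\<lambda>k. M' \<inter> mpart M k)"
    and N': "gsub (edge \<alpha>) N N'" "N.O.bounded (\<lambda>k. N' \<inter> mpart N k)"
    and ext: "h \<in> extensional M'"
    and ex: "\<And>m. m \<in> M' \<Longrightarrow> \<exists>n. R m n"
    and val: "\<And>m n. m \<in> M' \<Longrightarrow> R m n \<Longrightarrow> n \<in> carrier N \<and> h m = N' +>\<^bsub>N\<^esub> n"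
    and add: "\<And>m n m' n'. \<lbrakk>m \<in> M'; m' \<in> M'; R m n; R m' n'\<rbrakk> \<Longrightarrow> R (m \<oplus>\<^bsub>M\<^esub> m') (n \<oplus>\<^bsub>N\<^esub> n')"
    and act: "\<And>m n p. \<lbrakk>m \<in> M'; R m n\<rbrakk> \<Longrightarrow> R (M.act m p) (N.act n p)"
    and deg: "\<And>m i. \<lbrakk>m \<in> M'; m \<in> mpart M i\<rbrakk> \<Longrightarrow> \<exists>n\<in>mpart N i. R m n"
  shows "(M', N', h) \<in> qreps B M N"
proof -
  interpret Q: gquot "edge \<alpha>" N N'
    by (intro gquot.intro gquot_axioms.intro N.gmod_axioms N'(1))
  note M'D = M.gsubD[OF M'(1)]
  have "h \<in> gr_hom B (sub_module M M') (quot_module N N')"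
  proof (rule gr_homI)
    fix m assume "m \<in> carrier (sub_module M M')"
    then have m: "m \<in> M'" by simp
    obtain n where n: "R m n" using ex[OF m] by blast
    note hn = val[OF m n]
    show "h m \<in> carrier (quot_module N N')" using hn by (auto simp: Q.quot_simps(1))
    show "h (mact (edge \<alpha>) (sub_module M M') m p) = mact (edge \<alpha>) (quot_module N N') (h m) p" for p
      using val[OF M'D(4)[OF m] act[OF m n], of p] hn by (simp add: Q.quot_act)
    fix m' assume "m' \<in> carrier (sub_module M M')"
    then have m': "m' \<in> M'" by simp
    obtain n' where n': "R m' n'" using ex[OF m'] by blast
    show "h (m \<oplus>\<^bsub>sub_module M M'\<^esub> m') = h m \<oplus>\<^bsub>quot_module N N'\<^esub> h m'"
      using val[OF M'D(3)[OF m m'] add[OF m m' n n']] hn val[OF m' n'] by (simp add: Q.quot_simps(4))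
  next
    fix m i assume "m \<in> mpart (sub_module M M') i"
    then have m: "m \<in> M'" "m \<in> mpart M i" by auto
    then show "h m \<in> mpart (quot_module N N') i" using deg[OF m] val[OF m(1)] by (auto simp: Q.quot_simps(3))
  qed (use ext in simp)
  then show ?thesis using M.cofin_subs_iff N.fin_subs_iff M' N' unfolding qreps_def by blast
qed

context
  fixes M' N' h assumes r: "(M', N', h) \<in> qreps B M N"
begin

lemma qrep_subs:
  "gsub (edge \<alpha>) M M'" "M.O.cobounded (\<lambda>k. M' \<inter> mpart M k)"
  "gsub (edge \<alpha>) N N'" "N.O.bounded (\<lambda>k. N' \<inter> mpart N k)"
  using r M.cofin_subs_iff N.fin_subs_iff unfolding qreps_def by auto

lemma qrep_hom: "h \<in> gr_hom B (sub_module M M') (quot_module N N')"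
  using r unfolding qreps_def by auto

text \<open>Conversely membership of \<open>n\<close> in the coset \<open>h m\<close> behaves like an additive relation that is compatible with
  the action and with homogeneous components.\<close>

lemma qrep_rules:
  shows "h \<in> extensional M'"
    and "m \<in> M' \<Longrightarrow> \<exists>n. n \<in> h m"
    and "m \<in> M' \<Longrightarrow> n \<in> h m \<Longrightarrow> n \<in> carrier N \<and> h m = N' +>\<^bsub>N\<^esub> n"
    and "\<lbrakk>m \<in> M'; m' \<in> M'; n \<in> h m; n' \<in> h m'\<rbrakk> \<Longrightarrow> n \<oplus>\<^bsub>N\<^esub> n' \<in> h (m \<oplus>\<^bsub>M\<^esub> m')"
    and "\<lbrakk>m \<in> M'; n \<in> h m\<rbrakk> \<Longrightarrow> N.act n p \<in> h (M.act m p)"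
    and "\<lbrakk>m \<in> M'; m \<in> mpart M i\<rbrakk> \<Longrightarrow> \<exists>n\<in>mpart N i. n \<in> h m"
    and "h \<zero>\<^bsub>M\<^esub> = N'"
    and "\<lbrakk>m \<in> M'; n \<in> h m; n' \<in> h m\<rbrakk> \<Longrightarrow> \<exists>x\<in>N'. n = x \<oplus>\<^bsub>N\<^esub> n'"
    and "\<lbrakk>m \<in> M'; n \<in> h m; x \<in> N'\<rbrakk> \<Longrightarrow> x \<oplus>\<^bsub>N\<^esub> n \<in> h m"
    and "\<lbrakk>m \<in> M'; n \<in> h m\<rbrakk> \<Longrightarrow> hcomp N n i \<in> h (hcomp M m i)"
proof -
  interpret Q: gquot "edge \<alpha>" N N' by (intro gquot.intro gquot_axioms.intro N.gmod_axioms qrep_subs(3))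
  interpret S: gmod "edge \<alpha>" "sub_module M M'" by (rule gmod.intro) (rule M.sub_module_graded[OF qrep_subs(1)])
  interpret QQ: gmod "edge \<alpha>" "quot_module N N'" by (rule gmod.intro) (rule Q.quot_graded)
  interpret P: gmod_pair "edge \<alpha>" "sub_module M M'" "quot_module N N'"
    by (intro gmod_pair.intro S.gmod_axioms QQ.gmod_axioms)
  note M'D = M.gsubD[OF qrep_subs(1)]
  note h = gr_homD[OF qrep_hom]
  show "h \<in> extensional M'" using h(1) by simp
  have rep: "\<exists>n\<in>carrier N. h m = Q.\<pi> n" if "m \<in> M'" for m using h(2)[of m] that by (auto simp: Q.quot_simps(1))
  show ex: "\<exists>n. n \<in> h m" if "m \<in> M'" for m using rep[OF that] Q.coset_self by blast
  show val: "n \<in> carrier N \<and> h m = Q.\<pi> n" if "m \<in> M'" "n \<in> h m" for m n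
    using rep[OF that(1)] that(2) Q.coset_eq Q.coset_carrier by blast
  show add: "n \<oplus>\<^bsub>N\<^esub> n' \<in> h (m \<oplus>\<^bsub>M\<^esub> m')" if "m \<in> M'" "m' \<in> M'" "n \<in> h m" "n' \<in> h m'" for m m' n n'
    using h(3)[of m m'] val[OF that(1,3)] val[OF that(2,4)] that Q.coset_self by (simp add: Q.quot_simps(4))
  show "N.act n p \<in> h (M.act m p)" if "m \<in> M'" "n \<in> h m" for m n p
    using h(4)[of m p] val[OF that] that Q.coset_self by (simp add: Q.quot_act)
  show "\<exists>n\<in>mpart N i. n \<in> h m" if "m \<in> M'" "m \<in> mpart M i" for m i
    using h(5)[of m i] that Q.coset_self N.mpart_carrier by (auto simp: Q.quot_simps(3))
  show "h \<zero>\<^bsub>M\<^esub> = N'" using P.gr_hom_zero[OF qrep_hom] by (simp add: Q.quot_simps(2))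
  show "\<exists>x\<in>N'. n = x \<oplus>\<^bsub>N\<^esub> n'" if "m \<in> M'" "n \<in> h m" "n' \<in> h m" for m n n'
    using val[OF that(1,3)] that(2) Q.mem_coset by blast
  show "x \<oplus>\<^bsub>N\<^esub> n \<in> h m" if "m \<in> M'" "n \<in> h m" "x \<in> N'" for m n x
    using val[OF that(1,2)] that(3) Q.mem_coset by blast
  show "hcomp N n i \<in> h (hcomp M m i)" if mM: "m \<in> M'" and n: "n \<in> h m" for m n i
  proof -
    have eq: "hcomp (quot_module N N') (Q.\<pi> x) i = Q.\<pi> (hcomp N x i)" if "x \<in> carrier N" for x
      using that
    proof (induction rule: N.carrier_induct)
      case (homog j x)
      have "Q.\<pi> x \<in> mpart (quot_module N N') j" using homog by (auto simp: Q.quot_simps(3))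
      from QQ.hcomp_homog[OF this, of i] show ?case
        using N.hcomp_homog[OF homog, of i] Q.coset_zero by (simp add: Q.quot_simps(2))
    next
      case (add x y)
      then show ?case
        using QQ.hcomp_add[of "Q.\<pi> x" "Q.\<pi> y" i] by (simp add: Q.quot_simps(1) Q.quot_simps(4) N.hcomp_add)
    qed
    have eqS: "hcomp (sub_module M M') x i = hcomp M x i" if "x \<in> M'" for x
    proof -
      have "x \<in> carrier (sub_module M M')" using that by simp
      then show ?thesis
      proof (induction rule: S.carrier_induct)
        case (homog j x)
        then show ?case using S.hcomp_homog[OF homog, of i] M.hcomp_homog[of x j i] by simp
      next
        case (add x y)
        then show ?case using S.hcomp_add[of x y i] M.hcomp_add[of x y i] M'D(1) by simp
      qed
    qed
    have "hcomp (quot_module N N') (h m) i = h (hcomp (sub_module M M') m i)"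
      by (rule P.gr_hom_hcomp[OF qrep_hom]) (use mM in simp)
    then have "Q.\<pi> (hcomp N n i) = h (hcomp M m i)" using val[OF mM n] eq eqS[OF mM] by simp
    then show ?thesis using Q.coset_self val[OF mM n] by (metis N.hcomp_carrier)
  qed
qed

lemma qrep_tact: "\<lbrakk>m \<in> M'; n \<in> h m\<rbrakk> \<Longrightarrow> tact (edge \<alpha>) N i p n \<in> h (tact (edge \<alpha>) M i p m)"
  unfolding tact_def by (rule qrep_rules(5))

lemma qrep_mmap: "\<lbrakk>m \<in> M'; n \<in> h m\<rbrakk> \<Longrightarrow> mmap (edge \<alpha>) N i j n \<in> h (mmap (edge \<alpha>) M i j m) \<and> mmap (edge \<alpha>) M i j m \<in> M'"
proof (induction j rule: M.mmap_induct[of _ i])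
  case (up j)
  then show ?case using qrep_rules(5) M.gsubD(4)[OF qrep_subs(1)] by (simp add: M.mmap_up N.mmap_up)
next
  case (down j)
  then show ?case using qrep_rules(5) M.gsubD(4)[OF qrep_subs(1)] by (simp add: M.mmap_down N.mmap_down)
qed simp

lemma qrep_lift:
  assumes "m \<in> M'" "n \<in> h m"
  shows "N.O.lift 0 k i n j \<in> h (M.O.lift 0 k i m j)"
  unfolding M.O.lift_def N.O.lift_def using qrep_mmap[OF assms] qrep_tact by blast

lemma fam_sub: "a \<in> M.O.fam 0 n \<Longrightarrow> a k \<in> M'"
  by (rule M.cofinite_fam[OF qrep_subs(1,2)])

end

text \<open>The difference of the families lies in a bounded subrepresentation.\<close>

lemma fam_eqI:
  assumes S: "gsub (edge \<alpha>) N S" "N.O.bounded (\<lambda>k. S \<inter> mpart N k)"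
    and a: "a \<in> N.O.fam 0 n" and b: "b \<in> N.O.fam 0 n" and d: "\<And>k. \<exists>x\<in>S. a k = x \<oplus>\<^bsub>N\<^esub> b k"
  shows "a = b"
proof -
  have cl: "N.O.oclosed (\<lambda>k. S \<inter> mpart N k)"
    using S(1) N.submodule_oclosed unfolding gsub_def by blast
  let ?c = "\<lambda>k. a k \<oplus>\<^bsub>N\<^esub> N.O.pact (-1) b k"
  have c: "?c \<in> N.O.fam 0 n" using N.O.fam_add[OF a N.O.fam_pact[OF b]] .
  have ab: "a k \<in> carrier N" "b k \<in> carrier N" for k
    using N.O.famD(1)[OF a] N.O.famD(1)[OF b] N.mpart_carrier by blast+
  have neg: "N.O.pact (-1) b k = \<ominus>\<^bsub>N\<^esub> b k" for k
    unfolding N.O.pact_def by (rule N.O.act_uminus[OF N.O.famD(1)[OF b]])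
  have "?c k \<in> S" for k
  proof -
    obtain x where x: "x \<in> S" "a k = x \<oplus>\<^bsub>N\<^esub> b k" using d by blast
    then have "?c k = x" using ab N.gsubD(1)[OF S(1)] by (simp add: neg N.R.M.a_assoc N.R.M.r_neg)
    then show ?thesis using x by simp
  qed
  then have "?c k = \<zero>\<^bsub>N\<^esub>" for k
    by (intro N.O.fam_eq_zero[OF cl S(2) c]) (use N.O.famD(1)[OF c] in blast)
  then have "a k = b k" for k
    unfolding neg using ab by (metis N.R.M.minus_equality N.R.M.minus_minus N.R.M.a_inv_closed)
  then show ?thesis by blast
qed

text \<open>The unique family of \<open>N\<close> that represents the image of a family of \<open>M\<close> under a homomorphism into a quotient of \<open>N\<close>.\<close>

definition induced_map :: "('m \<Rightarrow> 'm set) \<Rightarrow> int \<Rightarrow> (int \<Rightarrow> 'm) \<Rightarrow> int \<Rightarrow> 'm" where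
  "induced_map h n a = (THE b. b \<in> N.O.fam 0 n \<and> (\<forall>k. b k \<in> h (a k)))"

context
  fixes M' N' h assumes r: "(M', N', h) \<in> qreps B M N"
begin

lemma induced_map_unique:
  assumes a: "a \<in> M.O.fam 0 n" and b: "b \<in> N.O.fam 0 n" "\<And>k. b k \<in> h (a k)" "b' \<in> N.O.fam 0 n" "\<And>k. b' k \<in> h (a k)"
  shows "b = b'"
  by (rule fam_eqI[OF qrep_subs(3,4)[OF r] b(1,3)]) (rule qrep_rules(8)[OF r fam_sub[OF r a] b(2,4)])

text \<open>Choose representatives of the images of two entries with coprime round trip factors, and combine
  the families that they generate with the Bezout coefficients.\<close>

lemma induced_map_ex:
  assumes a: "a \<in> M.O.fam 0 n"
  shows "\<exists>b. b \<in> N.O.fam 0 n \<and> (\<forall>k. b k \<in> h (a k))"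
proof -
  let ?k = "n - int \<alpha>"
  obtain u w where uw: "u * cc (L 0 n) (L \<alpha> ?k) (L 0 n) + w * cc (L 0 n) (L \<alpha> n) (L 0 n) = (1::'k poly)"
    by (rule M.O.fam_zero_bezout)
  note aM = fam_sub[OF r a]
  obtain x where x: "x \<in> mpart N ?k" "x \<in> h (a ?k)" using qrep_rules(6)[OF r aM M.O.famD(1)[OF a]] by blast
  obtain y where y: "y \<in> mpart N n" "y \<in> h (a n)" using qrep_rules(6)[OF r aM M.O.famD(1)[OF a]] by blast
  let ?b = "\<lambda>j. N.O.pact u (N.O.lift 0 n ?k x) j \<oplus>\<^bsub>N\<^esub> N.O.pact w (N.O.lift 0 n n y) j"
  have "?b \<in> N.O.fam 0 n" by (intro N.O.fam_add N.O.fam_pact N.O.lift_fam x y)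
  moreover have "?b j \<in> h (a j)" for j
  proof -
    have l: "M.O.lift 0 n ?k (a ?k) j \<in> M'" "M.O.lift 0 n n (a n) j \<in> M'"
      using fam_sub[OF r M.O.lift_fam[OF M.O.famD(1)[OF a]]] by blast+
    have t: "tact (edge \<alpha>) M j p m \<in> M'" if "m \<in> M'" for m p
      unfolding tact_def using M.gsubD(4)[OF qrep_subs(1)[OF r] that] .
    have "?b j \<in> h (tact (edge \<alpha>) M j u (M.O.lift 0 n ?k (a ?k) j) \<oplus>\<^bsub>M\<^esub> tact (edge \<alpha>) M j w (M.O.lift 0 n n (a n) j))"
      unfolding N.O.pact_def
      by (intro qrep_rules(4)[OF r] qrep_tact[OF r] qrep_lift[OF r] aM x(2) y(2) t l)
    also have "tact (edge \<alpha>) M j u (M.O.lift 0 n ?k (a ?k) j) \<oplus>\<^bsub>M\<^esub> tact (edge \<alpha>) M j w (M.O.lift 0 n n (a n) j) = a j"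
      using M.O.act_bezout[OF uw M.O.famD(1)[OF a]] by (simp add: M.O.lift_proj_same[OF a] M.O.pact_def)
    finally show ?thesis .
  qed
  ultimately show ?thesis by blast
qed

lemma induced_map:
  assumes "a \<in> M.O.fam 0 n"
  shows "induced_map h n a \<in> N.O.fam 0 n" "induced_map h n a k \<in> h (a k)"
proof -
  have "\<exists>!b. b \<in> N.O.fam 0 n \<and> (\<forall>k. b k \<in> h (a k))"
    using induced_map_ex[OF assms] induced_map_unique[OF assms] by (intro ex_ex1I) auto
  from theI'[OF this] show "induced_map h n a \<in> N.O.fam 0 n" "induced_map h n a k \<in> h (a k)" unfolding induced_map_def by auto
qed

lemma induced_map_eqI: "\<lbrakk>a \<in> M.O.fam 0 n; b \<in> N.O.fam 0 n; \<And>k. b k \<in> h (a k)\<rbrakk> \<Longrightarrow> induced_map h n a = b"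
  by (rule induced_map_unique[OF _ induced_map(1) induced_map(2)])

lemma induced_map_ohom: "F.ohom (induced_map h)"
  unfolding F.ohom_def
proof (intro conjI allI ballI)
  fix n a assume a: "a \<in> M.O.fam 0 n"
  note aM = fam_sub[OF r a] and p = induced_map[OF a]
  show "induced_map h n a \<in> N.O.fam 0 n" by (rule p(1))
  show "induced_map h n (M.O.pact q a) = N.O.pact q (induced_map h n a)" for q
    by (rule induced_map_eqI[OF M.O.fam_pact[OF a] N.O.fam_pact[OF p(1)]])
      (unfold M.O.pact_def N.O.pact_def, rule qrep_tact[OF r aM p(2)])
  show "induced_map h m (M.O.tr 0 n m a) = N.O.tr 0 n m (induced_map h n a)" for m
    by (rule induced_map_eqI[OF M.O.fam_tr[OF a] N.O.fam_tr[OF p(1)]])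
      (unfold M.O.tr_def N.O.tr_def, rule qrep_tact[OF r aM p(2)])
  fix b assume b: "b \<in> M.O.fam 0 n"
  show "induced_map h n (a \<oplus>\<^bsub>fun_group M\<^esub> b) = induced_map h n a \<oplus>\<^bsub>fun_group N\<^esub> induced_map h n b"
    unfolding fun_group_simps
    by (rule induced_map_eqI[OF M.O.fam_add[OF a b] N.O.fam_add[OF p(1) induced_map(1)[OF b]]])
      (rule qrep_rules(4)[OF r aM fam_sub[OF r b] p(2) induced_map(2)[OF b]])
qed

end

text \<open>The homomorphism that the functor assigns to a representative of a morphism.\<close>

definition induced_hom :: "'m qrep \<Rightarrow> 'm \<Rightarrow> 'm" where
  "induced_hom r = (THE g. g \<in> gr_hom (gwa (edge 0)) M.FX N.FX \<and>
     (\<forall>n. \<forall>a\<in>M.O.fam 0 n. g (M.F\<theta> n a) = N.F\<theta> n (induced_map (snd (snd r)) n a)))"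

lemma induced_hom_unique:
  assumes "g \<in> gr_hom (gwa (edge 0)) M.FX N.FX" "\<forall>n. \<forall>a\<in>M.O.fam 0 n. g (M.F\<theta> n a) = N.F\<theta> n (induced_map (snd (snd r)) n a)"
  shows "induced_hom r = g"
  unfolding induced_hom_def using assms by (intro the_equality conjI) (auto intro: F.hom_unique)

lemma induced_hom:
  assumes r: "r \<in> qreps B M N"
  shows "induced_hom r \<in> gr_hom (gwa (edge 0)) M.FX N.FX"
    "a \<in> M.O.fam 0 n \<Longrightarrow> induced_hom r (M.F\<theta> n a) = N.F\<theta> n (induced_map (snd (snd r)) n a)"
proof -
  obtain M' N' h where eq: "r = (M', N', h)" by (cases r)
  obtain g where g: "g \<in> gr_hom (gwa (edge 0)) M.FX N.FX"
    "\<forall>n. \<forall>a\<in>M.O.fam 0 n. g (M.F\<theta> n a) = N.F\<theta> n (induced_map (snd (snd r)) n a)"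
    using F.hom_of_ohom[OF induced_map_ohom[OF r[unfolded eq]]] unfolding eq by auto
  have "induced_hom r = g" by (rule induced_hom_unique[OF g])
  then show "induced_hom r \<in> gr_hom (gwa (edge 0)) M.FX N.FX"
    "a \<in> M.O.fam 0 n \<Longrightarrow> induced_hom r (M.F\<theta> n a) = N.F\<theta> n (induced_map (snd (snd r)) n a)"
    using g by auto
qed

lemma induced_hom_eq_iff:
  assumes r: "(M1, N1, h1) \<in> qreps B M N" and r': "(M2, N2, h2) \<in> qreps B M N"
  shows "induced_hom (M1, N1, h1) = induced_hom (M2, N2, h2) \<longleftrightarrow> (\<forall>n. \<forall>a\<in>M.O.fam 0 n. induced_map h1 n a = induced_map h2 n a)"
proof
  assume eq: "induced_hom (M1, N1, h1) = induced_hom (M2, N2, h2)"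
  show "\<forall>n. \<forall>a\<in>M.O.fam 0 n. induced_map h1 n a = induced_map h2 n a"
  proof (intro allI ballI)
    fix n a assume a: "a \<in> M.O.fam 0 n"
    show "induced_map h1 n a = induced_map h2 n a"
      using induced_hom(2)[OF r a] induced_hom(2)[OF r' a] eq by (intro F.B.\<theta>_inj[OF induced_map(1)[OF r a] induced_map(1)[OF r' a]]) simp
  qed
next
  assume eq: "\<forall>n. \<forall>a\<in>M.O.fam 0 n. induced_map h1 n a = induced_map h2 n a"
  show "induced_hom (M1, N1, h1) = induced_hom (M2, N2, h2)"
    by (rule induced_hom_unique[OF induced_hom(1)[OF r']]) (use eq induced_hom(2)[OF r'] in auto)
qed

lemma set_add_coset:
  assumes S: "gsub (edge \<alpha>) N S" and N1: "gsub (edge \<alpha>) N N1" "N1 \<subseteq> S" and n: "n \<in> carrier N"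
  shows "S <+>\<^bsub>N\<^esub> (N1 +>\<^bsub>N\<^esub> n) = S +>\<^bsub>N\<^esub> n"
proof -
  interpret S: gquot "edge \<alpha>" N S by (intro gquot.intro gquot_axioms.intro N.gmod_axioms S)
  interpret Q: gquot "edge \<alpha>" N N1 by (intro gquot.intro gquot_axioms.intro N.gmod_axioms N1(1))
  show ?thesis
  proof (intro equalityI subsetI)
    fix x assume "x \<in> S <+>\<^bsub>N\<^esub> (N1 +>\<^bsub>N\<^esub> n)"
    then obtain s y where sy: "s \<in> S" "y \<in> N1" "x = s \<oplus>\<^bsub>N\<^esub> (y \<oplus>\<^bsub>N\<^esub> n)"
      using Q.mem_coset[OF n] by (auto simp: set_add_mem)
    then have "x = (s \<oplus>\<^bsub>N\<^esub> y) \<oplus>\<^bsub>N\<^esub> n" using S.N_simps(1) N1(2) n by (simp add: N.R.M.a_assoc subset_iff)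
    moreover have "s \<oplus>\<^bsub>N\<^esub> y \<in> S" using sy N1(2) S.N_simps(3) by blast
    ultimately show "x \<in> S +>\<^bsub>N\<^esub> n" using S.mem_coset[OF n] by blast
  next
    fix x assume "x \<in> S +>\<^bsub>N\<^esub> n"
    then obtain s where "s \<in> S" "x = s \<oplus>\<^bsub>N\<^esub> n" using S.mem_coset[OF n] by blast
    then show "x \<in> S <+>\<^bsub>N\<^esub> (N1 +>\<^bsub>N\<^esub> n)" using Q.coset_self[OF n] by (auto simp: set_add_mem)
  qed
qed

text \<open>Finite-dimensional submodules generate no families.\<close>

lemma tors_sub:
  assumes "gsub (edge \<alpha>) N N1" "N.O.bounded (\<lambda>k. N1 \<inter> mpart N k)"
  shows "N1 \<subseteq> N.total N.O.tors"
proof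
  fix x assume x: "x \<in> N1"
  have cl: "N.O.oclosed (\<lambda>k. N1 \<inter> mpart N k)"
    using assms(1) N.submodule_oclosed unfolding gsub_def by blast
  have "hcomp N x i \<in> N.O.tors i" for i
    using N.O.bounded_tors[OF cl assms(2), of i] N.gsubD(5)[OF assms(1) x, of i] N.hcomp_mpart[OF N.gsubD(1)[OF assms(1) x], of i]
    by blast
  then show "x \<in> N.total N.O.tors" using N.gsubD(1)[OF assms(1) x] unfolding N.total_def by blast
qed

lemma torsion_sub:
  "gsub (edge \<alpha>) N (N.total N.O.tors)" "N.O.bounded (\<lambda>k. N.total N.O.tors \<inter> mpart N k)"
  using N.total_gsub[OF N.O.tors_oclosed] N.O.tors_bounded[OF N.ofg] by simp_all

text \<open>Equivalent representatives agree on a cofinite submodule up to a finite-dimensional one, hence on families. Conversely,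
  if two representatives induce the same map of families, then their values at an element generate the same
  families, so they differ by torsion, and all torsion elements together form a finite-dimensional submodule.\<close>

lemma induced_hom_qrel:
  assumes r: "(M1, N1, h1) \<in> qreps B M N" and r': "(M2, N2, h2) \<in> qreps B M N"
  shows "((M1, N1, h1), (M2, N2, h2)) \<in> qrel B M N \<longleftrightarrow> induced_hom (M1, N1, h1) = induced_hom (M2, N2, h2)"
proof
  assume "((M1, N1, h1), (M2, N2, h2)) \<in> qrel B M N"
  then obtain M0 N0 where M0: "M0 \<in> cofin_subs B M" "M0 \<subseteq> M1 \<inter> M2" and N0: "N0 \<in> fin_subs B N" "N1 \<union> N2 \<subseteq> N0"
    and eq: "\<And>m. m \<in> M0 \<Longrightarrow> N0 <+>\<^bsub>N\<^esub> h1 m = N0 <+>\<^bsub>N\<^esub> h2 m"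
    unfolding qrel_def by auto
  have N0': "gsub (edge \<alpha>) N N0" "N.O.bounded (\<lambda>k. N0 \<inter> mpart N k)" using N0(1) N.fin_subs_iff by blast+
  have M0': "gsub (edge \<alpha>) M M0" "M.O.cobounded (\<lambda>k. M0 \<inter> mpart M k)" using M0(1) M.cofin_subs_iff by blast+
  show "induced_hom (M1, N1, h1) = induced_hom (M2, N2, h2)"
    unfolding induced_hom_eq_iff[OF r r']
  proof (intro allI ballI)
    fix n a assume a: "a \<in> M.O.fam 0 n"
    have aM: "a k \<in> M0" for k by (rule M.cofinite_fam[OF M0' a])
    show "induced_map h1 n a = induced_map h2 n a"
    proof (rule fam_eqI[OF N0' induced_map(1)[OF r a] induced_map(1)[OF r' a]])
      fix k
      note b1 = induced_map(2)[OF r a, of k] and b2 = induced_map(2)[OF r' a, of k]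
      have c1: "induced_map h1 n a k \<in> carrier N" and c2: "induced_map h2 n a k \<in> carrier N"
        using qrep_rules(3)[OF r fam_sub[OF r a] b1] qrep_rules(3)[OF r' fam_sub[OF r' a] b2] by blast+
      have "induced_map h1 n a k \<in> N0 <+>\<^bsub>N\<^esub> h1 (a k)"
        unfolding set_add_mem using N.gsubD(2)[OF N0'(1)] b1 c1
        by (intro bexI[of _ "\<zero>\<^bsub>N\<^esub>"] bexI[of _ "induced_map h1 n a k"]) auto
      then obtain x y where xy: "x \<in> N0" "y \<in> h2 (a k)" "induced_map h1 n a k = x \<oplus>\<^bsub>N\<^esub> y"
        unfolding eq[OF aM] set_add_mem by blast
      obtain z where z: "z \<in> N2" "y = z \<oplus>\<^bsub>N\<^esub> induced_map h2 n a k"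
        using qrep_rules(8)[OF r' fam_sub[OF r' a] xy(2) b2] by blast
      have "z \<in> N0" using z N0(2) by blast
      then show "\<exists>x\<in>N0. induced_map h1 n a k = x \<oplus>\<^bsub>N\<^esub> induced_map h2 n a k"
        using xy z c2 N.gsubD(1,3)[OF N0'(1)]
        by (intro bexI[of _ "x \<oplus>\<^bsub>N\<^esub> z"]) (auto simp: N.R.M.a_assoc)
    qed
  qed
next
  assume eq: "induced_hom (M1, N1, h1) = induced_hom (M2, N2, h2)"
  then have eq: "\<And>n a. a \<in> M.O.fam 0 n \<Longrightarrow> induced_map h1 n a = induced_map h2 n a" unfolding induced_hom_eq_iff[OF r r'] by blast
  let ?N0 = "N.total N.O.tors"
  note g1 = qrep_subs[OF r] and g2 = qrep_subs[OF r']
  note d1 = M.gsubD[OF g1(1)] and d2 = M.gsubD[OF g2(1)]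
  note I = M.cofinite_inter[OF g1(1,2) g2(1,2)]
  have key: "\<exists>x\<in>?N0. n1 = x \<oplus>\<^bsub>N\<^esub> n2" if m: "m \<in> M1 \<inter> M2" and n: "n1 \<in> h1 m" "n2 \<in> h2 m" for m n1 n2
  proof -
    have c: "n1 \<in> carrier N" "n2 \<in> carrier N"
      using qrep_rules(3)[OF r _ n(1)] qrep_rules(3)[OF r' _ n(2)] m by blast+
    \<comment> \<open>the difference of the two values is torsion in every degree\<close>
    let ?x = "n1 \<oplus>\<^bsub>N\<^esub> \<ominus>\<^bsub>N\<^esub> n2"
    have "hcomp N ?x i \<in> N.O.tors i" for i
    proof -
      define m' x1 x2 where "m' = hcomp M m i" and "x1 = hcomp N n1 i" and "x2 = hcomp N n2 i"
      have m': "m' \<in> M1" "m' \<in> M2" "m' \<in> mpart M i" unfolding m'_def using m d1(5) d2(5) M.hcomp_mpart[OF d1(1)] by auto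
      have x: "x1 \<in> mpart N i" "x2 \<in> mpart N i" "x1 \<in> h1 m'" "x2 \<in> h2 m'"
        unfolding x1_def x2_def m'_def using N.hcomp_mpart c qrep_rules(10)[OF r _ n(1)] qrep_rules(10)[OF r' _ n(2)] m by auto
      have lift: "N.O.lift 0 k i x1 = N.O.lift 0 k i x2" for k
      proof -
        note f = M.O.lift_fam[OF m'(3), of 0 k]
        have "induced_map h1 k (M.O.lift 0 k i m') = N.O.lift 0 k i x1"
          by (rule induced_map_eqI[OF r f N.O.lift_fam[OF x(1)]]) (rule qrep_lift[OF r m'(1) x(3)])
        moreover have "induced_map h2 k (M.O.lift 0 k i m') = N.O.lift 0 k i x2"
          by (rule induced_map_eqI[OF r' f N.O.lift_fam[OF x(2)]]) (rule qrep_lift[OF r' m'(2) x(4)])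
        ultimately show ?thesis using eq[OF f] by simp
      qed
      have xc: "N.O.lift 0 k i x2 j \<in> carrier N" for k j
        using N.O.famD(1)[OF N.O.lift_fam[OF x(2)]] N.mpart_carrier by blast
      have "hcomp N ?x i = x1 \<oplus>\<^bsub>N\<^esub> tact (edge \<alpha>) N i (-1) x2"
        unfolding x1_def x2_def using c N.hcomp_mpart[OF c(2)] by (simp add: N.hcomp_add N.hcomp_minus N.O.act_uminus)
      moreover have "N.O.lift 0 k i (x1 \<oplus>\<^bsub>N\<^esub> tact (edge \<alpha>) N i (-1) x2) = (\<lambda>_. \<zero>\<^bsub>N\<^esub>)" for k
      proof -
        have "tact (edge \<alpha>) N j (-1) (N.O.lift 0 k i x2 j) = \<ominus>\<^bsub>N\<^esub> N.O.lift 0 k i x2 j" for j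
          by (rule N.O.act_uminus[OF N.O.famD(1)[OF N.O.lift_fam[OF x(2)]]])
        then show ?thesis
          using x xc by (simp add: N.O.lift_add N.O.lift_act N.tact_mpart N.O.pact_def lift N.R.M.r_neg)
      qed
      ultimately show ?thesis unfolding N.O.tors_def using x N.tact_mpart N.mpart_add by simp
    qed
    then have "?x \<in> ?N0" unfolding N.total_def using c by simp
    moreover have "n1 = ?x \<oplus>\<^bsub>N\<^esub> n2" using c by (simp add: N.R.M.a_assoc N.R.M.l_neg)
    ultimately show ?thesis by blast
  qed
  interpret S: gquot "edge \<alpha>" N ?N0 by (intro gquot.intro gquot_axioms.intro N.gmod_axioms torsion_sub(1))
  have "?N0 <+>\<^bsub>N\<^esub> h1 m = ?N0 <+>\<^bsub>N\<^esub> h2 m" if m: "m \<in> M1 \<inter> M2" for m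
  proof -
    obtain n1 n2 where n: "n1 \<in> h1 m" "n2 \<in> h2 m" using m qrep_rules(2)[OF r] qrep_rules(2)[OF r'] by blast
    have v1: "n1 \<in> carrier N" "h1 m = N1 +>\<^bsub>N\<^esub> n1" and v2: "n2 \<in> carrier N" "h2 m = N2 +>\<^bsub>N\<^esub> n2"
      using qrep_rules(3)[OF r _ n(1)] qrep_rules(3)[OF r' _ n(2)] m by auto
    have "?N0 +>\<^bsub>N\<^esub> n1 = ?N0 +>\<^bsub>N\<^esub> n2" using S.coset_eq_iff[OF v1(1) v2(1)] key[OF m n] by blast
    then show ?thesis
      unfolding v1(2) v2(2)
      using set_add_coset[OF torsion_sub(1) g1(3) tors_sub[OF g1(3,4)] v1(1)]
        set_add_coset[OF torsion_sub(1) g2(3) tors_sub[OF g2(3,4)] v2(1)] by simp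
  qed
  moreover have "M1 \<inter> M2 \<in> cofin_subs B M" using M.cofin_subs_iff I by blast
  moreover have "?N0 \<in> fin_subs B N" using N.fin_subs_iff torsion_sub by blast
  moreover have "N1 \<union> N2 \<subseteq> ?N0" using tors_sub[OF g1(3,4)] tors_sub[OF g2(3,4)] by blast
  ultimately show "((M1, N1, h1), (M2, N2, h2)) \<in> qrel B M N"
    unfolding qrel_def using r r' by blast
qed

text \<open>Given a map of families, let \<open>val i v \<beta>\<close> mean that \<open>\<beta>\<close> is a possible value at \<open>v\<close>: the families generated by
  \<open>v\<close> are mapped to those generated by \<open>\<beta>\<close>. The value is unique up to torsion, and it exists for all entries
  of families, since the families generated by an entry are multiples of the family itself. So its domain is cofinite.\<close>

lemma induced_hom_surj:
  assumes g: "g \<in> gr_hom (gwa (edge 0)) M.FX N.FX"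
  shows "\<exists>r\<in>qreps B M N. induced_hom r = g"
proof -
  obtain \<chi> where \<chi>0: "F.ohom \<chi>" and g\<chi>: "\<And>n a. a \<in> M.O.fam 0 n \<Longrightarrow> g (M.F\<theta> n a) = N.F\<theta> n (\<chi> n a)"
    using F.ohom_of_hom[OF g] by blast
  note \<chi> = F.ohomD[OF \<chi>0]
  define val where "val i v \<beta> \<longleftrightarrow> \<beta> \<in> mpart N i \<and> (\<forall>n. \<chi> n (M.O.lift 0 n i v) = N.O.lift 0 n i \<beta>)" for i v \<beta>
  have vadd: "val i (v \<oplus>\<^bsub>M\<^esub> w) (\<beta> \<oplus>\<^bsub>N\<^esub> \<gamma>)" if "val i v \<beta>" "val i w \<gamma>" "v \<in> mpart M i" "w \<in> mpart M i" for i v w \<beta> \<gamma>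
    using that \<chi>(2)[OF M.O.lift_fam[OF that(3)] M.O.lift_fam[OF that(4)]] unfolding val_def
    by (simp add: M.O.lift_add N.O.lift_add N.mpart_add)
  have vact: "val i (tact (edge \<alpha>) M i p v) (tact (edge \<alpha>) N i p \<beta>)" if "val i v \<beta>" "v \<in> mpart M i" for i v \<beta> p
    using that \<chi>(3)[OF M.O.lift_fam[OF that(2)]] unfolding val_def
    by (simp add: M.O.lift_act N.O.lift_act N.tact_mpart)
  have ve: "val j (mmap (edge \<alpha>) M i j v) (mmap (edge \<alpha>) N i j \<beta>)" if "val i v \<beta>" "v \<in> mpart M i" for i j v \<beta>
    using that \<chi>(3)[OF M.O.lift_fam[OF that(2)]] unfolding val_def
    by (simp add: M.O.lift_e N.O.lift_e N.mmap_mpart)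
  have vz: "val i \<zero>\<^bsub>M\<^esub> \<zero>\<^bsub>N\<^esub>" for i
  proof -
    have "\<chi> n (\<lambda>_. \<zero>\<^bsub>M\<^esub>) = (\<lambda>_. \<zero>\<^bsub>N\<^esub>)" for n
    proof -
      have "M.O.pact 0 (\<lambda>_. \<zero>\<^bsub>M\<^esub>) = (\<lambda>_. \<zero>\<^bsub>M\<^esub>)" by (simp add: M.O.pact_def)
      then have "\<chi> n (\<lambda>_. \<zero>\<^bsub>M\<^esub>) = N.O.pact 0 (\<chi> n (\<lambda>_. \<zero>\<^bsub>M\<^esub>))"
        using \<chi>(3)[OF M.O.fam_zero[of 0 n], where p = 0] by simp
      then show ?thesis using N.O.famD(1)[OF \<chi>(1)[OF M.O.fam_zero]] by (simp add: N.O.pact_def)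
    qed
    then show ?thesis unfolding val_def by (simp add: N.mpart_zero)
  qed
  have vfam: "val k (a k) (\<chi> n a k)" if a: "a \<in> M.O.fam 0 n" for a n k
  proof -
    have "\<chi> m (M.O.lift 0 m k (a k)) = N.O.lift 0 m k (\<chi> n a k)" for m
      using \<chi>(3)[OF M.O.fam_tr[OF a]] \<chi>(4)[OF a] by (simp add: M.O.lift_proj[OF a] N.O.lift_proj[OF \<chi>(1)[OF a]])
    then show ?thesis unfolding val_def using N.O.famD(1)[OF \<chi>(1)[OF a]] by blast
  qed
  define Q where "Q = (\<lambda>k. {m. m \<in> mpart M k \<and> (\<exists>\<beta>. val k m \<beta>)})"
  have Qm: "m \<in> Q k \<longleftrightarrow> m \<in> mpart M k \<and> (\<exists>\<beta>. val k m \<beta>)" for m k by (simp add: Q_def)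
  have Q: "M.O.oclosed Q"
  proof (rule M.O.oclosedI, goal_cases)
    case 1 then show ?case by (simp add: Qm)
  next
    case 2 show ?case unfolding Qm using vz M.mpart_zero by blast
  next
    case 3 then show ?case unfolding Qm using vadd M.mpart_add by blast
  next
    case 4 then show ?case unfolding Qm using vact M.tact_mpart by blast
  next
    case 5 then show ?case unfolding Qm using ve M.mmap_mpart by blast
  qed
  have famQ: "a k \<in> Q k" if "a \<in> M.O.fam 0 n" for a n k
    unfolding Qm using vfam[OF that] M.O.famD(1)[OF that] by blast
  have cob: "M.O.cobounded Q"
  proof (rule M.O.torsion_cobounded[OF M.ofg Q])
    fix k v assume v: "v \<in> mpart M k"
    show "tact (edge \<alpha>) M k (rr \<alpha> k) v \<in> Q k"
      using famQ[OF M.O.lift_fam[OF v, of 0 k], of k] by (simp add: M.O.lift_rr[OF v])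
  qed
  let ?M0 = "M.total Q" and ?N0 = "N.total N.O.tors"
  note M0 = M.total_gsub[OF Q]
  interpret S: gmod "edge \<alpha>" "sub_module M ?M0" by (rule gmod.intro) (rule M.sub_module_graded[OF M0(1)])
  interpret T: gquot "edge \<alpha>" N ?N0 by (intro gquot.intro gquot_axioms.intro N.gmod_axioms torsion_sub(1))
  interpret TQ: gmod "edge \<alpha>" "quot_module N ?N0" by (rule gmod.intro) (rule T.quot_graded)
  interpret P: gmod_pair "edge \<alpha>" "sub_module M ?M0" "quot_module N ?N0"
    by (intro gmod_pair.intro S.gmod_axioms TQ.gmod_axioms)
  have vuniq: "T.\<pi> \<beta> = T.\<pi> \<gamma>" if "val i v \<beta>" "val i v \<gamma>" for i v \<beta> \<gamma>
  proof -
    have bg: "\<beta> \<in> mpart N i" "\<gamma> \<in> mpart N i" "\<And>n. N.O.lift 0 n i \<beta> = N.O.lift 0 n i \<gamma>"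
      using that unfolding val_def by auto
    note c = N.mpart_carrier[OF bg(1)] N.mpart_carrier[OF bg(2)]
    let ?x = "\<beta> \<oplus>\<^bsub>N\<^esub> tact (edge \<alpha>) N i (-1) \<gamma>"
    have "N.O.lift 0 k i ?x = (\<lambda>_. \<zero>\<^bsub>N\<^esub>)" for k
    proof -
      have "tact (edge \<alpha>) N j (-1) (N.O.lift 0 k i \<gamma> j) = \<ominus>\<^bsub>N\<^esub> N.O.lift 0 k i \<gamma> j"
        "N.O.lift 0 k i \<gamma> j \<in> carrier N" for j
        using N.O.act_uminus[OF N.O.famD(1)[OF N.O.lift_fam[OF bg(2)]]] N.mpart_carrier[OF N.O.famD(1)[OF N.O.lift_fam[OF bg(2)]]]
        by blast+
      then show ?thesis
        using bg by (simp add: N.O.lift_add N.O.lift_act N.tact_mpart N.O.pact_def N.R.M.r_neg)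
    qed
    then have "?x \<in> N.O.tors i" unfolding N.O.tors_def using bg N.tact_mpart N.mpart_add by simp
    then have "?x \<in> ?N0" using N.total_gsub(2)[OF N.O.tors_oclosed, of i] by blast
    moreover have "\<beta> = ?x \<oplus>\<^bsub>N\<^esub> \<gamma>"
      using c bg(2) by (simp add: N.O.act_uminus N.R.M.a_assoc N.R.M.l_neg)
    ultimately show ?thesis using T.coset_eq_iff[OF c] by blast
  qed
  define \<psi> where "\<psi> i v = T.\<pi> (SOME \<beta>. val i v \<beta>)" for i v
  have \<psi>: "\<psi> i v = T.\<pi> \<beta>" if "val i v \<beta>" for i v \<beta>
    unfolding \<psi>_def by (rule vuniq[OF someI[of "val i v"] that]) (rule that)
  have ex: "\<exists>\<beta>. val i v \<beta> \<and> \<beta> \<in> mpart N i \<and> v \<in> mpart M i" if "v \<in> mpart (sub_module M ?M0) i" for v i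
  proof -
    have "v \<in> Q i" using that M0(2)[of i] by auto
    then show ?thesis unfolding Qm val_def by blast
  qed
  have hom: "P.hom_of \<psi> \<in> gr_hom B (sub_module M ?M0) (quot_module N ?N0)"
    "\<And>m i. m \<in> mpart (sub_module M ?M0) i \<Longrightarrow> P.hom_of \<psi> m = \<psi> i m"
  proof -
    have 1: "\<psi> i v \<in> mpart (quot_module N ?N0) i" if "v \<in> mpart (sub_module M ?M0) i" for i v
      using ex[OF that] \<psi> by (auto simp: T.quot_simps(3))
    have 2: "\<psi> i (v \<oplus>\<^bsub>sub_module M ?M0\<^esub> w) = \<psi> i v \<oplus>\<^bsub>quot_module N ?N0\<^esub> \<psi> i w"
      if vw: "v \<in> mpart (sub_module M ?M0) i" "w \<in> mpart (sub_module M ?M0) i" for i v w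
    proof -
      obtain \<beta> \<gamma> where b: "val i v \<beta>" "\<beta> \<in> mpart N i" "v \<in> mpart M i" "val i w \<gamma>" "\<gamma> \<in> mpart N i" "w \<in> mpart M i"
        using ex[OF vw(1)] ex[OF vw(2)] by blast
      show ?thesis using \<psi>[OF vadd[OF b(1,4,3,6)]] \<psi>[OF b(1)] \<psi>[OF b(4)] N.mpart_carrier[OF b(2)] N.mpart_carrier[OF b(5)]
        by (simp add: T.quot_simps(4))
    qed
    have 3: "\<psi> i (tact (edge \<alpha>) (sub_module M ?M0) i p v) = tact (edge \<alpha>) (quot_module N ?N0) i p (\<psi> i v)"
      if v: "v \<in> mpart (sub_module M ?M0) i" for i v p
    proof -
      obtain \<beta> where b: "val i v \<beta>" "\<beta> \<in> mpart N i" "v \<in> mpart M i" using ex[OF v] by blast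
      show ?thesis using \<psi>[OF vact[OF b(1,3)]] \<psi>[OF b(1)] N.mpart_carrier[OF b(2)] by (simp add: T.quot_tact)
    qed
    have 4: "\<psi> j (mmap (edge \<alpha>) (sub_module M ?M0) i j v) = mmap (edge \<alpha>) (quot_module N ?N0) i j (\<psi> i v)"
      if v: "v \<in> mpart (sub_module M ?M0) i" for i j v
    proof -
      obtain \<beta> where b: "val i v \<beta>" "\<beta> \<in> mpart N i" "v \<in> mpart M i" using ex[OF v] by blast
      show ?thesis using \<psi>[OF ve[OF b(1,3)]] \<psi>[OF b(1)] N.mpart_carrier[OF b(2)] by (simp add: T.quot_mmap)
    qed
    show "P.hom_of \<psi> \<in> gr_hom B (sub_module M ?M0) (quot_module N ?N0)"
      using P.hom_of(1)[of \<psi>, OF 1 2 3 4] by blast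
    show "P.hom_of \<psi> m = \<psi> i m" if "m \<in> mpart (sub_module M ?M0) i" for m i
      using P.hom_of(2)[of \<psi>, OF 1 2 3 4] that by blast
  qed
  have "M.O.cobounded (\<lambda>k. ?M0 \<inter> mpart M k)" using cob by (simp add: M0(2))
  then have r: "(?M0, ?N0, P.hom_of \<psi>) \<in> qreps B M N"
    unfolding qreps_def using hom(1) M.cofin_subs_iff M0(1) N.fin_subs_iff torsion_sub by blast
  have "induced_hom (?M0, ?N0, P.hom_of \<psi>) = g"
  proof (rule induced_hom_unique[OF g], intro allI ballI)
    fix n a assume a: "a \<in> M.O.fam 0 n"
    have "induced_map (P.hom_of \<psi>) n a = \<chi> n a"
    proof (rule induced_map_eqI[OF r a \<chi>(1)[OF a]])
      fix k
      have "a k \<in> mpart (sub_module M ?M0) k" using famQ[OF a, of k] M0(2)[of k] by auto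
      then show "\<chi> n a k \<in> P.hom_of \<psi> (a k)"
        using hom(2)[of "a k" k] \<psi>[OF vfam[OF a]] T.coset_self N.mpart_carrier[OF N.O.famD(1)[OF \<chi>(1)[OF a]]] by simp
    qed
    then show "g (M.F\<theta> n a) = N.F\<theta> n (induced_map (snd (snd (?M0, ?N0, P.hom_of \<psi>))) n a)" using g\<chi>[OF a] by simp
  qed
  then show ?thesis using r by blast
qed

end

subsection \<open>The operations on representatives\<close>

lemma gr_hom_ops:
  fixes f :: "'k::field_char_0 poly" and L M N :: "('k free_alg set, 'u) gmodule"
  assumes obj: "L \<in> gr_obj (gwa f)" "M \<in> gr_obj (gwa f)" "N \<in> gr_obj (gwa f)"
  shows "restrict (\<lambda>m. m) (carrier M) \<in> gr_hom (gwa f) M M"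
    and "restrict (\<lambda>m. \<zero>\<^bsub>N\<^esub>) (carrier M) \<in> gr_hom (gwa f) M N"
    and "\<lbrakk>h \<in> gr_hom (gwa f) L M; g \<in> gr_hom (gwa f) M N\<rbrakk> \<Longrightarrow> compose (carrier L) g h \<in> gr_hom (gwa f) L N"
    and "\<lbrakk>g \<in> gr_hom (gwa f) M N; g' \<in> gr_hom (gwa f) M N\<rbrakk>
      \<Longrightarrow> restrict (\<lambda>m. g m \<oplus>\<^bsub>N\<^esub> g' m) (carrier M) \<in> gr_hom (gwa f) M N"
    and "g \<in> gr_hom (gwa f) M N \<Longrightarrow> restrict (\<lambda>m. ract N (g m) (scal (gwa f) c)) (carrier M) \<in> gr_hom (gwa f) M N"
proof -
  let ?C = "gr_cat TYPE('u) (gwa f)"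
  interpret C: linear_category ?C by (rule gr_cat_linear)
  have sel: "obj ?C = gr_obj (gwa f)" "homs ?C = gr_hom (gwa f)"
    "cmp ?C = (\<lambda>L M N g f. compose (carrier L) g f)" "idm ?C = (\<lambda>M. restrict (\<lambda>m. m) (carrier M))"
    "hadd ?C = (\<lambda>M N f g. restrict (\<lambda>m. f m \<oplus>\<^bsub>N\<^esub> g m) (carrier M))"
    "hzero ?C = (\<lambda>M N. restrict (\<lambda>m. \<zero>\<^bsub>N\<^esub>) (carrier M))"
    "hscale ?C = (\<lambda>M N c g. restrict (\<lambda>m. ract N (g m) (scal (gwa f) c)) (carrier M))"
    by (simp_all add: gr_cat_def)
  interpret G: comm_group "\<lparr>carrier = homs ?C M N, monoid.mult = hadd ?C M N, one = hzero ?C M N\<rparr>"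
    by (rule C.hom_group) (use obj in \<open>simp_all add: sel\<close>)
  show "restrict (\<lambda>m. m) (carrier M) \<in> gr_hom (gwa f) M M"
    using C.id_hom[of M] obj by (simp add: sel)
  show "restrict (\<lambda>m. \<zero>\<^bsub>N\<^esub>) (carrier M) \<in> gr_hom (gwa f) M N"
    using G.one_closed by (simp add: sel)
  show "\<lbrakk>h \<in> gr_hom (gwa f) L M; g \<in> gr_hom (gwa f) M N\<rbrakk> \<Longrightarrow> compose (carrier L) g h \<in> gr_hom (gwa f) L N"
    using C.cmp_hom[of L M N h g] obj by (simp add: sel)
  show "\<lbrakk>g \<in> gr_hom (gwa f) M N; g' \<in> gr_hom (gwa f) M N\<rbrakk>
      \<Longrightarrow> restrict (\<lambda>m. g m \<oplus>\<^bsub>N\<^esub> g' m) (carrier M) \<in> gr_hom (gwa f) M N"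
    using G.m_closed[of g g'] by (simp add: sel)
  show "g \<in> gr_hom (gwa f) M N \<Longrightarrow> restrict (\<lambda>m. ract N (g m) (scal (gwa f) c)) (carrier M) \<in> gr_hom (gwa f) M N"
    using C.scale_hom[of M N g c] obj by (simp add: sel)
qed

lemma (in realized) \<theta>_zero: "\<theta> n \<zero>\<^bsub>G\<^esub> = \<zero>\<^bsub>X\<^esub>"
  using \<theta>_act[OF R.C_zero, of n 0] X.O.act_0[OF \<theta>_mpart[OF R.C_zero]] by simp

context grmod_inf
begin

lemma FX_obj: "FX \<in> gr_obj (gwa (edge 0))"
  unfolding gr_obj_iff using F_real by (rule realized.axioms(2))

lemma whole_sub: "gsub (edge \<alpha>) M (carrier M)" "O.cobounded (\<lambda>k. carrier M \<inter> mpart M k)"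
proof -
  show "gsub (edge \<alpha>) M (carrier M)" by (rule gsubI) auto
  show "O.cobounded (\<lambda>k. carrier M \<inter> mpart M k)"
    unfolding O.cobounded_def
    by (intro exI[of _ 0] exI[of _ 1] conjI allI impI ballI) (auto simp: mpart_carrier tact_mpart O.act_one)
qed

lemma zero_sub: "gsub (edge \<alpha>) M {\<zero>\<^bsub>M\<^esub>}" "O.bounded (\<lambda>k. {\<zero>\<^bsub>M\<^esub>} \<inter> mpart M k)"
proof -
  show "gsub (edge \<alpha>) M {\<zero>\<^bsub>M\<^esub>}" by (rule gsubI) auto
  show "O.bounded (\<lambda>k. {\<zero>\<^bsub>M\<^esub>} \<inter> mpart M k)"
    unfolding O.bounded_def by (intro exI[of _ 0] exI[of _ 1] conjI allI impI ballI) (auto simp: O.act_one)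
qed

lemma zero_coset: "m \<in> carrier M \<Longrightarrow> {\<zero>\<^bsub>M\<^esub>} +>\<^bsub>M\<^esub> m = {m}"
  unfolding a_r_coset_def' by simp

lemma finite_sum:
  assumes 1: "gsub (edge \<alpha>) M M1" "O.bounded (\<lambda>k. M1 \<inter> mpart M k)"
    and 2: "gsub (edge \<alpha>) M M2" "O.bounded (\<lambda>k. M2 \<inter> mpart M k)"
  shows "gsub (edge \<alpha>) M (M1 <+>\<^bsub>M\<^esub> M2)" "O.bounded (\<lambda>k. (M1 <+>\<^bsub>M\<^esub> M2) \<inter> mpart M k)"
proof -
  note d1 = gsubD[OF 1(1)] and d2 = gsubD[OF 2(1)]
  show "gsub (edge \<alpha>) M (M1 <+>\<^bsub>M\<^esub> M2)"
  proof (rule gsubI)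
    show "M1 <+>\<^bsub>M\<^esub> M2 \<subseteq> carrier M" using d1(1) d2(1) by (auto simp: set_add_mem)
    show "\<zero>\<^bsub>M\<^esub> \<in> M1 <+>\<^bsub>M\<^esub> M2"
      unfolding set_add_mem using d1(2) d2(2) by (intro bexI[of _ "\<zero>\<^bsub>M\<^esub>"]) simp_all
    show "act m p \<in> M1 <+>\<^bsub>M\<^esub> M2" if m: "m \<in> M1 <+>\<^bsub>M\<^esub> M2" for m p
    proof -
      obtain a b where ab: "a \<in> M1" "b \<in> M2" "m = a \<oplus>\<^bsub>M\<^esub> b" using m unfolding set_add_mem by blast
      then have "act m p = act a p \<oplus>\<^bsub>M\<^esub> act b p" using d1(1) d2(1) by (simp add: act_rules)
      then show ?thesis unfolding set_add_mem using d1(4)[OF ab(1), of p] d2(4)[OF ab(2), of p] by blast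
    qed
    show "hcomp M m i \<in> M1 <+>\<^bsub>M\<^esub> M2" if m: "m \<in> M1 <+>\<^bsub>M\<^esub> M2" for m i
    proof -
      obtain a b where ab: "a \<in> M1" "b \<in> M2" "m = a \<oplus>\<^bsub>M\<^esub> b" using m unfolding set_add_mem by blast
      then have "hcomp M m i = hcomp M a i \<oplus>\<^bsub>M\<^esub> hcomp M b i" using d1(1) d2(1) by (simp add: hcomp_add)
      then show ?thesis unfolding set_add_mem using d1(5)[OF ab(1), of i] d2(5)[OF ab(2), of i] by blast
    qed
    fix m n assume mn: "m \<in> M1 <+>\<^bsub>M\<^esub> M2" "n \<in> M1 <+>\<^bsub>M\<^esub> M2"
    obtain a b where ab: "a \<in> M1" "b \<in> M2" "m = a \<oplus>\<^bsub>M\<^esub> b" using mn(1) unfolding set_add_mem by blast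
    obtain c d where cd: "c \<in> M1" "d \<in> M2" "n = c \<oplus>\<^bsub>M\<^esub> d" using mn(2) unfolding set_add_mem by blast
    have "m \<oplus>\<^bsub>M\<^esub> n = (a \<oplus>\<^bsub>M\<^esub> c) \<oplus>\<^bsub>M\<^esub> (b \<oplus>\<^bsub>M\<^esub> d)" using ab cd d1(1) d2(1) by (simp add: R.M.a_ac)
    then show "m \<oplus>\<^bsub>M\<^esub> n \<in> M1 <+>\<^bsub>M\<^esub> M2"
      unfolding set_add_mem using d1(3)[OF ab(1) cd(1)] d2(3)[OF ab(2) cd(2)] by blast
  qed
  obtain K1 q1 where q1: "q1 \<noteq> 0 \<and> (\<forall>k. \<bar>k\<bar> \<ge> K1 \<longrightarrow> M1 \<inter> mpart M k \<subseteq> {\<zero>\<^bsub>M\<^esub>}) \<and>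
      (\<forall>k. \<forall>v\<in>M1 \<inter> mpart M k. tact (edge \<alpha>) M k q1 v = \<zero>\<^bsub>M\<^esub>)"
    using 1(2) unfolding O.bounded_def by (elim exE)
  obtain K2 q2 where q2: "q2 \<noteq> 0 \<and> (\<forall>k. \<bar>k\<bar> \<ge> K2 \<longrightarrow> M2 \<inter> mpart M k \<subseteq> {\<zero>\<^bsub>M\<^esub>}) \<and>
      (\<forall>k. \<forall>v\<in>M2 \<inter> mpart M k. tact (edge \<alpha>) M k q2 v = \<zero>\<^bsub>M\<^esub>)"
    using 2(2) unfolding O.bounded_def by (elim exE)
  have dec: "\<exists>a\<in>M1 \<inter> mpart M k. \<exists>b\<in>M2 \<inter> mpart M k. x = a \<oplus>\<^bsub>M\<^esub> b"
    if x: "x \<in> (M1 <+>\<^bsub>M\<^esub> M2) \<inter> mpart M k" for x k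
  proof -
    obtain a b where ab: "a \<in> M1" "b \<in> M2" "x = a \<oplus>\<^bsub>M\<^esub> b" using IntD1[OF x] unfolding set_add_mem by blast
    have "x = hcomp M x k" using x hcomp_homog[of x k k] by simp
    also have "\<dots> = hcomp M a k \<oplus>\<^bsub>M\<^esub> hcomp M b k" unfolding ab(3) using ab d1(1) d2(1) by (simp add: hcomp_add)
    finally show ?thesis
      using d1(5)[OF ab(1)] d2(5)[OF ab(2)] hcomp_mpart[OF d1(1)[OF ab(1)]] hcomp_mpart[OF d2(1)[OF ab(2)]] by blast
  qed
  show "O.bounded (\<lambda>k. (M1 <+>\<^bsub>M\<^esub> M2) \<inter> mpart M k)"
    unfolding O.bounded_def
  proof (intro exI[of _ "max K1 K2"] exI[of _ "q1 * q2"] conjI allI impI ballI)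
    show "q1 * q2 \<noteq> 0" using q1 q2 by simp
    show "(M1 <+>\<^bsub>M\<^esub> M2) \<inter> mpart M k \<subseteq> {\<zero>\<^bsub>M\<^esub>}" if k: "\<bar>k\<bar> \<ge> max K1 K2" for k
    proof
      fix x assume "x \<in> (M1 <+>\<^bsub>M\<^esub> M2) \<inter> mpart M k"
      then obtain a b where ab: "a \<in> M1 \<inter> mpart M k" "b \<in> M2 \<inter> mpart M k" "x = a \<oplus>\<^bsub>M\<^esub> b" using dec by blast
      have "M1 \<inter> mpart M k \<subseteq> {\<zero>\<^bsub>M\<^esub>}" "M2 \<inter> mpart M k \<subseteq> {\<zero>\<^bsub>M\<^esub>}" using q1 q2 k by simp_all
      then have "a = \<zero>\<^bsub>M\<^esub>" "b = \<zero>\<^bsub>M\<^esub>" using ab by blast+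
      then show "x \<in> {\<zero>\<^bsub>M\<^esub>}" using ab(3) by simp
    qed
    fix k x assume "x \<in> (M1 <+>\<^bsub>M\<^esub> M2) \<inter> mpart M k"
    then obtain a b where ab: "a \<in> M1 \<inter> mpart M k" "b \<in> M2 \<inter> mpart M k" "x = a \<oplus>\<^bsub>M\<^esub> b" using dec by blast
    then have m: "a \<in> mpart M k" "b \<in> mpart M k" by blast+
    have "tact (edge \<alpha>) M k (q1 * q2) a = tact (edge \<alpha>) M k q2 (tact (edge \<alpha>) M k q1 a)"
      using O.act_mult[OF m(1), of q2 q1] by (simp add: mult.commute)
    moreover have "tact (edge \<alpha>) M k q1 a = \<zero>\<^bsub>M\<^esub>" "tact (edge \<alpha>) M k q2 b = \<zero>\<^bsub>M\<^esub>" using q1 q2 ab by simp_all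
    ultimately show "tact (edge \<alpha>) M k (q1 * q2) x = \<zero>\<^bsub>M\<^esub>"
      unfolding ab(3) O.act_add[OF m] using O.act_mult[OF m(2), of q1 q2] by simp
  qed
qed

end

context qpair
begin

text \<open>To identify the homomorphism induced by a representative it suffices to exhibit the image of each family up to the quotient.\<close>

lemma induced_hom_eqI:
  assumes r: "(M', N', h) \<in> qreps B M N" and g: "g \<in> gr_hom (gwa (edge 0)) M.FX N.FX"
    and "\<And>n a. a \<in> M.O.fam 0 n \<Longrightarrow> \<chi> n a \<in> N.O.fam 0 n" "\<And>n a k. a \<in> M.O.fam 0 n \<Longrightarrow> \<chi> n a k \<in> h (a k)"
    and "\<And>n a. a \<in> M.O.fam 0 n \<Longrightarrow> g (M.F\<theta> n a) = N.F\<theta> n (\<chi> n a)"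
  shows "induced_hom (M', N', h) = g"
proof (rule induced_hom_unique[OF g], intro allI ballI)
  fix n a assume a: "a \<in> M.O.fam 0 n"
  have "induced_map h n a = \<chi> n a" by (rule induced_map_eqI[OF r a assms(3)[OF a] assms(4)[OF a]])
  then show "g (M.F\<theta> n a) = N.F\<theta> n (induced_map (snd (snd (M', N', h))) n a)" using assms(5)[OF a] by simp
qed

lemma F\<theta>_carrier: "a \<in> M.O.fam 0 n \<Longrightarrow> M.F\<theta> n a \<in> carrier M.FX"
  by (rule F.A.X.mpart_carrier[OF F.A.\<theta>_mpart])

lemma zero_rep:
  shows "(carrier M, {\<zero>\<^bsub>N\<^esub>}, restrict (\<lambda>m. {\<zero>\<^bsub>N\<^esub>}) (carrier M)) \<in> qreps B M N" (is "?r \<in> _")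
    and "induced_hom (carrier M, {\<zero>\<^bsub>N\<^esub>}, restrict (\<lambda>m. {\<zero>\<^bsub>N\<^esub>}) (carrier M)) = restrict (\<lambda>m. \<zero>\<^bsub>N.FX\<^esub>) (carrier M.FX)"
proof -
  show r: "?r \<in> qreps B M N"
    by (rule qrepI[where R = "\<lambda>m n. n = \<zero>\<^bsub>N\<^esub>", OF M.whole_sub N.zero_sub])
      (use N.zero_coset[OF N.R.M.zero_closed] N.mpart_zero in auto)
  show "induced_hom ?r = restrict (\<lambda>m. \<zero>\<^bsub>N.FX\<^esub>) (carrier M.FX)"
  proof (rule induced_hom_eqI[OF r gr_hom_ops(2)[OF M.FX_obj M.FX_obj N.FX_obj] N.O.fam_zero])
    fix n k a assume a: "a \<in> M.O.fam 0 n"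
    show "\<zero>\<^bsub>N\<^esub> \<in> restrict (\<lambda>m. {\<zero>\<^bsub>N\<^esub>}) (carrier M) (a k)" using M.mpart_carrier[OF M.O.famD(1)[OF a]] by simp
    show "restrict (\<lambda>m. \<zero>\<^bsub>N.FX\<^esub>) (carrier M.FX) (M.F\<theta> n a) = N.F\<theta> n (\<lambda>_. \<zero>\<^bsub>N\<^esub>)"
      using F.B.\<theta>_zero[of n] F\<theta>_carrier[OF a] by (simp add: fun_group_simps)
  qed
qed

lemma qadd_rep:
  assumes r1: "(M1, N1, f) \<in> qreps B M N" and r2: "(M2, N2, g) \<in> qreps B M N"
  shows "qadd N (M1, N1, f) (M2, N2, g) \<in> qreps B M N"
    and "induced_hom (qadd N (M1, N1, f) (M2, N2, g))
      = restrict (\<lambda>m. induced_hom (M1, N1, f) m \<oplus>\<^bsub>N.FX\<^esub> induced_hom (M2, N2, g) m) (carrier M.FX)"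
proof -
  let ?R = "\<lambda>m n. \<exists>n1\<in>f m. \<exists>n2\<in>g m. n = n1 \<oplus>\<^bsub>N\<^esub> n2"
  let ?h = "restrict (\<lambda>m. f m <+>\<^bsub>N\<^esub> g m) (M1 \<inter> M2)"
  note s1 = qrep_subs[OF r1] and s2 = qrep_subs[OF r2] and q1 = qrep_rules[OF r1] and q2 = qrep_rules[OF r2]
  note I = M.cofinite_inter[OF s1(1,2) s2(1,2)] and S = N.finite_sum[OF s1(3,4) s2(3,4)]
  interpret Q1: gquot "edge \<alpha>" N N1 by (intro gquot.intro gquot_axioms.intro N.gmod_axioms s1(3))
  interpret Q2: gquot "edge \<alpha>" N N2 by (intro gquot.intro gquot_axioms.intro N.gmod_axioms s2(3))
  interpret Q: gquot "edge \<alpha>" N "N1 <+>\<^bsub>N\<^esub> N2" by (intro gquot.intro gquot_axioms.intro N.gmod_axioms S(1))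
  have r: "(M1 \<inter> M2, N1 <+>\<^bsub>N\<^esub> N2, ?h) \<in> qreps B M N"
  proof (rule qrepI[where R = ?R, OF I S])
    show "?h \<in> extensional (M1 \<inter> M2)" by simp
    show "\<exists>n. ?R m n" if m: "m \<in> M1 \<inter> M2" for m
      using q1(2)[of m] q2(2)[of m] m by blast
    show "n \<in> carrier N \<and> ?h m = N1 <+>\<^bsub>N\<^esub> N2 +>\<^bsub>N\<^esub> n" if m: "m \<in> M1 \<inter> M2" and n: "?R m n" for m n
    proof -
      obtain n1 n2 where n12: "n1 \<in> f m" "n2 \<in> g m" "n = n1 \<oplus>\<^bsub>N\<^esub> n2" using n by blast
      have c: "n1 \<in> carrier N" "f m = N1 +>\<^bsub>N\<^esub> n1" "n2 \<in> carrier N" "g m = N2 +>\<^bsub>N\<^esub> n2"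
        using q1(3)[OF _ n12(1)] q2(3)[OF _ n12(2)] m by auto
      have nc: "n \<in> carrier N" using n12 c by simp
      have "f m <+>\<^bsub>N\<^esub> g m = N1 <+>\<^bsub>N\<^esub> N2 +>\<^bsub>N\<^esub> n"
      proof (intro equalityI subsetI)
        fix x assume "x \<in> f m <+>\<^bsub>N\<^esub> g m"
        then obtain a b where ab: "a \<in> f m" "b \<in> g m" "x = a \<oplus>\<^bsub>N\<^esub> b" unfolding set_add_mem by blast
        obtain y1 where y1: "y1 \<in> N1" "a = y1 \<oplus>\<^bsub>N\<^esub> n1" using ab(1) Q1.mem_coset[OF c(1)] c(2) by blast
        obtain y2 where y2: "y2 \<in> N2" "b = y2 \<oplus>\<^bsub>N\<^esub> n2" using ab(2) Q2.mem_coset[OF c(3)] c(4) by blast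
        have "x = (y1 \<oplus>\<^bsub>N\<^esub> y2) \<oplus>\<^bsub>N\<^esub> n"
          using ab(3) y1 y2 c(1,3) n12(3) Q1.N_simps(1) Q2.N_simps(1) by (simp add: N.R.M.a_ac)
        moreover have "y1 \<oplus>\<^bsub>N\<^esub> y2 \<in> N1 <+>\<^bsub>N\<^esub> N2" using y1 y2 unfolding set_add_mem by blast
        ultimately show "x \<in> N1 <+>\<^bsub>N\<^esub> N2 +>\<^bsub>N\<^esub> n" using Q.mem_coset[OF nc] by blast
      next
        fix x assume "x \<in> N1 <+>\<^bsub>N\<^esub> N2 +>\<^bsub>N\<^esub> n"
        then obtain y where y: "y \<in> N1 <+>\<^bsub>N\<^esub> N2" "x = y \<oplus>\<^bsub>N\<^esub> n" using Q.mem_coset[OF nc] by blast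
        then obtain y1 y2 where yy: "y1 \<in> N1" "y2 \<in> N2" "y = y1 \<oplus>\<^bsub>N\<^esub> y2" unfolding set_add_mem by blast
        have "x = (y1 \<oplus>\<^bsub>N\<^esub> n1) \<oplus>\<^bsub>N\<^esub> (y2 \<oplus>\<^bsub>N\<^esub> n2)"
          using y(2) yy c(1,3) n12(3) Q1.N_simps(1) Q2.N_simps(1) by (simp add: N.R.M.a_ac)
        moreover have "y1 \<oplus>\<^bsub>N\<^esub> n1 \<in> f m" "y2 \<oplus>\<^bsub>N\<^esub> n2 \<in> g m"
          using q1(9)[OF _ n12(1) yy(1)] q2(9)[OF _ n12(2) yy(2)] m by blast+
        ultimately show "x \<in> f m <+>\<^bsub>N\<^esub> g m" unfolding set_add_mem by blast
      qed
      then show ?thesis using nc m by simp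
    qed
    show "?R (m \<oplus>\<^bsub>M\<^esub> m') (n \<oplus>\<^bsub>N\<^esub> n')"
      if m: "m \<in> M1 \<inter> M2" "m' \<in> M1 \<inter> M2" and n: "?R m n" "?R m' n'" for m n m' n'
    proof -
      obtain n1 n2 where n12: "n1 \<in> f m" "n2 \<in> g m" "n = n1 \<oplus>\<^bsub>N\<^esub> n2" using n(1) by blast
      obtain n3 n4 where n34: "n3 \<in> f m'" "n4 \<in> g m'" "n' = n3 \<oplus>\<^bsub>N\<^esub> n4" using n(2) by blast
      have "n1 \<in> carrier N" "n2 \<in> carrier N" "n3 \<in> carrier N" "n4 \<in> carrier N"
        using q1(3)[OF _ n12(1)] q2(3)[OF _ n12(2)] q1(3)[OF _ n34(1)] q2(3)[OF _ n34(2)] m by blast+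
      then have "n \<oplus>\<^bsub>N\<^esub> n' = (n1 \<oplus>\<^bsub>N\<^esub> n3) \<oplus>\<^bsub>N\<^esub> (n2 \<oplus>\<^bsub>N\<^esub> n4)" using n12(3) n34(3) by (simp add: N.R.M.a_ac)
      moreover have "n1 \<oplus>\<^bsub>N\<^esub> n3 \<in> f (m \<oplus>\<^bsub>M\<^esub> m')" "n2 \<oplus>\<^bsub>N\<^esub> n4 \<in> g (m \<oplus>\<^bsub>M\<^esub> m')"
        using q1(4)[OF _ _ n12(1) n34(1)] q2(4)[OF _ _ n12(2) n34(2)] m by blast+
      ultimately show ?thesis by blast
    qed
    show "?R (M.act m p) (N.act n p)" if m: "m \<in> M1 \<inter> M2" and n: "?R m n" for m n p
    proof -
      obtain n1 n2 where n12: "n1 \<in> f m" "n2 \<in> g m" "n = n1 \<oplus>\<^bsub>N\<^esub> n2" using n by blast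
      have "n1 \<in> carrier N" "n2 \<in> carrier N" using q1(3)[OF _ n12(1)] q2(3)[OF _ n12(2)] m by blast+
      then have "N.act n p = N.act n1 p \<oplus>\<^bsub>N\<^esub> N.act n2 p" using n12(3) by (simp add: N.act_rules)
      moreover have "N.act n1 p \<in> f (M.act m p)" "N.act n2 p \<in> g (M.act m p)"
        using q1(5)[OF _ n12(1)] q2(5)[OF _ n12(2)] m by blast+
      ultimately show ?thesis by blast
    qed
    show "\<exists>n\<in>mpart N i. ?R m n" if m: "m \<in> M1 \<inter> M2" "m \<in> mpart M i" for m i
    proof -
      obtain n1 n2 where "n1 \<in> mpart N i" "n1 \<in> f m" "n2 \<in> mpart N i" "n2 \<in> g m"
        using q1(6)[OF _ m(2)] q2(6)[OF _ m(2)] m(1) by blast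
      then show ?thesis using N.mpart_add by blast
    qed
  qed
  have eq: "qadd N (M1, N1, f) (M2, N2, g) = (M1 \<inter> M2, N1 <+>\<^bsub>N\<^esub> N2, ?h)" by (simp add: qadd_def)
  show "qadd N (M1, N1, f) (M2, N2, g) \<in> qreps B M N" unfolding eq by (rule r)
  show "induced_hom (qadd N (M1, N1, f) (M2, N2, g))
      = restrict (\<lambda>m. induced_hom (M1, N1, f) m \<oplus>\<^bsub>N.FX\<^esub> induced_hom (M2, N2, g) m) (carrier M.FX)"
    unfolding eq
  proof (rule induced_hom_eqI[OF r gr_hom_ops(4)[OF M.FX_obj M.FX_obj N.FX_obj induced_hom(1)[OF r1] induced_hom(1)[OF r2]]])
    fix n a assume a: "a \<in> M.O.fam 0 n"
    note p = induced_map[OF r1 a] induced_map[OF r2 a]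
    show "(\<lambda>k. induced_map f n a k \<oplus>\<^bsub>N\<^esub> induced_map g n a k) \<in> N.O.fam 0 n" by (rule N.O.fam_add[OF p(1,3)])
    show "induced_map f n a k \<oplus>\<^bsub>N\<^esub> induced_map g n a k \<in> ?h (a k)" for k
      using M.cofinite_fam[OF I a, of k] p(2,4)[of k] by (auto simp: set_add_mem)
    show "restrict (\<lambda>m. induced_hom (M1, N1, f) m \<oplus>\<^bsub>N.FX\<^esub> induced_hom (M2, N2, g) m) (carrier M.FX) (M.F\<theta> n a)
        = N.F\<theta> n (\<lambda>k. induced_map f n a k \<oplus>\<^bsub>N\<^esub> induced_map g n a k)"
      using induced_hom(2)[OF r1 a] induced_hom(2)[OF r2 a] F\<theta>_carrier[OF a] F.B.\<theta>_add[OF p(1,3)] by (simp add: fun_group_simps)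
  qed
qed

lemma qscale_rep:
  assumes r1: "(M', N', f) \<in> qreps B M N"
  shows "qscale B N c (M', N', f) \<in> qreps B M N"
    and "induced_hom (qscale B N c (M', N', f))
      = restrict (\<lambda>m. ract N.FX (induced_hom (M', N', f) m) (scal (gwa (edge 0)) c)) (carrier M.FX)"
proof -
  let ?c = "free_const c :: 'k free_alg"
  let ?R = "\<lambda>m n. \<exists>n1\<in>f m. n = N.act n1 ?c"
  let ?h = "restrict (\<lambda>m. coset_act N N' (f m) (scal B c)) M'"
  note s = qrep_subs[OF r1] and q = qrep_rules[OF r1]
  interpret Q: gquot "edge \<alpha>" N N' by (intro gquot.intro gquot_axioms.intro N.gmod_axioms s(3))
  have val: "n \<in> carrier N \<and> ?h m = N' +>\<^bsub>N\<^esub> n" if m: "m \<in> M'" and n: "?R m n" for m n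
  proof -
    obtain n1 where n1: "n1 \<in> f m" "n = N.act n1 ?c" using n by blast
    have c: "n1 \<in> carrier N" "f m = N' +>\<^bsub>N\<^esub> n1" using q(3)[OF m n1(1)] by blast+
    show ?thesis using m n1(2) c Q.coset_act_eq[OF c(1), of ?c] by (simp add: gwa_proj_hom(5))
  qed
  have r: "(M', N', ?h) \<in> qreps B M N"
  proof (rule qrepI[where R = ?R, OF s _ _ val])
    show "?h \<in> extensional M'" by simp
    show "\<exists>n. ?R m n" if m: "m \<in> M'" for m using q(2)[OF m] by blast
    show "?R (m \<oplus>\<^bsub>M\<^esub> m') (n \<oplus>\<^bsub>N\<^esub> n')"
      if m: "m \<in> M'" "m' \<in> M'" and n: "?R m n" "?R m' n'" for m n m' n'
    proof -
      obtain n1 where n1: "n1 \<in> f m" "n = N.act n1 ?c" using n(1) by blast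
      obtain n2 where n2: "n2 \<in> f m'" "n' = N.act n2 ?c" using n(2) by blast
      have "n \<oplus>\<^bsub>N\<^esub> n' = N.act (n1 \<oplus>\<^bsub>N\<^esub> n2) ?c"
        using n1(2) n2(2) q(3)[OF m(1) n1(1)] q(3)[OF m(2) n2(1)] by (simp add: N.act_rules)
      then show ?thesis using q(4)[OF m n1(1) n2(1)] by blast
    qed
    show "?R (M.act m p) (N.act n p)" if m: "m \<in> M'" and n: "?R m n" for m n p
    proof -
      obtain n1 where n1: "n1 \<in> f m" "n = N.act n1 ?c" using n by blast
      have "N.act n p = N.act n1 (?c * p)" using n1(2) q(3)[OF m n1(1)] by (simp add: N.act_rules)
      also have "\<dots> = N.act (N.act n1 p) ?c"
        using q(3)[OF m n1(1)] by (subst free_const_central) (simp add: N.act_rules)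
      finally show ?thesis using q(5)[OF m n1(1), of p] by blast
    qed
    show "\<exists>n\<in>mpart N i. ?R m n" if m: "m \<in> M'" "m \<in> mpart M i" for m i
    proof -
      obtain n1 where n1: "n1 \<in> mpart N i" "n1 \<in> f m" using q(6)[OF m] by blast
      have "N.act n1 ?c \<in> mpart N i" using N.mpart_act[OF n1(1) homog_const, of c] by simp
      then show ?thesis using n1(2) by blast
    qed
  qed
  have eq: "qscale B N c (M', N', f) = (M', N', ?h)" by (simp add: qscale_def)
  show "qscale B N c (M', N', f) \<in> qreps B M N" unfolding eq by (rule r)
  show "induced_hom (qscale B N c (M', N', f))
      = restrict (\<lambda>m. ract N.FX (induced_hom (M', N', f) m) (scal (gwa (edge 0)) c)) (carrier M.FX)"
    unfolding eq
  proof (rule induced_hom_eqI[OF r gr_hom_ops(5)[OF M.FX_obj M.FX_obj N.FX_obj induced_hom(1)[OF r1]]])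
    fix n a assume a: "a \<in> M.O.fam 0 n"
    note p = induced_map[OF r1 a]
    show "N.O.pact [:c:] (induced_map f n a) \<in> N.O.fam 0 n" by (rule N.O.fam_pact[OF p(1)])
    show "N.O.pact [:c:] (induced_map f n a) k \<in> ?h (a k)" for k
    proof -
      have aM: "a k \<in> M'" by (rule fam_sub[OF r1 a])
      have e: "N.O.pact [:c:] (induced_map f n a) k = N.act (induced_map f n a k) ?c"
        by (simp add: N.O.pact_def tact_def free_eval_const)
      have "?R (a k) (N.act (induced_map f n a k) ?c)" using p(2) by blast
      from val[OF aM this] show ?thesis unfolding e using Q.coset_self by simp
    qed
    show "restrict (\<lambda>m. ract N.FX (induced_hom (M', N', f) m) (scal (gwa (edge 0)) c)) (carrier M.FX) (M.F\<theta> n a)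
        = N.F\<theta> n (N.O.pact [:c:] (induced_map f n a))"
      using induced_hom(2)[OF r1 a] F\<theta>_carrier[OF a] F.B.\<theta>_act[OF p(1), of "[:c:]"]
      by (simp add: gwa_proj_hom(5) tact_def mact_def free_eval_const)
  qed
qed

end

lemma (in grmod_inf) id_rep:
  shows "(carrier M, {\<zero>\<^bsub>M\<^esub>}, restrict (\<lambda>m. {m}) (carrier M)) \<in> qreps (gwa (edge \<alpha>)) M M" (is "?r \<in> _")
    and "qpair.induced_hom \<alpha> M M (carrier M, {\<zero>\<^bsub>M\<^esub>}, restrict (\<lambda>m. {m}) (carrier M)) = restrict (\<lambda>m. m) (carrier FX)"
proof -
  interpret P: qpair \<alpha> M M by (rule qpair.intro) (rule grmod_inf_axioms)+
  show r: "?r \<in> qreps (gwa (edge \<alpha>)) M M"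
    by (rule P.qrepI[where R = "\<lambda>m n. n = m", OF whole_sub zero_sub])
      (auto simp: zero_coset)
  show "P.induced_hom ?r = restrict (\<lambda>m. m) (carrier FX)"
  proof (rule P.induced_hom_eqI[OF r gr_hom_ops(1)[OF FX_obj FX_obj FX_obj], of "\<lambda>n a. a"])
    fix n k a assume a: "a \<in> O.fam 0 n"
    show "a k \<in> restrict (\<lambda>m. {m}) (carrier M) (a k)" using mpart_carrier[OF O.famD(1)[OF a]] by simp
    show "restrict (\<lambda>m. m) (carrier FX) (F\<theta> n a) = F\<theta> n a" using P.F\<theta>_carrier[OF a] by simp
  qed simp
qed

text \<open>The composite of representatives is the relation that passes through elements of \<open>M\<close> on which both are defined. Its
  domain is cofinite and its indeterminacy finite-dimensional, with the products of the annihilators; on families it is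
  the composite since families of \<open>M\<close> lie in the domain of the second representative.\<close>

lemma qcomp_rep:
  fixes L M N :: "('k::field_char_0 free_alg set, 'm) gmodule"
  assumes "qpair \<alpha> L M" "qpair \<alpha> M N"
    and r1: "(L1, M1, f) \<in> qreps (gwa (edge \<alpha>)) L M" and r2: "(M2, N2, g) \<in> qreps (gwa (edge \<alpha>)) M N"
  shows "qcomp (M2, N2, g) (L1, M1, f) \<in> qreps (gwa (edge \<alpha>)) L N"
    and "qpair.induced_hom \<alpha> L N (qcomp (M2, N2, g) (L1, M1, f))
      = compose (carrier (grmod_inf.FX \<alpha> L)) (qpair.induced_hom \<alpha> M N (M2, N2, g)) (qpair.induced_hom \<alpha> L M (L1, M1, f))"
proof -
  interpret LM: qpair \<alpha> L M by (rule assms(1))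
  interpret MN: qpair \<alpha> M N by (rule assms(2))
  interpret LN: qpair \<alpha> L N by (intro qpair.intro LM.M.grmod_inf_axioms MN.N.grmod_inf_axioms)
  note s1 = LM.qrep_subs[OF r1] and s2 = MN.qrep_subs[OF r2] and q1 = LM.qrep_rules[OF r1] and q2 = MN.qrep_rules[OF r2]
  note dL = LM.M.gsubD[OF s1(1)] and dM1 = LM.N.gsubD[OF s1(3)] and dM2 = LM.N.gsubD[OF s2(1)] and dN = MN.N.gsubD[OF s2(3)]
  define L' where "L' = {l \<in> L1. f l \<inter> M2 \<noteq> {}}"
  define N' where "N' = (\<Union>m\<in>M1 \<inter> M2. g m)"
  define h where "h = restrict (\<lambda>l. \<Union>m\<in>f l \<inter> M2. g m) L'"
  have eq: "qcomp (M2, N2, g) (L1, M1, f) = (L', N', h)"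
    by (simp add: qcomp_def L'_def N'_def h_def Let_def)
  have L'I: "l \<in> L'" if "l \<in> L1" "m \<in> f l" "m \<in> M2" for l m using that unfolding L'_def by blast
  have L'D: "l \<in> L1" "\<exists>m. m \<in> f l \<and> m \<in> M2" if "l \<in> L'" for l using that unfolding L'_def by blast+
  have N'I: "n \<in> N'" if "m \<in> M1" "m \<in> M2" "n \<in> g m" for m n using that unfolding N'_def by blast
  have N'D: "\<exists>m. m \<in> M1 \<and> m \<in> M2 \<and> n \<in> g m" if "n \<in> N'" for n using that unfolding N'_def by blast
  have L'sub: "gsub (edge \<alpha>) L L'"
  proof (rule LM.M.gsubI)
    show "L' \<subseteq> carrier L" using L'D(1) dL(1) by blast
    show "\<zero>\<^bsub>L\<^esub> \<in> L'" by (rule L'I[OF dL(2)]) (use q1(7) dM1(2) dM2(2) in auto)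
    show "l \<oplus>\<^bsub>L\<^esub> l' \<in> L'" if l: "l \<in> L'" "l' \<in> L'" for l l'
    proof -
      obtain m m' where "m \<in> f l" "m \<in> M2" "m' \<in> f l'" "m' \<in> M2" using L'D(2)[OF l(1)] L'D(2)[OF l(2)] by blast
      then show ?thesis using L'I[OF dL(3) q1(4) dM2(3)] L'D(1)[OF l(1)] L'D(1)[OF l(2)] by blast
    qed
    show "LM.M.act l p \<in> L'" if l: "l \<in> L'" for l p
    proof -
      obtain m where "m \<in> f l" "m \<in> M2" using L'D(2)[OF l] by blast
      then show ?thesis using L'I[OF dL(4) q1(5) dM2(4)] L'D(1)[OF l] by blast
    qed
    show "hcomp L l i \<in> L'" if l: "l \<in> L'" for l i
    proof -
      obtain m where "m \<in> f l" "m \<in> M2" using L'D(2)[OF l] by blast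
      then show ?thesis using L'I[OF dL(5) q1(10) dM2(5)] L'D(1)[OF l] by blast
    qed
  qed
  have L'cof: "LM.M.O.cobounded (\<lambda>k. L' \<inter> mpart L k)"
  proof -
    obtain K1 p1 where 1: "p1 \<noteq> 0 \<and> (\<forall>k. \<bar>k\<bar> \<ge> K1 \<longrightarrow> mpart L k \<subseteq> L1 \<inter> mpart L k) \<and>
        (\<forall>k. \<forall>v\<in>mpart L k. tact (edge \<alpha>) L k p1 v \<in> L1 \<inter> mpart L k)"
      using s1(2) unfolding LM.M.O.cobounded_def by (elim exE)
    obtain K2 p2 where 2: "p2 \<noteq> 0 \<and> (\<forall>k. \<bar>k\<bar> \<ge> K2 \<longrightarrow> mpart M k \<subseteq> M2 \<inter> mpart M k) \<and>
        (\<forall>k. \<forall>v\<in>mpart M k. tact (edge \<alpha>) M k p2 v \<in> M2 \<inter> mpart M k)"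
      using s2(2) unfolding LM.N.O.cobounded_def by (elim exE)
    show ?thesis
      unfolding LM.M.O.cobounded_def
    proof (intro exI[of _ "max K1 K2"] exI[of _ "p2 * p1"] conjI allI impI ballI)
      show "p2 * p1 \<noteq> 0" using 1 2 by simp
      show "mpart L k \<subseteq> L' \<inter> mpart L k" if k: "\<bar>k\<bar> \<ge> max K1 K2" for k
      proof
        fix l assume l: "l \<in> mpart L k"
        have "mpart L k \<subseteq> L1 \<inter> mpart L k" and M2: "mpart M k \<subseteq> M2 \<inter> mpart M k" using 1 2 k by simp_all
        then have l1: "l \<in> L1" using l by blast
        obtain m where "m \<in> mpart M k" "m \<in> f l" using q1(6)[OF l1 l] by blast
        then show "l \<in> L' \<inter> mpart L k" using L'I[OF l1] M2 l by blast
      qed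
      fix k l assume l: "l \<in> mpart L k"
      let ?l = "tact (edge \<alpha>) L k p1 l"
      have l1: "?l \<in> L1" "?l \<in> mpart L k" using 1 l by blast+
      obtain m where m: "m \<in> mpart M k" "m \<in> f ?l" using q1(6)[OF l1] by blast
      have "tact (edge \<alpha>) M k p2 m \<in> f (tact (edge \<alpha>) L k p2 ?l)" by (rule LM.qrep_tact[OF r1 l1(1) m(2)])
      moreover have "tact (edge \<alpha>) M k p2 m \<in> M2" using 2 m(1) by blast
      moreover have "tact (edge \<alpha>) L k p2 ?l \<in> L1" using dL(4)[OF l1(1)] unfolding tact_def .
      ultimately have "tact (edge \<alpha>) L k p2 ?l \<in> L'" by (intro L'I)
      then show "tact (edge \<alpha>) L k (p2 * p1) l \<in> L' \<inter> mpart L k"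
        using LM.M.O.act_mult[OF l, of p2 p1] LM.M.tact_mpart[OF l] by simp
    qed
  qed
  have N'sub: "gsub (edge \<alpha>) N N'"
  proof (rule MN.N.gsubI)
    show "N' \<subseteq> carrier N" using N'D q2(3) by blast
    show "\<zero>\<^bsub>N\<^esub> \<in> N'" by (rule N'I[OF dM1(2) dM2(2)]) (use q2(7) dN(2) in simp)
    show "n \<oplus>\<^bsub>N\<^esub> n' \<in> N'" if n: "n \<in> N'" "n' \<in> N'" for n n'
    proof -
      obtain m m' where "m \<in> M1" "m \<in> M2" "n \<in> g m" "m' \<in> M1" "m' \<in> M2" "n' \<in> g m'"
        using N'D[OF n(1)] N'D[OF n(2)] by blast
      then show ?thesis using N'I[OF dM1(3) dM2(3) q2(4)] by blast
    qed
    show "MN.N.act n p \<in> N'" if n: "n \<in> N'" for n p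
      using N'D[OF n] N'I[OF dM1(4) dM2(4) q2(5)] by blast
    show "hcomp N n i \<in> N'" if n: "n \<in> N'" for n i
      using N'D[OF n] N'I[OF dM1(5) dM2(5) q2(10)] by blast
  qed
  have N'fin: "MN.N.O.bounded (\<lambda>k. N' \<inter> mpart N k)"
  proof -
    obtain K1 p1 where 1: "p1 \<noteq> 0 \<and> (\<forall>k. \<bar>k\<bar> \<ge> K1 \<longrightarrow> M1 \<inter> mpart M k \<subseteq> {\<zero>\<^bsub>M\<^esub>}) \<and>
        (\<forall>k. \<forall>v\<in>M1 \<inter> mpart M k. tact (edge \<alpha>) M k p1 v = \<zero>\<^bsub>M\<^esub>)"
      using s1(4) unfolding LM.N.O.bounded_def by (elim exE)
    obtain K2 p2 where 2: "p2 \<noteq> 0 \<and> (\<forall>k. \<bar>k\<bar> \<ge> K2 \<longrightarrow> N2 \<inter> mpart N k \<subseteq> {\<zero>\<^bsub>N\<^esub>}) \<and>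
        (\<forall>k. \<forall>v\<in>N2 \<inter> mpart N k. tact (edge \<alpha>) N k p2 v = \<zero>\<^bsub>N\<^esub>)"
      using s2(4) unfolding MN.N.O.bounded_def by (elim exE)
    have dec: "\<exists>m. m \<in> M1 \<and> m \<in> M2 \<and> m \<in> mpart M k \<and> x \<in> g m" if x: "x \<in> N'" "x \<in> mpart N k" for x k
    proof -
      obtain m where m: "m \<in> M1" "m \<in> M2" "x \<in> g m" using N'D[OF x(1)] by blast
      have "hcomp N x k = x" using MN.N.hcomp_homog[OF x(2), of k] by simp
      then have "x \<in> g (hcomp M m k)" using q2(10)[OF m(2,3), of k] by simp
      then show ?thesis using dM1(5)[OF m(1)] dM2(5)[OF m(2)] LM.N.hcomp_mpart[OF dM1(1)[OF m(1)]] by blast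
    qed
    show ?thesis
      unfolding MN.N.O.bounded_def
    proof (intro exI[of _ "max K1 K2"] exI[of _ "p2 * p1"] conjI allI impI ballI)
      show "p2 * p1 \<noteq> 0" using 1 2 by simp
      show "N' \<inter> mpart N k \<subseteq> {\<zero>\<^bsub>N\<^esub>}" if k: "\<bar>k\<bar> \<ge> max K1 K2" for k
      proof
        fix x assume x: "x \<in> N' \<inter> mpart N k"
        then obtain m where m: "m \<in> M1" "m \<in> mpart M k" "x \<in> g m" using dec[of x k] by blast
        have "M1 \<inter> mpart M k \<subseteq> {\<zero>\<^bsub>M\<^esub>}" and N2: "N2 \<inter> mpart N k \<subseteq> {\<zero>\<^bsub>N\<^esub>}" using 1 2 k by simp_all
        then have "m = \<zero>\<^bsub>M\<^esub>" using m by blast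
        then have "x \<in> N2" using m(3) q2(7) by simp
        then show "x \<in> {\<zero>\<^bsub>N\<^esub>}" using N2 x by blast
      qed
      fix k x assume x: "x \<in> N' \<inter> mpart N k"
      then obtain m where m: "m \<in> M1" "m \<in> M2" "m \<in> mpart M k" "x \<in> g m" using dec[of x k] by blast
      have "tact (edge \<alpha>) M k p1 m = \<zero>\<^bsub>M\<^esub>" using 1 m by blast
      then have "tact (edge \<alpha>) N k p1 x \<in> N2" using MN.qrep_tact[OF r2 m(2,4), of k p1] q2(7) by simp
      moreover have xk: "x \<in> mpart N k" using x by blast
      ultimately have "tact (edge \<alpha>) N k p2 (tact (edge \<alpha>) N k p1 x) = \<zero>\<^bsub>N\<^esub>"
        using 2 MN.N.tact_mpart[OF xk] by blast
      then show "tact (edge \<alpha>) N k (p2 * p1) x = \<zero>\<^bsub>N\<^esub>" using MN.N.O.act_mult[OF xk, of p2 p1] by simp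
    qed
  qed
  interpret Q: gquot "edge \<alpha>" N N' by (intro gquot.intro gquot_axioms.intro MN.N.gmod_axioms N'sub)
  let ?R = "\<lambda>l n. \<exists>m. m \<in> f l \<and> m \<in> M2 \<and> n \<in> g m"
  have h_mem: "x \<in> h l \<longleftrightarrow> ?R l x" if "l \<in> L'" for x l using that unfolding h_def by auto
  have r: "(L', N', h) \<in> qreps (gwa (edge \<alpha>)) L N"
  proof (rule LN.qrepI[where R = ?R, OF L'sub L'cof N'sub N'fin])
    show "h \<in> extensional L'" unfolding h_def by simp
    show "\<exists>n. ?R l n" if l: "l \<in> L'" for l using L'D(2)[OF l] q2(2) by blast
    show "n \<in> carrier N \<and> h l = N' +>\<^bsub>N\<^esub> n" if l: "l \<in> L'" and n: "?R l n" for l n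
    proof -
      obtain m where m: "m \<in> f l" "m \<in> M2" "n \<in> g m" using n by blast
      have nc: "n \<in> carrier N" using q2(3)[OF m(2,3)] by blast
      have "x \<in> h l \<longleftrightarrow> x \<in> N' +>\<^bsub>N\<^esub> n" for x
        unfolding h_mem[OF l] Q.mem_coset[OF nc]
      proof
        assume "?R l x"
        then obtain m' where m': "m' \<in> f l" "m' \<in> M2" "x \<in> g m'" by blast
        obtain y where y: "y \<in> M1" "m' = y \<oplus>\<^bsub>M\<^esub> m" using q1(8)[OF L'D(1)[OF l] m'(1) m(1)] by blast
        \<comment> \<open>two intermediate elements differ by an element of \<open>M1 \<inter> M2\<close>, so the values differ by an element of \<open>N'\<close>\<close>
        have "y = m' \<oplus>\<^bsub>M\<^esub> \<ominus>\<^bsub>M\<^esub> m"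
          using y dM1(1)[OF y(1)] dM2(1)[OF m(2)] by (simp add: LM.N.R.M.a_assoc LM.N.R.M.r_neg)
        then have yM2: "y \<in> M2" using dM2(3)[OF m'(2) dM2(6)[OF m(2)]] by simp
        obtain z where z: "z \<in> g y" using q2(2)[OF yM2] by blast
        have zc: "z \<in> carrier N" using q2(3)[OF yM2 z] by blast
        have "z \<oplus>\<^bsub>N\<^esub> n \<in> g m'" using q2(4)[OF yM2 m(2) z m(3)] y(2) by simp
        then obtain w where w: "w \<in> N2" "x = w \<oplus>\<^bsub>N\<^esub> (z \<oplus>\<^bsub>N\<^esub> n)" using q2(8)[OF m'(2,3)] by blast
        then have "x = (w \<oplus>\<^bsub>N\<^esub> z) \<oplus>\<^bsub>N\<^esub> n" using dN(1)[OF w(1)] zc nc by (simp add: MN.N.R.M.a_assoc)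
        moreover have "w \<oplus>\<^bsub>N\<^esub> z \<in> N'" by (rule N'I[OF y(1) yM2 q2(9)[OF yM2 z w(1)]])
        ultimately show "\<exists>x'\<in>N'. x = x' \<oplus>\<^bsub>N\<^esub> n" by blast
      next
        assume "\<exists>x'\<in>N'. x = x' \<oplus>\<^bsub>N\<^esub> n"
        then obtain x' where x': "x' \<in> N'" "x = x' \<oplus>\<^bsub>N\<^esub> n" by blast
        obtain y where y: "y \<in> M1" "y \<in> M2" "x' \<in> g y" using N'D[OF x'(1)] by blast
        have "y \<oplus>\<^bsub>M\<^esub> m \<in> f l" by (rule q1(9)[OF L'D(1)[OF l] m(1) y(1)])
        moreover have "y \<oplus>\<^bsub>M\<^esub> m \<in> M2" by (rule dM2(3)[OF y(2) m(2)])
        moreover have "x \<in> g (y \<oplus>\<^bsub>M\<^esub> m)" unfolding x'(2) by (rule q2(4)[OF y(2) m(2) y(3) m(3)])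
        ultimately show "?R l x" by blast
      qed
      then show ?thesis using nc by blast
    qed
    show "?R (l \<oplus>\<^bsub>L\<^esub> l') (n \<oplus>\<^bsub>N\<^esub> n')"
      if l: "l \<in> L'" "l' \<in> L'" and n: "?R l n" "?R l' n'" for l n l' n'
    proof -
      obtain m m' where "m \<in> f l" "m \<in> M2" "n \<in> g m" "m' \<in> f l'" "m' \<in> M2" "n' \<in> g m'" using n by blast
      then show ?thesis using q1(4)[OF L'D(1)[OF l(1)] L'D(1)[OF l(2)]] dM2(3) q2(4) by blast
    qed
    show "?R (LM.M.act l p) (MN.N.act n p)" if l: "l \<in> L'" and n: "?R l n" for l n p
      using n q1(5)[OF L'D(1)[OF l]] dM2(4) q2(5) by blast
    show "\<exists>n\<in>mpart N i. ?R l n" if l: "l \<in> L'" "l \<in> mpart L i" for l i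
    proof -
      obtain m where m: "m \<in> f l" "m \<in> M2" using L'D(2)[OF l(1)] by blast
      have "hcomp L l i = l" using LM.M.hcomp_homog[OF l(2), of i] by simp
      then have "hcomp M m i \<in> f l" using q1(10)[OF L'D(1)[OF l(1)] m(1), of i] by simp
      moreover have m2: "hcomp M m i \<in> M2" "hcomp M m i \<in> mpart M i"
        using dM2(5)[OF m(2)] LM.N.hcomp_mpart[OF dM2(1)[OF m(2)]] by blast+
      ultimately show ?thesis using q2(6)[OF m2] by blast
    qed
  qed
  show "qcomp (M2, N2, g) (L1, M1, f) \<in> qreps (gwa (edge \<alpha>)) L N" unfolding eq by (rule r)
  show "LN.induced_hom (qcomp (M2, N2, g) (L1, M1, f)) = compose (carrier LM.M.FX) (MN.induced_hom (M2, N2, g)) (LM.induced_hom (L1, M1, f))"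
    unfolding eq
  proof (rule LN.induced_hom_eqI[OF r gr_hom_ops(3)[OF LM.M.FX_obj LM.N.FX_obj MN.N.FX_obj LM.induced_hom(1)[OF r1] MN.induced_hom(1)[OF r2]]])
    fix n a assume a: "a \<in> LM.M.O.fam 0 n"
    note p = LM.induced_map[OF r1 a]
    note p' = MN.induced_map[OF r2 p(1)]
    show "MN.induced_map g n (LM.induced_map f n a) \<in> MN.N.O.fam 0 n" by (rule p'(1))
    show "MN.induced_map g n (LM.induced_map f n a) k \<in> h (a k)" for k
      unfolding h_mem[OF LN.fam_sub[OF r a]] using p(2) p'(2) MN.fam_sub[OF r2 p(1)] by blast
    show "compose (carrier LM.M.FX) (MN.induced_hom (M2, N2, g)) (LM.induced_hom (L1, M1, f)) (LM.M.F\<theta> n a)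
        = MN.N.F\<theta> n (MN.induced_map g n (LM.induced_map f n a))"
      using LM.induced_hom(2)[OF r1 a] MN.induced_hom(2)[OF r2 p(1)] LM.F\<theta>_carrier[OF a] by (simp add: compose_def)
  qed
qed

subsection \<open>Morphisms of the quotient category as homomorphisms\<close>

context qpair
begin

lemma qrel_iff: "\<lbrakk>r \<in> qreps B M N; r' \<in> qreps B M N\<rbrakk> \<Longrightarrow> (r, r') \<in> qrel B M N \<longleftrightarrow> induced_hom r = induced_hom r'"
  by (cases r, cases r') (simp add: induced_hom_qrel)

text \<open>Morphisms of the quotient category are equivalence classes, and these are the sets of representatives of one homomorphism.\<close>

definition cls :: "('m \<Rightarrow> 'm) \<Rightarrow> 'm qrep set" where
  "cls g = {r \<in> qreps B M N. induced_hom r = g}"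

definition hom_of_cls :: "'m qrep set \<Rightarrow> 'm \<Rightarrow> 'm" where
  "hom_of_cls R = induced_hom (SOME r. r \<in> R)"

text \<open>All operations on classes are unions of classes of composites of representatives; by this lemma and its consequences all
  members of such a union are equal.\<close>

lemma qrel_class:
  assumes "r \<in> qreps B M N"
  shows "qrel B M N `` {r} = cls (induced_hom r)"
proof -
  have "qrel B M N \<subseteq> qreps B M N \<times> qreps B M N" unfolding qrel_def by auto
  then show ?thesis unfolding cls_def using assms qrel_iff[OF assms] by auto
qed

lemma cls_nonempty: "g \<in> gr_hom (gwa (edge 0)) M.FX N.FX \<Longrightarrow> \<exists>r. r \<in> cls g"
  using induced_hom_surj unfolding cls_def by blast

lemma hom_of_cls: "g \<in> gr_hom (gwa (edge 0)) M.FX N.FX \<Longrightarrow> hom_of_cls (cls g) = g"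
proof -
  assume "g \<in> gr_hom (gwa (edge 0)) M.FX N.FX"
  from someI_ex[OF cls_nonempty[OF this]] show ?thesis unfolding hom_of_cls_def cls_def by simp
qed

lemma quotient_homs: "qreps B M N // qrel B M N = cls ` gr_hom (gwa (edge 0)) M.FX N.FX"
proof (intro equalityI subsetI)
  fix R assume "R \<in> qreps B M N // qrel B M N"
  then obtain r where r: "r \<in> qreps B M N" "R = qrel B M N `` {r}" by (rule quotientE)
  then show "R \<in> cls ` gr_hom (gwa (edge 0)) M.FX N.FX" using qrel_class[OF r(1)] induced_hom(1)[OF r(1)] by simp
next
  fix R assume "R \<in> cls ` gr_hom (gwa (edge 0)) M.FX N.FX"
  then obtain g where g: "g \<in> gr_hom (gwa (edge 0)) M.FX N.FX" "R = cls g" by blast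
  obtain r where r: "r \<in> qreps B M N" "induced_hom r = g" using induced_hom_surj[OF g(1)] by blast
  then have "R = qrel B M N `` {r}" using qrel_class[OF r(1)] g(2) by simp
  then show "R \<in> qreps B M N // qrel B M N" using quotientI[OF r(1)] by simp
qed

lemma bij_hom_of_cls: "bij_betw hom_of_cls (qreps B M N // qrel B M N) (gr_hom (gwa (edge 0)) M.FX N.FX)"
  unfolding quotient_homs
  by (rule bij_betw_byWitness[where f' = cls]) (auto simp: hom_of_cls)

lemma qadd_cls:
  assumes u: "u \<in> gr_hom (gwa (edge 0)) M.FX N.FX" and v: "v \<in> gr_hom (gwa (edge 0)) M.FX N.FX"
  shows "(\<Union>f\<in>cls u. \<Union>g\<in>cls v. qrel B M N `` {qadd N f g}) = cls (restrict (\<lambda>m. u m \<oplus>\<^bsub>N.FX\<^esub> v m) (carrier M.FX))"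
proof -
  have "qrel B M N `` {qadd N f g} = cls (restrict (\<lambda>m. u m \<oplus>\<^bsub>N.FX\<^esub> v m) (carrier M.FX))"
    if "f \<in> cls u" "g \<in> cls v" for f g
  proof -
    have f: "f \<in> qreps B M N" "induced_hom f = u" and g: "g \<in> qreps B M N" "induced_hom g = v" using that unfolding cls_def by auto
    have "qadd N f g \<in> qreps B M N"
      "induced_hom (qadd N f g) = restrict (\<lambda>m. induced_hom f m \<oplus>\<^bsub>N.FX\<^esub> induced_hom g m) (carrier M.FX)"
      using qadd_rep f(1) g(1) by (cases f, cases g, simp)+
    then show ?thesis using qrel_class f(2) g(2) by simp
  qed
  then show ?thesis using cls_nonempty[OF u] cls_nonempty[OF v] by auto
qed

lemma qscale_cls:
  assumes u: "u \<in> gr_hom (gwa (edge 0)) M.FX N.FX"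
  shows "(\<Union>f\<in>cls u. qrel B M N `` {qscale B N c f})
    = cls (restrict (\<lambda>m. ract N.FX (u m) (scal (gwa (edge 0)) c)) (carrier M.FX))"
proof -
  have "qrel B M N `` {qscale B N c f} = cls (restrict (\<lambda>m. ract N.FX (u m) (scal (gwa (edge 0)) c)) (carrier M.FX))"
    if "f \<in> cls u" for f
  proof -
    have f: "f \<in> qreps B M N" "induced_hom f = u" using that unfolding cls_def by auto
    have "qscale B N c f \<in> qreps B M N"
      "induced_hom (qscale B N c f) = restrict (\<lambda>m. ract N.FX (induced_hom f m) (scal (gwa (edge 0)) c)) (carrier M.FX)"
      using qscale_rep f(1) by (cases f, simp)+
    then show ?thesis using qrel_class f(2) by simp
  qed
  then show ?thesis using cls_nonempty[OF u] by auto
qed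

end

lemma qcomp_cls:
  fixes L M N :: "('k::field_char_0 free_alg set, 'm) gmodule"
  assumes LM: "qpair \<alpha> L M" and MN: "qpair \<alpha> M N"
    and u: "u \<in> gr_hom (gwa (edge 0)) (grmod_inf.FX \<alpha> L) (grmod_inf.FX \<alpha> M)"
    and v: "v \<in> gr_hom (gwa (edge 0)) (grmod_inf.FX \<alpha> M) (grmod_inf.FX \<alpha> N)"
  shows "(\<Union>g\<in>qpair.cls \<alpha> M N v. \<Union>f\<in>qpair.cls \<alpha> L M u. qrel (gwa (edge \<alpha>)) L N `` {qcomp g f})
    = qpair.cls \<alpha> L N (compose (carrier (grmod_inf.FX \<alpha> L)) v u)"
proof -
  interpret LM: qpair \<alpha> L M by (rule LM)
  interpret MN: qpair \<alpha> M N by (rule MN)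
  interpret LN: qpair \<alpha> L N by (intro qpair.intro LM.M.grmod_inf_axioms MN.N.grmod_inf_axioms)
  have "qrel (gwa (edge \<alpha>)) L N `` {qcomp g f} = LN.cls (compose (carrier LM.M.FX) v u)"
    if "f \<in> LM.cls u" "g \<in> MN.cls v" for f g
  proof -
    have f: "f \<in> qreps (gwa (edge \<alpha>)) L M" "LM.induced_hom f = u" using that unfolding LM.cls_def by auto
    have g: "g \<in> qreps (gwa (edge \<alpha>)) M N" "MN.induced_hom g = v" using that unfolding MN.cls_def by auto
    have "qcomp g f \<in> qreps (gwa (edge \<alpha>)) L N"
      "LN.induced_hom (qcomp g f) = compose (carrier LM.M.FX) (MN.induced_hom g) (LM.induced_hom f)"
      using qcomp_rep[OF LM MN] f(1) g(1) by (cases f, cases g, simp)+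
    then show ?thesis using LN.qrel_class f(2) g(2) by simp
  qed
  then show ?thesis using LM.cls_nonempty[OF u] MN.cls_nonempty[OF v] by auto
qed

lemma qgr_fully_faithful:
  assumes inf: "infinite (UNIV :: 'u set)"
  shows "fully_faithful (gr_cat TYPE('u) (gwa (edge 0))) (qgr_cat TYPE('u) (gwa (edge \<alpha> :: 'k::field_char_0 poly)))
    (grmod_inf.FX \<alpha>) (qpair.hom_of_cls \<alpha>)"
proof -
  let ?B = "gwa (edge \<alpha> :: 'k poly)" and ?A = "gwa (edge 0 :: 'k poly)"
  let ?C = "gr_cat TYPE('u) ?A" and ?D = "qgr_cat TYPE('u) ?B"
  let ?F = "grmod_inf.FX \<alpha> :: ('k free_alg set, 'u) gmodule \<Rightarrow> ('k free_alg set, 'u) gmodule"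
  have C: "obj ?C = gr_obj ?A" "homs ?C = gr_hom ?A"
    "cmp ?C = (\<lambda>L M N g f. compose (carrier L) g f)" "idm ?C = (\<lambda>M. restrict (\<lambda>m. m) (carrier M))"
    "hadd ?C = (\<lambda>M N f g. restrict (\<lambda>m. f m \<oplus>\<^bsub>N\<^esub> g m) (carrier M))"
    "hzero ?C = (\<lambda>M N. restrict (\<lambda>m. \<zero>\<^bsub>N\<^esub>) (carrier M))"
    "hscale ?C = (\<lambda>M N c g. restrict (\<lambda>m. ract N (g m) (scal ?A c)) (carrier M))"
    by (simp_all add: gr_cat_def)
  have P: "grmod_inf \<alpha> X" if "X \<in> obj ?D" for X
    using that gr_obj_iff[of X \<alpha>] by (simp add: qgr_cat_def grmod_inf_def grmod_inf_axioms_def inf)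
  have PP: "qpair \<alpha> X Y" if "X \<in> obj ?D" "Y \<in> obj ?D" for X Y
    using P that by (intro qpair.intro)
  have FO: "?F X \<in> gr_obj ?A" if "X \<in> obj ?D" for X using grmod_inf.FX_obj[OF P[OF that]] .
  have homs: "homs ?D X Y = qpair.cls \<alpha> X Y ` gr_hom ?A (?F X) (?F Y)" if "X \<in> obj ?D" "Y \<in> obj ?D" for X Y
    using qpair.quotient_homs[OF PP[OF that]] by (simp add: qgr_cat_def)
  note hom_cls = qpair.hom_of_cls[OF PP]
  have idm: "idm ?D X = qpair.cls \<alpha> X X (restrict (\<lambda>m. m) (carrier (?F X)))" if X: "X \<in> obj ?D" for X
    using qpair.qrel_class[OF PP[OF X X] grmod_inf.id_rep(1)[OF P[OF X]]] grmod_inf.id_rep(2)[OF P[OF X]]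
    by (simp add: qgr_cat_def)
  have hzero: "hzero ?D X Y = qpair.cls \<alpha> X Y (restrict (\<lambda>m. \<zero>\<^bsub>?F Y\<^esub>) (carrier (?F X)))"
    if XY: "X \<in> obj ?D" "Y \<in> obj ?D" for X Y
    using qpair.qrel_class[OF PP[OF XY] qpair.zero_rep(1)[OF PP[OF XY]]] qpair.zero_rep(2)[OF PP[OF XY]]
    by (simp add: qgr_cat_def)
  have cmp: "cmp ?D X Y Z (qpair.cls \<alpha> Y Z v) (qpair.cls \<alpha> X Y u) = qpair.cls \<alpha> X Z (compose (carrier (?F X)) v u)"
    if "X \<in> obj ?D" "Y \<in> obj ?D" "Z \<in> obj ?D" "u \<in> gr_hom ?A (?F X) (?F Y)" "v \<in> gr_hom ?A (?F Y) (?F Z)" for X Y Z u v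
    using qcomp_cls[OF PP[OF that(1,2)] PP[OF that(2,3)] that(4,5)] by (simp add: qgr_cat_def)
  have hadd: "hadd ?D X Y (qpair.cls \<alpha> X Y u) (qpair.cls \<alpha> X Y v)
      = qpair.cls \<alpha> X Y (restrict (\<lambda>m. u m \<oplus>\<^bsub>?F Y\<^esub> v m) (carrier (?F X)))"
    if "X \<in> obj ?D" "Y \<in> obj ?D" "u \<in> gr_hom ?A (?F X) (?F Y)" "v \<in> gr_hom ?A (?F X) (?F Y)" for X Y u v
    using qpair.qadd_cls[OF PP[OF that(1,2)] that(3,4)] by (simp add: qgr_cat_def)
  have hscale: "hscale ?D X Y c (qpair.cls \<alpha> X Y u)
      = qpair.cls \<alpha> X Y (restrict (\<lambda>m. ract (?F Y) (u m) (scal ?A c)) (carrier (?F X)))"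
    if "X \<in> obj ?D" "Y \<in> obj ?D" "u \<in> gr_hom ?A (?F X) (?F Y)" for X Y u c
    using qpair.qscale_cls[OF PP[OF that(1,2)] that(3)] by (simp add: qgr_cat_def)
  show ?thesis
  proof (rule fully_faithful.intro[OF gr_cat_linear fully_faithful_axioms.intro], goal_cases)
    case (1 X) then show ?case using FO by (simp add: C)
  next
    case (2 X Y) then show ?case using qpair.bij_hom_of_cls[OF PP] by (simp add: C qgr_cat_def)
  next
    case (3 X)
    note ops = gr_hom_ops(1)[OF FO[OF 3] FO[OF 3] FO[OF 3]]
    show ?case unfolding idm[OF 3] homs[OF 3 3] by (rule imageI[OF ops])
  next
    case (4 X)
    note ops = gr_hom_ops(1)[OF FO[OF 4] FO[OF 4] FO[OF 4]]
    show ?case unfolding idm[OF 4] hom_cls[OF 4 4 ops] by (simp add: C)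
  next
    case (5 X Y Z f g)
    obtain u where u: "u \<in> gr_hom ?A (?F X) (?F Y)" "f = qpair.cls \<alpha> X Y u"
      using 5(4) unfolding homs[OF 5(1,2)] by blast
    obtain v where v: "v \<in> gr_hom ?A (?F Y) (?F Z)" "g = qpair.cls \<alpha> Y Z v"
      using 5(5) unfolding homs[OF 5(2,3)] by blast
    note uv = u v
    note ops = gr_hom_ops(3)[OF FO[OF 5(1)] FO[OF 5(2)] FO[OF 5(3)] uv(1,3)]
    show ?case unfolding uv(2,4) cmp[OF 5(1,2,3) uv(1,3)] homs[OF 5(1,3)] by (rule imageI[OF ops])
  next
    case (6 X Y Z f g)
    obtain u where u: "u \<in> gr_hom ?A (?F X) (?F Y)" "f = qpair.cls \<alpha> X Y u"
      using 6(4) unfolding homs[OF 6(1,2)] by blast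
    obtain v where v: "v \<in> gr_hom ?A (?F Y) (?F Z)" "g = qpair.cls \<alpha> Y Z v"
      using 6(5) unfolding homs[OF 6(2,3)] by blast
    note uv = u v
    note ops = gr_hom_ops(3)[OF FO[OF 6(1)] FO[OF 6(2)] FO[OF 6(3)] uv(1,3)]
    show ?case
      unfolding uv(2,4) cmp[OF 6(1,2,3) uv(1,3)] hom_cls[OF 6(1,3) ops] hom_cls[OF 6(1,2) uv(1)] hom_cls[OF 6(2,3) uv(3)]
      by (simp add: C)
  next
    case (7 X Y f g)
    obtain u where u: "u \<in> gr_hom ?A (?F X) (?F Y)" "f = qpair.cls \<alpha> X Y u"
      using 7(3) unfolding homs[OF 7(1,2)] by blast
    obtain v where v: "v \<in> gr_hom ?A (?F X) (?F Y)" "g = qpair.cls \<alpha> X Y v"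
      using 7(4) unfolding homs[OF 7(1,2)] by blast
    note uv = u v
    note ops = gr_hom_ops(4)[OF FO[OF 7(1)] FO[OF 7(1)] FO[OF 7(2)] uv(1,3)]
    show ?case unfolding uv(2,4) hadd[OF 7(1,2) uv(1,3)] homs[OF 7(1,2)] by (rule imageI[OF ops])
  next
    case (8 X Y f g)
    obtain u where u: "u \<in> gr_hom ?A (?F X) (?F Y)" "f = qpair.cls \<alpha> X Y u"
      using 8(3) unfolding homs[OF 8(1,2)] by blast
    obtain v where v: "v \<in> gr_hom ?A (?F X) (?F Y)" "g = qpair.cls \<alpha> X Y v"
      using 8(4) unfolding homs[OF 8(1,2)] by blast
    note uv = u v
    note ops = gr_hom_ops(4)[OF FO[OF 8(1)] FO[OF 8(1)] FO[OF 8(2)] uv(1,3)]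
    show ?case
      unfolding uv(2,4) hadd[OF 8(1,2) uv(1,3)] hom_cls[OF 8(1,2) ops] hom_cls[OF 8(1,2) uv(1)] hom_cls[OF 8(1,2) uv(3)]
      by (simp add: C)
  next
    case (9 X Y)
    note ops = gr_hom_ops(2)[OF FO[OF 9(1)] FO[OF 9(1)] FO[OF 9(2)]]
    show ?case unfolding hzero[OF 9] homs[OF 9] by (rule imageI[OF ops])
  next
    case (10 X Y)
    note ops = gr_hom_ops(2)[OF FO[OF 10(1)] FO[OF 10(1)] FO[OF 10(2)]]
    show ?case unfolding hzero[OF 10] hom_cls[OF 10 ops] by (simp add: C)
  next
    case (11 X Y f c)
    obtain u where u: "u \<in> gr_hom ?A (?F X) (?F Y)" "f = qpair.cls \<alpha> X Y u" using 11(3) unfolding homs[OF 11(1,2)] by blast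
    note ops = gr_hom_ops(5)[OF FO[OF 11(1)] FO[OF 11(1)] FO[OF 11(2)] u(1)]
    show ?case unfolding u(2) hscale[OF 11(1,2) u(1)] homs[OF 11(1,2)] by (rule imageI[OF ops])
  next
    case (12 X Y f c)
    obtain u where u: "u \<in> gr_hom ?A (?F X) (?F Y)" "f = qpair.cls \<alpha> X Y u" using 12(3) unfolding homs[OF 12(1,2)] by blast
    note ops = gr_hom_ops(5)[OF FO[OF 12(1)] FO[OF 12(1)] FO[OF 12(2)] u(1)]
    show ?case unfolding u(2) hscale[OF 12(1,2) u(1)] hom_cls[OF 12(1,2) ops] hom_cls[OF 12(1,2) u(1)] by (simp add: C)
  qed
qed

subsection \<open>Essential surjectivity\<close>

text \<open>A bijective map of representations has an inverse map, and both extend to homomorphisms.\<close>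

lemma realized_iso:
  fixes X X' :: "('k::field_char_0 free_alg set, 'u) gmodule"
  assumes A: "realized G \<beta> C act e X \<theta>" and B: "realized G' \<beta> C' act' e' X' \<theta>'"
    and bij: "\<And>n. bij_betw (\<chi> n) (C n) (C' n)"
    and add: "\<And>n v w. \<lbrakk>v \<in> C n; w \<in> C n\<rbrakk> \<Longrightarrow> \<chi> n (v \<oplus>\<^bsub>G\<^esub> w) = \<chi> n v \<oplus>\<^bsub>G'\<^esub> \<chi> n w"
    and act: "\<And>n p v. v \<in> C n \<Longrightarrow> \<chi> n (act n p v) = act' n p (\<chi> n v)"
    and e: "\<And>n m v. v \<in> C n \<Longrightarrow> \<chi> m (e n m v) = e' n m (\<chi> n v)"
  shows "\<exists>u. iso_in (gr_cat TYPE('u) (gwa (edge \<beta>))) X X' u"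
proof -
  interpret A: realized G \<beta> C act e X \<theta> by (rule A)
  interpret B: realized G' \<beta> C' act' e' X' \<theta>' by (rule B)
  note AB = realized_pair.intro[OF A B] and BA = realized_pair.intro[OF B A]
  note AA = realized_pair.intro[OF A A] and BB = realized_pair.intro[OF B B]
  have \<chi>: "\<chi> n v \<in> C' n" if "v \<in> C n" for n v using bij_betwE[OF bij] that by blast
  define \<rho> where "\<rho> n = inv_into (C n) (\<chi> n)" for n
  have \<rho>\<chi>: "\<rho> n (\<chi> n v) = v" if "v \<in> C n" for n v
    unfolding \<rho>_def using bij[of n] that by (simp add: bij_betw_def)
  have \<rho>: "\<rho> n w \<in> C n" "\<chi> n (\<rho> n w) = w" if "w \<in> C' n" for n w
    unfolding \<rho>_def using bij[of n] that by (auto simp: bij_betw_def intro: inv_into_into f_inv_into_f)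
  have oh: "realized_pair.ohom G C act e G' C' act' e' \<chi>"
    unfolding realized_pair.ohom_def[OF AB] by (intro conjI allI ballI \<chi> add act e)
  have oh': "realized_pair.ohom G' C' act' e' G C act e \<rho>"
    unfolding realized_pair.ohom_def[OF BA]
  proof (intro conjI allI ballI)
    fix n w assume w: "w \<in> C' n"
    show "\<rho> n w \<in> C n" by (rule \<rho>(1)[OF w])
    show "\<rho> n (act' n p w) = act n p (\<rho> n w)" for p
      using act[OF \<rho>(1)[OF w], of p] \<rho>(2)[OF w] \<rho>\<chi>[OF A.R.act_C[OF \<rho>(1)[OF w]], of p] by simp
    show "\<rho> m (e' n m w) = e n m (\<rho> n w)" for m
      using e[OF \<rho>(1)[OF w], of m] \<rho>(2)[OF w] \<rho>\<chi>[OF A.R.e_C[OF \<rho>(1)[OF w]], of m] by simp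
    fix w' assume w': "w' \<in> C' n"
    show "\<rho> n (w \<oplus>\<^bsub>G'\<^esub> w') = \<rho> n w \<oplus>\<^bsub>G\<^esub> \<rho> n w'"
      using add[OF \<rho>(1)[OF w] \<rho>(1)[OF w']] \<rho>(2)[OF w] \<rho>(2)[OF w'] \<rho>\<chi>[OF A.R.C_add[OF \<rho>(1)[OF w] \<rho>(1)[OF w']]] by simp
  qed
  obtain h where h: "h \<in> gr_hom (gwa (edge \<beta>)) X X'" "\<And>n v. v \<in> C n \<Longrightarrow> h (\<theta> n v) = \<theta>' n (\<chi> n v)"
    using realized_pair.hom_of_ohom[OF AB oh] by blast
  obtain h' where h': "h' \<in> gr_hom (gwa (edge \<beta>)) X' X" "\<And>n w. w \<in> C' n \<Longrightarrow> h' (\<theta>' n w) = \<theta> n (\<rho> n w)"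
    using realized_pair.hom_of_ohom[OF BA oh'] by blast
  have obj: "X \<in> gr_obj (gwa (edge \<beta>))" "X' \<in> gr_obj (gwa (edge \<beta>))"
    unfolding gr_obj_iff by (rule A.X.grmod_axioms B.X.grmod_axioms)+
  have "compose (carrier X) h' h = restrict (\<lambda>m. m) (carrier X)"
  proof (rule realized_pair.hom_unique[OF AA gr_hom_ops(3)[OF obj(1,2,1) h(1) h'(1)] gr_hom_ops(1)[OF obj(1,1,1)]])
    fix n v assume v: "v \<in> C n"
    have "\<theta> n v \<in> carrier X" by (rule A.X.mpart_carrier[OF A.\<theta>_mpart[OF v]])
    then show "compose (carrier X) h' h (\<theta> n v) = restrict (\<lambda>m. m) (carrier X) (\<theta> n v)"
      using h(2)[OF v] h'(2)[OF \<chi>[OF v]] \<rho>\<chi>[OF v] by (simp add: compose_def)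
  qed
  moreover have "compose (carrier X') h h' = restrict (\<lambda>m. m) (carrier X')"
  proof (rule realized_pair.hom_unique[OF BB gr_hom_ops(3)[OF obj(2,1,2) h'(1) h(1)] gr_hom_ops(1)[OF obj(2,2,2)]])
    fix n w assume w: "w \<in> C' n"
    have "\<theta>' n w \<in> carrier X'" by (rule B.X.mpart_carrier[OF B.\<theta>_mpart[OF w]])
    then show "compose (carrier X') h h' (\<theta>' n w) = restrict (\<lambda>m. m) (carrier X') (\<theta>' n w)"
      using h'(2)[OF w] h(2)[OF \<rho>(1)[OF w]] \<rho>(2)[OF w] by (simp add: compose_def)
  qed
  ultimately have "iso_in (gr_cat TYPE('u) (gwa (edge \<beta>))) X X' h"
    unfolding iso_in_def using h(1) h'(1) by (auto simp: gr_cat_def)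
  then show ?thesis by (rule exI[of _ h])
qed

text \<open>The module \<open>X\<close> realizes the families \<open>H\<close> of \<open>Y\<close> at the divisors \<open>L \<alpha> k\<close>. An element \<open>v\<close> of \<open>Y\<close> of
  degree \<open>n\<close> yields for each \<open>k\<close> the family that it generates at \<open>L \<alpha> k\<close>, and these form a family \<open>\<chi> n v\<close> of \<open>X\<close>. The
  entry at \<open>n\<close> of the \<open>k\<close>-th of them is \<open>v\<close> times a round trip factor, and two of these factors are coprime; this gives injectivity
  and, with the Bezout coefficients, a preimage of a given family of \<open>X\<close>.\<close>

lemma essentially_surjective:
  fixes Y :: "('k::field_char_0 free_alg set, 'u) gmodule"
  assumes inf: "infinite (UNIV :: 'u set)" and Y: "Y \<in> gr_obj (gwa (edge 0))"
  shows "\<exists>X\<in>gr_obj (gwa (edge \<alpha>)). \<exists>u. iso_in (gr_cat TYPE('u) (gwa (edge 0))) Y (grmod_inf.FX \<alpha> X) u"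
proof -
  interpret Y: grmod_inf 0 Y
    using Y by (intro grmod_inf.intro grmod_inf_axioms.intro inf) (simp add: gr_obj_iff)
  interpret H: orep "fun_group Y" \<alpha> "Y.O.H \<alpha>" "\<lambda>_. Y.O.pact" "Y.O.tr \<alpha>" by (rule Y.O.H_orep) simp
  have ofg: "H.ofg" by (rule Y.O.H_ofg[OF Y.ofg]) simp
  have "inj_on (\<lambda>a. (a (i - int 0), a (i + int \<alpha>))) (Y.O.H \<alpha> i)" for i
    by (intro inj_onI Y.O.fam_determined[of \<alpha> _ i]) (auto dest: Y.O.H_fam)
  from H.realization[OF ofg inf this]
  obtain X :: "('k free_alg set, 'u) gmodule" and \<theta> where X: "grmod \<alpha> X" "\<forall>n. bij_betw (\<theta> n) (Y.O.H \<alpha> n) (mpart X n)"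
    "\<forall>n. \<forall>v\<in>Y.O.H \<alpha> n. \<forall>w\<in>Y.O.H \<alpha> n. \<theta> n (v \<oplus>\<^bsub>fun_group Y\<^esub> w) = \<theta> n v \<oplus>\<^bsub>X\<^esub> \<theta> n w"
    "\<forall>n p. \<forall>v\<in>Y.O.H \<alpha> n. \<theta> n (Y.O.pact p v) = tact (edge \<alpha>) X n p (\<theta> n v)"
    "\<forall>n m. \<forall>v\<in>Y.O.H \<alpha> n. \<theta> m (Y.O.tr \<alpha> n m v) = mmap (edge \<alpha>) X n m (\<theta> n v)"
    by (elim exE conjE) (rule that, assumption+)
  interpret R: realized "fun_group Y" \<alpha> "Y.O.H \<alpha>" "\<lambda>_. Y.O.pact" "Y.O.tr \<alpha>" X \<theta>
    by (intro realized.intro realized_axioms.intro H.orep_axioms X(1)) (use X(2-) in auto)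
  interpret X: grmod_inf \<alpha> X by (intro grmod_inf.intro grmod_inf_axioms.intro inf X(1))
  define \<chi> where "\<chi> n v k = \<theta> k (Y.O.lift \<alpha> k n v)" for n :: int and v k
  have lift: "Y.O.lift \<alpha> k n v \<in> Y.O.H \<alpha> k" if "v \<in> mpart Y n" for k n v by (rule Y.O.lift_H[OF _ that]) simp
  have \<chi>_fam: "\<chi> n v \<in> R.X.O.fam 0 n" if v: "v \<in> mpart Y n" for n v
  proof (rule R.X.O.famI)
    fix i j
    show "\<chi> n v i \<in> mpart X i" unfolding \<chi>_def by (rule R.\<theta>_mpart[OF lift[OF v]])
    show "mmap (edge \<alpha>) X i j (\<chi> n v i) = tact (edge \<alpha>) X j (cc (L 0 n) (L \<alpha> i) (L \<alpha> j)) (\<chi> n v j)"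
      unfolding \<chi>_def R.\<theta>_e[OF lift[OF v], symmetric] Y.O.tr_lift[OF v] by (rule R.\<theta>_act[OF lift[OF v]])
  qed
  have bz: "bezout (cc (L 0 n) (L \<alpha> (n - int \<alpha>)) (L 0 n)) (cc (L 0 n) (L \<alpha> n) (L 0 n) :: 'k poly)" for n
    by (rule cc_L0_bezout) simp_all
  have inj: "inj_on (\<chi> n) (mpart Y n)" for n
  proof (rule inj_onI)
    fix v w assume v: "v \<in> mpart Y n" and w: "w \<in> mpart Y n" and eq: "\<chi> n v = \<chi> n w"
    have "Y.O.lift \<alpha> k n v = Y.O.lift \<alpha> k n w" for k
      using fun_cong[OF eq, of k] unfolding \<chi>_def by (rule R.\<theta>_inj[OF lift[OF v] lift[OF w]])
    then have "Y.O.lift \<alpha> k n v n = Y.O.lift \<alpha> k n w n" for k by simp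
    then have "tact (edge 0) Y n (cc (L 0 n) (L \<alpha> k) (L 0 n)) v = tact (edge 0) Y n (cc (L 0 n) (L \<alpha> k) (L 0 n)) w" for k
      unfolding Y.O.lift_def by (simp add: Y.O.e_id[OF v] Y.O.e_id[OF w])
    then show "v = w" by (intro Y.O.bezout_cancel[OF bz v w])
  qed
  have surj: "\<exists>v\<in>mpart Y n. \<chi> n v = a" if a: "a \<in> R.X.O.fam 0 n" for n a
  proof -
    obtain b where b: "\<And>k. b k \<in> Y.O.H \<alpha> k" "\<And>k. a k = \<theta> k (b k)"
      using R.\<theta>_surj[OF R.X.O.famD(1)[OF a]] by metis
    have bC: "b k j \<in> mpart Y j" for k j using Y.O.famD(1)[OF Y.O.H_fam[OF b(1)]] .
    \<comment> \<open>compatibility of the family \<open>a\<close> of \<open>X\<close>, read in the families \<open>b k\<close> of \<open>Y\<close>\<close>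
    have tr: "Y.O.tr \<alpha> i k (b i) = Y.O.pact (cc (L 0 n) (L \<alpha> i) (L \<alpha> k)) (b k)" for i k
    proof (rule R.\<theta>_inj[OF H.e_C[OF b(1)] H.act_C[OF b(1)]])
      have "\<theta> k (Y.O.tr \<alpha> i k (b i)) = mmap (edge \<alpha>) X i k (a i)" by (simp add: R.\<theta>_e[OF b(1)] b(2))
      also have "\<dots> = tact (edge \<alpha>) X k (cc (L 0 n) (L \<alpha> i) (L \<alpha> k)) (a k)" by (rule R.X.O.famD(2)[OF a])
      finally show "\<theta> k (Y.O.tr \<alpha> i k (b i)) = \<theta> k (Y.O.pact (cc (L 0 n) (L \<alpha> i) (L \<alpha> k)) (b k))"
        by (simp add: R.\<theta>_act[OF b(1)] b(2))
    qed
    have lb: "Y.O.lift \<alpha> k n (b i n) = Y.O.pact (cc (L 0 n) (L \<alpha> i) (L 0 n)) (b k)" for i k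
    proof -
      have "Y.O.lift \<alpha> k n (b i n) = Y.O.pact (cc (L \<alpha> i) (L 0 n) (L \<alpha> k)) (Y.O.pact (cc (L 0 n) (L \<alpha> i) (L \<alpha> k)) (b k))"
        unfolding Y.O.lift_proj[OF Y.O.H_fam[OF b(1)]] tr ..
      also have "\<dots> = Y.O.pact (cc (L \<alpha> i) (L 0 n) (L \<alpha> k) * cc (L 0 n) (L \<alpha> i) (L \<alpha> k)) (b k)"
        by (rule H.act_mult[OF b(1), symmetric])
      also have "cc (L \<alpha> i) (L 0 n) (L \<alpha> k) * cc (L 0 n) (L \<alpha> i) (L \<alpha> k) = (cc (L 0 n) (L \<alpha> i) (L 0 n) :: 'k poly)"
        by (subst cc_cocycle[symmetric]) simp
      finally show ?thesis .
    qed
    obtain u w where uw: "u * cc (L 0 n) (L \<alpha> (n - int \<alpha>)) (L 0 n) + w * cc (L 0 n) (L \<alpha> n) (L 0 n) = (1 :: 'k poly)"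
      using bz unfolding bezout_def by blast
    define v where "v = tact (edge 0) Y n u (b (n - int \<alpha>) n) \<oplus>\<^bsub>Y\<^esub> tact (edge 0) Y n w (b n n)"
    have v: "v \<in> mpart Y n" unfolding v_def using bC Y.tact_mpart Y.mpart_add by blast
    have "Y.O.lift \<alpha> k n v = b k" for k
    proof -
      have "Y.O.lift \<alpha> k n v = (\<lambda>j. Y.O.pact u (Y.O.lift \<alpha> k n (b (n - int \<alpha>) n)) j
          \<oplus>\<^bsub>Y\<^esub> Y.O.pact w (Y.O.lift \<alpha> k n (b n n)) j)"
        unfolding v_def using bC by (simp add: Y.O.lift_add Y.O.lift_act Y.tact_mpart)
      also have "\<dots> = b k" using H.act_bezout[OF uw b(1)[of k]] unfolding lb by simp
      finally show ?thesis .
    qed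
    then have "\<chi> n v = a" unfolding \<chi>_def using b(2) by auto
    then show ?thesis using v by blast
  qed
  have "\<exists>u. iso_in (gr_cat TYPE('u) (gwa (edge 0))) Y X.FX u"
  proof (rule realized_iso[OF grmod_realized[OF Y.grmod_axioms] X.F_real, where \<chi> = \<chi>])
    show "bij_betw (\<chi> n) (mpart Y n) (R.X.O.fam 0 n)" for n
      unfolding bij_betw_def using inj[of n] \<chi>_fam[of _ n] surj[of _ n] by (auto simp: image_iff)
    show "\<chi> n (v \<oplus>\<^bsub>Y\<^esub> w) = \<chi> n v \<oplus>\<^bsub>fun_group X\<^esub> \<chi> n w" if "v \<in> mpart Y n" "w \<in> mpart Y n" for n v w
    proof (rule ext)
      fix k
      show "\<chi> n (v \<oplus>\<^bsub>Y\<^esub> w) k = (\<chi> n v \<oplus>\<^bsub>fun_group X\<^esub> \<chi> n w) k"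
        using R.\<theta>_add[OF lift[OF that(1), of k] lift[OF that(2), of k]] unfolding \<chi>_def by (simp add: Y.O.lift_add[OF that])
    qed
    show "\<chi> n (tact (edge 0) Y n p v) = R.X.O.pact p (\<chi> n v)" if "v \<in> mpart Y n" for n p v
    proof (rule ext)
      fix k
      show "\<chi> n (tact (edge 0) Y n p v) k = R.X.O.pact p (\<chi> n v) k"
        using R.\<theta>_act[OF lift[OF that, of k], of p] unfolding \<chi>_def R.X.O.pact_def by (simp add: Y.O.lift_act[OF that])
    qed
    show "\<chi> m (mmap (edge 0) Y n m v) = R.X.O.tr 0 n m (\<chi> n v)" if "v \<in> mpart Y n" for n m v
    proof (rule ext)
      fix k
      show "\<chi> m (mmap (edge 0) Y n m v) k = R.X.O.tr 0 n m (\<chi> n v) k"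
        using R.\<theta>_act[OF lift[OF that, of k]] unfolding \<chi>_def R.X.O.tr_def by (simp add: Y.O.lift_e[OF that])
    qed
  qed
  moreover have "X \<in> gr_obj (gwa (edge \<alpha>))" unfolding gr_obj_iff by (rule X(1))
  ultimately show ?thesis by blast
qed

section \<open>The equivalence\<close>

theorem theorem4p19:
  fixes \<iota> :: "(nat \<Rightarrow> 'k::{alg_closed_field, field_char_0}) \<Rightarrow> 'u"
    and \<alpha> :: nat
  assumes "inj \<iota>" and "\<alpha> > 0"
  shows "linearly_equivalent
    (gr_cat TYPE('u) (gwa ([:0, 1:] ^ 2 :: 'k poly)))
    (qgr_cat TYPE('u) (gwa ([:0, 1:] * [:of_nat \<alpha>, 1:] :: 'k poly)))"
proof -
  \<comment> \<open>constant functions with values in the prime field show that the type is infinite\<close>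
  have "i = j" if "\<iota> (\<lambda>_. of_nat i) = \<iota> (\<lambda>_. of_nat j)" for i j :: nat
  proof -
    have "(\<lambda>_::nat. of_nat i :: 'k) = (\<lambda>_. of_nat j)" by (rule injD[OF assms(1)]) (rule that)
    from fun_cong[OF this] show ?thesis by simp
  qed
  then have "infinite (range (\<lambda>i::nat. \<iota> (\<lambda>_. of_nat i)))"
    by (intro range_inj_infinite injI)
  then have inf: "infinite (UNIV :: 'u set)" by (rule infinite_super[OF subset_UNIV])
  have "linearly_equivalent (gr_cat TYPE('u) (gwa (edge 0 :: 'k poly))) (qgr_cat TYPE('u) (gwa (edge \<alpha> :: 'k poly)))"
  proof (rule fully_faithful.equivalence[OF qgr_fully_faithful[OF inf]])
    fix Y assume "Y \<in> obj (gr_cat TYPE('u) (gwa (edge 0 :: 'k poly)))"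
    then have "Y \<in> gr_obj (gwa (edge 0))" by (simp add: gr_cat_def)
    from essentially_surjective[OF inf this, of \<alpha>]
    show "\<exists>X\<in>obj (qgr_cat TYPE('u) (gwa (edge \<alpha>))). \<exists>u. iso_in (gr_cat TYPE('u) (gwa (edge 0))) Y (grmod_inf.FX \<alpha> X) u"
      by (simp add: qgr_cat_def)
  qed
  then show ?thesis by (simp add: edge_def power2_eq_square)
qed

end
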